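(* Let $d\ge 2$, $T\in(0,\pi]$, $0<t_0<T_0\le T$ with $T_0<\pi$, and let $\rho\in W(T,t_0,T_0)$. Let $n\in\{1,2,\dots\}$ and $2n<\alpha<2(n+1)$. Then for a complex-valued function $f$ on $\mathbf{S}^{d-1}$ the following are equivalent: (1) $f\in H^{\alpha}(\mathbf{S}^{d-1})$. (2) $f\in L^2(\mathbf{S}^{d-1})$ and there exist $g_1,g_2,\dots,g_n\in L^2(\mathbf{S}^{d-1})$ such that $S^{\rho,T}_\alpha(f,g_1,\dots,g_n)\in L^2(\mathbf{S}^{d-1})$. The equivalence of (1) and (2) also holds for $\alpha=2n$, $n=1,2,\dots$, provided that $\rho$ satisfies $$\frac{d-1}{d+2n-1}\cdot\frac{\left(\int_0^{T}\theta^{d-2}\rho(\theta)\,d\theta\right)^2\int_0^{T}\theta^{2n+d}\rho(\theta)\,d\theta}{\int_0^{T_0}\theta^{d-2}\rho(\theta)\,d\theta\;\int_0^{T_0}\theta^{d}\rho(\theta)\,d\theta\;\int_0^{T_0}\theta^{2n+d-2}\rho(\theta)\,d\theta}<1 .$$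
   Context: $\mathbf{S}^{d-1}$ is the unit sphere of $\mathbf{R}^d$ with uniform surface measure $\sigma$; functions are complex valued. For fixed $\xi\in\mathbf{S}^{d-1}$, points of $\mathbf{S}^{d-1}$ are written $(\theta,\tau')$, where $\theta\in[0,\pi]$ is the angle to $\xi$ and $\tau'\in\mathbf{S}^{d-2}$; then $d\sigma=\sin^{d-2}\theta\,d\theta\,d\sigma'(\tau')$ with $\sigma'$ the uniform surface measure on $\mathbf{S}^{d-2}$ (counting measure on two points if $d=2$), and $|\mathbf{S}^{d-2}|$ is its total mass. $C(\xi,t)=\{\eta\in\mathbf{S}^{d-1}:\xi\cdot\eta\ge\cos t\}$. Weights: $W(T,t_0,T_0)=\{\rho\in L^2(0,T):\rho\ge0\text{ a.e.},\ \int_{t_0}^{T_0}\rho(\theta)\,d\theta>0\}$. Generalized averaging: for $t\in(0,T]$ and $f\in L^2(\mathbf{S}^{d-1})$, $$A^\rho_tf(\xi)=z_t^{-1}\int_{C(\xi,t)}f(\theta,\tau')\,\rho\!\left(\tfrac{T}{t}\theta\right)d\sigma(\theta,\tau'),\qquad z_t=|\mathbf{S}^{d-2}|\frac tT\int_0^T\sin^{d-2}\!\left(\tfrac{t\theta}{T}\right)\rho(\theta)\,d\theta .$$ $A^\rho_t(|\xi-\cdot|^{2k})(\xi)$ denotes the average at the point $\xi$ of the function $\eta\mapsto|\xi-\eta|^{2k}$. Generalized square function: for $n\in\{1,2,\dots\}$ and $f,g_1,\dots,g_n\in L^2(\mathbf{S}^{d-1})$, if $2n<\alpha<2(n+1)$,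 $$S^{\rho,T}_\alpha(f,g_1,\dots,g_n)(\xi)^2=\int_0^T\Big|A^\rho_tf(\xi)-f(\xi)-\sum_{k=1}^ng_k(\xi)A^\rho_t(|\xi-\cdot|^{2k})(\xi)\Big|^2\frac{dt}{t^{2\alpha+1}},$$ and if $\alpha=2n$, $$S^{\rho,T}_{2n}(f,g_1,\dots,g_n)(\xi)^2=\int_0^T\Big|A^\rho_tf(\xi)-f(\xi)-\sum_{k=1}^{n-1}g_k(\xi)A^\rho_t(|\xi-\cdot|^{2k})(\xi)-A^\rho_t(g_n)(\xi)\,A^\rho_t(|\xi-\cdot|^{2n})(\xi)\Big|^2\frac{dt}{t^{4n+1}} .$$ Sobolev space: for $l\ge0$ let $\{Y_l^j\}_{j=1}^{\nu(l)}$ be an orthonormal basis (in $L^2(\mathbf{S}^{d-1})$) of the space $\mathbb{H}_l^d$ of spherical harmonics of degree $l$ in $d$ dimensions, $\nu(l)=\dim\mathbb{H}_l^d$, and $\hat f_{lj}=\int_{\mathbf{S}^{d-1}}f\,\overline{Y_l^j}\,d\sigma$. $H^\alpha(\mathbf{S}^{d-1})$ is the completion of $C^\infty(\mathbf{S}^{d-1})$ with respect to the norm $$\|f\|_{H^\alpha(\mathbf{S}^{d-1})}^2=\sum_{l=0}^\infty\big(1+l^{1/2}(l+d-2)^{1/2}\big)^{2\alpha}\sum_{j=1}^{\nu(l)}|\hat f_{lj}|^2$$ (identified with the subspace of $f\in L^2(\mathbf{S}^{d-1})$ for which this is finite). *)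

theory Defs
  imports "HOL-Analysis.Analysis"
begin

text \<open>
  The ambient space \<open>\<real>\<^sup>d\<close> is a Euclidean space \<^typ>\<open>'a::euclidean_space\<close> with \<open>d = DIM('a)\<close>.
  Functions on the sphere are functions on \<^typ>\<open>'a\<close> whose values off the sphere are irrelevant,
  because every measure and quantifier below is restricted to \<open>sphere 0 1\<close>.
\<close>

text \<open>
  Surface measure of a Borel set \<open>E\<close> in the unit sphere is \<open>d\<close> times the volume of the cone
  \<open>{r x | 0 < r \<le> 1, x \<in> E}\<close> (polar coordinates). The measure is completed, so that the
  measurable functions are all functions measurable with respect to surface measure.
\<close>

definition sphere_measure :: "'a::euclidean_space measure" where
  "sphere_measure = completion (scale_measure (of_nat DIM('a))
     (distr (restrict_space lborel (cball 0 1 - {0}))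
            (restrict_space borel (sphere 0 1)) (\<lambda>x. x /\<^sub>R norm x)))"

definition square_integrable :: "'x measure \<Rightarrow> ('x \<Rightarrow> 'b::real_normed_vector) \<Rightarrow> bool" where
  "square_integrable M f \<longleftrightarrow> f \<in> borel_measurable M \<and> integrable M (\<lambda>x. (norm (f x))\<^sup>2)"

text \<open>The square function may take the value \<open>\<infinity>\<close>, hence the following variants.\<close>

definition square_integrable_ennreal :: "'x measure \<Rightarrow> ('x \<Rightarrow> ennreal) \<Rightarrow> bool" where
  "square_integrable_ennreal M F \<longleftrightarrow> F \<in> borel_measurable M \<and> (\<integral>\<^sup>+x. (F x)\<^sup>2 \<partial>M) < \<infinity>"

definition ennreal_sqrt :: "ennreal \<Rightarrow> ennreal" where
  "ennreal_sqrt x = (if x = \<infinity> then \<infinity> else ennreal (sqrt (enn2real x)))"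

definition weights :: "real \<Rightarrow> real \<Rightarrow> real \<Rightarrow> (real \<Rightarrow> real) set" where
  "weights T t0 T0 = {\<rho>. square_integrable (lebesgue_on {0<..<T}) \<rho>
     \<and> (AE \<theta> in lebesgue_on {0<..<T}. 0 \<le> \<rho> \<theta>)
     \<and> (LINT \<theta>:{t0<..<T0}|lebesgue. \<rho> \<theta>) > 0}"

definition spherical_cap :: "'a::euclidean_space \<Rightarrow> real \<Rightarrow> 'a set" where
  "spherical_cap \<xi> t = {\<eta> \<in> sphere 0 1. \<xi> \<bullet> \<eta> \<ge> cos t}"

text \<open>
  The total mass of the unit sphere of \<open>\<real>\<^sup>m\<close> (for \<open>m \<ge> 1\<close>) is \<open>m\<close> times the volume of the unit
  ball; for \<open>m = 1\<close> this is \<open>2\<close>, the counting measure of two points.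
\<close>

definition sphere_area :: "nat \<Rightarrow> real" where
  "sphere_area m = real m * unit_ball_vol (real m)"

lemma emeasure_sphere_measure_sphere:
  "emeasure (sphere_measure :: 'a::euclidean_space measure) (sphere 0 1)
     = ennreal (sphere_area DIM('a))"
proof -
  let ?R = "restrict_space lborel (cball 0 1 - {0}) :: 'a measure"
  let ?S = "restrict_space borel (sphere 0 1) :: 'a measure"
  have [measurable]: "(\<lambda>x. x /\<^sub>R norm x) \<in> measurable ?R ?S"
    by (intro measurable_restrict_space3) auto
  have S: "sphere 0 1 \<in> sets ?S"
    using sets.top[of ?S] by (simp add: space_restrict_space)
  have "emeasure (distr ?R ?S (\<lambda>x. x /\<^sub>R norm x)) (sphere 0 1) = emeasure ?R (space ?R)"
    using S by (subst emeasure_distr) (auto intro!: arg_cong[where f="emeasure _"] simp: space_restrict_space)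
  also have "\<dots> = emeasure lborel (cball 0 1 - {0::'a})"
    by (subst emeasure_restrict_space) (auto simp: space_restrict_space)
  also have "\<dots> = emeasure lborel (cball 0 1 :: 'a set)"
    by (subst emeasure_Diff) auto
  also have "\<dots> = ennreal (unit_ball_vol (real DIM('a)))"
    by (simp add: emeasure_cball)
  finally have *: "emeasure (distr ?R ?S (\<lambda>x. x /\<^sub>R norm x)) (sphere 0 1) = ennreal (unit_ball_vol (real DIM('a)))" .
  show ?thesis using S
    by (simp add: sphere_measure_def * sphere_area_def ennreal_mult'' ennreal_of_nat_eq_real_of_nat)
qed

definition avg_const :: "'a::euclidean_space itself \<Rightarrow> (real \<Rightarrow> real) \<Rightarrow> real \<Rightarrow> real \<Rightarrow> real" where
  "avg_const _ \<rho> T t = sphere_area (DIM('a) - 1) * (t / T) *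
     (LINT \<theta>:{0<..<T}|lebesgue. sin (t * \<theta> / T) ^ (DIM('a) - 2) * \<rho> \<theta>)"

text \<open>On the sphere, \<open>arccos (\<xi> \<bullet> \<eta>)\<close> is the angle \<open>\<theta>\<close> between \<open>\<eta>\<close> and \<open>\<xi>\<close>.\<close>

definition gen_avg ::
  "(real \<Rightarrow> real) \<Rightarrow> real \<Rightarrow> real \<Rightarrow> ('a::euclidean_space \<Rightarrow> complex) \<Rightarrow> 'a \<Rightarrow> complex" where
  "gen_avg \<rho> T t f \<xi> =
     (LINT \<eta>:spherical_cap \<xi> t|sphere_measure. f \<eta> * of_real (\<rho> (T / t * arccos (\<xi> \<bullet> \<eta>))))
       / of_real (avg_const TYPE('a) \<rho> T t)"

definition avg_dist_power ::
  "(real \<Rightarrow> real) \<Rightarrow> real \<Rightarrow> real \<Rightarrow> nat \<Rightarrow> 'a::euclidean_space \<Rightarrow> complex" where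
  "avg_dist_power \<rho> T t k \<xi> = gen_avg \<rho> T t (\<lambda>\<eta>. of_real (norm (\<xi> - \<eta>) ^ (2 * k))) \<xi>"

text \<open>The functions \<open>g\<^sub>1, \<dots>, g\<^sub>n\<close> are given as \<open>g 1, \<dots>, g n\<close>.\<close>

definition square_fun_integrand ::
  "(real \<Rightarrow> real) \<Rightarrow> real \<Rightarrow> real \<Rightarrow> nat \<Rightarrow> ('a::euclidean_space \<Rightarrow> complex)
     \<Rightarrow> (nat \<Rightarrow> 'a \<Rightarrow> complex) \<Rightarrow> 'a \<Rightarrow> real \<Rightarrow> complex" where
  "square_fun_integrand \<rho> T \<alpha> n f g \<xi> t =
     (if \<alpha> = 2 * real n
      then gen_avg \<rho> T t f \<xi> - f \<xi>
             - (\<Sum>k\<in>{1..<n}. g k \<xi> * avg_dist_power \<rho> T t k \<xi>)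
             - gen_avg \<rho> T t (g n) \<xi> * avg_dist_power \<rho> T t n \<xi>
      else gen_avg \<rho> T t f \<xi> - f \<xi>
             - (\<Sum>k\<in>{1..n}. g k \<xi> * avg_dist_power \<rho> T t k \<xi>))"

definition square_fun ::
  "(real \<Rightarrow> real) \<Rightarrow> real \<Rightarrow> real \<Rightarrow> nat \<Rightarrow> ('a::euclidean_space \<Rightarrow> complex)
     \<Rightarrow> (nat \<Rightarrow> 'a \<Rightarrow> complex) \<Rightarrow> 'a \<Rightarrow> ennreal" where
  "square_fun \<rho> T \<alpha> n f g \<xi> = ennreal_sqrt
     (\<integral>\<^sup>+t\<in>{0<..<T}. ennreal ((cmod (square_fun_integrand \<rho> T \<alpha> n f g \<xi> t))\<^sup>2
        / t powr (2 * \<alpha> + 1)) \<partial>lebesgue)"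

definition laplacian :: "('a::euclidean_space \<Rightarrow> complex) \<Rightarrow> 'a \<Rightarrow> complex" where
  "laplacian p x =
     (\<Sum>b\<in>Basis. frechet_derivative (\<lambda>y. frechet_derivative p (at y) b) (at x) b)"

text \<open>
  A spherical harmonic of degree \<open>l\<close> is the restriction to the sphere of a homogeneous harmonic
  polynomial of degree \<open>l\<close> with complex coefficients.
\<close>

definition spherical_harmonic :: "nat \<Rightarrow> ('a::euclidean_space \<Rightarrow> complex) \<Rightarrow> bool" where
  "spherical_harmonic l Y \<longleftrightarrow> (\<exists>p. polynomial_function p
     \<and> (\<forall>c x. p (c *\<^sub>R x) = of_real (c ^ l) * p x)
     \<and> (\<forall>x. laplacian p x = 0)
     \<and> (\<forall>x\<in>sphere 0 1. Y x = p x))"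

text \<open>Being a basis, the family forces \<open>N\<close> to be the dimension of the space of harmonics.\<close>

definition harmonic_onb :: "nat \<Rightarrow> nat \<Rightarrow> (nat \<Rightarrow> 'a::euclidean_space \<Rightarrow> complex) \<Rightarrow> bool" where
  "harmonic_onb l N Y \<longleftrightarrow>
     (\<forall>j\<in>{1..N}. spherical_harmonic l (Y j))
     \<and> (\<forall>i\<in>{1..N}. \<forall>j\<in>{1..N}.
          (LINT x|sphere_measure. Y i x * cnj (Y j x)) = (if i = j then 1 else 0))
     \<and> (\<forall>h. spherical_harmonic l h \<longrightarrow>
          (\<exists>c. \<forall>x\<in>sphere 0 1. h x = (\<Sum>j=1..N. c j * Y j x)))"

definition fourier_coeff :: "('a::euclidean_space \<Rightarrow> complex) \<Rightarrow> ('a \<Rightarrow> complex) \<Rightarrow> complex" where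
  "fourier_coeff f Y = (LINT x|sphere_measure. f x * cnj (Y x))"

definition sobolev_norm_sq ::
  "(nat \<Rightarrow> nat) \<Rightarrow> (nat \<Rightarrow> nat \<Rightarrow> 'a::euclidean_space \<Rightarrow> complex) \<Rightarrow> real
     \<Rightarrow> ('a \<Rightarrow> complex) \<Rightarrow> ennreal" where
  "sobolev_norm_sq \<nu> Y \<alpha> f = (\<Sum>l. ennreal
     ((1 + sqrt (real l) * sqrt (real l + real DIM('a) - 2)) powr (2 * \<alpha>)
        * (\<Sum>j=1..\<nu> l. (cmod (fourier_coeff f (Y l j)))\<^sup>2)))"

definition sobolev_space ::
  "(nat \<Rightarrow> nat) \<Rightarrow> (nat \<Rightarrow> nat \<Rightarrow> 'a::euclidean_space \<Rightarrow> complex) \<Rightarrow> real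
     \<Rightarrow> ('a \<Rightarrow> complex) set" where
  "sobolev_space \<nu> Y \<alpha> =
     {f. square_integrable sphere_measure f \<and> sobolev_norm_sq \<nu> Y \<alpha> f < \<infinity>}"

definition weight_moment :: "(real \<Rightarrow> real) \<Rightarrow> real \<Rightarrow> nat \<Rightarrow> real" where
  "weight_moment \<rho> R m = (LINT \<theta>:{0<..<R}|lebesgue. \<theta> ^ m * \<rho> \<theta>)"

end

theory Submission
  imports Defs "HOL-Probability.Distributions" "HOL-Computational_Algebra.Polynomial"
begin

text \<open>
  Averaging over caps commutes with rotations, so by the Funk--Hecke formula (\<open>funk_hecke\<close>) it
  acts on spherical harmonics of degree \<open>l\<close> as multiplication by a number \<open>mult l t\<close>: the average of
  the Gegenbauer polynomial of degree \<open>l\<close>, evaluated at the cosine of the angle to the centre of the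
  cap. Parseval's identity for a complete system of harmonics (\<open>parseval\<close>) then turns the square
  function into a sum over degrees, and everything rests on the size of the multipliers, compared
  with powers of the eigenvalue \<open>\<lambda> = l (l + d - 2)\<close>.

  The Gegenbauer polynomial has a Taylor expansion at \<open>1\<close> in powers of \<open>2 - 2 x\<close>, which for
  \<open>x = \<xi> \<bullet> \<eta>\<close> is the squared distance of \<open>\<xi>\<close> and \<open>\<eta>\<close>. Its \<open>k\<close>-th coefficient is of order \<open>\<lambda>\<^sup>k\<close>, and the
  remainder is at most the first omitted term, because the Gegenbauer equation forces all
  derivatives to be largest at \<open>1\<close> (\<open>geg_taylor_remainder\<close>). After averaging, the powers of the
  distance become the functions \<open>adist k t\<close>, which are of exact order \<open>t\<^sup>2\<^sup>k\<close>. So \<open>mult l t\<close> has an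
  expansion in precisely the functions that the square function subtracts.

  If \<open>f\<close> lies in the Sobolev space, let \<open>g\<^sub>k\<close> have the coefficients of \<open>f\<close> times the \<open>k\<close>-th Taylor
  coefficients; these are square summable. What remains of the square function is the Taylor
  remainder of order \<open>n + 1\<close>. It is at most \<open>(\<lambda> t\<^sup>2)\<^sup>n\<^sup>+\<^sup>1\<close> for small \<open>t\<close> and at most a multiple of
  \<open>(\<lambda> t\<^sup>2)\<^sup>n\<close> for large \<open>t\<close>, and for \<open>2n < \<alpha> < 2n + 2\<close> the integral of its square against
  \<open>t\<^sup>-\<^sup>2\<^sup>\<alpha>\<^sup>-\<^sup>1\<close> is at most a multiple of \<open>\<lambda>\<^sup>\<alpha>\<close> (\<open>rem_integral_upper\<close>). For \<open>\<alpha> = 2n\<close> the bound for large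
  \<open>t\<close> just fails. There \<open>g\<^sub>n\<close> is averaged as well, so that the critical term carries an extra factor
  \<open>mult l t\<close>, and it suffices that the integral of \<open>(mult l t)\<^sup>2 / t\<close> over \<open>t > \<lambda>\<^sup>-\<^sup>1\<^sup>/\<^sup>2\<close> is bounded
  uniformly in \<open>l\<close> (\<open>mult_decay\<close>). In dimension at least \<open>3\<close> this follows from the decay of Gegenbauer
  polynomials; on the circle the multipliers are values of a Fourier transform, and it is a mean
  value estimate that uses that the weight is square integrable.

  Conversely, let the square function be square integrable for some \<open>g\<^sub>1, \<dots>, g\<^sub>n\<close>. For each
  coefficient the integral over \<open>t\<close> is finite, and none of the functions \<open>t\<^sup>2\<^sup>k\<close> with \<open>k \<le> n\<close> is square
  integrable against \<open>t\<^sup>-\<^sup>4\<^sup>n\<^sup>-\<^sup>1\<close> at \<open>0\<close>. This forces the coefficients of \<open>g\<^sub>k\<close> to be those of \<open>f\<close> times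
  the Taylor coefficients (\<open>expansion_coefficients_zero\<close>). For \<open>\<alpha> > 2n\<close> the remainder is at least half
  of its leading term as long as \<open>\<lambda> t\<^sup>2\<close> is small, and its integral is at least a multiple of \<open>\<lambda>\<^sup>\<alpha>\<close>
  (\<open>rem_integral_lower\<close>). For \<open>\<alpha> = 2n\<close> the square integrability of \<open>g\<^sub>n\<close> already gives the claim.

  The Funk--Hecke formula and the completeness of the harmonics are obtained from moments: the
  integral of a harmonic of degree \<open>l\<close> against a power of \<open>\<xi> \<bullet> \<eta>\<close> is computed by Gaussian
  integration by parts in the ambient space (\<open>gauss_moment_harmonic\<close>), and a measure on a bounded
  set is determined by its moments along all directions (locale \<open>moment_match\<close>).
\<close>

section \<open>Surface measure and polar coordinates\<close>

text \<open>
  Surface measure on the Borel sets of the sphere, where products and null sets are easier to handle.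
\<close>

definition surface :: "'a::euclidean_space measure" where
  "surface = scale_measure (of_nat DIM('a))
     (distr (restrict_space lborel (cball 0 1 - {0}))
            (restrict_space borel (sphere 0 1)) (\<lambda>x. x /\<^sub>R norm x))"

lemma sphere_measure_eq_completion: "sphere_measure = completion surface" unfolding sphere_measure_def surface_def ..

lemma sets_surface [measurable_cong]:
  "sets (surface :: 'a::euclidean_space measure) = sets (restrict_space borel (sphere 0 1))" by (simp add: surface_def)

lemma space_surface [simp]: "space (surface :: 'a::euclidean_space measure) = sphere 0 1"
  by (simp add: surface_def space_scale_measure space_restrict_space)

lemma measurable_normalize [measurable]:
  "(\<lambda>x. x /\<^sub>R norm x) \<in> measurable (restrict_space lborel (cball 0 1 - {0::'a::euclidean_space}))
     (restrict_space borel (sphere 0 1))" by (intro measurable_restrict_space3) auto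

lemma emeasure_surface_sphere:
  "emeasure (surface :: 'a::euclidean_space measure) (sphere 0 1) = ennreal (sphere_area DIM('a))"
proof -
  have "sphere 0 1 \<in> sets (surface :: 'a measure)" using sets.top[of "surface :: 'a measure"] by simp
  then show ?thesis using emeasure_sphere_measure_sphere[where 'a='a]
    by (simp add: sphere_measure_eq_completion emeasure_completion)
qed

lemma finite_measure_surface [simp]: "finite_measure (surface :: 'a::euclidean_space measure)"
  by (intro finite_measureI) (simp add: emeasure_surface_sphere)

lemma sigma_finite_surface [simp]: "sigma_finite_measure (surface :: 'a::euclidean_space measure)"
  using finite_measure.axioms(1)[OF finite_measure_surface] .

text \<open>The value at the origin, a null set, is arbitrary; a point of the sphere makes the map total.\<close>

definition direction :: "'a::euclidean_space \<Rightarrow> 'a" where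
  "direction x = (if x = 0 then (SOME b. b \<in> Basis) else x /\<^sub>R norm x)"

lemma norm_direction [simp]: "norm (direction (x::'a::euclidean_space)) = 1"
proof -
  have "(SOME b. b \<in> (Basis :: 'a set)) \<in> Basis" using nonempty_Basis by (simp add: some_in_eq)
  then show ?thesis by (auto simp: direction_def)
qed

lemma measurable_direction_borel [measurable]: "direction \<in> borel_measurable borel"
  unfolding direction_def by measurable

lemma measurable_direction [measurable]:
  "direction \<in> measurable borel (restrict_space borel (sphere 0 1))" by (intro measurable_restrict_space2) auto

lemma direction_scaleR: "c > 0 \<Longrightarrow> x \<noteq> 0 \<Longrightarrow> direction (c *\<^sub>R x) = direction x" by (simp add: direction_def)

lemma sets_cone [measurable]:
  assumes "E \<in> sets (restrict_space borel (sphere 0 1))"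
  shows "{x::'a::euclidean_space. direction x \<in> E} \<in> sets borel"
  using measurable_sets[OF measurable_direction assms] by (simp add: vimage_def)

lemma emeasure_cone_unit:
  assumes E: "E \<in> sets (surface :: 'a::euclidean_space measure)"
  shows "emeasure surface E
    = of_nat DIM('a) * emeasure lborel {x::'a. x \<noteq> 0 \<and> norm x \<le> 1 \<and> direction x \<in> E}"
proof -
  let ?R = "restrict_space lborel (cball 0 1 - {0}) :: 'a measure"
  have E': "E \<in> sets (restrict_space borel (sphere (0::'a) 1))" using E by (simp add: sets_surface)
  have "emeasure (distr ?R (restrict_space borel (sphere 0 1)) (\<lambda>x. x /\<^sub>R norm x)) E
      = emeasure ?R ((\<lambda>x. x /\<^sub>R norm x) -` E \<inter> space ?R)" by (intro emeasure_distr measurable_normalize E')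
  also have "(\<lambda>x. x /\<^sub>R norm x) -` E \<inter> space ?R = {x::'a. x \<noteq> 0 \<and> norm x \<le> 1 \<and> direction x \<in> E}"
    by (auto simp: space_restrict_space direction_def)
  also have "emeasure ?R \<dots> = emeasure lborel \<dots>" by (intro emeasure_restrict_space) auto
  finally show ?thesis by (simp add: surface_def)
qed

lemma emeasure_cone:
  assumes E: "E \<in> sets (surface :: 'a::euclidean_space measure)" and R: "R > 0"
  shows "of_nat DIM('a) * emeasure lborel {x::'a. x \<noteq> 0 \<and> norm x \<le> R \<and> direction x \<in> E}
    = ennreal (R ^ DIM('a)) * emeasure surface E"
proof -
  define C where "C r = {x::'a. x \<noteq> 0 \<and> norm x \<le> r \<and> direction x \<in> E}" for r
  have E': "E \<in> sets (restrict_space borel (sphere (0::'a) 1))" using E by (simp add: sets_surface)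
  have meas [measurable]: "C r \<in> sets borel" for r
  proof -
    have "C r = ({x. direction x \<in> E} - {0}) \<inter> cball 0 r" by (auto simp: C_def)
    then show ?thesis using sets_cone[OF E'] by auto
  qed
  have "C R = (\<lambda>x. R *\<^sub>R x + 0) ` C 1"
  proof (intro equalityI subsetI)
    fix x assume x: "x \<in> C R"
    then have "inverse R *\<^sub>R x \<in> C 1" using R by (auto simp: C_def direction_scaleR field_simps)
    then show "x \<in> (\<lambda>x. R *\<^sub>R x + 0) ` C 1" using R by (intro image_eqI[of _ _ "inverse R *\<^sub>R x"]) auto
  qed (use R in \<open>auto simp: C_def direction_scaleR\<close>)
  then have "emeasure lebesgue (C R) = ennreal (R ^ DIM('a)) * emeasure lebesgue (C 1)"
    using emeasure_lebesgue_affine[of R 0 "C 1"] R by (simp add: ennreal_power)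
  then have "emeasure lborel (C R) = ennreal (R ^ DIM('a)) * emeasure lborel (C 1)" by (simp add: emeasure_completion)
  then show ?thesis using emeasure_cone_unit[OF E] by (simp add: C_def mult_ac)
qed

text \<open>
  Lebesgue measure is the product of \<open>r\<^sup>d\<^sup>-\<^sup>1 dr\<close> and surface measure: by scaling the
  cones over a fixed set, both measures agree on balls, and these determine the radial measure.
\<close>

lemma nn_integral_radial_cone:
  assumes E: "E \<in> sets (surface :: 'a::euclidean_space measure)"
    and w [measurable]: "w \<in> borel_measurable borel"
  shows "(\<integral>\<^sup>+x. w (norm x) * indicator E (direction x) \<partial>(lborel :: 'a measure))
    = (\<integral>\<^sup>+r. w r * ennreal (r ^ (DIM('a) - 1)) * indicator {0<..} r \<partial>lborel) * emeasure surface E"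
proof -
  have E': "E \<in> sets (restrict_space borel (sphere (0::'a) 1))" using E by (simp add: sets_surface)
  note [measurable] = sets_cone[OF E']
  define d where "d = DIM('a)"
  have d: "d > 0" by (simp add: d_def)
  define C where "C = {x::'a. x \<noteq> 0 \<and> direction x \<in> E}"
  have "C = {x. direction x \<in> E} - {0}" by (auto simp: C_def)
  then have [measurable]: "C \<in> sets borel" using sets_cone[OF E'] by auto
  define M where "M = distr (density (lborel::'a measure) (\<lambda>x. of_nat d * indicator C x)) borel norm"
  define N where "N = density lborel (\<lambda>r::real. emeasure surface E * (of_nat d * ennreal (r ^ (d - 1)) * indicator {0<..} r))"
  have fin: "emeasure (surface :: 'a measure) E < \<infinity>"
    using finite_measure.emeasure_finite[OF finite_measure_surface, of E] by (simp add: top.not_eq_extremum)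
  have M_eq: "emeasure M {..R} = (if R > 0 then ennreal (R ^ d) * emeasure surface E else 0)" for R
  proof -
    have "emeasure M {..R} = (\<integral>\<^sup>+x. of_nat d * indicator C x * indicator {..R} (norm x) \<partial>lborel)"
    proof -
      have "norm -` {..R} = (cball 0 R :: 'a set)" by auto
      then show ?thesis unfolding M_def by (subst emeasure_distr)
          (auto simp: emeasure_density intro!: nn_integral_cong split: split_indicator)
    qed
    also have "\<dots> = (\<integral>\<^sup>+x. of_nat d * indicator (C \<inter> {x. norm x \<le> R}) x \<partial>lborel)"
      by (intro nn_integral_cong) (auto split: split_indicator)
    also have "\<dots> = of_nat d * emeasure lborel (C \<inter> {x. norm x \<le> R})" by (subst nn_integral_cmult_indicator) auto
    also have "\<dots> = (if R > 0 then ennreal (R ^ d) * emeasure surface E else 0)"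
    proof (cases "R > 0")
      case True
      have "C \<inter> {x. norm x \<le> R} = {x. x \<noteq> 0 \<and> norm x \<le> R \<and> direction x \<in> E}" by (auto simp: C_def)
      then show ?thesis using emeasure_cone[OF E True] True by (simp add: d_def)
    next
      case False
      have "C \<inter> {x. norm x \<le> R} = {}"
      proof -
        have "\<not> norm x \<le> R" if "x \<noteq> 0" for x :: 'a using that False by (smt (verit) zero_less_norm_iff)
        then show ?thesis by (auto simp: C_def)
      qed
      then show ?thesis using False by simp
    qed
    finally show ?thesis .
  qed
  have N_eq: "emeasure N {..R} = (if R > 0 then ennreal (R ^ d) * emeasure surface E else 0)" for R
  proof -
    have "emeasure N {..R} = (\<integral>\<^sup>+r. emeasure surface E * (ennreal (real d * r ^ (d - 1)) * indicator {0<..R} r) \<partial>lborel)"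
      unfolding N_def by (subst emeasure_density)
        (auto intro!: nn_integral_cong simp: ennreal_mult ennreal_of_nat_eq_real_of_nat split: split_indicator)
    also have "\<dots> = emeasure surface E * (\<integral>\<^sup>+r. ennreal (real d * r ^ (d - 1)) * indicator {0<..R} r \<partial>lborel)"
      by (subst nn_integral_cmult) auto
    also have "(\<integral>\<^sup>+r. ennreal (real d * r ^ (d - 1)) * indicator {0<..R} r \<partial>lborel)
       = (\<integral>\<^sup>+r. ennreal (real d * r ^ (d - 1)) * indicator {0..R} r \<partial>lborel)"
      by (intro nn_integral_cong_AE AE_I[of _ _ "{0}"]) (auto split: split_indicator)
    also have "\<dots> = (if R > 0 then ennreal (R ^ d) else 0)"
    proof (cases "R > 0")
      case True
      have "(\<integral>\<^sup>+r. ennreal (real d * r ^ (d - 1)) * indicator {0..R} r \<partial>lborel) = ennreal (R ^ d - 0 ^ d)"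
        using True by (intro nn_integral_FTC_Icc) (auto intro!: derivative_eq_intros)
      then show ?thesis using True d by simp
    next
      case False
      have "AE r in lborel. ennreal (real d * r ^ (d - 1)) * indicator {0..R} r = 0"
        using False by (intro AE_I[of _ _ "{0}"]) (auto split: split_indicator)
      then have "(\<integral>\<^sup>+r. ennreal (real d * r ^ (d - 1)) * indicator {0..R} r \<partial>lborel) = 0"
        by (subst nn_integral_0_iff_AE) auto
      then show ?thesis using False by simp
    qed
    finally show ?thesis by (auto simp: mult.commute)
  qed
  have MN: "M = N"
  proof (rule measure_eqI_generator_eq[where \<Omega>=UNIV and E="range (\<lambda>a::real. {..a})" and A="\<lambda>i::nat. {..real i}"])
    show "Int_stable (range (\<lambda>a::real. {..a}))" by (auto simp: Int_stable_def)
    show "sets M = sigma_sets UNIV (range (\<lambda>a::real. {..a}))" "sets N = sigma_sets UNIV (range (\<lambda>a::real. {..a}))"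
      by (auto simp: M_def N_def borel_eq_atMost)
    show "(\<Union>i. {..real i}) = UNIV" by (auto intro: real_arch_simple)
    show "emeasure M {..real i} \<noteq> \<infinity>" for i using fin by (auto simp: M_eq ennreal_mult_eq_top_iff)
  qed (auto simp: M_eq N_eq)
  have "(\<lambda>x::'a. indicator E (direction x) :: ennreal) = indicator {x. direction x \<in> E}"
    by (auto split: split_indicator)
  then have [measurable]: "(\<lambda>x::'a. indicator E (direction x) :: ennreal) \<in> borel_measurable borel" by simp
  have "of_nat d * (\<integral>\<^sup>+x. w (norm x) * indicator E (direction x) \<partial>(lborel :: 'a measure))
      = (\<integral>\<^sup>+x. of_nat d * (w (norm x) * indicator E (direction x)) \<partial>(lborel :: 'a measure))"
    by (subst nn_integral_cmult) auto
  also have "\<dots> = (\<integral>\<^sup>+x. of_nat d * indicator C x * w (norm x) \<partial>(lborel :: 'a measure))"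
    by (intro nn_integral_cong_AE AE_I[of _ _ "{0}"]) (auto simp: C_def split: split_indicator)
  also have "\<dots> = (\<integral>\<^sup>+r. w r \<partial>M)" unfolding M_def by (subst nn_integral_distr) (auto simp: nn_integral_density)
  also have "\<dots> = (\<integral>\<^sup>+r. (of_nat d * emeasure surface E) * (w r * ennreal (r ^ (d - 1)) * indicator {0<..} r) \<partial>lborel)"
    unfolding MN N_def by (subst nn_integral_density) (auto intro!: nn_integral_cong simp: mult_ac)
  also have "\<dots> = of_nat d * ((\<integral>\<^sup>+r. w r * ennreal (r ^ (d - 1)) * indicator {0<..} r \<partial>lborel) * emeasure surface E)"
    by (subst nn_integral_cmult) (auto simp: mult_ac)
  finally have *: "of_nat d * (\<integral>\<^sup>+x. w (norm x) * indicator E (direction x) \<partial>(lborel :: 'a measure))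
     = of_nat d * ((\<integral>\<^sup>+r. w r * ennreal (r ^ (d - 1)) * indicator {0<..} r \<partial>lborel) * emeasure surface E)" .
  have "(of_nat d :: ennreal) \<noteq> 0" "(of_nat d :: ennreal) \<noteq> \<infinity>" using d by (auto simp: ennreal_of_nat_eq_real_of_nat)
  then show ?thesis using * by (simp add: d_def ennreal_mult_cancel_left)
qed

text \<open>For a radial weight the direction of a point is independent of its norm.\<close>

lemma polar_coordinates:
  fixes w :: "real \<Rightarrow> real"
  assumes w [measurable]: "w \<in> borel_measurable borel" and w0: "\<And>r. r \<ge> 0 \<Longrightarrow> w r \<ge> 0"
    and C: "(\<integral>\<^sup>+r. ennreal (w r * r ^ (DIM('a) - 1)) * indicator {0<..} r \<partial>lborel) = ennreal C"
  shows "distr (density lborel (\<lambda>x::'a::euclidean_space. ennreal (w (norm x))))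
      (restrict_space borel (sphere 0 1)) direction = density surface (\<lambda>_. ennreal C)"
proof (rule measure_eqI)
  fix E assume "E \<in> sets (distr (density lborel (\<lambda>x::'a. ennreal (w (norm x)))) (restrict_space borel (sphere 0 1)) direction)"
  then have E: "E \<in> sets (surface :: 'a measure)" and E': "E \<in> sets (restrict_space borel (sphere (0::'a) 1))"
    by (auto simp: sets_surface)
  note [measurable] = sets_cone[OF E']
  have "emeasure (distr (density lborel (\<lambda>x::'a. ennreal (w (norm x)))) (restrict_space borel (sphere 0 1)) direction) E
     = (\<integral>\<^sup>+x. ennreal (w (norm x)) * indicator {x. direction x \<in> E} x \<partial>(lborel :: 'a measure))"
    using E' by (subst emeasure_distr) (auto simp: emeasure_density vimage_def)
  also have "\<dots> = (\<integral>\<^sup>+x. ennreal (w (norm x)) * indicator E (direction x) \<partial>(lborel :: 'a measure))"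
    by (intro nn_integral_cong) (auto split: split_indicator)
  also have "\<dots> = (\<integral>\<^sup>+r. ennreal (w r) * ennreal (r ^ (DIM('a) - 1)) * indicator {0<..} r \<partial>lborel) * emeasure surface E"
    by (intro nn_integral_radial_cone E) measurable
  also have "(\<integral>\<^sup>+r. ennreal (w r) * ennreal (r ^ (DIM('a) - 1)) * indicator {0<..} r \<partial>lborel)
     = (\<integral>\<^sup>+r. ennreal (w r * r ^ (DIM('a) - 1)) * indicator {0<..} r \<partial>lborel)"
    by (intro nn_integral_cong) (auto simp: ennreal_mult w0 split: split_indicator)
  also have "\<dots> = ennreal C" by (rule C)
  also have "ennreal C * emeasure surface E = emeasure (density surface (\<lambda>_. ennreal C)) E"
    using E by (simp add: emeasure_density nn_integral_cmult_indicator)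
  finally show "emeasure (distr (density lborel (\<lambda>x::'a. ennreal (w (norm x)))) (restrict_space borel (sphere 0 1)) direction) E
     = emeasure (density surface (\<lambda>_. ennreal C)) E" .
qed (simp add: sets_surface)

lemma integral_polar:
  fixes w :: "real \<Rightarrow> real" and F :: "'a::euclidean_space \<Rightarrow> 'b::{banach, second_countable_topology}"
  assumes w [measurable]: "w \<in> borel_measurable borel" and w0: "\<And>r. r \<ge> 0 \<Longrightarrow> w r \<ge> 0"
    and C: "(\<integral>\<^sup>+r. ennreal (w r * r ^ (DIM('a) - 1)) * indicator {0<..} r \<partial>lborel) = ennreal C" "C \<ge> 0"
    and F: "F \<in> borel_measurable (surface :: 'a measure)"
  shows "(LINT x|lborel. w (norm x) *\<^sub>R F (direction x)) = C *\<^sub>R (LINT \<eta>|surface. F \<eta>)"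
    and "integrable surface F \<Longrightarrow> integrable lborel (\<lambda>x. w (norm x) *\<^sub>R F (direction x))"
proof -
  have F' [measurable]: "F \<in> borel_measurable (restrict_space borel (sphere (0::'a) 1))"
    using F by (simp add: measurable_cong_sets[OF sets_surface refl])
  note F [measurable]
  have eq: "distr (density lborel (\<lambda>x::'a. ennreal (w (norm x))))
      (restrict_space borel (sphere 0 1)) direction = density surface (\<lambda>_. ennreal C)"
    by (rule polar_coordinates[OF w w0 C(1)])
  have "(LINT x|lborel. w (norm x) *\<^sub>R F (direction x))
     = (LINT \<eta>|distr (density lborel (\<lambda>x::'a. ennreal (w (norm x)))) (restrict_space borel (sphere 0 1)) direction. F \<eta>)"
    by (subst integral_distr) (auto simp: integral_density w0)
  also have "\<dots> = (LINT \<eta>|surface. C *\<^sub>R F \<eta>)" unfolding eq using C(2) by (subst integral_density) auto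
  finally show "(LINT x|lborel. w (norm x) *\<^sub>R F (direction x)) = C *\<^sub>R (LINT \<eta>|surface. F \<eta>)" by simp
  assume "integrable surface F"
  then have "integrable (density surface (\<lambda>_. ennreal C)) F" using C(2) by (subst integrable_density) auto
  then have "integrable (distr (density lborel (\<lambda>x::'a. ennreal (w (norm x)))) (restrict_space borel (sphere 0 1)) direction) F"
    unfolding eq .
  then show "integrable lborel (\<lambda>x. w (norm x) *\<^sub>R F (direction x))"
    by (subst (asm) integrable_distr_eq) (auto simp: integrable_density w0)
qed

section \<open>Harmonic polynomials and their Gaussian moments\<close>

definition dird :: "'a::euclidean_space \<Rightarrow> ('a \<Rightarrow> 'b::real_normed_vector) \<Rightarrow> 'a \<Rightarrow> 'b" where
  "dird b p x = frechet_derivative p (at x) b"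

lemma dird_eqI: "(p has_derivative D) (at x) \<Longrightarrow> dird b p x = D b" unfolding dird_def using frechet_derivative_at by metis

lemma differentiable_dird:
  assumes "p differentiable (at x)"
  shows "(p has_derivative (\<lambda>b. dird b p x)) (at x)" using assms by (simp add: dird_def frechet_derivative_works)

lemma dird_add:
  "p differentiable (at x) \<Longrightarrow> q differentiable (at x) \<Longrightarrow>
    dird b (\<lambda>x. p x + q x) x = dird b p x + dird b q x"
  by (rule dird_eqI) (auto intro!: derivative_eq_intros dest!: differentiable_dird)

lemma dird_mult:
  fixes p q :: "'a::euclidean_space \<Rightarrow> real"
  shows "p differentiable (at x) \<Longrightarrow> q differentiable (at x) \<Longrightarrow>
    dird b (\<lambda>x. p x * q x) x = p x * dird b q x + dird b p x * q x"
  by (rule dird_eqI) (auto intro!: derivative_eq_intros dest!: differentiable_dird)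

lemma real_polynomial_function_differentiable:
  "real_polynomial_function p \<Longrightarrow> (p :: 'a::euclidean_space \<Rightarrow> real) differentiable (at x)"
proof (induction rule: real_polynomial_function.induct)
  case (linear f)
  then show ?case using bounded_linear_imp_differentiable by blast
qed auto

lemma dird_linear: "bounded_linear f \<Longrightarrow> dird b f = (\<lambda>x. f b)"
  by (rule ext, rule dird_eqI, rule bounded_linear_imp_has_derivative)

lemma dird_const [simp]: "dird b (\<lambda>x. c) = (\<lambda>x. 0)" by (rule ext) (auto intro!: dird_eqI derivative_eq_intros)

lemma dird_add_poly:
  fixes p q :: "'a::euclidean_space \<Rightarrow> real"
  shows "real_polynomial_function p \<Longrightarrow> real_polynomial_function q \<Longrightarrow>
    dird b (\<lambda>x. p x + q x) = (\<lambda>x. dird b p x + dird b q x)"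
  by (rule ext) (simp add: dird_add real_polynomial_function_differentiable)

lemma dird_mult_poly:
  fixes p q :: "'a::euclidean_space \<Rightarrow> real"
  shows "real_polynomial_function p \<Longrightarrow> real_polynomial_function q \<Longrightarrow>
    dird b (\<lambda>x. p x * q x) = (\<lambda>x. p x * dird b q x + dird b p x * q x)"
  by (rule ext) (simp add: dird_mult real_polynomial_function_differentiable)

lemma real_polynomial_function_dird:
  "real_polynomial_function p \<Longrightarrow> real_polynomial_function (dird b (p :: 'a::euclidean_space \<Rightarrow> real))"
proof (induction rule: real_polynomial_function.induct)
  case (linear f)
  then show ?case by (auto simp: dird_linear)
qed (auto simp: dird_add_poly dird_mult_poly)

lemma dird_commute:
  "real_polynomial_function p \<Longrightarrow> dird a (dird b p) = dird b (dird a (p :: 'a::euclidean_space \<Rightarrow> real))"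
proof (induction rule: real_polynomial_function.induct)
  case (linear f)
  then show ?case by (simp add: dird_linear)
next
  case (const c)
  show ?case by simp
next
  case (add f g)
  then show ?case by (simp add: dird_add_poly real_polynomial_function_dird)
next
  case (mult f g)
  note p = mult.hyps mult.hyps[THEN real_polynomial_function_dird]
  have "dird a (dird b (\<lambda>x. f x * g x))
      = (\<lambda>x. (f x * dird a (dird b g) x + dird a f x * dird b g x) +
          (dird b f x * dird a g x + dird a (dird b f) x * g x))" for a b
    by (simp add: dird_mult_poly p dird_add_poly real_polynomial_function.intros(4))
  then show ?case by (simp add: mult.IH add_ac mult_ac)
qed

lemma real_polynomial_function_growth:
  assumes "real_polynomial_function (p :: 'a::euclidean_space \<Rightarrow> real)"
  obtains C N where "C \<ge> 0" "\<And>x. \<bar>p x\<bar> \<le> C * (1 + norm x) ^ N"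
proof -
  have "\<exists>C N. C \<ge> 0 \<and> (\<forall>x. \<bar>p x\<bar> \<le> C * (1 + norm x) ^ N)" using assms
  proof (induction rule: real_polynomial_function.induct)
    case (linear f)
    then obtain K where "K \<ge> 0" "\<And>x. \<bar>f x\<bar> \<le> norm x * K" using bounded_linear.nonneg_bounded[OF linear] by auto
    then have "\<bar>f x\<bar> \<le> K * (1 + norm x) ^ 1" for x by (smt (verit, best) mult.commute mult_left_mono power_one_right)
    then show ?case using \<open>K \<ge> 0\<close> by blast
  next
    case (const c)
    show ?case by (rule exI[of _ "\<bar>c\<bar>"], rule exI[of _ 0]) auto
  next
    case (add f g)
    then obtain C N D M where *: "C \<ge> 0" "\<And>x. \<bar>f x\<bar> \<le> C * (1 + norm x) ^ N"
      "D \<ge> 0" "\<And>x. \<bar>g x\<bar> \<le> D * (1 + norm x) ^ M" by blast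
    have "\<bar>f x + g x\<bar> \<le> (C + D) * (1 + norm x) ^ (N + M)" for x
    proof -
      have "C * (1 + norm x) ^ N \<le> C * (1 + norm x) ^ (N + M)" "D * (1 + norm x) ^ M \<le> D * (1 + norm x) ^ (N + M)"
        using * by (auto intro!: mult_left_mono power_increasing)
      then show ?thesis using *(2)[of x] *(4)[of x] by (simp add: algebra_simps)
    qed
    then show ?case using * by (intro exI[of _ "C + D"] exI[of _ "N + M"]) auto
  next
    case (mult f g)
    then obtain C N D M where *: "C \<ge> 0" "\<And>x. \<bar>f x\<bar> \<le> C * (1 + norm x) ^ N"
      "D \<ge> 0" "\<And>x. \<bar>g x\<bar> \<le> D * (1 + norm x) ^ M" by blast
    have "\<bar>f x * g x\<bar> \<le> (C * D) * (1 + norm x) ^ (N + M)" for x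
      using mult_mono[OF *(2)[of x] *(4)[of x]] * by (simp add: abs_mult power_add mult_ac)
    then show ?case using * by (intro exI[of _ "C * D"] exI[of _ "N + M"]) auto
  qed
  then show ?thesis using that by blast
qed

lemma real_polynomial_function_measurable:
  "real_polynomial_function p \<Longrightarrow> (p :: 'a::euclidean_space \<Rightarrow> real) \<in> borel_measurable borel"
  by (intro borel_measurable_continuous_onI continuous_on_polymonial_function)
     (simp add: real_polynomial_function_eq)

text \<open>
  The radial factor of a Gaussian moment of degree \<open>m - d + 1\<close> in \<open>d\<close> dimensions.
\<close>

definition gauss_const :: "nat \<Rightarrow> real" where
  "gauss_const m = (LINT r|lborel. indicator {0..} r * (exp (-r\<^sup>2) * r ^ m))"

lemma has_bochner_integral_gauss_const:
  "has_bochner_integral lborel (\<lambda>r. indicator {0..} r * (exp (-r\<^sup>2) * r ^ m)) (gauss_const m)"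
  and gauss_const_pos: "gauss_const m > 0"
  and gauss_const_rec: "gauss_const (m + 2) = (real m + 1) / 2 * gauss_const m"
proof -
  have even: "has_bochner_integral lborel (\<lambda>r. indicator {0..} r * (exp (-r\<^sup>2) * r ^ (2 * k)))
      (sqrt pi / 2 * (fact (2 * k) / (2 ^ (2 * k) * fact k)))" for k using gaussian_moment_even_pos[of k] by simp
  have odd: "has_bochner_integral lborel (\<lambda>r. indicator {0..} r * (exp (-r\<^sup>2) * r ^ (2 * k + 1))) (fact k / 2 :: real)" for k
    using gaussian_moment_odd_pos[of k] by (simp only: real_scaleR_def)
  have c_even: "gauss_const (2 * k) = sqrt pi / 2 * (fact (2 * k) / (2 ^ (2 * k) * fact k))" for k
    unfolding gauss_const_def by (rule has_bochner_integral_integral_eq[OF even])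
  have c_odd: "gauss_const (2 * k + 1) = fact k / 2" for k
    unfolding gauss_const_def by (rule has_bochner_integral_integral_eq[OF odd])
  show "has_bochner_integral lborel (\<lambda>r. indicator {0..} r * (exp (-r\<^sup>2) * r ^ m)) (gauss_const m)"
  proof (cases "even m")
    case True
    then obtain k where "m = 2 * k" by (elim evenE)
    then show ?thesis using even[of k] c_even[of k] by simp
  next
    case False
    then obtain k where "m = 2 * k + 1" by (elim oddE)
    then show ?thesis using odd[of k] c_odd[of k] by (simp only:)
  qed
  show "gauss_const m > 0"
  proof (cases "even m")
    case True
    then obtain k where "m = 2 * k" by (elim evenE)
    then show ?thesis using c_even[of k] by simp
  next
    case False
    then obtain k where "m = 2 * k + 1" by (elim oddE)
    then show ?thesis by (simp only: c_odd) simp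
  qed
  show "gauss_const (m + 2) = (real m + 1) / 2 * gauss_const m"
  proof (cases "even m")
    case True
    then obtain k where k: "m = 2 * k" by (elim evenE)
    have "gauss_const (m + 2) = sqrt pi / 2 * (fact (2 * k + 2) / (2 ^ (2 * k + 2) * fact (k + 1)))"
      using c_even[of "k + 1"] k by simp
    also have "(fact (2 * k + 2) :: real) = (2 * real k + 2) * (2 * real k + 1) * fact (2 * k)"
      by (simp add: algebra_simps)
    also have "(fact (k + 1) :: real) = (real k + 1) * fact k" by simp
    also have "(2::real) ^ (2 * k + 2) = 4 * 2 ^ (2 * k)" by simp
    also have "sqrt pi / 2 * ((2 * real k + 2) * (2 * real k + 1) * fact (2 * k) / (4 * 2 ^ (2 * k) * ((real k + 1) * fact k)))
      = (2 * real k + 1) / 2 * (sqrt pi / 2 * (fact (2 * k) / (2 ^ (2 * k) * fact k)))"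
    proof -
      have "s / 2 * ((2 * x + 2) * (2 * x + 1) * C / (4 * A * ((x + 1) * B))) = (2 * x + 1) / 2 * (s / 2 * (C / (A * B)))"
        if "A > 0" "B > 0" "x \<ge> 0" for s A B C x :: real using that by (simp add: divide_simps)
      then show ?thesis by simp
    qed
    finally show ?thesis using k c_even[of k] by simp
  next
    case False
    then obtain k where k: "m = 2 * k + 1" by (elim oddE)
    then have "m + 2 = 2 * (k + 1) + 1" by simp
    then have g1: "gauss_const (m + 2) = fact (k + 1) / 2" by (simp only: c_odd)
    have g2: "gauss_const m = fact k / 2" unfolding k by (rule c_odd)
    show ?thesis unfolding g1 g2 using k by (simp add: field_simps)
  qed
qed

lemma nn_integral_gauss_const:
  "(\<integral>\<^sup>+r. ennreal (exp (-r\<^sup>2) * r ^ m) * indicator {0<..} r \<partial>lborel) = ennreal (gauss_const m)"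
proof -
  have "(\<integral>\<^sup>+r. ennreal (exp (-r\<^sup>2) * r ^ m) * indicator {0<..} r \<partial>lborel)
     = (\<integral>\<^sup>+r. ennreal (indicator {0..} r * (exp (-r\<^sup>2) * r ^ m)) \<partial>lborel)"
    by (intro nn_integral_cong_AE AE_I[of _ _ "{0}"]) (auto split: split_indicator)
  also have "\<dots> = ennreal (gauss_const m)" unfolding gauss_const_def
    by (intro nn_integral_eq_integral has_bochner_integral_gauss_const[THEN integrable.intros])
       (auto split: split_indicator)
  finally show ?thesis .
qed

lemma integrable_power_gauss:
  "integrable lborel (\<lambda>x::'a::euclidean_space. norm x ^ m * exp (-(norm x)\<^sup>2))"
proof -
  have "integrable lborel (\<lambda>x::'a. (exp (-(norm x)\<^sup>2) * norm x ^ m) *\<^sub>R (1::real))"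
  proof (rule integral_polar(2)[where F="\<lambda>_. 1::real" and w="\<lambda>r. exp (-r\<^sup>2) * r ^ m"])
    show "(\<integral>\<^sup>+r. ennreal (exp (-r\<^sup>2) * r ^ m * r ^ (DIM('a) - 1)) * indicator {0<..} r \<partial>lborel)
       = ennreal (gauss_const (m + (DIM('a) - 1)))"
      using nn_integral_gauss_const[of "m + (DIM('a) - 1)"] by (simp only: power_add mult.assoc)
    show "integrable (surface :: 'a measure) (\<lambda>_. 1 :: real)"
      using finite_measure.integrable_const[OF finite_measure_surface] by blast
  qed (use gauss_const_pos in \<open>auto simp: less_imp_le\<close>)
  then show ?thesis by (simp add: mult.commute)
qed

lemma integrable_poly_gauss:
  assumes "real_polynomial_function (p :: 'a::euclidean_space \<Rightarrow> real)"
  shows "integrable lborel (\<lambda>x. p x * exp (-(norm x)\<^sup>2))"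
proof -
  obtain C N where C: "C \<ge> 0" "\<And>x. \<bar>p x\<bar> \<le> C * (1 + norm x) ^ N"
    using real_polynomial_function_growth[OF assms] by blast
  note [measurable] = real_polynomial_function_measurable[OF assms]
  have "integrable lborel (\<lambda>x::'a. C * 2 ^ N * (norm x ^ 0 * exp (-(norm x)\<^sup>2) + norm x ^ N * exp (-(norm x)\<^sup>2)))"
    by (intro integrable_mult_right Bochner_Integration.integrable_add integrable_power_gauss)
  then show ?thesis
  proof (rule Bochner_Integration.integrable_bound)
    show "AE x in lborel. norm (p x * exp (-(norm x)\<^sup>2))
        \<le> norm (C * 2 ^ N * (norm x ^ 0 * exp (-(norm x)\<^sup>2) + norm x ^ N * exp (-(norm x)\<^sup>2)))"
    proof (rule AE_I2)
      fix x :: 'a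
      have "(1 + norm x) ^ N \<le> (2 * max 1 (norm x)) ^ N" by (intro power_mono) auto
      also have "\<dots> \<le> 2 ^ N * (1 + norm x ^ N)" by (auto simp: power_mult_distrib max_def intro!: mult_left_mono)
      finally have "C * (1 + norm x) ^ N \<le> C * (2 ^ N * (1 + norm x ^ N))" using C by (intro mult_left_mono) auto
      then have "\<bar>p x\<bar> \<le> C * (2 ^ N * (1 + norm x ^ N))" using C(2)[of x] by simp
      then have "\<bar>p x\<bar> * exp (-(norm x)\<^sup>2) \<le> C * (2 ^ N * (1 + norm x ^ N)) * exp (-(norm x)\<^sup>2)"
        by (intro mult_right_mono) auto
      then show "norm (p x * exp (-(norm x)\<^sup>2))
        \<le> norm (C * 2 ^ N * (norm x ^ 0 * exp (-(norm x)\<^sup>2) + norm x ^ N * exp (-(norm x)\<^sup>2)))"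
        using C by (simp add: abs_mult algebra_simps)
    qed
  qed measurable
qed

lemma lborel_integral_translation:
  fixes f :: "'a::euclidean_space \<Rightarrow> real"
  assumes "f \<in> borel_measurable borel"
  shows "(LINT x|lborel. f (x + c)) = (LINT x|lborel. f x)"
    and "integrable lborel f \<Longrightarrow> integrable lborel (\<lambda>x. f (x + c))"
proof -
  have "(LINT x|lborel. f x) = (LINT x|distr lborel borel ((+) c). f x)" by (simp add: lborel_distr_plus)
  also have "\<dots> = (LINT x|lborel. f (x + c))" using assms by (subst integral_distr) (auto simp: add.commute)
  finally show "(LINT x|lborel. f (x + c)) = (LINT x|lborel. f x)" ..
  assume "integrable lborel f"
  then have "integrable (distr lborel borel ((+) c)) f" by (simp add: lborel_distr_plus)
  then show "integrable lborel (\<lambda>x. f (x + c))"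
    by (subst (asm) integrable_distr_eq) (use assms in \<open>auto simp: add.commute\<close>)
qed

text \<open>
  The integral of a derivative along \<open>b\<close> vanishes because translation by \<open>b\<close>
  preserves Lebesgue measure.
\<close>

lemma gauss_integration_by_parts:
  fixes p :: "'a::euclidean_space \<Rightarrow> real"
  assumes p: "real_polynomial_function p"
  shows "(LINT x|lborel. (x \<bullet> b) * p x * exp (-(norm x)\<^sup>2))
    = (1/2) * (LINT x|lborel. dird b p x * exp (-(norm x)\<^sup>2))"
proof -
  define \<phi> where "\<phi> x = p x * exp (-(norm x)\<^sup>2)" for x
  define q where "q x = dird b p x - 2 * (x \<bullet> b) * p x" for x
  define \<psi> where "\<psi> x = q x * exp (-(norm x)\<^sup>2)" for x
  have lin: "real_polynomial_function (\<lambda>x. x \<bullet> b)"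
    by (intro real_polynomial_function.intros(1) bounded_linear_inner_left)
  have xp: "real_polynomial_function (\<lambda>x. (x \<bullet> b) * p x)" using lin p by auto
  have q: "real_polynomial_function q" unfolding q_def mult.assoc
    using real_polynomial_function_dird[OF p] xp by (intro real_polynomial_function_diff) auto
  note [measurable] = real_polynomial_function_measurable[OF p] real_polynomial_function_measurable[OF q]
  have [measurable]: "\<phi> \<in> borel_measurable borel" "\<psi> \<in> borel_measurable borel" unfolding \<phi>_def \<psi>_def by measurable
  have int: "integrable lborel \<phi>" "integrable lborel \<psi>"
    unfolding \<phi>_def \<psi>_def using integrable_poly_gauss[OF p] integrable_poly_gauss[OF q] by auto
  have deriv: "((\<lambda>r. \<phi> (x + r *\<^sub>R b)) has_real_derivative \<psi> (x + r *\<^sub>R b)) (at r)" for x r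
  proof -
    have dp: "(p has_derivative (\<lambda>h. dird h p y)) (at y)" for y
      by (intro differentiable_dird real_polynomial_function_differentiable p)
    have "(\<phi> has_derivative (\<lambda>h. dird h p y * exp (-(norm y)\<^sup>2) + p y * (exp (-(norm y)\<^sup>2) * (- (2 * (y \<bullet> h)))))) (at y)" for y
    proof -
      have 1: "((\<lambda>y. (norm y)\<^sup>2) has_derivative (\<lambda>h. 2 * (y \<bullet> h))) (at y)" unfolding power2_norm_eq_inner
        by (rule has_derivative_eq_rhs[OF has_derivative_inner[OF has_derivative_ident has_derivative_ident]])
           (simp add: inner_commute)
      show ?thesis unfolding \<phi>_def
        by (rule has_derivative_eq_rhs[OF has_derivative_mult[OF dp has_derivative_exp[OF has_derivative_minus[OF 1]]]])
           (rule ext, simp add: algebra_simps)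
    qed
    note d\<phi> = this
    define y where "y = x + r *\<^sub>R b"
    have "((\<lambda>r. x + r *\<^sub>R b) has_derivative (\<lambda>s. s *\<^sub>R b)) (at r)" by (auto intro!: derivative_eq_intros)
    from has_derivative_compose[OF this d\<phi>]
    have "((\<lambda>r. \<phi> (x + r *\<^sub>R b)) has_derivative (\<lambda>s. dird (s *\<^sub>R b) p y * exp (-(norm y)\<^sup>2)
        + p y * (exp (-(norm y)\<^sup>2) * (- (2 * (y \<bullet> (s *\<^sub>R b))))))) (at r)" by (simp only: y_def)
    moreover have "dird (s *\<^sub>R b) p y * exp (-(norm y)\<^sup>2)
        + p y * (exp (-(norm y)\<^sup>2) * (- (2 * (y \<bullet> (s *\<^sub>R b))))) = \<psi> y * s" for s
      using linear_scale[OF has_derivative_linear[OF dp[of y]], of s b] by (simp add: \<psi>_def q_def algebra_simps)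
    ultimately show ?thesis unfolding has_field_derivative_def y_def[symmetric] by (elim has_derivative_eq_rhs) auto
  qed
  have cont: "isCont (\<lambda>r. \<psi> (x + r *\<^sub>R b)) r" for x r
  proof -
    have "continuous_on UNIV q"
      using q by (intro continuous_on_polymonial_function) (simp add: real_polynomial_function_eq)
    then have "continuous_on UNIV (\<lambda>r. \<psi> (x + r *\<^sub>R b))" unfolding \<psi>_def
      by (auto intro!: continuous_intros elim: continuous_on_compose2)
    then show ?thesis by (simp add: continuous_on_eq_continuous_at)
  qed
  have ftc: "(LINT r|lborel. \<psi> (x + r *\<^sub>R b) * indicator {0..1} r) = \<phi> (x + b) - \<phi> x" for x
    using integral_FTC_Icc_real[of 0 1 "\<lambda>r. \<phi> (x + r *\<^sub>R b)" "\<lambda>r. \<psi> (x + r *\<^sub>R b)"] deriv cont by simp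
  have "integrable (lborel \<Otimes>\<^sub>M lborel) (\<lambda>(r::real, x::'a). \<psi> (x + r *\<^sub>R b) * indicator {0..1} r)"
  proof (rule lborel_pair.Fubini_integrable)
    have "(LINT y|lborel. norm (case (r, y) of (r, x) \<Rightarrow> \<psi> (x + r *\<^sub>R b) * indicator {0..1} r))
       = (LINT y|lborel. \<bar>\<psi> y\<bar>) * indicator {0..1} r" for r :: real
      using lborel_integral_translation(1)[of "\<lambda>x. \<bar>\<psi> x\<bar>" "r *\<^sub>R b"] by (auto simp: abs_mult split: split_indicator)
    then show "integrable lborel (\<lambda>r. LINT y|lborel. norm (case (r, y) of (r, x) \<Rightarrow> \<psi> (x + r *\<^sub>R b) * indicator {0..1} r))"
      by simp
    show "AE r in lborel. integrable lborel (\<lambda>y. case (r, y) of (r, x) \<Rightarrow> \<psi> (x + r *\<^sub>R b) * indicator {0..1} r)"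
      using lborel_integral_translation(2)[OF _ int(2)] by auto
  qed measurable
  then have "(LINT x|lborel. LINT r|lborel. \<psi> (x + r *\<^sub>R b) * indicator {0..1} r)
     = (LINT r|lborel. LINT x|lborel. \<psi> (x + r *\<^sub>R b) * indicator {0..1} r)"
    by (rule lborel_pair.Fubini_integral[of "\<lambda>r x. \<psi> (x + r *\<^sub>R b) * indicator {0..1} r"])
  also have "\<dots> = (LINT r|lborel. (LINT x|lborel. \<psi> x) * indicator {0..1::real} r)"
    by (intro Bochner_Integration.integral_cong) (auto simp: lborel_integral_translation(1)[of \<psi>])
  also have "\<dots> = (LINT x|lborel. \<psi> x)" by simp
  also have "(LINT x|lborel. LINT r|lborel. \<psi> (x + r *\<^sub>R b) * indicator {0..1} r) = (LINT x|lborel. \<phi> (x + b) - \<phi> x)"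
    by (simp add: ftc)
  also have "\<dots> = 0" using int(1) lborel_integral_translation[of \<phi> b] by (subst Bochner_Integration.integral_diff) auto
  finally have "(LINT x|lborel. dird b p x * exp (-(norm x)\<^sup>2) - 2 * ((x \<bullet> b) * p x * exp (-(norm x)\<^sup>2))) = 0"
    by (simp add: \<psi>_def q_def algebra_simps)
  then show ?thesis
    using integrable_poly_gauss[OF xp] integrable_poly_gauss[OF real_polynomial_function_dird[OF p, of b]]
    by (subst (asm) Bochner_Integration.integral_diff) auto
qed

definition homogeneous :: "nat \<Rightarrow> ('a::euclidean_space \<Rightarrow> real) \<Rightarrow> bool" where
  "homogeneous l H \<longleftrightarrow> (\<forall>c>0. \<forall>x. H (c *\<^sub>R x) = c ^ l * H x)"

lemma integral_homogeneous_gauss: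
  fixes H :: "'a::euclidean_space \<Rightarrow> real"
  assumes H: "real_polynomial_function H" and l: "homogeneous l H"
  shows "(LINT x|lborel. H x * exp (-(norm x)\<^sup>2)) = gauss_const (l + DIM('a) - 1) * (LINT \<eta>|surface. H \<eta>)"
proof -
  note [measurable] = real_polynomial_function_measurable[OF H]
  have "(LINT x|lborel. H x * exp (-(norm x)\<^sup>2)) = (LINT x|lborel. (exp (-(norm x)\<^sup>2) * norm x ^ l) *\<^sub>R H (direction x))"
  proof (rule integral_cong_AE)
    have "H x = norm x ^ l * H (direction x)" if "x \<noteq> 0" for x
      using l[unfolded homogeneous_def, rule_format, of "norm x" "direction x"] that by (simp add: direction_def)
    then show "AE x in lborel. H x * exp (-(norm x)\<^sup>2) = (exp (-(norm x)\<^sup>2) * norm x ^ l) *\<^sub>R H (direction x)"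
      by (intro AE_I[of _ _ "{0}"]) (auto simp: mult_ac)
  qed measurable
  also have "\<dots> = gauss_const (l + DIM('a) - 1) *\<^sub>R (LINT \<eta>|surface. H \<eta>)"
  proof (rule integral_polar(1)[where w="\<lambda>r. exp (-r\<^sup>2) * r ^ l"])
    have "l + DIM('a) - 1 = l + (DIM('a) - 1)" using DIM_positive[where 'a='a] by linarith
    then show "(\<integral>\<^sup>+r. ennreal (exp (-r\<^sup>2) * r ^ l * r ^ (DIM('a) - 1)) * indicator {0<..} r \<partial>lborel)
       = ennreal (gauss_const (l + DIM('a) - 1))"
      using nn_integral_gauss_const[of "l + (DIM('a) - 1)"] by (simp only: power_add mult.assoc)
    have "H \<in> borel_measurable (restrict_space borel (sphere 0 1))" by (intro measurable_restrict_space1) measurable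
    then show "H \<in> borel_measurable surface" by (simp add: measurable_cong_sets[OF sets_surface refl])
  qed (use gauss_const_pos in \<open>auto simp: less_imp_le\<close>)
  finally show ?thesis by simp
qed

lemma homogeneous_dird:
  assumes H: "real_polynomial_function H" and l: "homogeneous (Suc l) (H :: 'a::euclidean_space \<Rightarrow> real)"
  shows "homogeneous l (dird b H)" unfolding homogeneous_def
proof (intro allI impI)
  fix c :: real and x :: 'a assume c: "c > 0"
  have dH: "(H has_derivative (\<lambda>h. dird h H y)) (at y)" for y
    by (intro differentiable_dird real_polynomial_function_differentiable H)
  have "((\<lambda>x. H (c *\<^sub>R x)) has_derivative (\<lambda>h. dird (c *\<^sub>R h) H (c *\<^sub>R x))) (at x)"
    by (rule has_derivative_compose[of "\<lambda>x. c *\<^sub>R x" "\<lambda>h. c *\<^sub>R h", OF _ dH]) (auto intro!: derivative_eq_intros)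
  moreover have "(\<lambda>x. H (c *\<^sub>R x)) = (\<lambda>x. c ^ Suc l * H x)" using l c by (auto simp: homogeneous_def)
  moreover have "((\<lambda>x. c ^ Suc l * H x) has_derivative (\<lambda>h. c ^ Suc l * dird h H x)) (at x)"
    using dH by (auto intro!: derivative_eq_intros)
  ultimately have "(\<lambda>h. dird (c *\<^sub>R h) H (c *\<^sub>R x)) = (\<lambda>h. c ^ Suc l * dird h H x)" using has_derivative_unique by metis
  then have "dird (c *\<^sub>R b) H (c *\<^sub>R x) = c ^ Suc l * dird b H x" by metis
  moreover have "dird (c *\<^sub>R b) H (c *\<^sub>R x) = c * dird b H (c *\<^sub>R x)"
    using linear_scale[OF has_derivative_linear[OF dH[of "c *\<^sub>R x"]], of c b] by simp
  ultimately show "dird b H (c *\<^sub>R x) = c ^ l * dird b H x" using c by simp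
qed

lemma euler_homogeneous:
  assumes H: "real_polynomial_function H" and l: "homogeneous l (H :: 'a::euclidean_space \<Rightarrow> real)"
  shows "dird x H x = real l * H x"
proof -
  have dH: "(H has_derivative (\<lambda>h. dird h H y)) (at y)" for y
    by (intro differentiable_dird real_polynomial_function_differentiable H)
  have "((\<lambda>c. H (c *\<^sub>R x)) has_derivative (\<lambda>h. dird (h *\<^sub>R x) H (1 *\<^sub>R x))) (at 1)"
    by (rule has_derivative_compose[of "\<lambda>c. c *\<^sub>R x" "\<lambda>h. h *\<^sub>R x" 1 UNIV H, OF _ dH]) (auto intro!: derivative_eq_intros)
  moreover have "dird (h *\<^sub>R x) H y = h * dird x H y" for h y
    using linear_scale[OF has_derivative_linear[OF dH[of y]], of h x] by simp
  ultimately have "((\<lambda>c. H (c *\<^sub>R x)) has_real_derivative dird x H x) (at 1)"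
    unfolding has_field_derivative_def by (elim has_derivative_eq_rhs) (auto simp: mult.commute)
  moreover have "((\<lambda>c. H (c *\<^sub>R x)) has_real_derivative real l * H x) (at 1)"
  proof (rule has_field_derivative_transform_within_open[where S="{0<..}"])
    show "((\<lambda>c. c ^ l * H x) has_real_derivative real l * H x) (at 1)" by (auto intro!: derivative_eq_intros)
    show "c \<in> {0<..} \<Longrightarrow> c ^ l * H x = H (c *\<^sub>R x)" for c using l by (simp add: homogeneous_def)
  qed auto
  ultimately show ?thesis by (rule DERIV_unique)
qed

lemma homogeneous_0_const:
  assumes H: "real_polynomial_function H" and l: "homogeneous 0 (H :: 'a::euclidean_space \<Rightarrow> real)"
  shows "H x = H 0"
proof -
  have "continuous_on UNIV H"
    using H by (intro continuous_on_polymonial_function) (simp add: real_polynomial_function_eq)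
  then have "isCont H 0" by (simp add: continuous_on_eq_continuous_at)
  moreover have "((\<lambda>c. c *\<^sub>R x) \<longlongrightarrow> 0) (at_right (0::real))" by (auto intro!: tendsto_eq_intros)
  ultimately have "((\<lambda>c. H (c *\<^sub>R x)) \<longlongrightarrow> H 0) (at_right (0::real))" by (rule isCont_tendsto_compose)
  moreover have "eventually (\<lambda>c. H (c *\<^sub>R x) = H x) (at_right (0::real))"
    using l by (auto simp: homogeneous_def eventually_at_filter)
  ultimately have "((\<lambda>c. H x) \<longlongrightarrow> H 0) (at_right (0::real))" by (simp cong: tendsto_cong)
  then show ?thesis using tendsto_unique[OF trivial_limit_at_right_real tendsto_const] by blast
qed

definition harmonic :: "('a::euclidean_space \<Rightarrow> real) \<Rightarrow> bool" where
  "harmonic H \<longleftrightarrow> (\<forall>x. (\<Sum>b\<in>Basis. dird b (dird b H) x) = 0)"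

lemma harmonic_dird:
  assumes H: "real_polynomial_function H" and h: "harmonic H"
  shows "harmonic (dird a H)" unfolding harmonic_def
proof
  fix x
  note r = real_polynomial_function_dird
  have 1: "dird b (dird b (dird a H)) = dird a (dird b (dird b H))" for b
    by (simp add: dird_commute[OF H, of b a] dird_commute[OF r[OF H], of b a])
  have d: "dird b (dird b H) differentiable (at x)" for b by (intro real_polynomial_function_differentiable r H)
  have "((\<lambda>x. \<Sum>b\<in>Basis. dird b (dird b H) x) has_derivative (\<lambda>c. \<Sum>b\<in>Basis. dird c (dird b (dird b H)) x)) (at x)"
    by (intro has_derivative_sum differentiable_dird d)
  then have "dird a (\<lambda>x. \<Sum>b\<in>Basis. dird b (dird b H) x) x = (\<Sum>b\<in>Basis. dird a (dird b (dird b H)) x)" by (rule dird_eqI)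
  moreover have "(\<lambda>x. \<Sum>b\<in>Basis. dird b (dird b H) x) = (\<lambda>x. 0)" using h by (auto simp: harmonic_def)
  ultimately show "(\<Sum>b\<in>Basis. dird b (dird b (dird a H)) x) = 0" by (simp add: 1)
qed

text \<open>
  The Gaussian moments of \<open>H(x) (\<xi> \<bullet> x)\<^sup>m\<close> for a harmonic \<open>H\<close> of degree \<open>l\<close>, divided by \<open>H(\<xi>)\<close>, as
  computed by integration by parts; \<open>G\<close> is the total Gaussian mass. What matters is that they
  depend on the degree alone.
\<close>

fun gauss_moment :: "real \<Rightarrow> nat \<Rightarrow> nat \<Rightarrow> real" where
  "gauss_moment G l 0 = (if l = 0 then G else 0)"
| "gauss_moment G l (Suc 0) = real l / 2 * gauss_moment G (l - 1) 0"
| "gauss_moment G l (Suc (Suc m)) = real l / 2 * gauss_moment G (l - 1) (Suc m) + (real m + 1) / 2 * gauss_moment G l m"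

text \<open>
  By Euler's identity \<open>l H\<close> is the sum of the \<open>x\<^sub>b \<partial>\<^sub>b H\<close>, and integration by parts turns its
  integral into half the integral of the Laplacian, which vanishes.
\<close>

lemma gauss_moment_harmonic_0:
  fixes H :: "'a::euclidean_space \<Rightarrow> real"
  assumes H: "real_polynomial_function H" and l: "homogeneous l H" and h: "harmonic H"
  shows "(LINT x|lborel. H x * exp (-(norm x)\<^sup>2))
    = gauss_moment (LINT x|(lborel :: 'a measure). exp (-(norm x)\<^sup>2)) l 0 * H \<xi>"
proof (cases "l = 0")
  case True
  then have "H x = H \<xi>" for x using homogeneous_0_const[of H x] homogeneous_0_const[of H \<xi>] H l by simp
  then have "(LINT x|lborel. H x * exp (-(norm x)\<^sup>2)) = (LINT x|lborel. H \<xi> * exp (-(norm (x::'a))\<^sup>2))"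
    by (intro Bochner_Integration.integral_cong) auto
  then show ?thesis using True by simp
next
  case False
  have H1: "real_polynomial_function (dird b H)" for b by (intro real_polynomial_function_dird H)
  have "real_polynomial_function (\<lambda>x. x \<bullet> b)" for b :: 'a
    by (intro real_polynomial_function.intros(1) bounded_linear_inner_left)
  then have H2: "real_polynomial_function (\<lambda>x. (x \<bullet> b) * dird b H x)" for b using H1 by auto
  have "H x = (1 / real l) * (\<Sum>b\<in>Basis. (x \<bullet> b) * dird b H x)" for x
  proof -
    have dH: "(H has_derivative (\<lambda>h. dird h H y)) (at y)" for y
      by (intro differentiable_dird real_polynomial_function_differentiable H)
    have "dird x H x = dird (\<Sum>b\<in>Basis. (x \<bullet> b) *\<^sub>R b) H x" by (simp add: euclidean_representation)
    also have "\<dots> = (\<Sum>b\<in>Basis. (x \<bullet> b) * dird b H x)"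
      using linear_sum[OF has_derivative_linear[OF dH[of x]], of "\<lambda>b. (x \<bullet> b) *\<^sub>R b" Basis]
        linear_scale[OF has_derivative_linear[OF dH[of x]]] by simp
    finally show ?thesis using euler_homogeneous[OF H l, of x] False by (simp add: field_simps)
  qed
  then have "(LINT x|lborel. H x * exp (-(norm x)\<^sup>2))
     = (LINT x|lborel. (1 / real l) * (\<Sum>b\<in>Basis. (x \<bullet> b) * dird b H x * exp (-(norm x)\<^sup>2)))"
    by (intro Bochner_Integration.integral_cong) (auto simp: sum_distrib_right)
  also have "\<dots> = (1 / real l) * (\<Sum>b\<in>Basis. LINT x|lborel. (x \<bullet> b) * dird b H x * exp (-(norm x)\<^sup>2))"
    by (subst integral_mult_right_zero, subst Bochner_Integration.integral_sum) (auto intro: integrable_poly_gauss[OF H2])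
  also have "\<dots> = (1 / real l) * (\<Sum>b\<in>Basis. (1/2) * (LINT x|lborel. dird b (dird b H) x * exp (-(norm x)\<^sup>2)))"
    by (simp add: gauss_integration_by_parts[OF H1])
  also have "\<dots> = (1 / real l) * (1/2) * (LINT x|lborel. (\<Sum>b\<in>Basis. dird b (dird b H) x * exp (-(norm x)\<^sup>2)))"
    by (subst Bochner_Integration.integral_sum)
      (auto intro: integrable_poly_gauss[OF real_polynomial_function_dird[OF H1]] simp: sum_distrib_left mult_ac)
  also have "\<dots> = 0" using h by (simp add: sum_distrib_right[symmetric] harmonic_def)
  finally show ?thesis using False by simp
qed

text \<open>
  Integrating by parts along \<open>\<xi>\<close> replaces \<open>H\<close> by its derivative along \<open>\<xi>\<close>, which is again harmonic
  and homogeneous, and whose value at \<open>\<xi>\<close> is \<open>l H(\<xi>)\<close> by Euler's identity.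
\<close>

lemma gauss_moment_harmonic:
  fixes H :: "'a::euclidean_space \<Rightarrow> real"
  assumes "real_polynomial_function H" and "homogeneous l H" and "harmonic H" and xi: "norm \<xi> = 1"
  shows "(LINT x|lborel. H x * (\<xi> \<bullet> x) ^ m * exp (-(norm x)\<^sup>2))
    = gauss_moment (LINT x|(lborel :: 'a measure). exp (-(norm x)\<^sup>2)) l m * H \<xi>"
proof -
  define G where "G = (LINT x|(lborel :: 'a measure). exp (-(norm x)\<^sup>2))"
  have lin: "real_polynomial_function (\<lambda>x. \<xi> \<bullet> x)"
    by (intro real_polynomial_function.intros(1) bounded_linear_inner_right)
  have pw: "real_polynomial_function (\<lambda>x. (\<xi> \<bullet> x) ^ m)" for m using lin by auto
  have dpw: "dird \<xi> (\<lambda>x. (\<xi> \<bullet> x) ^ m) y = real m * (\<xi> \<bullet> y) ^ (m - 1)" for m y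
  proof -
    have "((\<lambda>x. (\<xi> \<bullet> x) ^ m) has_derivative (\<lambda>h. real m * (\<xi> \<bullet> h) * (\<xi> \<bullet> y) ^ (m - 1))) (at y)"
      by (auto intro!: derivative_eq_intros)
    from dird_eqI[OF this, of \<xi>] show ?thesis using xi by (simp add: norm_eq_1)
  qed
  have step: "(LINT x|lborel. K x * (\<xi> \<bullet> x) ^ Suc m * exp (-(norm x)\<^sup>2))
     = (1/2) * ((LINT x|lborel. dird \<xi> K x * (\<xi> \<bullet> x) ^ m * exp (-(norm x)\<^sup>2))
        + real m * (LINT x|lborel. K x * (\<xi> \<bullet> x) ^ (m - 1) * exp (-(norm x)\<^sup>2)))"
    if K: "real_polynomial_function K" for K m
  proof -
    have Kp: "real_polynomial_function (\<lambda>x. K x * (\<xi> \<bullet> x) ^ m)" for m using K pw by auto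
    have dKp: "real_polynomial_function (\<lambda>x. dird \<xi> K x * (\<xi> \<bullet> x) ^ m)" for m
      using real_polynomial_function_dird[OF K] pw by auto
    have "(LINT x|lborel. K x * (\<xi> \<bullet> x) ^ Suc m * exp (-(norm x)\<^sup>2))
      = (LINT x|lborel. (x \<bullet> \<xi>) * (K x * (\<xi> \<bullet> x) ^ m) * exp (-(norm x)\<^sup>2))"
      by (intro Bochner_Integration.integral_cong) (auto simp: inner_commute)
    also have "\<dots> = (1/2) * (LINT x|lborel. dird \<xi> (\<lambda>x. K x * (\<xi> \<bullet> x) ^ m) x * exp (-(norm x)\<^sup>2))"
      by (rule gauss_integration_by_parts[OF Kp])
    also have "(LINT x|lborel. dird \<xi> (\<lambda>x. K x * (\<xi> \<bullet> x) ^ m) x * exp (-(norm x)\<^sup>2))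
       = (LINT x|lborel. dird \<xi> K x * (\<xi> \<bullet> x) ^ m * exp (-(norm x)\<^sup>2)
            + real m * (K x * (\<xi> \<bullet> x) ^ (m - 1) * exp (-(norm x)\<^sup>2)))"
      by (intro Bochner_Integration.integral_cong) (auto simp: dird_mult_poly[OF K pw] dpw algebra_simps)
    also have "\<dots> = (LINT x|lborel. dird \<xi> K x * (\<xi> \<bullet> x) ^ m * exp (-(norm x)\<^sup>2))
        + real m * (LINT x|lborel. K x * (\<xi> \<bullet> x) ^ (m - 1) * exp (-(norm x)\<^sup>2))"
      by (subst Bochner_Integration.integral_add) (auto intro: integrable_poly_gauss[OF Kp] integrable_poly_gauss[OF dKp])
    finally show ?thesis .
  qed
  have deriv: "(LINT x|lborel. dird \<xi> K x * (\<xi> \<bullet> x) ^ m * exp (-(norm x)\<^sup>2)) = real l * gauss_moment G (l - 1) m * K \<xi>"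
    if K: "real_polynomial_function K" "homogeneous l K" "harmonic K"
      and IH: "\<And>H. real_polynomial_function H \<Longrightarrow> homogeneous (l - 1) H \<Longrightarrow> harmonic H \<Longrightarrow>
        (LINT x|lborel. H x * (\<xi> \<bullet> x) ^ m * exp (-(norm x)\<^sup>2)) = gauss_moment G (l - 1) m * H \<xi>"
    for K l m
  proof (cases l)
    case 0
    have "K = (\<lambda>x. K 0)" using homogeneous_0_const[OF K(1)] K(2) 0 by auto
    then have "dird \<xi> K = (\<lambda>x. 0)" using dird_const by metis
    then show ?thesis using 0 by simp
  next
    case (Suc k)
    then have "homogeneous (l - 1) (dird \<xi> K)" using homogeneous_dird[OF K(1)] K(2) by simp
    then show ?thesis using IH[of "dird \<xi> K"] real_polynomial_function_dird[OF K(1)] harmonic_dird[OF K(1,3)]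
        euler_homogeneous[OF K(1,2), of \<xi>] by simp
  qed
  have "(LINT x|lborel. H x * (\<xi> \<bullet> x) ^ m * exp (-(norm x)\<^sup>2)) = gauss_moment G l m * H \<xi>" using assms(1-3)
  proof (induction m arbitrary: l H rule: less_induct)
    case (less m)
    note H = less.prems
    consider "m = 0" | "m = Suc 0" | k where "m = Suc (Suc k)" by (metis nat.exhaust)
    then show ?case
    proof cases
      case 1
      then show ?thesis using gauss_moment_harmonic_0[OF H, of \<xi>] by (simp add: G_def)
    next
      case 2
      then show ?thesis using step[OF H(1), of 0] deriv[OF H, of 0] less.IH[of 0] by simp
    next
      case 3
      then show ?thesis
        using step[OF H(1), of "Suc k"] deriv[OF H, of "Suc k"] less.IH[of "Suc k"] less.IH[of k _ l, OF _ H]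
        by (simp add: algebra_simps)
    qed
  qed
  then show ?thesis by (simp add: G_def)
qed


lemma measurable_surface_continuous:
  fixes f :: "'a::euclidean_space \<Rightarrow> 'b::topological_space"
  shows "continuous_on (sphere 0 1) f \<Longrightarrow> f \<in> borel_measurable surface"
  by (subst measurable_cong_sets[OF sets_surface refl], rule borel_measurable_continuous_on_restrict)

lemma integrable_surface_bounded:
  fixes f :: "'a::euclidean_space \<Rightarrow> 'b::{banach, second_countable_topology}"
  assumes "f \<in> borel_measurable surface" "\<And>x. norm x = 1 \<Longrightarrow> norm (f x) \<le> B"
  shows "integrable surface f"
proof -
  interpret finite_measure "surface :: 'a measure" by (rule finite_measure_surface)
  show ?thesis by (rule integrable_const_bound[of _ B]) (use assms in auto)
qed

lemma continuous_sphere_bounded: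
  fixes f :: "'a::euclidean_space \<Rightarrow> 'b::real_normed_vector"
  assumes "continuous_on (sphere 0 1) f"
  obtains B where "B \<ge> 0" "\<And>x. norm x = 1 \<Longrightarrow> norm (f x) \<le> B"
proof -
  have "bounded (f ` sphere 0 1)" using assms by (intro compact_imp_bounded compact_continuous_image) auto
  then obtain B where "\<forall>y\<in>f ` sphere 0 1. norm y \<le> B" by (auto simp: bounded_iff)
  then show ?thesis by (intro that[of "max B 0"]) (auto simp: le_max_iff_disj)
qed

lemma integrable_surface_continuous:
  fixes f :: "'a::euclidean_space \<Rightarrow> 'b::{banach, second_countable_topology}"
  assumes "continuous_on (sphere 0 1) f"
  shows "integrable surface f"
  using continuous_sphere_bounded[OF assms] integrable_surface_bounded[OF measurable_surface_continuous[OF assms]]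
  by metis

text \<open>In polar coordinates the radial integral splits off a Gaussian moment.\<close>

definition sphere_moment :: "'a::euclidean_space itself \<Rightarrow> nat \<Rightarrow> nat \<Rightarrow> real" where
  "sphere_moment _ l m = gauss_moment (LINT x|(lborel :: 'a measure). exp (-(norm x)\<^sup>2)) l m
     / gauss_const (l + m + DIM('a) - 1)"

lemma sphere_moment_harmonic:
  fixes H :: "'a::euclidean_space \<Rightarrow> real"
  assumes H: "real_polynomial_function H" "homogeneous l H" "harmonic H" and xi: "norm \<xi> = 1"
  shows "(LINT \<eta>|surface. H \<eta> * (\<xi> \<bullet> \<eta>) ^ m) = sphere_moment TYPE('a) l m * H \<xi>"
proof -
  have lin: "real_polynomial_function (\<lambda>x. \<xi> \<bullet> x)"
    by (intro real_polynomial_function.intros(1) bounded_linear_inner_right)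
  then have "real_polynomial_function (\<lambda>x. H x * (\<xi> \<bullet> x) ^ m)" using H by auto
  moreover have "homogeneous (l + m) (\<lambda>x. H x * (\<xi> \<bullet> x) ^ m)"
    using H(2) by (auto simp: homogeneous_def power_mult_distrib power_add)
  ultimately have "(LINT x|lborel. H x * (\<xi> \<bullet> x) ^ m * exp (-(norm x)\<^sup>2))
      = gauss_const (l + m + DIM('a) - 1) * (LINT \<eta>|surface. H \<eta> * (\<xi> \<bullet> \<eta>) ^ m)" by (rule integral_homogeneous_gauss)
  then show ?thesis using gauss_moment_harmonic[OF H xi, of m] gauss_const_pos[of "l + m + DIM('a) - 1"]
    by (simp add: sphere_moment_def field_simps)
qed

lemma dird_Complex:
  fixes u v :: "'a::euclidean_space \<Rightarrow> real"
  assumes "u differentiable (at x)" "v differentiable (at x)"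
  shows "dird b (\<lambda>x. Complex (u x) (v x)) x = Complex (dird b u x) (dird b v x)"
proof -
  have "((\<lambda>x. of_real (u x) + \<i> * of_real (v x)) has_derivative
      (\<lambda>b. of_real (dird b u x) + \<i> * of_real (dird b v x))) (at x)"
    using assms[THEN differentiable_dird] by (intro derivative_intros has_derivative_of_real has_derivative_mult_right)
  then show ?thesis unfolding Complex_eq by (rule dird_eqI)
qed

lemma laplacian_dird: "laplacian p x = (\<Sum>b\<in>Basis. dird b (dird b p) x)" by (simp add: laplacian_def dird_def[abs_def])

lemma laplacian_Complex:
  fixes u v :: "'a::euclidean_space \<Rightarrow> real"
  assumes "real_polynomial_function u" "real_polynomial_function v"
  shows "laplacian (\<lambda>x. Complex (u x) (v x)) x
    = Complex (\<Sum>b\<in>Basis. dird b (dird b u) x) (\<Sum>b\<in>Basis. dird b (dird b v) x)"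
proof -
  note d = real_polynomial_function_differentiable
  have "dird b (\<lambda>x. Complex (u x) (v x)) = (\<lambda>x. Complex (dird b u x) (dird b v x))" for b
    by (rule ext) (intro dird_Complex d assms)
  then have "dird b (dird b (\<lambda>x. Complex (u x) (v x))) x = Complex (dird b (dird b u) x) (dird b (dird b v) x)" for b
    by (simp add: dird_Complex d real_polynomial_function_dird assms)
  then show ?thesis by (simp add: laplacian_dird complex_eq_iff)
qed

lemma spherical_harmonic_decompose:
  assumes "spherical_harmonic l (Y :: 'a::euclidean_space \<Rightarrow> complex)"
  obtains u v where "real_polynomial_function u" "homogeneous l u" "harmonic u"
    "real_polynomial_function v" "homogeneous l v" "harmonic v"
    "\<And>x. norm x = 1 \<Longrightarrow> Y x = Complex (u x) (v x)"
proof -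
  obtain p where p: "polynomial_function p" "\<And>c x. p (c *\<^sub>R x) = of_real (c ^ l) * p x"
    "\<And>x. laplacian p x = 0" "\<And>x. norm x = 1 \<Longrightarrow> Y x = p x" using assms by (auto simp: spherical_harmonic_def)
  define u v where "u = Re \<circ> p" and "v = Im \<circ> p"
  have uv: "real_polynomial_function u" "real_polynomial_function v"
    using p(1) bounded_linear_Re bounded_linear_Im by (auto simp: u_def v_def polynomial_function_def)
  have p_eq: "p = (\<lambda>x. Complex (u x) (v x))" by (auto simp: u_def v_def)
  have h: "homogeneous l u" "homogeneous l v"
    using p(2) by (auto simp: homogeneous_def u_def v_def simp flip: of_real_power)
  have "Complex (\<Sum>b\<in>Basis. dird b (dird b u) x) (\<Sum>b\<in>Basis. dird b (dird b v) x) = 0" for x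
    using laplacian_Complex[OF uv, of x] p(3)[of x] unfolding p_eq by simp
  then have "harmonic u" "harmonic v" by (auto simp: harmonic_def complex_eq_iff)
  with uv h show ?thesis using that[of u v] p(4) by (simp add: p_eq)
qed

lemma spherical_harmonic_continuous:
  assumes "spherical_harmonic l (Y :: 'a::euclidean_space \<Rightarrow> complex)"
  shows "continuous_on (sphere 0 1) Y"
proof -
  obtain p where p: "polynomial_function p" "\<And>x. norm x = 1 \<Longrightarrow> Y x = p x"
    using assms by (auto simp: spherical_harmonic_def)
  have "continuous_on (sphere 0 1) p" by (rule continuous_on_polymonial_function[OF p(1)])
  then show ?thesis by (rule continuous_on_eq) (use p(2) in auto)
qed

lemma sphere_moment_spherical_harmonic:
  assumes Y: "spherical_harmonic l (Y :: 'a::euclidean_space \<Rightarrow> complex)" and xi: "norm \<xi> = 1"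
  shows "(LINT \<eta>|surface. Y \<eta> * of_real ((\<xi> \<bullet> \<eta>) ^ m)) = of_real (sphere_moment TYPE('a) l m) * Y \<xi>"
proof -
  obtain u v where u: "real_polynomial_function u" "homogeneous l u" "harmonic u"
    and v: "real_polynomial_function v" "homogeneous l v" "harmonic v"
    and Y_eq: "\<And>x. norm x = 1 \<Longrightarrow> Y x = Complex (u x) (v x)" using spherical_harmonic_decompose[OF Y] by blast
  have i: "integrable (surface :: 'a measure) (\<lambda>\<eta>. w \<eta> * (\<xi> \<bullet> \<eta>) ^ m)" if "real_polynomial_function w" for w :: "'a \<Rightarrow> real"
    by (intro integrable_surface_continuous continuous_intros continuous_on_polymonial_function)
       (use that in \<open>simp add: real_polynomial_function_eq\<close>)
  have "(LINT \<eta>|surface. Y \<eta> * of_real ((\<xi> \<bullet> \<eta>) ^ m))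
     = (LINT \<eta>|surface. of_real (u \<eta> * (\<xi> \<bullet> \<eta>) ^ m) + \<i> * of_real (v \<eta> * (\<xi> \<bullet> \<eta>) ^ m))"
    by (intro Bochner_Integration.integral_cong) (auto simp: Y_eq Complex_eq algebra_simps)
  also have "\<dots> = of_real (LINT \<eta>|surface. u \<eta> * (\<xi> \<bullet> \<eta>) ^ m) + \<i> * of_real (LINT \<eta>|surface. v \<eta> * (\<xi> \<bullet> \<eta>) ^ m)"
    using i[OF u(1)] i[OF v(1)] by (subst Bochner_Integration.integral_add)
       (auto intro!: integrable_mult_right integrable_of_real simp del: of_real_mult of_real_power)
  also have "\<dots> = of_real (sphere_moment TYPE('a) l m) * Y \<xi>"
    using sphere_moment_harmonic[OF u xi] sphere_moment_harmonic[OF v xi] Y_eq[OF xi]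
    by (simp add: Complex_eq algebra_simps)
  finally show ?thesis .
qed

section \<open>Gegenbauer polynomials\<close>

text \<open>
  The Gegenbauer equation \<open>(1 - x\<^sup>2) p'' - a x p' + \<mu> p = 0\<close>. The class of these equations is closed
  under differentiation, so what holds for its solutions holds for all their derivatives.
\<close>

definition geg_ode :: "real \<Rightarrow> real \<Rightarrow> real poly \<Rightarrow> bool" where
  "geg_ode a \<mu> p \<longleftrightarrow> [:1, 0, -1:] * pderiv (pderiv p) - [:0, a:] * pderiv p + smult \<mu> p = 0"

lemma geg_ode_poly:
  "geg_ode a \<mu> p \<longleftrightarrow>
    (\<forall>x. (1 - x\<^sup>2) * poly (pderiv (pderiv p)) x - a * x * poly (pderiv p) x + \<mu> * poly p x = 0)"
proof -
  have "geg_ode a \<mu> p \<longleftrightarrow> poly ([:1, 0, -1:] * pderiv (pderiv p) - [:0, a:] * pderiv p + smult \<mu> p) = poly 0"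
    unfolding geg_ode_def poly_eq_poly_eq_iff ..
  also have "\<dots> \<longleftrightarrow> (\<forall>x. (1 - x\<^sup>2) * poly (pderiv (pderiv p)) x - a * x * poly (pderiv p) x + \<mu> * poly p x = 0)"
    by (simp add: fun_eq_iff power2_eq_square algebra_simps)
  finally show ?thesis .
qed

lemma geg_ode_smult: "geg_ode a \<mu> p \<Longrightarrow> geg_ode a \<mu> (smult c p)" unfolding geg_ode_poly
proof
  fix x assume *: "\<forall>x. (1 - x\<^sup>2) * poly (pderiv (pderiv p)) x - a * x * poly (pderiv p) x + \<mu> * poly p x = 0"
  have "(1 - x\<^sup>2) * poly (pderiv (pderiv (smult c p))) x - a * x * poly (pderiv (smult c p)) x + \<mu> * poly (smult c p) x
     = c * ((1 - x\<^sup>2) * poly (pderiv (pderiv p)) x - a * x * poly (pderiv p) x + \<mu> * poly p x)"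
    by (simp add: pderiv_smult algebra_simps)
  then show "(1 - x\<^sup>2) * poly (pderiv (pderiv (smult c p))) x - a * x * poly (pderiv (smult c p)) x + \<mu> * poly (smult c p) x = 0"
    using * by simp
qed

lemma geg_ode_pderiv:
  assumes "geg_ode a \<mu> p"
  shows "geg_ode (a + 2) (\<mu> - a) (pderiv p)"
proof -
  have "pderiv ([:1, 0, -1:] * pderiv (pderiv p) - [:0, a:] * pderiv p + smult \<mu> p) = 0"
    using assms by (simp add: geg_ode_def)
  then have "poly (pderiv ([:1, 0, -1:] * pderiv (pderiv p) - [:0, a:] * pderiv p + smult \<mu> p)) x = 0" for x by simp
  then show ?thesis unfolding geg_ode_poly
    by (simp add: pderiv_add pderiv_diff pderiv_minus pderiv_mult pderiv_smult pderiv_pCons power2_eq_square algebra_simps)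
qed

lemma geg_ode_at_1: "geg_ode a \<mu> p \<Longrightarrow> a * poly (pderiv p) 1 = \<mu> * poly p 1"
  unfolding geg_ode_poly by (drule spec[of _ 1]) simp

text \<open>
  At \<open>1\<close> the equation determines the derivative from the value, and so on for all derivatives.
\<close>

lemma geg_ode_zero:
  assumes "geg_ode a \<mu> p" "a > 0" "poly p 1 = 0"
  shows "p = 0" using assms
proof (induction "degree p" arbitrary: p a \<mu> rule: less_induct)
  case less
  show ?case
  proof (cases "degree p = 0")
    case True
    then obtain c where "p = [:c:]" by (elim degree_eq_zeroE)
    then show ?thesis using less.prems by simp
  next
    case False
    have "poly (pderiv p) 1 = 0" using geg_ode_at_1[OF less.prems(1)] less.prems by simp
    then have "pderiv p = 0" using False less.prems geg_ode_pderiv[OF less.prems(1)]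
      by (intro less.hyps[of "pderiv p" "a + 2"]) (auto simp: degree_pderiv)
    then show ?thesis using False by (simp add: pderiv_eq_0_iff)
  qed
qed

text \<open>
  The energy \<open>y\<^sup>2 + (1 - x\<^sup>2) y'\<^sup>2 / \<mu>\<close> has derivative \<open>2 (a - 1) x y'\<^sup>2 / \<mu>\<close>, so it
  increases on \<open>[0, 1]\<close>.
\<close>

lemma geg_ode_bound_pos:
  assumes ode: "geg_ode a \<mu> p" and a: "a \<ge> 1" and mu: "\<mu> > 0" and x: "0 \<le> x" "x \<le> 1"
  shows "(poly p x)\<^sup>2 + (1 - x\<^sup>2) * (poly (pderiv p) x)\<^sup>2 / \<mu> \<le> (poly p 1)\<^sup>2"
proof -
  define \<nu> where "\<nu> = 1 / \<mu>"
  define E where "E x = (poly p x)\<^sup>2 + \<nu> * ((1 - x\<^sup>2) * (poly (pderiv p) x)\<^sup>2)" for x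
  have "E x \<le> E 1"
  proof (rule DERIV_nonneg_imp_nondecreasing[OF x(2)])
    fix t assume t: "x \<le> t" "t \<le> 1"
    define y y' y'' where "y = poly p t" and "y' = poly (pderiv p) t" and "y'' = poly (pderiv (pderiv p)) t"
    have eq: "(1 - t\<^sup>2) * y'' = a * t * y' - \<mu> * y"
      using ode unfolding geg_ode_poly y_def y'_def y''_def by (smt (verit))
    have "(E has_real_derivative 2 * y * y' + \<nu> * (- 2 * t * y'\<^sup>2 + (1 - t\<^sup>2) * (2 * y' * y''))) (at t)"
      unfolding E_def y_def y'_def y''_def by (auto intro!: derivative_eq_intros simp: algebra_simps)
    also have "(- 2 * t * y'\<^sup>2 + (1 - t\<^sup>2) * (2 * y' * y'')) = - 2 * t * y'\<^sup>2 + 2 * y' * ((1 - t\<^sup>2) * y'')"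
      by (simp add: algebra_simps)
    also have "2 * y * y' + \<nu> * (- 2 * t * y'\<^sup>2 + 2 * y' * ((1 - t\<^sup>2) * y'')) = 2 * (a - 1) * t * y'\<^sup>2 / \<mu>"
      unfolding eq \<nu>_def using mu by (simp add: field_simps power2_eq_square)
    finally show "\<exists>d. (E has_real_derivative d) (at t) \<and> 0 \<le> d"
      using a mu x t by (intro exI[of _ "2 * (a - 1) * t * y'\<^sup>2 / \<mu>"] conjI) auto
  qed
  then show ?thesis by (simp add: E_def \<nu>_def)
qed

lemma geg_ode_bound:
  assumes ode: "geg_ode a \<mu> p" and a: "a \<ge> 1" and mu: "\<mu> \<ge> 0"
    and par: "\<And>x. \<bar>poly p (-x)\<bar> = \<bar>poly p x\<bar>" and x: "\<bar>x\<bar> \<le> 1"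
  shows "\<bar>poly p x\<bar> \<le> \<bar>poly p 1\<bar>"
proof (cases "\<mu> = 0")
  case True
  then have "poly (pderiv p) 1 = 0" using geg_ode_at_1[OF ode] a by simp
  then have "pderiv p = 0" using geg_ode_zero[OF geg_ode_pderiv[OF ode]] a by simp
  then obtain c where "p = [:c:]" by (auto simp: pderiv_eq_0_iff elim: degree_eq_zeroE)
  then show ?thesis by simp
next
  case False
  have *: "\<bar>poly p x\<bar> \<le> \<bar>poly p 1\<bar>" if "0 \<le> x" "x \<le> 1" for x
  proof -
    have "0 \<le> (1 - x\<^sup>2) * (poly (pderiv p) x)\<^sup>2 / \<mu>"
      using that mu by (auto intro!: divide_nonneg_nonneg mult_nonneg_nonneg simp: power_le_one)
    then have "(poly p x)\<^sup>2 \<le> (poly p 1)\<^sup>2" using geg_ode_bound_pos[OF ode a _ that] mu False by linarith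
    then show ?thesis by (simp add: abs_le_square_iff)
  qed
  show ?thesis using *[of x] *[of "-x"] par[of x] x by (cases "x \<ge> 0") auto
qed

text \<open>The recursion makes both the ordinary and the zonal polynomial below satisfy their equations.\<close>

fun geg_coeff :: "nat \<Rightarrow> nat \<Rightarrow> nat \<Rightarrow> real" where
  "geg_coeff d l 0 = 1"
| "geg_coeff d l (Suc i) = - geg_coeff d l i * (real l - 2 * real i) * (real l - 2 * real i - 1)
     / ((2 * real i + 2) * (2 * real l - 2 * real i - 4 + real d))"

text \<open>The eigenvalue of minus the spherical Laplacian on harmonics of degree \<open>l\<close>.\<close>

definition geg_eigen :: "nat \<Rightarrow> nat \<Rightarrow> real" where
  "geg_eigen d l = real l * (real l + real d - 2)"

lemma geg_coeff_telescope:
  assumes d: "d \<ge> 2" and i: "i \<le> l div 2" "i > 0"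
  shows "geg_coeff d l i * (2 * real i * (2 * real l - 2 * real i + real d - 2))
    = - (geg_coeff d l (i - 1) * real (l - 2 * (i - 1)) * (real (l - 2 * (i - 1)) - 1))"
proof -
  obtain j where j: "i = Suc j" using i by (cases i) auto
  have l: "2 * j + 2 \<le> l" using i j by linarith
  then have "real l \<ge> 2 * real j + 2" by linarith
  then have pos: "2 * real l - 2 * real j - 4 + real d > 0" using d by linarith
  have l': "real (l - 2 * j) = real l - 2 * real j" using l by (simp add: of_nat_diff)
  have "2 * real i = 2 * real j + 2" "2 * real l - 2 * real i + real d - 2 = 2 * real l - 2 * real j - 4 + real d"
    using j by auto
  then show ?thesis using pos unfolding j diff_Suc_1 l' by (simp only: geg_coeff.simps) simp
qed

text \<open>
  The cancellation behind two computations: with \<open>R = 1\<close> it yields the Gegenbauer equation, with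
  powers of \<open>x \<bullet> x\<close> the harmonicity of the zonal polynomial.
\<close>

lemma geg_coeff_sum:
  fixes X R :: "nat \<Rightarrow> 'b::comm_ring_1" and c :: "real \<Rightarrow> 'b"
  assumes c: "\<And>x y. c (x * y) = c x * c y" "\<And>x. c (- x) = - c x" "c 0 = 0"
    and d: "d \<ge> 2"
  shows "(\<Sum>i\<le>l div 2. c (geg_coeff d l i * real (l - 2 * i) * (real (l - 2 * i) - 1)) * X (l - 2 * i - 2) * R i
    + c (geg_coeff d l i * (2 * real i * (2 * real l - 2 * real i + real d - 2))) * X (l - 2 * i) * R (i - 1)) = 0"
proof -
  define u where "u i = c (geg_coeff d l i * real (l - 2 * i) * (real (l - 2 * i) - 1)) * X (l - 2 * i - 2) * R i" for i
  define b where "b i = c (geg_coeff d l i * (2 * real i * (2 * real l - 2 * real i + real d - 2))) * X (l - 2 * i) * R (i - 1)" for i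
  have b: "b i = - u (i - 1)" if "i \<le> l div 2" "i > 0" for i
  proof -
    have "l - 2 * (i - 1) - 2 = l - 2 * i" using that by auto
    then show ?thesis unfolding b_def u_def geg_coeff_telescope[OF d that] using c(2) by simp
  qed
  have "(\<Sum>i\<le>M. u i + b i) = u M" if "M \<le> l div 2" for M using that
  proof (induction M)
    case 0
    then show ?case by (simp add: b_def c(3))
  next
    case (Suc M)
    then show ?case using b[of "Suc M"] by simp
  qed
  moreover have "u (l div 2) = 0"
  proof -
    define n where "n = l - 2 * (l div 2)"
    have "n = 0 \<or> n = 1" unfolding n_def by presburger
    then have "geg_coeff d l (l div 2) * real n * (real n - 1) = 0" by auto
    then have "c (geg_coeff d l (l div 2) * real n * (real n - 1)) = 0" by (simp only: c(3))
    then show ?thesis unfolding u_def n_def[symmetric] by (simp only: mult_zero_left)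
  qed
  ultimately show ?thesis by (simp add: u_def b_def)
qed

lemma pderiv_sum': "pderiv (\<Sum>i\<in>I. f i) = (\<Sum>i\<in>I. pderiv (f i))"
  by (induction I rule: infinite_finite_induct) (auto simp: pderiv_add)

definition geg_raw :: "nat \<Rightarrow> nat \<Rightarrow> real poly" where
  "geg_raw d l = (\<Sum>i\<le>l div 2. monom (geg_coeff d l i) (l - 2 * i))"

lemma geg_raw_ode:
  assumes "d \<ge> 2"
  shows "geg_ode (real d - 1) (geg_eigen d l) (geg_raw d l)" unfolding geg_ode_poly
proof
  fix x :: real
  have p0: "poly (geg_raw d l) x = (\<Sum>i\<le>l div 2. geg_coeff d l i * x ^ (l - 2 * i))"
    by (simp add: geg_raw_def poly_sum poly_monom)
  have p1: "x * poly (pderiv (geg_raw d l)) x = (\<Sum>i\<le>l div 2. geg_coeff d l i * real (l - 2 * i) * x ^ (l - 2 * i))"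
  proof -
    have "x * poly (pderiv (monom c k)) x = c * real k * x ^ k" for k c
      by (cases k) (auto simp: pderiv_monom poly_monom)
    then show ?thesis unfolding geg_raw_def pderiv_sum' poly_sum sum_distrib_left by simp
  qed
  have p2: "poly (pderiv (pderiv (geg_raw d l))) x =
      (\<Sum>i\<le>l div 2. geg_coeff d l i * real (l - 2 * i) * (real (l - 2 * i) - 1) * x ^ (l - 2 * i - 2))"
  proof -
    have "poly (pderiv (pderiv (monom c k))) x = c * real k * (real k - 1) * x ^ (k - 2)" for k c
      by (cases k) (auto simp: pderiv_monom poly_monom numeral_2_eq_2)
    then show ?thesis unfolding geg_raw_def pderiv_sum' poly_sum by simp
  qed
  have p3: "x\<^sup>2 * poly (pderiv (pderiv (geg_raw d l))) x =
      (\<Sum>i\<le>l div 2. geg_coeff d l i * real (l - 2 * i) * (real (l - 2 * i) - 1) * x ^ (l - 2 * i))"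
  proof -
    have "x\<^sup>2 * x ^ (k - 2) = x ^ k" if "k \<ge> 2" for k using that by (metis le_add_diff_inverse power_add)
    then have "x\<^sup>2 * (real k * (real k - 1) * x ^ (k - 2)) = real k * (real k - 1) * x ^ k" for k
      by (cases "k \<ge> 2") (auto simp: not_le less_2_cases_iff)
    then have "x\<^sup>2 * (c * real k * (real k - 1) * x ^ (k - 2)) = c * real k * (real k - 1) * x ^ k" for k c
      by (metis (no_types, opaque_lifting) mult.assoc mult.left_commute)
    then show ?thesis unfolding p2 sum_distrib_left by (simp only:)
  qed
  have "(1 - x\<^sup>2) * poly (pderiv (pderiv (geg_raw d l))) x - (real d - 1) * x * poly (pderiv (geg_raw d l)) x
      + geg_eigen d l * poly (geg_raw d l) x
    = poly (pderiv (pderiv (geg_raw d l))) x - x\<^sup>2 * poly (pderiv (pderiv (geg_raw d l))) x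
      - (real d - 1) * (x * poly (pderiv (geg_raw d l)) x) + geg_eigen d l * poly (geg_raw d l) x"
    by (simp add: algebra_simps)
  also have "\<dots> = (\<Sum>i\<le>l div 2. id (geg_coeff d l i * real (l - 2 * i) * (real (l - 2 * i) - 1)) * x ^ (l - 2 * i - 2) * 1
    + id (geg_coeff d l i * (2 * real i * (2 * real l - 2 * real i + real d - 2))) * x ^ (l - 2 * i) * 1)"
    unfolding p0 p1 p3 unfolding p2 sum_distrib_left sum_subtractf[symmetric] sum.distrib[symmetric]
  proof (rule sum.cong, rule refl)
    fix i assume "i \<in> {..l div 2}"
    then have "real (l - 2 * i) = real l - 2 * real i" by (auto simp: of_nat_diff)
    then have *: "geg_eigen d l - real (l - 2 * i) * (real (l - 2 * i) - 1) - (real d - 1) * real (l - 2 * i)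
      = 2 * real i * (2 * real l - 2 * real i + real d - 2)" by (simp add: geg_eigen_def algebra_simps)
    show "geg_coeff d l i * real (l - 2 * i) * (real (l - 2 * i) - 1) * x ^ (l - 2 * i - 2) -
        geg_coeff d l i * real (l - 2 * i) * (real (l - 2 * i) - 1) * x ^ (l - 2 * i) -
        (real d - 1) * (geg_coeff d l i * real (l - 2 * i) * x ^ (l - 2 * i)) +
        geg_eigen d l * (geg_coeff d l i * x ^ (l - 2 * i)) =
      id (geg_coeff d l i * real (l - 2 * i) * (real (l - 2 * i) - 1)) * x ^ (l - 2 * i - 2) * 1
        + id (geg_coeff d l i * (2 * real i * (2 * real l - 2 * real i + real d - 2))) * x ^ (l - 2 * i) * 1"
      unfolding *[symmetric] by (simp add: algebra_simps)
  qed
  also have "\<dots> = 0" using geg_coeff_sum[of "id :: real \<Rightarrow> real" d l "\<lambda>k. x ^ k" "\<lambda>_. 1"] assms by simp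
  finally show "(1 - x\<^sup>2) * poly (pderiv (pderiv (geg_raw d l))) x - (real d - 1) * x * poly (pderiv (geg_raw d l)) x
      + geg_eigen d l * poly (geg_raw d l) x = 0" .
qed

lemma coeff_geg_raw: "coeff (geg_raw d l) l = 1"
proof -
  have "coeff (geg_raw d l) l = (\<Sum>i\<le>l div 2. if i = 0 then 1 else 0)" unfolding geg_raw_def coeff_sum
    by (intro sum.cong) auto
  also have "\<dots> = 1" by simp
  finally show ?thesis .
qed

lemma degree_geg_raw: "degree (geg_raw d l) = l"
proof (rule antisym)
  show "degree (geg_raw d l) \<le> l"
    unfolding geg_raw_def by (rule degree_sum_le) (auto intro: order.trans[OF degree_monom_le])
  show "l \<le> degree (geg_raw d l)" by (rule le_degree) (simp add: coeff_geg_raw)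
qed

lemma geg_raw_1: "d \<ge> 2 \<Longrightarrow> poly (geg_raw d l) 1 \<noteq> 0"
  using geg_ode_zero[OF geg_raw_ode, of d l] coeff_geg_raw[of d l] by fastforce

text \<open>The Gegenbauer polynomial, normalised to be \<open>1\<close> at \<open>1\<close>.\<close>

definition geg :: "nat \<Rightarrow> nat \<Rightarrow> real poly" where
  "geg d l = smult (inverse (poly (geg_raw d l) 1)) (geg_raw d l)"

lemma geg_1 [simp]: "d \<ge> 2 \<Longrightarrow> poly (geg d l) 1 = 1" by (simp add: geg_def geg_raw_1)

lemma degree_geg: "d \<ge> 2 \<Longrightarrow> degree (geg d l) = l" by (simp add: geg_def degree_geg_raw geg_raw_1)

lemma geg_0 [simp]: "geg d 0 = 1" by (simp add: geg_def geg_raw_def monom_0)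

lemma geg_ode_geg: "d \<ge> 2 \<Longrightarrow> geg_ode (real d - 1) (geg_eigen d l) (geg d l)"
  unfolding geg_def by (intro geg_ode_smult geg_raw_ode)

lemma geg_derivs_ode:
  assumes "d \<ge> 2"
  shows "geg_ode (real d - 1 + 2 * real k) (geg_eigen d l - real k * (real k + real d - 2)) ((pderiv ^^ k) (geg d l))"
proof (induction k)
  case (Suc k)
  have *: "real d - 1 + 2 * real k + 2 = real d - 1 + 2 * real (Suc k)"
    "geg_eigen d l - real k * (real k + real d - 2) - (real d - 1 + 2 * real k)
      = geg_eigen d l - real (Suc k) * (real (Suc k) + real d - 2)" by (simp_all add: algebra_simps)
  show ?case using geg_ode_pderiv[OF Suc] unfolding * by simp
qed (use geg_ode_geg[OF assms] in simp)

lemma geg_parity: "poly ((pderiv ^^ k) (geg d l)) (- x) = (-1) ^ (l + k) * poly ((pderiv ^^ k) (geg d l)) x"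
proof -
  have "pcompose (geg d l) [:0, -1:] = smult ((-1) ^ l) (geg d l)"
  proof (rule poly_eq_poly_eq_iff[THEN iffD1], rule ext)
    fix x :: real
    have "(- x) ^ (l - 2 * i) = (-1) ^ l * x ^ (l - 2 * i)" if "i \<le> l div 2" for i
    proof -
      have "(- x) ^ (l - 2 * i) = (-1) ^ (l - 2 * i) * x ^ (l - 2 * i)" by (rule power_minus)
      also have "(-1::real) ^ (l - 2 * i) = (-1) ^ (l - 2 * i + 2 * i)" by (simp add: power_add)
      also have "l - 2 * i + 2 * i = l" using that by linarith
      finally show ?thesis .
    qed
    then show "poly (pcompose (geg d l) [:0, -1:]) x = poly (smult ((-1) ^ l) (geg d l)) x"
      by (simp add: geg_def geg_raw_def poly_pcompose poly_sum poly_monom sum_distrib_left mult_ac)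
  qed
  then have "pcompose ((pderiv ^^ k) (geg d l)) [:0, -1:] = smult ((-1) ^ (l + k)) ((pderiv ^^ k) (geg d l))"
  proof (induction k)
    case (Suc k)
    have "pderiv (pcompose ((pderiv ^^ k) (geg d l)) [:0, -1:]) = smult ((-1) ^ (l + k)) ((pderiv ^^ Suc k) (geg d l))"
      using Suc by (simp add: pderiv_smult)
    then have "smult (-1) (pcompose ((pderiv ^^ Suc k) (geg d l)) [:0, -1:]) = smult ((-1) ^ (l + k)) ((pderiv ^^ Suc k) (geg d l))"
      by (simp add: pderiv_pcompose pderiv_pCons)
    then have "smult (-1) (smult (-1) (pcompose ((pderiv ^^ Suc k) (geg d l)) [:0, -1:]))
        = smult (-1) (smult ((-1) ^ (l + k)) ((pderiv ^^ Suc k) (geg d l)))" by (simp only:)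
    then show ?case by simp
  qed simp
  then have "poly (pcompose ((pderiv ^^ k) (geg d l)) [:0, -1:]) x = poly (smult ((-1) ^ (l + k)) ((pderiv ^^ k) (geg d l))) x"
    by simp
  then show ?thesis by (simp add: poly_pcompose)
qed

definition geg_d1 :: "nat \<Rightarrow> nat \<Rightarrow> nat \<Rightarrow> real" where
  "geg_d1 d l k = poly ((pderiv ^^ k) (geg d l)) 1"

lemma geg_d1_0: "d \<ge> 2 \<Longrightarrow> geg_d1 d l 0 = 1" by (simp add: geg_d1_def)

text \<open>
  At \<open>1\<close> the second order term of the equation for the \<open>k\<close>-th derivative vanishes.
\<close>

lemma geg_d1_Suc:
  assumes "d \<ge> 2"
  shows "geg_d1 d l (Suc k) = (geg_eigen d l - real k * (real k + real d - 2)) / (real d - 1 + 2 * real k) * geg_d1 d l k"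
proof -
  have "real d - 1 + 2 * real k > 0" using assms by linarith
  then show ?thesis using geg_ode_at_1[OF geg_derivs_ode[OF assms, of k l]] by (simp add: geg_d1_def field_simps)
qed

lemma geg_eigen_mono:
  assumes "d \<ge> 2" "k \<le> l"
  shows "real k * (real k + real d - 2) \<le> geg_eigen d l" unfolding geg_eigen_def using assms by (intro mult_mono) auto

lemma geg_eigen_nonneg: "d \<ge> 2 \<Longrightarrow> geg_eigen d l \<ge> 0" using geg_eigen_mono[of d 0 l] by simp

lemma geg_d1_zero:
  assumes "d \<ge> 2" "k > l"
  shows "geg_d1 d l k = 0" using assms(2)
proof (induction k)
  case (Suc k)
  show ?case
  proof (cases "k = l")
    case True
    then show ?thesis unfolding geg_d1_Suc[OF assms(1)] by (simp add: geg_eigen_def)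
  next
    case False
    then show ?thesis using Suc unfolding geg_d1_Suc[OF assms(1)] by simp
  qed
qed simp

lemma geg_derivs_zero:
  assumes "d \<ge> 2" "k > l"
  shows "(pderiv ^^ k) (geg d l) = 0" using geg_ode_zero[OF geg_derivs_ode[OF assms(1)]] geg_d1_zero[OF assms] assms(1)
  by (simp add: geg_d1_def)

lemma geg_d1_nonneg:
  assumes "d \<ge> 2"
  shows "geg_d1 d l k \<ge> 0"
proof (induction k)
  case (Suc k)
  show ?case
  proof (cases "k \<le> l")
    case True
    have "real d - 1 + 2 * real k > 0" using assms by linarith
    then show ?thesis using Suc geg_eigen_mono[OF assms True] unfolding geg_d1_Suc[OF assms]
      by (intro mult_nonneg_nonneg divide_nonneg_nonneg) auto
  next
    case False
    then show ?thesis using geg_d1_zero[OF assms, of l "Suc k"] by simp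
  qed
qed (simp add: geg_d1_0 assms)

lemma geg_d1_upper:
  assumes "d \<ge> 2"
  shows "geg_d1 d l k \<le> geg_eigen d l ^ k"
proof (induction k)
  case (Suc k)
  show ?case
  proof (cases "k \<le> l")
    case True
    have d: "real d - 1 + 2 * real k \<ge> 1" using assms by linarith
    have "0 \<le> real k * (real k + real d - 2)" using assms by (intro mult_nonneg_nonneg) auto
    then have "(geg_eigen d l - real k * (real k + real d - 2)) \<le> geg_eigen d l * (real d - 1 + 2 * real k)"
      using mult_left_mono[OF d geg_eigen_nonneg[OF assms, of l]] by linarith
    then have "(geg_eigen d l - real k * (real k + real d - 2)) / (real d - 1 + 2 * real k) \<le> geg_eigen d l"
      using d by (simp add: divide_le_eq)
    then show ?thesis using Suc geg_d1_nonneg[OF assms, of l k] geg_eigen_nonneg[OF assms, of l]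
      unfolding geg_d1_Suc[OF assms] power_Suc by (intro mult_mono) auto
  next
    case False
    then show ?thesis using geg_d1_zero[OF assms, of l "Suc k"] geg_eigen_nonneg[OF assms, of l] by simp
  qed
qed (simp add: geg_d1_0 assms)

text \<open>
  For \<open>l \<ge> k\<close> none of the \<open>k\<close> factors in the product formula vanishes, and each is comparable to the
  eigenvalue, uniformly in \<open>l\<close>.
\<close>

lemma geg_d1_lower:
  assumes "d \<ge> 2"
  obtains c where "c > 0" "\<And>l. l \<ge> k \<Longrightarrow> c * geg_eigen d l ^ k \<le> geg_d1 d l k"
proof -
  have "\<exists>c>0. \<forall>l\<ge>k. c * geg_eigen d l ^ k \<le> geg_d1 d l k"
  proof -
    have "\<exists>c>0. \<forall>l\<ge>k. c * geg_eigen d l ^ j \<le> geg_d1 d l j" if "j \<le> k" for j using that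
    proof (induction j)
      case 0
      show ?case by (rule exI[of _ 1]) (simp add: geg_d1_0 assms)
    next
      case (Suc j)
      then obtain c where c: "c > 0" "\<And>l. l \<ge> k \<Longrightarrow> c * geg_eigen d l ^ j \<le> geg_d1 d l j" by auto
      define r where "r = (real j * (real j + real d - 2)) / (real (Suc j) * (real (Suc j) + real d - 2))"
      have pos: "real (Suc j) * (real (Suc j) + real d - 2) > 0" using assms by (intro mult_pos_pos) auto
      have "real j * (real j + real d - 2) < real (Suc j) * (real (Suc j) + real d - 2)"
        using assms by (simp add: algebra_simps)
      then have r: "r < 1" "r \<ge> 0" using pos assms by (auto simp: r_def divide_less_eq)
      have dj: "real d - 1 + 2 * real j > 0" using assms by linarith
      define c' where "c' = (1 - r) / (real d - 1 + 2 * real j)"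
      have c': "c' > 0" using r dj by (simp add: c'_def)
      have "c' * c * geg_eigen d l ^ Suc j \<le> geg_d1 d l (Suc j)" if l: "l \<ge> k" for l
      proof -
        have "real (Suc j) * (real (Suc j) + real d - 2) \<le> geg_eigen d l"
          using geg_eigen_mono[OF assms, of "Suc j" l] Suc.prems l by simp
        then have "r * (real (Suc j) * (real (Suc j) + real d - 2)) \<le> r * geg_eigen d l"
          using r by (intro mult_left_mono)
        moreover have "r * (real (Suc j) * (real (Suc j) + real d - 2)) = real j * (real j + real d - 2)"
        proof -
          have "b / a * a = b" if "a > 0" for a b :: real using that by simp
          from this[OF pos] show ?thesis unfolding r_def .
        qed
        ultimately have "(1 - r) * geg_eigen d l \<le> geg_eigen d l - real j * (real j + real d - 2)"
          by (simp add: algebra_simps)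
        then have "c' * geg_eigen d l \<le> (geg_eigen d l - real j * (real j + real d - 2)) / (real d - 1 + 2 * real j)"
          using divide_right_mono[OF _ less_imp_le[OF dj]] by (simp add: c'_def)
        then have "(c' * geg_eigen d l) * (c * geg_eigen d l ^ j) \<le> geg_d1 d l (Suc j)"
          unfolding geg_d1_Suc[OF assms] using c(2)[OF l] c(1) c' geg_eigen_nonneg[OF assms, of l]
          by (intro mult_mono) (auto intro: order.trans[OF _ \<open>c' * geg_eigen d l \<le> _\<close>])
        then show ?thesis by (simp add: mult_ac)
      qed
      then show ?case using c c' by (intro exI[of _ "c' * c"]) auto
    qed
    then show ?thesis by blast
  qed
  then show ?thesis using that by blast
qed

lemma geg_derivs_bound:
  assumes d: "d \<ge> 2" and x: "\<bar>x\<bar> \<le> 1"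
  shows "\<bar>poly ((pderiv ^^ k) (geg d l)) x\<bar> \<le> geg_d1 d l k"
proof (cases "k \<le> l")
  case True
  have "\<bar>poly ((pderiv ^^ k) (geg d l)) x\<bar> \<le> \<bar>poly ((pderiv ^^ k) (geg d l)) 1\<bar>"
  proof (rule geg_ode_bound[OF geg_derivs_ode[OF d] _ _ _ x])
    show "1 \<le> real d - 1 + 2 * real k" using d by linarith
    show "0 \<le> geg_eigen d l - real k * (real k + real d - 2)" using geg_eigen_mono[OF d True] by simp
  qed (simp add: geg_parity abs_mult power_abs)
  then show ?thesis using geg_d1_nonneg[OF d, of l k] by (simp add: geg_d1_def)
next
  case False
  then show ?thesis using geg_derivs_zero[OF d, of l k] geg_d1_nonneg[OF d, of l k] by simp
qed

lemma geg_bound: "d \<ge> 2 \<Longrightarrow> \<bar>x\<bar> \<le> 1 \<Longrightarrow> \<bar>poly (geg d l) x\<bar> \<le> 1" using geg_derivs_bound[of d x 0 l] by (simp add: geg_d1_0)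

text \<open>
  Taylor coefficients of the Gegenbauer polynomial at \<open>1\<close> in the variable \<open>2 - 2 x\<close>, which is the
  squared distance of two points of the sphere whose inner product is \<open>x\<close>.
\<close>

definition geg_taylor :: "nat \<Rightarrow> nat \<Rightarrow> nat \<Rightarrow> real" where
  "geg_taylor d l k = (-1/2) ^ k * geg_d1 d l k / fact k"

text \<open>
  Taylor's theorem at \<open>1\<close>, where all derivatives attain their largest absolute value.
\<close>

lemma geg_taylor_remainder:
  assumes d: "d \<ge> 2" and x: "\<bar>x\<bar> \<le> 1"
  shows "\<bar>poly (geg d l) x - (\<Sum>k<n. geg_taylor d l k * (2 - 2 * x) ^ k)\<bar> \<le> \<bar>geg_taylor d l n\<bar> * (2 - 2 * x) ^ n"
proof -
  have pw: "geg_taylor d l k * (2 - 2 * x) ^ k = geg_d1 d l k / fact k * (x - 1) ^ k" for k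
  proof -
    have "(-1/2) ^ k * (2 - 2 * x) ^ k = (x - 1) ^ k"
      unfolding power_mult_distrib[symmetric] by (rule arg_cong[where f="\<lambda>u. u ^ k"]) (simp add: field_simps)
    then show ?thesis unfolding geg_taylor_def by (simp add: mult_ac)
  qed
  have abs: "\<bar>geg_taylor d l n\<bar> * (2 - 2 * x) ^ n = geg_d1 d l n / fact n * (1 - x) ^ n"
  proof -
    have "\<bar>geg_taylor d l n\<bar> * (2 - 2 * x) ^ n = \<bar>geg_taylor d l n * (2 - 2 * x) ^ n\<bar>" using x by (simp add: abs_mult)
    also have "\<dots> = geg_d1 d l n / fact n * (1 - x) ^ n" unfolding pw using geg_d1_nonneg[OF d, of l n] x
      by (simp add: abs_mult power_abs)
    finally show ?thesis .
  qed
  show ?thesis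
  proof (cases "n = 0 \<or> x = 1")
    case True
    then show ?thesis
    proof
      assume "n = 0"
      then show ?thesis using geg_bound[OF d x, of l] by (simp add: geg_taylor_def geg_d1_0 d)
    next
      assume x1: "x = 1"
      show ?thesis
      proof (cases n)
        case 0
        then show ?thesis using geg_bound[OF d x, of l] by (simp add: geg_taylor_def geg_d1_0 d)
      next
        case (Suc m)
        have "(\<Sum>k<n. geg_taylor d l k * (2 - 2 * x) ^ k) = geg_taylor d l 0"
          unfolding Suc x1 by (subst sum.lessThan_Suc_shift) simp
        then show ?thesis using x1 Suc by (simp add: geg_taylor_def geg_d1_0 d)
      qed
    qed
  next
    case False
    then have n: "n > 0" and x1: "x < 1" using x by auto
    have "\<exists>t>x. t < 1 \<and> poly (geg d l) x = (\<Sum>m<n. poly ((pderiv ^^ m) (geg d l)) 1 / fact m * (x - 1) ^ m)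
        + poly ((pderiv ^^ n) (geg d l)) t / fact n * (x - 1) ^ n" by (rule Taylor_down[OF n _ _ x1, where b=1]) auto
    then obtain t where t: "x < t" "t < 1"
      "poly (geg d l) x = (\<Sum>m<n. geg_d1 d l m / fact m * (x - 1) ^ m)
        + poly ((pderiv ^^ n) (geg d l)) t / fact n * (x - 1) ^ n" by (auto simp: geg_d1_def)
    then have "\<bar>poly (geg d l) x - (\<Sum>k<n. geg_taylor d l k * (2 - 2 * x) ^ k)\<bar>
       = \<bar>poly ((pderiv ^^ n) (geg d l)) t\<bar> / fact n * (1 - x) ^ n"
      unfolding pw using x1 by (simp add: abs_mult power_abs)
    also have "\<dots> \<le> geg_d1 d l n / fact n * (1 - x) ^ n" using geg_derivs_bound[OF d, of t n l] t x x1
      by (intro mult_right_mono divide_right_mono) auto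
    finally show ?thesis unfolding abs .
  qed
qed

lemma geg_taylor_upper:
  assumes "d \<ge> 2" shows "\<bar>geg_taylor d l k\<bar> \<le> geg_eigen d l ^ k"
proof -
  have "\<bar>geg_taylor d l k\<bar> = (1/2) ^ k * (geg_d1 d l k / fact k)"
    using geg_d1_nonneg[OF assms, of l k] by (simp add: geg_taylor_def abs_mult power_abs)
  also have "\<dots> \<le> 1 * geg_d1 d l k" using geg_d1_nonneg[OF assms, of l k]
    by (intro mult_mono) (auto simp: power_le_one divide_le_eq mult_le_cancel_left1)
  finally show ?thesis using geg_d1_upper[OF assms, of l k] by simp
qed

lemma geg_taylor_lower:
  assumes "d \<ge> 2"
  obtains c where "c > 0" "\<And>l. l \<ge> k \<Longrightarrow> c * geg_eigen d l ^ k \<le> \<bar>geg_taylor d l k\<bar>"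
proof -
  obtain c where c: "c > 0" "\<And>l. l \<ge> k \<Longrightarrow> c * geg_eigen d l ^ k \<le> geg_d1 d l k" using geg_d1_lower[OF assms] by blast
  have "(1/2) ^ k / fact k * c * geg_eigen d l ^ k \<le> \<bar>geg_taylor d l k\<bar>" if "l \<ge> k" for l
  proof -
    have "\<bar>geg_taylor d l k\<bar> = (1/2) ^ k / fact k * geg_d1 d l k"
      using geg_d1_nonneg[OF assms, of l k] by (simp add: geg_taylor_def abs_mult power_abs)
    moreover have "(1/2) ^ k / fact k * (c * geg_eigen d l ^ k) \<le> (1/2) ^ k / fact k * geg_d1 d l k"
      using c(2)[OF that] by (intro mult_left_mono) auto
    ultimately show ?thesis by (simp add: mult_ac)
  qed
  then show ?thesis using c by (intro that[of "(1/2) ^ k / fact k * c"]) auto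
qed


lemma dird_sum_poly:
  fixes T :: "'i \<Rightarrow> 'a::euclidean_space \<Rightarrow> real"
  assumes "\<And>i. i \<in> I \<Longrightarrow> real_polynomial_function (T i)"
  shows "dird b (\<lambda>x. \<Sum>i\<in>I. c i * T i x) = (\<lambda>x. \<Sum>i\<in>I. c i * dird b (T i) x)"
proof (rule ext, rule dird_eqI)
  fix x
  show "((\<lambda>x. \<Sum>i\<in>I. c i * T i x) has_derivative (\<lambda>b. \<Sum>i\<in>I. c i * dird b (T i) x)) (at x)"
    by (intro has_derivative_sum has_derivative_mult_right differentiable_dird
        real_polynomial_function_differentiable assms)
qed

lemma laplacian_zonal_monomial:
  fixes \<xi> :: "'a::euclidean_space"
  assumes xi: "norm \<xi> = 1"
  shows "(\<Sum>b\<in>Basis. dird b (dird b (\<lambda>x. (\<xi> \<bullet> x) ^ k * (x \<bullet> x) ^ i)) x)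
    = real k * (real k - 1) * (\<xi> \<bullet> x) ^ (k - 2) * (x \<bullet> x) ^ i
      + 2 * real i * (2 * real k + 2 * real i + real DIM('a) - 2) * (\<xi> \<bullet> x) ^ k * (x \<bullet> x) ^ (i - 1)"
proof -
  have dA: "((\<lambda>x. (\<xi> \<bullet> x) ^ k) has_derivative (\<lambda>h. real k * (\<xi> \<bullet> h) * (\<xi> \<bullet> x) ^ (k - 1))) (at x)" for k x
    by (auto intro!: derivative_eq_intros)
  have dQ1: "((\<lambda>x. x \<bullet> x) has_derivative (\<lambda>h. 2 * (x \<bullet> h))) (at x)" for x :: 'a
    by (rule has_derivative_eq_rhs[OF has_derivative_inner[OF has_derivative_ident has_derivative_ident]])
       (simp add: inner_commute)
  have dQ: "((\<lambda>x. (x \<bullet> x) ^ i) has_derivative (\<lambda>h. real i * (2 * (x \<bullet> h)) * (x \<bullet> x) ^ (i - 1))) (at x)" for i and x :: 'a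
    by (rule has_derivative_eq_rhs[OF has_derivative_power[OF dQ1]]) (simp add: mult_ac)
  have d1: "dird b (\<lambda>x. (\<xi> \<bullet> x) ^ k * (x \<bullet> x) ^ i)
     = (\<lambda>x. (\<xi> \<bullet> x) ^ k * (real i * (2 * (x \<bullet> b)) * (x \<bullet> x) ^ (i - 1)) + real k * (\<xi> \<bullet> b) * (\<xi> \<bullet> x) ^ (k - 1) * (x \<bullet> x) ^ i)" for b
    by (rule ext, rule dird_eqI[OF has_derivative_mult[OF dA dQ]])
  have dL: "((\<lambda>x. c * (x \<bullet> b)) has_derivative (\<lambda>h. c * (h \<bullet> b))) (at x)" for x b :: 'a and c
    by (auto intro!: derivative_eq_intros)
  have d2: "dird b (dird b (\<lambda>x. (\<xi> \<bullet> x) ^ k * (x \<bullet> x) ^ i)) x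
    = real k * (real k - 1) * (\<xi> \<bullet> x) ^ (k - 2) * (x \<bullet> x) ^ i * (\<xi> \<bullet> b)\<^sup>2
      + 4 * real k * real i * (\<xi> \<bullet> x) ^ (k - 1) * (x \<bullet> x) ^ (i - 1) * ((\<xi> \<bullet> b) * (x \<bullet> b))
      + 4 * real i * (real i - 1) * (\<xi> \<bullet> x) ^ k * (x \<bullet> x) ^ (i - 2) * (x \<bullet> b)\<^sup>2
      + 2 * real i * (\<xi> \<bullet> x) ^ k * (x \<bullet> x) ^ (i - 1)" if b: "b \<in> Basis" for b
  proof -
    have ki: "real k * real (k - 1) = real k * (real k - 1)" "real i * real (i - 1) = real i * (real i - 1)" for k i :: nat
      by (cases k; simp) (cases i; simp)
    have "((\<lambda>x. (\<xi> \<bullet> x) ^ k * ((2 * real i) * (x \<bullet> b) * (x \<bullet> x) ^ (i - 1)) + (real k * (\<xi> \<bullet> b)) * ((\<xi> \<bullet> x) ^ (k - 1) * (x \<bullet> x) ^ i))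
      has_derivative (\<lambda>h. ((\<xi> \<bullet> x) ^ k * ((2 * real i) * (x \<bullet> b) * (real (i - 1) * (2 * (x \<bullet> h)) * (x \<bullet> x) ^ (i - 1 - 1)) + (2 * real i) * (h \<bullet> b) * (x \<bullet> x) ^ (i - 1))
         + real k * (\<xi> \<bullet> h) * (\<xi> \<bullet> x) ^ (k - 1) * ((2 * real i) * (x \<bullet> b) * (x \<bullet> x) ^ (i - 1)))
         + (real k * (\<xi> \<bullet> b)) * ((\<xi> \<bullet> x) ^ (k - 1) * (real i * (2 * (x \<bullet> h)) * (x \<bullet> x) ^ (i - 1)) + real (k - 1) * (\<xi> \<bullet> h) * (\<xi> \<bullet> x) ^ (k - 1 - 1) * (x \<bullet> x) ^ i))) (at x)"
      by (intro has_derivative_add has_derivative_mult[OF dA] has_derivative_mult[OF dL dQ] has_derivative_mult_right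
          has_derivative_mult[OF dA dQ])
    from dird_eqI[OF this, of b] have "dird b (dird b (\<lambda>x. (\<xi> \<bullet> x) ^ k * (x \<bullet> x) ^ i)) x =
      (real k * real (k - 1)) * (\<xi> \<bullet> x) ^ (k - 2) * (x \<bullet> x) ^ i * (\<xi> \<bullet> b)\<^sup>2
      + 4 * real k * real i * (\<xi> \<bullet> x) ^ (k - 1) * (x \<bullet> x) ^ (i - 1) * ((\<xi> \<bullet> b) * (x \<bullet> b))
      + 4 * (real i * real (i - 1)) * (\<xi> \<bullet> x) ^ k * (x \<bullet> x) ^ (i - 2) * (x \<bullet> b)\<^sup>2
      + 2 * real i * (\<xi> \<bullet> x) ^ k * (x \<bullet> x) ^ (i - 1)"
      using b unfolding d1 by (simp add: algebra_simps power2_eq_square numeral_2_eq_2)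
    then show ?thesis by (simp only: ki mult.assoc)
  qed
  have s1: "(\<Sum>b\<in>Basis. (\<xi> \<bullet> b)\<^sup>2) = 1" using xi euclidean_inner[of \<xi> \<xi>] by (simp add: power2_eq_square norm_eq_1)
  have s2: "(\<Sum>b\<in>Basis. (\<xi> \<bullet> b) * (x \<bullet> b)) = \<xi> \<bullet> x" "(\<Sum>b\<in>Basis. (x \<bullet> b)\<^sup>2) = x \<bullet> x"
    by (simp_all add: euclidean_inner[of \<xi> x] euclidean_inner[of x x] power2_eq_square)
  have "(\<Sum>b\<in>Basis. dird b (dird b (\<lambda>x. (\<xi> \<bullet> x) ^ k * (x \<bullet> x) ^ i)) x)
    = real k * (real k - 1) * (\<xi> \<bullet> x) ^ (k - 2) * (x \<bullet> x) ^ i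
      + 4 * real k * real i * (\<xi> \<bullet> x) ^ (k - 1) * (x \<bullet> x) ^ (i - 1) * (\<xi> \<bullet> x)
      + 4 * real i * (real i - 1) * (\<xi> \<bullet> x) ^ k * (x \<bullet> x) ^ (i - 2) * (x \<bullet> x)
      + real DIM('a) * (2 * real i * (\<xi> \<bullet> x) ^ k * (x \<bullet> x) ^ (i - 1))"
    by (simp add: d2 sum.distrib sum_distrib_left[symmetric] s1 s2)
  also have "4 * real k * real i * (\<xi> \<bullet> x) ^ (k - 1) * (x \<bullet> x) ^ (i - 1) * (\<xi> \<bullet> x)
     = 4 * real k * real i * (\<xi> \<bullet> x) ^ k * (x \<bullet> x) ^ (i - 1)" by (cases k) (auto simp: mult_ac)
  also have "4 * real i * (real i - 1) * (\<xi> \<bullet> x) ^ k * (x \<bullet> x) ^ (i - 2) * (x \<bullet> x)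
     = 4 * real i * (real i - 1) * (\<xi> \<bullet> x) ^ k * (x \<bullet> x) ^ (i - 1)"
  proof (cases "i \<ge> 2")
    case True
    then obtain j where "i = Suc (Suc j)" by (metis Suc_le_D numeral_2_eq_2 Suc_le_mono)
    then show ?thesis by (simp add: mult_ac)
  qed (auto simp: not_le less_2_cases_iff)
  finally show ?thesis by (simp add: algebra_simps)
qed

lemma spherical_harmonic_of_real:
  assumes H: "real_polynomial_function (H :: 'a::euclidean_space \<Rightarrow> real)" and h: "harmonic H"
    and l: "\<And>c x. H (c *\<^sub>R x) = c ^ l * H x" and Y: "\<And>x. norm x = 1 \<Longrightarrow> Y x = of_real (H x)"
  shows "spherical_harmonic l Y"
proof -
  have eq: "(\<lambda>x. of_real (H x)) = (\<lambda>x. Complex (H x) 0)" by (simp add: complex_of_real_def)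
  have "polynomial_function ((\<lambda>x. complex_of_real x) \<circ> H)"
    using H by (intro polynomial_function_compose[OF _ polynomial_function_bounded_linear[OF bounded_linear_of_real]])
      (simp add: real_polynomial_function_eq)
  moreover have "laplacian (\<lambda>x. complex_of_real (H x)) x = 0" for x
    unfolding eq using h by (subst laplacian_Complex[OF H]) (auto simp: harmonic_def complex_eq_iff)
  ultimately show ?thesis unfolding spherical_harmonic_def
    using l Y by (intro exI[of _ "\<lambda>x. of_real (H x)"]) (auto simp: o_def)
qed

text \<open>
  Multiplying the monomial of degree \<open>l - 2 i\<close> by \<open>(x \<bullet> x)\<^sup>i\<close> makes the polynomial homogeneous without
  changing it on the sphere; the recursion for the coefficients says that the result is harmonic.
\<close>

lemma spherical_harmonic_zonal:
  fixes \<xi> :: "'a::euclidean_space"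
  assumes d: "DIM('a) \<ge> 2" and xi: "norm \<xi> = 1"
  shows "spherical_harmonic l (\<lambda>x. of_real (poly (geg DIM('a) l) (\<xi> \<bullet> x)))"
proof -
  define c where "c i = inverse (poly (geg_raw DIM('a) l) 1) * geg_coeff DIM('a) l i" for i
  define T where "T i x = (\<xi> \<bullet> x) ^ (l - 2 * i) * (x \<bullet> x) ^ i" for i x
  define H where "H = (\<lambda>x. \<Sum>i\<le>l div 2. c i * T i x)"
  have "real_polynomial_function (\<lambda>x. \<xi> \<bullet> x)" by (intro real_polynomial_function.intros(1) bounded_linear_inner_right)
  moreover have "real_polynomial_function (\<lambda>x::'a. x \<bullet> x)"
  proof -
    have "real_polynomial_function (\<lambda>x::'a. \<Sum>b\<in>Basis. (x \<bullet> b) * (x \<bullet> b))"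
      by (intro real_polynomial_function_sum real_polynomial_function.intros(4)
          real_polynomial_function.intros(1) bounded_linear_inner_left) auto
    moreover have "(\<lambda>x::'a. x \<bullet> x) = (\<lambda>x. \<Sum>b\<in>Basis. (x \<bullet> b) * (x \<bullet> b))" by (rule ext, rule euclidean_inner)
    ultimately show ?thesis by simp
  qed
  ultimately have T: "real_polynomial_function (T i)" for i unfolding T_def[abs_def] by auto
  then have H: "real_polynomial_function H"
    unfolding H_def by (intro real_polynomial_function_sum real_polynomial_function.intros(4)
      real_polynomial_function.intros(2)) auto
  have harm: "harmonic H" unfolding harmonic_def
  proof
    fix x :: 'a
    have "dird b (dird b H) x = (\<Sum>i\<le>l div 2. c i * dird b (dird b (T i)) x)" for b
      unfolding H_def using T by (simp add: dird_sum_poly real_polynomial_function_dird)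
    then have "(\<Sum>b\<in>Basis. dird b (dird b H) x) = (\<Sum>i\<le>l div 2. c i * (\<Sum>b\<in>Basis. dird b (dird b (T i)) x))"
      by (simp add: sum_distrib_left) (rule sum.swap)
    also have "\<dots> = (\<Sum>i\<le>l div 2. inverse (poly (geg_raw DIM('a) l) 1) *
        (id (geg_coeff DIM('a) l i * real (l - 2 * i) * (real (l - 2 * i) - 1)) * (\<xi> \<bullet> x) ^ (l - 2 * i - 2) * (x \<bullet> x) ^ i
        + id (geg_coeff DIM('a) l i * (2 * real i * (2 * real l - 2 * real i + real DIM('a) - 2))) * (\<xi> \<bullet> x) ^ (l - 2 * i) * (x \<bullet> x) ^ (i - 1)))"
    proof (rule sum.cong[OF refl])
      fix i assume i: "i \<in> {..l div 2}"
      then have li: "real (l - 2 * i) = real l - 2 * real i" by (auto simp: of_nat_diff)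
      have *: "2 * real (l - 2 * i) + 2 * real i + real DIM('a) - 2 = 2 * real l - 2 * real i + real DIM('a) - 2"
        unfolding li by simp
      show "c i * (\<Sum>b\<in>Basis. dird b (dird b (T i)) x) = inverse (poly (geg_raw DIM('a) l) 1) *
        (id (geg_coeff DIM('a) l i * real (l - 2 * i) * (real (l - 2 * i) - 1)) * (\<xi> \<bullet> x) ^ (l - 2 * i - 2) * (x \<bullet> x) ^ i
        + id (geg_coeff DIM('a) l i * (2 * real i * (2 * real l - 2 * real i + real DIM('a) - 2))) * (\<xi> \<bullet> x) ^ (l - 2 * i) * (x \<bullet> x) ^ (i - 1))"
        unfolding T_def[abs_def] laplacian_zonal_monomial[OF xi] * c_def id_def
        by (simp only: distrib_left mult.assoc mult.left_commute)
    qed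
    also have "\<dots> = 0" unfolding sum_distrib_left[symmetric]
      using geg_coeff_sum[of "id :: real \<Rightarrow> real" "DIM('a)" l "\<lambda>k. (\<xi> \<bullet> x) ^ k" "\<lambda>k. (x \<bullet> x) ^ k"] d by simp
    finally show "(\<Sum>b\<in>Basis. dird b (dird b H) x) = 0" .
  qed
  have hom: "H (a *\<^sub>R x) = a ^ l * H x" for a x
  proof -
    have "T i (a *\<^sub>R x) = a ^ l * T i x" if "i \<le> l div 2" for i
    proof -
      have "T i (a *\<^sub>R x) = a ^ (l - 2 * i + 2 * i) * T i x"
        by (simp add: T_def power_mult_distrib power_add power_mult power2_eq_square)
      also have "l - 2 * i + 2 * i = l" using that by linarith
      finally show ?thesis .
    qed
    then show ?thesis by (simp add: H_def sum_distrib_left mult_ac)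
  qed
  show ?thesis
  proof (rule spherical_harmonic_of_real[OF H harm hom])
    fix x :: 'a assume "norm x = 1"
    then show "complex_of_real (poly (geg DIM('a) l) (\<xi> \<bullet> x)) = of_real (H x)"
      by (simp add: H_def T_def c_def geg_def geg_raw_def poly_sum poly_monom norm_eq_1 sum_distrib_left mult_ac)
  qed
qed

section \<open>Integrals determined by moments\<close>

lemma integral_exp_sums:
  fixes h :: "'x \<Rightarrow> complex" and u :: "'x \<Rightarrow> real"
  assumes h: "integrable M h" and u [measurable]: "u \<in> borel_measurable M"
    and B: "\<And>x. x \<in> space M \<Longrightarrow> \<bar>u x\<bar> \<le> B"
  shows "(\<lambda>m. (LINT x|M. h x * of_real (u x ^ m)) /\<^sub>R fact m) sums (LINT x|M. h x * of_real (exp (u x)))"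
proof -
  note [measurable] = borel_measurable_integrable[OF h]
  define f where "f m x = (h x * of_real (u x ^ m)) /\<^sub>R fact m" for m x
  have [measurable]: "f m \<in> borel_measurable M" for m unfolding f_def by measurable
  have bound: "norm (f m x) \<le> norm (h x) * (\<bar>B\<bar> ^ m / fact m)" if "x \<in> space M" for m x
  proof -
    have "\<bar>u x\<bar> ^ m \<le> \<bar>B\<bar> ^ m" using B[OF that] by (intro power_mono) auto
    then have "norm (h x) * \<bar>u x\<bar> ^ m / fact m \<le> norm (h x) * \<bar>B\<bar> ^ m / fact m"
      by (intro divide_right_mono mult_left_mono) auto
    then show ?thesis by (simp add: f_def norm_mult norm_power power_abs divide_inverse mult_ac)
  qed
  have int: "integrable M (f m)" for m
  proof (rule Bochner_Integration.integrable_bound)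
    show "integrable M (\<lambda>x. norm (h x) * (\<bar>B\<bar> ^ m / fact m))" using h by (intro integrable_mult_left integrable_norm)
  qed (use bound in \<open>auto simp: f_def abs_mult\<close>)
  have sum_B: "summable (\<lambda>m. \<bar>B\<bar> ^ m / fact m)" using summable_exp[of "\<bar>B\<bar>"] by (simp add: divide_inverse mult.commute)
  have sums: "(\<lambda>m. f m x) sums (h x * of_real (exp (u x)))" for x
  proof -
    have "(\<lambda>m. u x ^ m /\<^sub>R fact m) sums exp (u x)" by (rule exp_converges)
    then have "(\<lambda>m. h x * of_real (u x ^ m /\<^sub>R fact m)) sums (h x * of_real (exp (u x)))"
      by (intro sums_mult) (simp only: sums_of_real_iff)
    then show ?thesis by (simp add: f_def scaleR_conv_of_real mult_ac)
  qed
  have "(\<lambda>m. LINT x|M. f m x) sums (LINT x|M. (\<Sum>m. f m x))"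
  proof (rule sums_integral[OF int])
    show "AE x in M. summable (\<lambda>m. norm (f m x))"
      using bound sum_B by (intro AE_I2 summable_comparison_test'[OF summable_mult[OF sum_B]]) auto
    have nn: "norm (LINT x|M. norm (f m x)) \<le> (LINT x|M. norm (h x)) * (\<bar>B\<bar> ^ m / fact m)" for m
    proof -
      have "(LINT x|M. norm (f m x)) \<le> (LINT x|M. norm (h x) * (\<bar>B\<bar> ^ m / fact m))"
        using bound int h by (intro integral_mono) auto
      then show ?thesis by simp
    qed
    show "summable (\<lambda>m. LINT x|M. norm (f m x))"
      by (rule summable_comparison_test'[OF summable_mult[OF sum_B], of 0, OF nn])
  qed
  then show ?thesis using sums[THEN sums_unique] by (simp add: f_def[abs_def])
qed

text \<open>
  Two weighted measures, mapped into a bounded part of a Euclidean space, agree there as soon as the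
  moments of all linear forms agree: exponentials of linear forms span an algebra, so the integrals
  of continuous functions agree.
\<close>

inductive_set exp_span :: "('b::euclidean_space \<Rightarrow> real) set" where
  base: "(\<lambda>x. c * exp (a \<bullet> x)) \<in> exp_span"
| sum: "f \<in> exp_span \<Longrightarrow> g \<in> exp_span \<Longrightarrow> (\<lambda>x. f x + g x) \<in> exp_span"

lemma exp_span_mult:
  assumes "f \<in> exp_span" "g \<in> exp_span"
  shows "(\<lambda>x. f x * g x) \<in> exp_span" using assms
proof (induction f)
  case (base c a)
  from base show ?case
  proof (induction g)
    case (base c' a')
    have "(\<lambda>x. c * exp (a \<bullet> x) * (c' * exp (a' \<bullet> x))) = (\<lambda>x. (c * c') * exp ((a + a') \<bullet> x))"
      by (simp add: exp_add inner_add_left mult_ac)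
    then show ?case using exp_span.base by metis
  next
    case (sum f g)
    then show ?case by (auto simp: distrib_left intro: exp_span.sum)
  qed
next
  case (sum f g)
  then show ?case by (auto simp: distrib_right intro: exp_span.sum)
qed

lemma exp_span_continuous: "f \<in> exp_span \<Longrightarrow> continuous_on S f"
  by (induction rule: exp_span.induct) (auto intro!: continuous_intros)

lemma exp_span_dense:
  fixes f :: "'b::euclidean_space \<Rightarrow> real"
  assumes "continuous_on (cball 0 B) f" "e > 0"
  obtains g where "g \<in> exp_span" "\<And>x. x \<in> cball 0 B \<Longrightarrow> \<bar>f x - g x\<bar> < e"
proof -
  interpret function_ring_on exp_span "cball (0::'b) B"
  proof
    show "(\<lambda>_. c) \<in> exp_span" for c using exp_span.base[of c 0] by simp
    show "\<exists>f\<in>exp_span. f x \<noteq> f y" if "x \<noteq> y" for x y :: 'b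
    proof
      show "(\<lambda>z. 1 * exp ((x - y) \<bullet> z)) \<in> exp_span" by (rule exp_span.base)
      show "1 * exp ((x - y) \<bullet> x) \<noteq> 1 * exp ((x - y) \<bullet> y)"
        using that by simp (metis eq_iff_diff_eq_0 inner_diff_right inner_eq_zero_iff)
    qed
  qed (auto intro: exp_span_mult exp_span.sum exp_span_continuous)
  show ?thesis using Stone_Weierstrass_basic[OF assms] that by blast
qed

locale moment_match =
  fixes M :: "'x measure" and N :: "'y measure" and h :: "'x \<Rightarrow> complex" and k :: "'y \<Rightarrow> complex"
    and u :: "'x \<Rightarrow> 'b::euclidean_space" and v :: "'y \<Rightarrow> 'b" and B :: real
  assumes h: "integrable M h" and k: "integrable N k"
    and u [measurable]: "u \<in> borel_measurable M" and v [measurable]: "v \<in> borel_measurable N"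
    and u_le: "\<And>x. x \<in> space M \<Longrightarrow> norm (u x) \<le> B" and v_le: "\<And>x. x \<in> space N \<Longrightarrow> norm (v x) \<le> B"
    and moments: "\<And>a m. (LINT x|M. h x * of_real ((a \<bullet> u x) ^ m)) = (LINT x|N. k x * of_real ((a \<bullet> v x) ^ m))"
begin

lemma measurable_hk [measurable]: "h \<in> borel_measurable M" "k \<in> borel_measurable N" using h k by auto

definition agree :: "('b \<Rightarrow> real) \<Rightarrow> bool" where
  "agree \<phi> \<longleftrightarrow> (LINT x|M. h x * of_real (\<phi> (u x))) = (LINT x|N. k x * of_real (\<phi> (v x)))"

lemma integrable_test:
  assumes [measurable]: "\<phi> \<in> borel_measurable borel" and C: "\<And>x. norm x \<le> B \<Longrightarrow> \<bar>\<phi> x\<bar> \<le> C"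
  shows "integrable M (\<lambda>x. h x * of_real (\<phi> (u x)))" "integrable N (\<lambda>x. k x * of_real (\<phi> (v x)))"
proof -
  show "integrable M (\<lambda>x. h x * of_real (\<phi> (u x)))"
  proof (rule Bochner_Integration.integrable_bound)
    show "integrable M (\<lambda>x. norm (h x) * \<bar>C\<bar>)" using h by (intro integrable_mult_left integrable_norm)
    show "AE x in M. norm (h x * of_real (\<phi> (u x))) \<le> norm (norm (h x) * \<bar>C\<bar>)"
    proof (rule AE_I2)
      fix x assume "x \<in> space M"
      then have "\<bar>\<phi> (u x)\<bar> \<le> \<bar>C\<bar>" using C[OF u_le] by (meson abs_ge_self order_trans)
      then show "norm (h x * of_real (\<phi> (u x))) \<le> norm (norm (h x) * \<bar>C\<bar>)" by (simp add: norm_mult mult_left_mono)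
    qed
  qed measurable
  show "integrable N (\<lambda>x. k x * of_real (\<phi> (v x)))"
  proof (rule Bochner_Integration.integrable_bound)
    show "integrable N (\<lambda>x. norm (k x) * \<bar>C\<bar>)" using k by (intro integrable_mult_left integrable_norm)
    show "AE x in N. norm (k x * of_real (\<phi> (v x))) \<le> norm (norm (k x) * \<bar>C\<bar>)"
    proof (rule AE_I2)
      fix x assume "x \<in> space N"
      then have "\<bar>\<phi> (v x)\<bar> \<le> \<bar>C\<bar>" using C[OF v_le] by (meson abs_ge_self order_trans)
      then show "norm (k x * of_real (\<phi> (v x))) \<le> norm (norm (k x) * \<bar>C\<bar>)" by (simp add: norm_mult mult_left_mono)
    qed
  qed measurable
qed

lemma agree_add:
  assumes "\<phi> \<in> borel_measurable borel" "\<And>x. norm x \<le> B \<Longrightarrow> \<bar>\<phi> x\<bar> \<le> C"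
    and "\<psi> \<in> borel_measurable borel" "\<And>x. norm x \<le> B \<Longrightarrow> \<bar>\<psi> x\<bar> \<le> D"
    and "agree \<phi>" "agree \<psi>"
  shows "agree (\<lambda>x. \<phi> x + \<psi> x)" using assms(5,6) integrable_test[OF assms(1,2)] integrable_test[OF assms(3,4)]
  by (simp add: agree_def distrib_left)

lemma agree_cmult: "agree \<phi> \<Longrightarrow> agree (\<lambda>x. c * \<phi> x)"
proof -
  assume a: "agree \<phi>"
  have "(LINT x|M. h x * of_real (c * \<phi> (u x))) = (LINT x|M. of_real c * (h x * of_real (\<phi> (u x))))"
    "(LINT x|N. k x * of_real (c * \<phi> (v x))) = (LINT x|N. of_real c * (k x * of_real (\<phi> (v x))))"
    by (rule Bochner_Integration.integral_cong[OF refl], simp)+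
  then show ?thesis using a by (simp add: agree_def)
qed

lemma agree_limit:
  assumes [measurable]: "\<And>n. \<phi> n \<in> borel_measurable borel" and C: "\<And>n x. norm x \<le> B \<Longrightarrow> \<bar>\<phi> n x\<bar> \<le> C"
    and [measurable]: "\<psi> \<in> borel_measurable borel"
    and lim: "\<And>x. norm x \<le> B \<Longrightarrow> (\<lambda>n. \<phi> n x) \<longlonglongrightarrow> \<psi> x"
    and ag: "\<And>n::nat. agree (\<phi> n)"
  shows "agree \<psi>"
proof -
  have "(\<lambda>n. LINT x|M. h x * of_real (\<phi> n (u x))) \<longlonglongrightarrow> (LINT x|M. h x * of_real (\<psi> (u x)))"
    by (rule integral_dominated_convergence[where w="\<lambda>x. norm (h x) * C"])
       (use h C u_le lim in \<open>auto intro!: AE_I2 tendsto_intros mult_left_mono simp: norm_mult\<close>)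
  moreover have "(\<lambda>n. LINT x|N. k x * of_real (\<phi> n (v x))) \<longlonglongrightarrow> (LINT x|N. k x * of_real (\<psi> (v x)))"
    by (rule integral_dominated_convergence[where w="\<lambda>x. norm (k x) * C"])
       (use k C v_le lim in \<open>auto intro!: AE_I2 tendsto_intros mult_left_mono simp: norm_mult\<close>)
  ultimately show ?thesis using ag LIMSEQ_unique unfolding agree_def by auto
qed

lemma agree_exp_span:
  assumes "\<phi> \<in> exp_span" shows "agree \<phi>" using assms
proof (induction rule: exp_span.induct)
  case (base c a)
  have "agree (\<lambda>x. exp (a \<bullet> x))" unfolding agree_def
  proof (rule sums_unique2)
    have le: "\<bar>a \<bullet> x\<bar> \<le> norm a * B" if "norm x \<le> B" for x
      using Cauchy_Schwarz_ineq2[of a x] mult_left_mono[OF that norm_ge_zero[of a]] by linarith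
    show "(\<lambda>m. (LINT x|M. h x * of_real ((a \<bullet> u x) ^ m)) /\<^sub>R fact m) sums (LINT x|M. h x * of_real (exp (a \<bullet> u x)))"
      by (rule integral_exp_sums[OF h]) (auto intro!: le u_le)
    show "(\<lambda>m. (LINT x|M. h x * of_real ((a \<bullet> u x) ^ m)) /\<^sub>R fact m) sums (LINT x|N. k x * of_real (exp (a \<bullet> v x)))"
      unfolding moments by (rule integral_exp_sums[OF k]) (auto intro!: le v_le)
  qed
  then show ?case by (rule agree_cmult)
next
  case (sum f g)
  have bd: "f \<in> borel_measurable borel \<and> (\<exists>C. \<forall>x. norm x \<le> B \<longrightarrow> \<bar>f x\<bar> \<le> C)" if f: "f \<in> exp_span" for f :: "'b \<Rightarrow> real"
  proof
    show "f \<in> borel_measurable borel" using exp_span_continuous[OF f, of UNIV] by (rule borel_measurable_continuous_onI)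
    have "compact (f ` cball 0 B)" by (intro compact_continuous_image exp_span_continuous f) auto
    then obtain C where "\<forall>y\<in>f ` cball 0 B. norm y \<le> C" using compact_imp_bounded bounded_iff by metis
    then show "\<exists>C. \<forall>x. norm x \<le> B \<longrightarrow> \<bar>f x\<bar> \<le> C" by (intro exI[of _ C]) simp
  qed
  show ?case using bd[OF sum.hyps(1)] bd[OF sum.hyps(2)] sum.IH by (auto intro: agree_add)
qed

lemma agree_continuous:
  fixes \<phi> :: "'b \<Rightarrow> real"
  assumes cont: "continuous_on UNIV \<phi>"
  shows "agree \<phi>"
proof -
  have "\<exists>g\<in>exp_span. \<forall>x\<in>cball 0 B. \<bar>\<phi> x - g x\<bar> < 1 / real (Suc n)" for n
    using exp_span_dense[OF continuous_on_subset[OF cont subset_UNIV], where e="1 / real (Suc n)"]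
    by (metis of_nat_0_less_iff zero_less_Suc zero_less_divide_1_iff)
  then have "\<forall>n. \<exists>g. g \<in> exp_span \<and> (\<forall>x\<in>cball 0 B. \<bar>\<phi> x - g x\<bar> < 1 / real (Suc n))" by blast
  from choice[OF this] obtain g where
    *: "\<forall>n. g n \<in> exp_span \<and> (\<forall>x\<in>cball 0 B. \<bar>\<phi> x - g n x\<bar> < 1 / real (Suc n))" ..
  then have g: "g n \<in> exp_span" for n by blast
  have g': "\<bar>\<phi> x - g n x\<bar> < 1 / real (Suc n)" if "norm x \<le> B" for n x using * that by (simp del: of_nat_Suc)
  have "compact (\<phi> ` cball 0 B)" by (intro compact_continuous_image continuous_on_subset[OF cont]) auto
  then obtain C where "\<forall>y\<in>\<phi> ` cball 0 B. norm y \<le> C" using compact_imp_bounded bounded_iff by metis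
  then have C: "\<bar>\<phi> x\<bar> \<le> C" if "norm x \<le> B" for x using that by auto
  show ?thesis
  proof (rule agree_limit)
    show "g n \<in> borel_measurable borel" for n
      using exp_span_continuous[OF g, of UNIV] by (rule borel_measurable_continuous_onI)
    show "\<phi> \<in> borel_measurable borel" using cont by (rule borel_measurable_continuous_onI)
    show "agree (g n)" for n by (intro agree_exp_span g)
    show "\<bar>g n x\<bar> \<le> C + 1" if "norm x \<le> B" for n x
    proof -
      have "1 / real (Suc n) \<le> 1" by simp
      then show ?thesis using g'[OF that, of n] C[OF that] by linarith
    qed
    show "(\<lambda>n. g n x) \<longlonglongrightarrow> \<phi> x" if "norm x \<le> B" for x
    proof (rule LIM_zero_cancel, rule Lim_null_comparison)
      show "\<forall>\<^sub>F n in sequentially. norm (g n x - \<phi> x) \<le> 1 / real (Suc n)"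
        using g'[OF that] by (auto intro!: always_eventually less_imp_le simp: abs_minus_commute)
      show "(\<lambda>n. 1 / real (Suc n)) \<longlonglongrightarrow> 0" using LIMSEQ_inverse_real_of_nat by (simp add: inverse_eq_divide)
    qed
  qed
qed

lemma agree_closed:
  assumes C: "closed (C :: 'b set)"
  shows "agree (indicator C)"
proof (cases "C = {}")
  case True
  then show ?thesis by (simp add: agree_def)
next
  case False
  define \<phi> where "\<phi> n x = max 0 (1 - real n * infdist x C)" for n x
  have cont: "continuous_on UNIV (\<phi> n)" for n unfolding \<phi>_def by (intro continuous_intros)
  show ?thesis
  proof (rule agree_limit)
    show "\<phi> n \<in> borel_measurable borel" for n by (rule borel_measurable_continuous_onI[OF cont])
    show "agree (\<phi> n)" for n by (rule agree_continuous[OF cont])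
    show "\<bar>\<phi> n x\<bar> \<le> 1" for n x using infdist_nonneg[of x C] by (auto simp: \<phi>_def max_def)
    show "indicator C \<in> borel_measurable borel" using C by (intro borel_measurable_indicator borel_closed)
    show "(\<lambda>n. \<phi> n x) \<longlonglongrightarrow> indicator C x" for x
    proof (cases "x \<in> C")
      case True
      then have "\<phi> n x = 1" for n by (simp add: \<phi>_def)
      then show ?thesis using True by simp
    next
      case F: False
      then have pos: "infdist x C > 0" using infdist_pos_not_in_closed[OF C False] by simp
      then obtain m :: nat where m: "1 < real m * infdist x C" using reals_Archimedean3 by blast
      have "\<phi> n x = 0" if "n \<ge> m" for n
      proof -
        have "real m * infdist x C \<le> real n * infdist x C" using that pos by (intro mult_right_mono) auto
        then show ?thesis using m by (simp add: \<phi>_def)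
      qed
      then have "\<forall>\<^sub>F n in sequentially. \<phi> n x = indicator C x" using F by (auto simp: eventually_sequentially)
      then show ?thesis by (rule tendsto_eventually)
    qed
  qed
qed

lemma agree_borel:
  assumes "S \<in> sets (borel :: 'b measure)"
  shows "agree (indicator S)"
proof -
  have "Int_stable (Collect (closed :: 'b set \<Rightarrow> bool))" by (auto simp: Int_stable_def)
  moreover have "Collect (closed :: 'b set \<Rightarrow> bool) \<subseteq> Pow UNIV" by simp
  moreover have "S \<in> sigma_sets UNIV (Collect closed)" using assms by (simp add: borel_eq_closed)
  ultimately show ?thesis
  proof (induction S rule: sigma_sets_induct_disjoint)
    case basic
    then show ?case by (auto intro: agree_closed)
  next
    case empty
    show ?case by (simp add: agree_def)
  next
    case (compl A)
    then have [measurable]: "A \<in> sets borel" by (simp add: borel_eq_closed)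
    have "agree (\<lambda>x. indicator UNIV x + (-1) * indicator A x)"
    proof (rule agree_add[where C=1 and D=1])
      show "agree (indicator UNIV)" by (intro agree_closed closed_UNIV)
      show "agree (\<lambda>x. (-1) * indicator A x)" by (rule agree_cmult[OF compl(2)])
    qed (auto split: split_indicator)
    moreover have "(\<lambda>x. indicator UNIV x + (-1) * indicator A x) = (indicator (UNIV - A) :: 'b \<Rightarrow> real)"
      by (auto split: split_indicator)
    ultimately show ?case by simp
  next
    case (union A)
    then have [measurable]: "A i \<in> sets borel" for i by (auto simp: borel_eq_closed)
    show ?case
    proof (rule agree_limit[where C=1])
      show "agree (\<lambda>x. \<Sum>i<n. indicator (A i) x)" for n
      proof (induction n)
        case 0
        show ?case by (simp add: agree_def)
      next
        case (Suc n)
        show ?case unfolding sum.lessThan_Suc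
        proof (rule agree_add[where C="real n" and D=1])
          show "\<bar>\<Sum>i<n. indicat_real (A i) x\<bar> \<le> real n" for x
            using sum_bounded_above[of "{..<n}" "\<lambda>i. indicat_real (A i) x" 1] by (auto simp: abs_of_nonneg sum_nonneg)
        qed (use Suc union in \<open>auto split: split_indicator\<close>)
      qed
      have eq: "(\<Sum>i<n. indicat_real (A i) x) = indicator (\<Union>i<n. A i) x" for n x
        using union(1) by (intro indicator_UN_disjoint[symmetric]) (auto intro: disjoint_family_on_mono)
      show "\<bar>\<Sum>i<n. indicat_real (A i) x\<bar> \<le> 1" for n x unfolding eq by (auto split: split_indicator)
      show "(\<lambda>n. \<Sum>i<n. indicat_real (A i) x) \<longlonglongrightarrow> indicator (\<Union>i. A i) x" for x unfolding eq by (rule LIMSEQ_indicator_UN)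
    qed auto
  qed
qed

text \<open>Simple functions approximate an integrable kernel from within its absolute value.\<close>

lemma agree_integrable:
  assumes K [measurable]: "K \<in> borel_measurable borel"
    and hK: "integrable M (\<lambda>x. h x * of_real (K (u x)))" and kK: "integrable N (\<lambda>x. k x * of_real (K (v x)))"
  shows "agree K"
proof -
  obtain F where F: "\<And>i. simple_function borel (F i)" "\<And>x. (\<lambda>i. F i x) \<longlonglongrightarrow> K x" "\<And>i x. \<bar>F i x\<bar> \<le> 2 * \<bar>K x\<bar>"
    using borel_measurable_implies_sequence_metric[OF K, of 0] by (auto simp: dist_real_def)
  have [measurable]: "F i \<in> borel_measurable borel" for i using F(1) by (rule borel_measurable_simple_function)
  have ag: "agree (F i)" for i
  proof -
    have fin: "finite (range (F i))" using simple_functionD(1)[OF F(1), of i] by simp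
    have meas [measurable]: "F i -` {y} \<in> sets borel" for y using simple_functionD(2)[OF F(1), of i "{y}"] by simp
    have "F i x = (\<Sum>y\<in>range (F i). y * indicator (F i -` {y}) x)" for x
    proof -
      have "(\<Sum>y\<in>range (F i). y * indicator (F i -` {y}) x) = (\<Sum>y\<in>range (F i). if y = F i x then y else 0)"
        by (intro sum.cong) (auto split: split_indicator)
      then show ?thesis using fin by simp
    qed
    then have eq: "F i = (\<lambda>x. \<Sum>y\<in>range (F i). y * indicator (F i -` {y}) x)" by blast
    have "agree (\<lambda>x. \<Sum>y\<in>R. y * indicator (F i -` {y}) x)" if "finite R" for R using that
    proof (induction R)
      case empty
      show ?case by (simp add: agree_def)
    next
      case (insert y R)
      show ?case unfolding sum.insert[OF insert.hyps]
      proof (rule agree_add[where C="\<bar>y\<bar>" and D="\<Sum>y\<in>R. \<bar>y\<bar>"])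
        show "agree (\<lambda>x. y * indicator (F i -` {y}) x)" by (intro agree_cmult agree_borel meas)
        show "\<bar>\<Sum>y\<in>R. y * indicator (F i -` {y}) x\<bar> \<le> (\<Sum>y\<in>R. \<bar>y\<bar>)" for x
          by (rule order.trans[OF sum_abs sum_mono]) (auto split: split_indicator)
        show "(\<lambda>x. \<Sum>y\<in>R. y * indicator (F i -` {y}) x) \<in> borel_measurable borel"
          "(\<lambda>x. y * indicator (F i -` {y}) x) \<in> borel_measurable borel" by measurable
        show "agree (\<lambda>x. \<Sum>y\<in>R. y * indicator (F i -` {y}) x)" by (rule insert.IH)
      qed (auto split: split_indicator)
    qed
    from this[OF fin] show ?thesis using eq by simp
  qed
  have "(\<lambda>i. LINT x|M. h x * of_real (F i (u x))) \<longlonglongrightarrow> (LINT x|M. h x * of_real (K (u x)))"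
  proof (rule integral_dominated_convergence[where w="\<lambda>x. 2 * norm (h x * of_real (K (u x)))"])
    show "AE x in M. norm (h x * of_real (F i (u x))) \<le> 2 * norm (h x * of_real (K (u x)))" for i
    proof (rule AE_I2)
      fix x
      show "norm (h x * of_real (F i (u x))) \<le> 2 * norm (h x * of_real (K (u x)))"
        using mult_left_mono[OF F(3)[of i "u x"] norm_ge_zero[of "h x"]] by (simp add: norm_mult mult_ac)
    qed
  qed (use hK F(2) in \<open>auto intro!: AE_I2 tendsto_intros\<close>)
  moreover have "(\<lambda>i. LINT x|N. k x * of_real (F i (v x))) \<longlonglongrightarrow> (LINT x|N. k x * of_real (K (v x)))"
  proof (rule integral_dominated_convergence[where w="\<lambda>x. 2 * norm (k x * of_real (K (v x)))"])
    show "AE x in N. norm (k x * of_real (F i (v x))) \<le> 2 * norm (k x * of_real (K (v x)))" for i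
    proof (rule AE_I2)
      fix x
      show "norm (k x * of_real (F i (v x))) \<le> 2 * norm (k x * of_real (K (v x)))"
        using mult_left_mono[OF F(3)[of i "v x"] norm_ge_zero[of "k x"]] by (simp add: norm_mult mult_ac)
    qed
  qed (use kK F(2) in \<open>auto intro!: AE_I2 tendsto_intros\<close>)
  ultimately show ?thesis using ag LIMSEQ_unique unfolding agree_def by auto
qed

end

section \<open>Zonal integration and the Funk--Hecke formula\<close>

definition sin_cos_integral :: "nat \<Rightarrow> nat \<Rightarrow> real" where
  "sin_cos_integral k m = (LINT \<theta>|lborel. cos \<theta> ^ m * sin \<theta> ^ k * indicator {0..pi} \<theta>)"

lemma integrable_continuous_Icc:
  fixes f :: "real \<Rightarrow> real"
  assumes "continuous_on {a..b} f"
  shows "integrable lborel (\<lambda>x. f x * indicator {a..b} x)"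
  using borel_integrable_atLeastAtMost'[OF assms] by (simp add: set_integrable_def mult.commute)

lemma sin_cos_integral_rec:
  "(real m + real k + 2) * sin_cos_integral k (m + 2) = (real m + 1) * sin_cos_integral k m"
proof -
  define F where "F \<theta> = cos \<theta> ^ (m + 1) * sin \<theta> ^ (k + 1)" for \<theta> :: real
  define f where "f \<theta> = (real m + real k + 2) * (cos \<theta> ^ (m + 2) * sin \<theta> ^ k) - (real m + 1) * (cos \<theta> ^ m * sin \<theta> ^ k)" for \<theta> :: real
  have "(F has_real_derivative f \<theta>) (at \<theta>)" for \<theta>
  proof -
    have "(F has_real_derivative ((real m + 1) * cos \<theta> ^ m * (- sin \<theta>)) * sin \<theta> ^ (k + 1)
        + ((real k + 1) * sin \<theta> ^ k * cos \<theta>) * cos \<theta> ^ (m + 1)) (at \<theta>)"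
    proof -
      have c: "((\<lambda>\<theta>. cos \<theta> ^ Suc m) has_real_derivative (1 + real m) * (- sin \<theta> * cos \<theta> ^ m)) (at \<theta>)"
        by (rule DERIV_power_Suc[OF DERIV_cos])
      have s: "((\<lambda>\<theta>. sin \<theta> ^ Suc k) has_real_derivative (1 + real k) * (cos \<theta> * sin \<theta> ^ k)) (at \<theta>)"
        by (rule DERIV_power_Suc[OF DERIV_sin])
      show ?thesis unfolding F_def using DERIV_mult[OF c s] by (simp add: mult_ac add_ac)
    qed
    also have "((real m + 1) * cos \<theta> ^ m * (- sin \<theta>)) * sin \<theta> ^ (k + 1)
        + ((real k + 1) * sin \<theta> ^ k * cos \<theta>) * cos \<theta> ^ (m + 1)
       = - (real m + 1) * cos \<theta> ^ m * sin \<theta> ^ k * (sin \<theta>)\<^sup>2 + (real k + 1) * sin \<theta> ^ k * cos \<theta> ^ (m + 2)"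
      by (simp add: algebra_simps power2_eq_square)
    also have "\<dots> = f \<theta>" unfolding sin_squared_eq f_def by (simp add: algebra_simps power2_eq_square)
    finally show ?thesis .
  qed
  moreover have "isCont f \<theta>" for \<theta> unfolding f_def by (intro continuous_intros)
  ultimately have "(LINT \<theta>|lborel. f \<theta> * indicator {0..pi} \<theta>) = F pi - F 0" by (intro integral_FTC_Icc_real) auto
  also have "\<dots> = 0" by (simp add: F_def)
  finally have "(LINT \<theta>|lborel. (real m + real k + 2) * (cos \<theta> ^ (m + 2) * sin \<theta> ^ k * indicator {0..pi} \<theta>)
      - (real m + 1) * (cos \<theta> ^ m * sin \<theta> ^ k * indicator {0..pi} \<theta>)) = 0" by (simp add: f_def algebra_simps)
  then show ?thesis unfolding sin_cos_integral_def by (subst (asm) Bochner_Integration.integral_diff)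
       (auto intro!: integrable_mult_right integrable_continuous_Icc continuous_intros)
qed

lemma sin_cos_integral_1: "sin_cos_integral k 1 = 0"
proof -
  have "((\<lambda>\<theta>. sin \<theta> ^ (k + 1) / (real k + 1)) has_real_derivative cos \<theta> * sin \<theta> ^ k) (at \<theta>)" for \<theta>
  proof -
    have "((\<lambda>\<theta>. sin \<theta> ^ Suc k / (1 + real k)) has_real_derivative (1 + real k) * (cos \<theta> * sin \<theta> ^ k) / (1 + real k)) (at \<theta>)"
      by (intro DERIV_cdivide DERIV_power_Suc DERIV_sin)
    then show ?thesis by (simp add: add.commute)
  qed
  then have "(LINT \<theta>|lborel. (cos \<theta> * sin \<theta> ^ k) * indicator {0..pi} \<theta>) = sin pi ^ (k + 1) / (real k + 1) - sin 0 ^ (k + 1) / (real k + 1)"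
    by (intro integral_FTC_Icc_real) (auto intro!: continuous_intros)
  then show ?thesis by (simp add: sin_cos_integral_def)
qed

lemma sin_integral_rec: "sin_cos_integral (k + 2) 0 = (real k + 1) / (real k + 2) * sin_cos_integral k 0"
proof -
  have "sin_cos_integral (k + 2) 0 = (LINT \<theta>|lborel. cos \<theta> ^ 0 * sin \<theta> ^ k * indicator {0..pi} \<theta> - cos \<theta> ^ 2 * sin \<theta> ^ k * indicator {0..pi} \<theta>)"
    unfolding sin_cos_integral_def
    by (intro Bochner_Integration.integral_cong) (simp_all only: power_add sin_squared_eq, simp add: algebra_simps)
  also have "\<dots> = sin_cos_integral k 0 - sin_cos_integral k 2" unfolding sin_cos_integral_def
    by (intro Bochner_Integration.integral_diff integrable_continuous_Icc continuous_intros)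
  also have "sin_cos_integral k 2 = sin_cos_integral k 0 / (real k + 2)"
  proof -
    have "real k + 2 > 0" by simp
    then show ?thesis using sin_cos_integral_rec[of 0 k] by (simp add: field_simps numeral_2_eq_2)
  qed
  finally show ?thesis by (simp add: field_simps)
qed

lemma sphere_area_rec:
  assumes "m \<ge> 1"
  shows "sphere_area (m + 2) = 2 * pi / real m * sphere_area m"
proof -
  have "Gamma (real m / 2 + 1 + 1) = (real m / 2 + 1) * Gamma (real m / 2 + 1)"
    by (intro Gamma_plus1) (auto simp: nonpos_Ints_def)
  moreover have "pi powr (real m / 2 + 1) = pi powr (real m / 2) * pi" by (simp add: powr_add)
  moreover have e: "(real m + 2) / 2 = real m / 2 + 1" by (simp add: field_simps)
  ultimately have V: "unit_ball_vol (real m + 2) = unit_ball_vol (real m) * pi / (real m / 2 + 1)"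
    unfolding unit_ball_vol_def e by (simp only:) simp
  have "(m + 2) * (V * p / (m / 2 + 1)) = 2 * p / m * (m * V)" if "m > 0" for m V p :: real
    using that by (simp add: divide_simps)
  from this[of "real m" "unit_ball_vol (real m)" pi] show ?thesis
    using assms unfolding sphere_area_def of_nat_add of_nat_numeral V by simp
qed

lemma sphere_area_slice: "sphere_area (k + 1) * sin_cos_integral k 0 = sphere_area (k + 2)"
proof (induction k rule: less_induct)
  case (less k)
  have 1: "sphere_area 1 = 2" "sphere_area 2 = 2 * pi" "sphere_area 3 = 4 * pi"
    using unit_ball_vol_1 unit_ball_vol_2 unit_ball_vol_3 by (simp_all add: sphere_area_def)
  consider "k = 0" | "k = 1" | j where "k = j + 2" by (metis One_nat_def add.commute add_2_eq_Suc not0_implies_Suc)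
  then show ?case
  proof cases
    case 1
    have "sin_cos_integral 0 0 = pi" by (simp add: sin_cos_integral_def)
    then show ?thesis using 1 \<open>sphere_area 1 = 2\<close> \<open>sphere_area 2 = 2 * pi\<close> by (simp add: numeral_2_eq_2)
  next
    case 2
    have "(LINT \<theta>|lborel. sin \<theta> * indicator {0..pi} \<theta>) = - cos pi - (- cos 0)"
      by (intro integral_FTC_Icc_real) (auto intro!: derivative_eq_intros continuous_intros)
    then have "sin_cos_integral 1 0 = 2" by (simp add: sin_cos_integral_def)
    then show ?thesis using 2 \<open>sphere_area 2 = 2 * pi\<close> \<open>sphere_area 3 = 4 * pi\<close> by (simp add: numeral_3_eq_3 numeral_2_eq_2)
  next
    case 3
    have "sphere_area (k + 1) * sin_cos_integral k 0
       = (2 * pi / real (j + 1) * sphere_area (j + 1)) * ((real j + 1) / (real j + 2) * sin_cos_integral j 0)"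
      using sphere_area_rec[of "j + 1"] sin_integral_rec[of j] 3 by (simp add: add_ac)
    also have "\<dots> = 2 * pi / (real j + 2) * (sphere_area (j + 1) * sin_cos_integral j 0)"
    proof -
      have "2 * p / x * A * (x / y * W) = 2 * p / y * (A * W)" if "x > 0" "y > 0" for p x y A W :: real
        using that by simp
      from this[of "real j + 1" "real j + 2"] show ?thesis by (simp add: add.commute)
    qed
    also have "\<dots> = 2 * pi / real (j + 2) * sphere_area (j + 2)" using less[of j] 3 by (simp add: add.commute)
    also have "\<dots> = sphere_area (k + 2)" using sphere_area_rec[of "j + 2"] 3 by simp
    finally show ?thesis .
  qed
qed

text \<open>The distribution of the angle to a fixed point of the sphere of dimension \<open>d - 1\<close>.\<close>

definition angle_measure :: "nat \<Rightarrow> real measure" where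
  "angle_measure d = density lborel (\<lambda>\<theta>. ennreal (sphere_area (d - 1) * sin \<theta> ^ (d - 2) * indicator {0..pi} \<theta>))"

lemma sets_angle_measure [measurable_cong, simp]: "sets (angle_measure d) = sets borel" by (simp add: angle_measure_def)

lemma space_angle_measure [simp]: "space (angle_measure d) = UNIV" by (simp add: angle_measure_def)

lemma sphere_area_nonneg [simp]: "sphere_area m \<ge> 0" by (simp add: sphere_area_def)

lemma angle_density_nonneg: "0 \<le> sphere_area (d - 1) * sin \<theta> ^ (d - 2) * indicator {0..pi} \<theta>"
  by (auto split: split_indicator intro!: mult_nonneg_nonneg zero_le_power sin_ge_zero)

lemma integral_angle_measure:
  fixes f :: "real \<Rightarrow> 'b::{banach, second_countable_topology}"
  assumes "f \<in> borel_measurable borel"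
  shows "(LINT \<theta>|angle_measure d. f \<theta>) = (LINT \<theta>|lborel. (sphere_area (d - 1) * sin \<theta> ^ (d - 2) * indicator {0..pi} \<theta>) *\<^sub>R f \<theta>)"
    and "integrable (angle_measure d) f \<longleftrightarrow> integrable lborel (\<lambda>\<theta>. (sphere_area (d - 1) * sin \<theta> ^ (d - 2) * indicator {0..pi} \<theta>) *\<^sub>R f \<theta>)"
  unfolding angle_measure_def using assms angle_density_nonneg by (auto simp: integral_density integrable_density)

lemma integral_angle_cos_power:
  "(LINT \<theta>|angle_measure d. cos \<theta> ^ m) = sphere_area (d - 1) * sin_cos_integral (d - 2) m"
  by (subst integral_angle_measure) (auto simp: sin_cos_integral_def mult_ac simp flip: integral_mult_right_zero)

lemma finite_measure_angle: "finite_measure (angle_measure d)"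
proof
  have "integrable lborel (\<lambda>\<theta>. (sphere_area (d - 1) * sin \<theta> ^ (d - 2)) * indicator {0..pi} \<theta>)"
    by (intro integrable_continuous_Icc continuous_intros)
  then have "(\<integral>\<^sup>+\<theta>. ennreal (sphere_area (d - 1) * sin \<theta> ^ (d - 2) * indicator {0..pi} \<theta>) \<partial>lborel) < \<infinity>"
    using angle_density_nonneg by (subst nn_integral_eq_integral) auto
  then show "emeasure (angle_measure d) (space (angle_measure d)) \<noteq> \<infinity>" by (simp add: angle_measure_def emeasure_density)
qed

lemma integral_inner_power:
  assumes d: "DIM('a::euclidean_space) \<ge> 2" and xi: "norm (\<xi>::'a) = 1"
  shows "(LINT \<eta>|surface. (\<xi> \<bullet> \<eta>) ^ m) = (LINT \<theta>|angle_measure DIM('a). cos \<theta> ^ m)"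
proof -
  obtain k where k: "DIM('a) = k + 2" using d by (metis add.commute le_Suc_ex)
  have "harmonic (\<lambda>x::'a. 1)" by (simp add: harmonic_def)
  then have s: "(LINT \<eta>|surface. (\<xi> \<bullet> \<eta>) ^ m) = sphere_moment TYPE('a) 0 m" for m
    using sphere_moment_harmonic[of "\<lambda>_. 1" 0 \<xi> m, OF real_polynomial_function.intros(2)] xi
    by (simp add: homogeneous_def)
  define G where "G = (LINT x|(lborel :: 'a measure). exp (-(norm x)\<^sup>2))"
  have rec: "sphere_moment TYPE('a) 0 (m + 2) = (real m + 1) / (real m + real k + 2) * sphere_moment TYPE('a) 0 m" for m
  proof -
    have "0 + (m + 2) + DIM('a) - 1 = (0 + m + DIM('a) - 1) + 2" using k by simp
    then have "gauss_const (0 + (m + 2) + DIM('a) - 1) = (real m + real k + 2) / 2 * gauss_const (0 + m + DIM('a) - 1)"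
      using gauss_const_rec[of "0 + m + DIM('a) - 1"] k by (simp add: add_ac)
    moreover have "gauss_moment G 0 (m + 2) = (real m + 1) / 2 * gauss_moment G 0 m" by simp
    ultimately show ?thesis using gauss_const_pos[of "0 + m + DIM('a) - 1"]
      unfolding sphere_moment_def G_def[symmetric] by (simp add: field_simps)
  qed
  have "sphere_moment TYPE('a) 0 m = sphere_area (k + 1) * sin_cos_integral k m"
  proof (induction m rule: less_induct)
    case (less m)
    consider "m = 0" | "m = 1" | j where "m = j + 2" by (metis One_nat_def add.commute add_2_eq_Suc not0_implies_Suc)
    then show ?case
    proof cases
      case 1
      have "measure (surface :: 'a measure) (sphere 0 1) = sphere_area DIM('a)"
        using emeasure_surface_sphere[where 'a='a] by (simp add: measure_def)
      then have "sphere_moment TYPE('a) 0 0 = sphere_area DIM('a)" using s[of 0] by simp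
      then show ?thesis using sphere_area_slice[of k] 1 k by simp
    next
      case 2
      then show ?thesis using sin_cos_integral_1[of k] by (simp add: sphere_moment_def)
    next
      case 3
      have "real j + real k + 2 > 0" by simp
      then have "sin_cos_integral k (j + 2) = (real j + 1) / (real j + real k + 2) * sin_cos_integral k j"
        using sin_cos_integral_rec[of j k] by (simp add: field_simps)
      then show ?thesis using rec[of j] less[of j] 3 by simp
    qed
  qed
  then show ?thesis unfolding integral_angle_cos_power s k by simp
qed

lemma measurable_inner_surface [measurable]:
  "(\<lambda>\<eta>. (\<xi>::'a::euclidean_space) \<bullet> \<eta>) \<in> borel_measurable surface"
  by (intro measurable_surface_continuous continuous_intros)

text \<open>Both distributions live on a bounded interval and have the same moments.\<close>

lemma distr_inner_surface:
  assumes d: "DIM('a::euclidean_space) \<ge> 2" and xi: "norm (\<xi>::'a) = 1"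
  shows "distr surface borel (\<lambda>\<eta>. \<xi> \<bullet> \<eta>) = distr (angle_measure DIM('a)) borel cos"
proof -
  interpret S: finite_measure "surface :: 'a measure" by simp
  interpret A: finite_measure "angle_measure DIM('a)" by (rule finite_measure_angle)
  interpret moment_match "surface :: 'a measure" "angle_measure DIM('a)" "\<lambda>_. 1" "\<lambda>_. 1" "\<lambda>\<eta>. \<xi> \<bullet> \<eta>" cos 1
  proof
    show "norm (\<xi> \<bullet> x) \<le> 1" if "x \<in> space surface" for x using Cauchy_Schwarz_ineq2[of \<xi> x] that xi by simp
    show "(LINT x|surface. 1 * complex_of_real ((a \<bullet> (\<xi> \<bullet> x)) ^ m)) =
         (LINT x|angle_measure DIM('a). 1 * complex_of_real ((a \<bullet> cos x) ^ m))" for a m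
      using integral_inner_power[OF d xi, of m] by (simp add: power_mult_distrib del: of_real_power of_real_mult)
  qed auto
  show ?thesis
  proof (rule measure_eqI)
    fix E assume "E \<in> sets (distr surface borel (\<lambda>\<eta>. \<xi> \<bullet> \<eta>))"
    then have E [measurable]: "E \<in> sets borel" by simp
    have E1: "(\<lambda>\<eta>. \<xi> \<bullet> \<eta>) -` E \<inter> space surface \<in> sets surface" and E2: "cos -` E \<in> sets (angle_measure DIM('a))"
      using measurable_sets[OF measurable_inner_surface E] measurable_sets[of cos borel borel E] by auto
    have "(LINT x|surface. complex_of_real (indicator E (\<xi> \<bullet> x))) = (LINT x|angle_measure DIM('a). complex_of_real (indicator E (cos x)))"
      using agree_borel[OF E] by (simp add: agree_def)
    then have "(LINT x|surface. indicat_real E (\<xi> \<bullet> x)) = (LINT x|angle_measure DIM('a). indicat_real E (cos x))"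
      by simp
    moreover have "(LINT x|surface. indicat_real E (\<xi> \<bullet> x)) = (LINT x|surface. indicat_real ((\<lambda>\<eta>. \<xi> \<bullet> \<eta>) -` E \<inter> space surface) x)"
      by (intro Bochner_Integration.integral_cong) (auto split: split_indicator)
    moreover have "(LINT x|angle_measure DIM('a). indicat_real E (cos x)) = (LINT x|angle_measure DIM('a). indicat_real (cos -` E) x)"
      by (intro Bochner_Integration.integral_cong) (auto split: split_indicator)
    ultimately have "measure surface ((\<lambda>\<eta>. \<xi> \<bullet> \<eta>) -` E \<inter> space surface) = measure (angle_measure DIM('a)) (cos -` E)"
      using E1 E2 by simp
    then show "emeasure (distr surface borel (\<lambda>\<eta>. \<xi> \<bullet> \<eta>)) E = emeasure (distr (angle_measure DIM('a)) borel cos) E"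
      by (simp add: emeasure_distr S.emeasure_eq_measure A.emeasure_eq_measure)
  qed simp
qed

lemma
  assumes d: "DIM('a::euclidean_space) \<ge> 2" and xi: "norm (\<xi>::'a) = 1"
  shows integral_zonal: "\<And>K :: real \<Rightarrow> 'b::{banach, second_countable_topology}. K \<in> borel_measurable borel \<Longrightarrow>
      (LINT \<eta>|surface. K (\<xi> \<bullet> \<eta>)) = (LINT \<theta>|angle_measure DIM('a). K (cos \<theta>))"
    and integrable_zonal: "\<And>K :: real \<Rightarrow> 'b. K \<in> borel_measurable borel \<Longrightarrow>
      integrable surface (\<lambda>\<eta>. K (\<xi> \<bullet> \<eta>)) \<longleftrightarrow> integrable (angle_measure DIM('a)) (\<lambda>\<theta>. K (cos \<theta>))"
    and nn_integral_zonal: "\<And>K :: real \<Rightarrow> ennreal. K \<in> borel_measurable borel \<Longrightarrow>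
      (\<integral>\<^sup>+\<eta>. K (\<xi> \<bullet> \<eta>) \<partial>surface) = (\<integral>\<^sup>+\<theta>. K (cos \<theta>) \<partial>angle_measure DIM('a))"
    and AE_zonal: "\<And>P. {x. P x} \<in> sets borel \<Longrightarrow> (AE \<eta> in surface. P (\<xi> \<bullet> \<eta>)) \<longleftrightarrow> (AE \<theta> in angle_measure DIM('a). P (cos \<theta>))"
proof -
  note eq = distr_inner_surface[OF d xi]
  fix K :: "real \<Rightarrow> 'b" assume [measurable]: "K \<in> borel_measurable borel"
  show "(LINT \<eta>|surface. K (\<xi> \<bullet> \<eta>)) = (LINT \<theta>|angle_measure DIM('a). K (cos \<theta>))"
    using arg_cong[OF eq, of "\<lambda>M. integral\<^sup>L M K"] by (simp add: integral_distr)
  show "integrable surface (\<lambda>\<eta>. K (\<xi> \<bullet> \<eta>)) \<longleftrightarrow> integrable (angle_measure DIM('a)) (\<lambda>\<theta>. K (cos \<theta>))"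
    using arg_cong[OF eq, of "\<lambda>M. integrable M K"] by (simp add: integrable_distr_eq)
next
  note eq = distr_inner_surface[OF d xi]
  fix K :: "real \<Rightarrow> ennreal" assume [measurable]: "K \<in> borel_measurable borel"
  show "(\<integral>\<^sup>+\<eta>. K (\<xi> \<bullet> \<eta>) \<partial>surface) = (\<integral>\<^sup>+\<theta>. K (cos \<theta>) \<partial>angle_measure DIM('a))"
    using arg_cong[OF eq, of "\<lambda>M. nn_integral M K"] by (simp add: nn_integral_distr)
next
  note eq = distr_inner_surface[OF d xi]
  fix P :: "real \<Rightarrow> bool" assume P: "{x. P x} \<in> sets borel"
  then have [measurable]: "Measurable.pred borel P" by (simp add: pred_def)
  show "(AE \<eta> in surface. P (\<xi> \<bullet> \<eta>)) \<longleftrightarrow> (AE \<theta> in angle_measure DIM('a). P (cos \<theta>))"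
    using arg_cong[OF eq, of "\<lambda>M. AE x in M. P x"] P by (simp add: AE_distr_iff)
qed

lemma measurable_poly [measurable]: "poly (p :: real poly) \<in> borel_measurable borel"
  by (intro borel_measurable_continuous_onI continuous_intros)

text \<open>
  The moments of \<open>Y\<close> against powers of \<open>\<xi> \<bullet> \<eta>\<close> are \<open>Y(\<xi>)\<close> times a factor that depends on the degree
  alone; the zonal harmonic, which is \<open>1\<close> at \<open>\<xi>\<close>, shows which factor. Moments determine the integral
  against any integrable kernel.
\<close>

lemma funk_hecke:
  fixes Y :: "'a::euclidean_space \<Rightarrow> complex" and K :: "real \<Rightarrow> real"
  assumes d: "DIM('a) \<ge> 2" and Y: "spherical_harmonic l Y" and xi: "norm \<xi> = 1"
    and K [measurable]: "K \<in> borel_measurable borel" and int: "integrable (angle_measure DIM('a)) (\<lambda>\<theta>. K (cos \<theta>))"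
  shows "(LINT \<eta>|surface. Y \<eta> * of_real (K (\<xi> \<bullet> \<eta>)))
    = of_real (LINT \<theta>|angle_measure DIM('a). poly (geg DIM('a) l) (cos \<theta>) * K (cos \<theta>)) * Y \<xi>"
proof -
  define P where "P = poly (geg DIM('a) l)"
  have [measurable]: "P \<in> borel_measurable borel" unfolding P_def by measurable
  have P_le: "\<bar>P (cos \<theta>)\<bar> \<le> 1" for \<theta> unfolding P_def by (intro geg_bound d) auto
  interpret A: finite_measure "angle_measure DIM('a)" by (rule finite_measure_angle)
  have mom: "(LINT \<theta>|angle_measure DIM('a). P (cos \<theta>) * cos \<theta> ^ m) = sphere_moment TYPE('a) l m" for m
  proof -
    have "(LINT \<eta>|surface. complex_of_real (P (\<xi> \<bullet> \<eta>)) * of_real ((\<xi> \<bullet> \<eta>) ^ m)) = of_real (sphere_moment TYPE('a) l m)"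
      using sphere_moment_spherical_harmonic[OF spherical_harmonic_zonal[OF d xi] xi, of l m] xi d
      by (simp add: P_def norm_eq_1 del: of_real_power)
    then have "(LINT \<eta>|surface. P (\<xi> \<bullet> \<eta>) * (\<xi> \<bullet> \<eta>) ^ m) = sphere_moment TYPE('a) l m"
      unfolding of_real_mult[symmetric] integral_complex_of_real by simp
    then show ?thesis using integral_zonal[OF d xi, of "\<lambda>x. P x * x ^ m"] by simp
  qed
  have kK: "integrable (angle_measure DIM('a)) (\<lambda>\<theta>. P (cos \<theta>) * K (cos \<theta>))"
  proof (rule Bochner_Integration.integrable_bound[OF int])
    show "AE \<theta> in angle_measure DIM('a). norm (P (cos \<theta>) * K (cos \<theta>)) \<le> norm (K (cos \<theta>))"
      using mult_right_mono[OF P_le abs_ge_zero] by (auto simp: abs_mult)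
  qed measurable
  interpret moment_match "surface :: 'a measure" "angle_measure DIM('a)" Y "\<lambda>\<theta>. of_real (P (cos \<theta>)) * Y \<xi>" "\<lambda>\<eta>. \<xi> \<bullet> \<eta>" cos 1
  proof
    show "integrable surface Y" by (intro integrable_surface_continuous spherical_harmonic_continuous[OF Y])
    have "integrable (angle_measure DIM('a)) (\<lambda>\<theta>. P (cos \<theta>))"
      by (rule A.integrable_const_bound[of _ 1]) (use P_le in auto)
    then show "integrable (angle_measure DIM('a)) (\<lambda>\<theta>. of_real (P (cos \<theta>)) * Y \<xi>)"
      by (intro integrable_mult_left integrable_of_real)
    show "norm (\<xi> \<bullet> x) \<le> 1" if "x \<in> space surface" for x using Cauchy_Schwarz_ineq2[of \<xi> x] that xi by simp
    show "(LINT x|surface. Y x * complex_of_real ((a \<bullet> (\<xi> \<bullet> x)) ^ m)) =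
         (LINT x|angle_measure DIM('a). of_real (P (cos x)) * Y \<xi> * complex_of_real ((a \<bullet> cos x) ^ m))" for a m
    proof -
      have "(LINT x|surface. Y x * complex_of_real ((a \<bullet> (\<xi> \<bullet> x)) ^ m))
         = (LINT x|surface. of_real (a ^ m) * (Y x * of_real ((\<xi> \<bullet> x) ^ m)))"
        by (intro Bochner_Integration.integral_cong) (auto simp: power_mult_distrib)
      also have "\<dots> = of_real (a ^ m) * (of_real (sphere_moment TYPE('a) l m) * Y \<xi>)"
        by (simp only: integral_mult_right_zero sphere_moment_spherical_harmonic[OF Y xi])
      also have "\<dots> = (LINT x|angle_measure DIM('a). of_real (P (cos x) * cos x ^ m) * (of_real (a ^ m) * Y \<xi>))"
        unfolding integral_mult_left_zero integral_complex_of_real mom by (simp only: mult_ac)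
      also have "\<dots> = (LINT x|angle_measure DIM('a). of_real (P (cos x)) * Y \<xi> * complex_of_real ((a \<bullet> cos x) ^ m))"
        by (intro Bochner_Integration.integral_cong) (auto simp: power_mult_distrib)
      finally show ?thesis .
    qed
  qed auto
  have "agree K"
  proof (rule agree_integrable[OF K])
    obtain B where B: "\<And>x. norm x = 1 \<Longrightarrow> norm (Y x) \<le> B"
      using continuous_sphere_bounded[OF spherical_harmonic_continuous[OF Y]] by blast
    have "integrable surface (\<lambda>\<eta>. K (\<xi> \<bullet> \<eta>))" using integrable_zonal[OF d xi K] int by simp
    then have "integrable surface (\<lambda>\<eta>. B * K (\<xi> \<bullet> \<eta>))" by simp
    then show "integrable surface (\<lambda>x. Y x * of_real (K (\<xi> \<bullet> x)))"
    proof (rule Bochner_Integration.integrable_bound)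
      show "AE x in surface. norm (Y x * of_real (K (\<xi> \<bullet> x))) \<le> norm (B * K (\<xi> \<bullet> x))"
        using B by (intro AE_I2) (auto simp: norm_mult abs_mult intro!: mult_right_mono order.trans[OF B abs_ge_self])
    qed measurable
    have "integrable (angle_measure DIM('a)) (\<lambda>\<theta>. complex_of_real (P (cos \<theta>) * K (cos \<theta>)) * Y \<xi>)"
      using kK by (intro integrable_mult_left integrable_of_real)
    then show "integrable (angle_measure DIM('a)) (\<lambda>\<theta>. of_real (P (cos \<theta>)) * Y \<xi> * of_real (K (cos \<theta>)))"
      by (simp add: mult_ac)
  qed
  then have "(LINT \<eta>|surface. Y \<eta> * of_real (K (\<xi> \<bullet> \<eta>)))
     = (LINT \<theta>|angle_measure DIM('a). of_real (P (cos \<theta>) * K (cos \<theta>)) * Y \<xi>)"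
    unfolding agree_def by (simp only: of_real_mult mult_ac)
  then show ?thesis by (simp only: integral_mult_left_zero integral_complex_of_real P_def)
qed

section \<open>Square integrable functions\<close>

lemma square_integrable_measurable [measurable_dest]:
  "square_integrable M f \<Longrightarrow> f \<in> borel_measurable M" by (simp add: square_integrable_def)

lemma measurable_cnj [measurable (raw)]:
  "f \<in> borel_measurable M \<Longrightarrow> (\<lambda>x. cnj (f x)) \<in> borel_measurable M"
  by (rule borel_measurable_continuous_on[of cnj]) (auto intro: continuous_intros)

lemma square_integrable_mult:
  fixes f g :: "'x \<Rightarrow> complex"
  assumes f: "square_integrable M f" and g: "square_integrable M g"
  shows "integrable M (\<lambda>x. f x * g x)" "integrable M (\<lambda>x. f x * cnj (g x))"
proof -
  note [measurable] = square_integrable_measurable[OF f] square_integrable_measurable[OF g]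
  have i: "integrable M (\<lambda>x. (norm (f x))\<^sup>2 + (norm (g x))\<^sup>2)" using f g by (auto simp: square_integrable_def)
  have b: "norm (f x) * norm (g x) \<le> (norm (f x))\<^sup>2 + (norm (g x))\<^sup>2" for x
    using sum_squares_bound[of "norm (f x)" "norm (g x)"] mult_nonneg_nonneg[OF norm_ge_zero[of "f x"] norm_ge_zero[of "g x"]] by linarith
  show "integrable M (\<lambda>x. f x * g x)" "integrable M (\<lambda>x. f x * cnj (g x))"
    by (rule Bochner_Integration.integrable_bound[OF i]; use b in \<open>simp add: norm_mult\<close>)+
qed

lemma square_integrable_add:
  fixes f g :: "'x \<Rightarrow> complex"
  assumes f: "square_integrable M f" and g: "square_integrable M g"
  shows "square_integrable M (\<lambda>x. f x + g x)"
proof -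
  note [measurable] = square_integrable_measurable[OF f] square_integrable_measurable[OF g]
  have i: "integrable M (\<lambda>x. 2 * ((norm (f x))\<^sup>2 + (norm (g x))\<^sup>2))" using f g by (auto simp: square_integrable_def)
  have "(norm (f x + g x))\<^sup>2 \<le> 2 * ((norm (f x))\<^sup>2 + (norm (g x))\<^sup>2)" for x
  proof -
    have "(norm (f x + g x))\<^sup>2 \<le> (norm (f x) + norm (g x))\<^sup>2" by (intro power_mono norm_triangle_ineq) auto
    also have "\<dots> \<le> 2 * ((norm (f x))\<^sup>2 + (norm (g x))\<^sup>2)"
      using sum_squares_bound[of "norm (f x)" "norm (g x)"] by (simp add: power2_sum)
    finally show ?thesis .
  qed
  then have "integrable M (\<lambda>x. (norm (f x + g x))\<^sup>2)" by (intro Bochner_Integration.integrable_bound[OF i]) auto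
  then show ?thesis by (simp add: square_integrable_def)
qed

lemma square_integrable_cmult:
  fixes f :: "'x \<Rightarrow> complex"
  assumes f: "square_integrable M f"
  shows "square_integrable M (\<lambda>x. c * f x)" using f by (auto simp: square_integrable_def norm_mult power_mult_distrib)

lemma square_integrable_diff:
  fixes f g :: "'x \<Rightarrow> complex"
  assumes f: "square_integrable M f" and g: "square_integrable M g"
  shows "square_integrable M (\<lambda>x. f x - g x)"
  using square_integrable_add[OF f square_integrable_cmult[OF g, of "-1"]] by simp

lemma square_integrable_sum:
  fixes f :: "'i \<Rightarrow> 'x \<Rightarrow> complex"
  assumes "\<And>i. i \<in> I \<Longrightarrow> square_integrable M (f i)"
  shows "square_integrable M (\<lambda>x. \<Sum>i\<in>I. f i x)"
  using assms by (induction I rule: infinite_finite_induct) (auto intro: square_integrable_add simp: square_integrable_def[of M "\<lambda>_. 0"])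

lemma norm_diff_square:
  "(norm (a - b :: complex))\<^sup>2 = (norm a)\<^sup>2 + (norm b)\<^sup>2 - 2 * Re (a * cnj b)"
  unfolding cmod_power2 by (simp add: power2_eq_square algebra_simps)

lemma integral_norm_diff_square:
  fixes f g :: "'x \<Rightarrow> complex"
  assumes f: "square_integrable M f" and g: "square_integrable M g"
  shows "(LINT x|M. (norm (f x - g x))\<^sup>2)
    = (LINT x|M. (norm (f x))\<^sup>2) + (LINT x|M. (norm (g x))\<^sup>2) - 2 * Re (LINT x|M. f x * cnj (g x))"
proof -
  have i: "integrable M (\<lambda>x. (norm (f x))\<^sup>2)" "integrable M (\<lambda>x. (norm (g x))\<^sup>2)"
    using f g by (auto simp: square_integrable_def)
  note fg = square_integrable_mult(2)[OF f g]
  have "(LINT x|M. (norm (f x - g x))\<^sup>2) = (LINT x|M. ((norm (f x))\<^sup>2 + (norm (g x))\<^sup>2) - 2 * Re (f x * cnj (g x)))"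
    by (simp only: norm_diff_square)
  also have "\<dots> = (LINT x|M. (norm (f x))\<^sup>2 + (norm (g x))\<^sup>2) - (LINT x|M. 2 * Re (f x * cnj (g x)))"
    by (intro Bochner_Integration.integral_diff Bochner_Integration.integrable_add i integrable_mult_right integrable_Re fg)
  also have "(LINT x|M. (norm (f x))\<^sup>2 + (norm (g x))\<^sup>2) = (LINT x|M. (norm (f x))\<^sup>2) + (LINT x|M. (norm (g x))\<^sup>2)"
    by (intro Bochner_Integration.integral_add i)
  also have "(LINT x|M. 2 * Re (f x * cnj (g x))) = 2 * Re (LINT x|M. f x * cnj (g x))"
    by (simp only: integral_mult_right_zero integral_Re[OF fg])
  finally show ?thesis .
qed

text \<open>Completeness of \<open>L\<^sup>2\<close>: a rapidly converging subsequence converges almost everywhere.\<close>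

lemma riesz_fischer:
  fixes S :: "nat \<Rightarrow> 'x \<Rightarrow> complex"
  assumes S: "\<And>n. square_integrable M (S n)"
    and cauchy: "\<And>e. e > 0 \<Longrightarrow> \<exists>N. \<forall>m\<ge>N. \<forall>n\<ge>N. (LINT x|M. (norm (S m x - S n x))\<^sup>2) < e"
  obtains g where "square_integrable M g" "(\<lambda>n. LINT x|M. (norm (S n x - g x))\<^sup>2) \<longlonglongrightarrow> 0"
proof -
  note [measurable] = square_integrable_measurable[OF S]
  have int: "integrable M (\<lambda>x. (norm (S m x - S n x))\<^sup>2)" for m n
    using square_integrable_diff[OF S S] by (simp add: square_integrable_def)
  have nn: "(\<integral>\<^sup>+x. ennreal ((norm (S m x - S n x))\<^sup>2) \<partial>M) = ennreal (LINT x|M. (norm (S m x - S n x))\<^sup>2)" for m n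
    by (rule nn_integral_eq_integral[OF int]) auto
  obtain r where r: "\<And>k m n. m \<ge> r k \<Longrightarrow> n \<ge> r k \<Longrightarrow> (LINT x|M. (norm (S m x - S n x))\<^sup>2) < (1/4) ^ k"
    using cauchy[of "(1/4) ^ k" for k] by (metis zero_less_divide_1_iff zero_less_numeral zero_less_power)
  define R where "R k = (\<Sum>i\<le>k. r i)" for k
  have R: "R k \<ge> r k" "R (Suc k) \<ge> R k" "R (Suc k) \<ge> r k" for k
    by (auto simp: R_def lessThan_Suc_atMost[symmetric] intro: trans_le_add1)
  have R_mono: "R i \<le> R j" if "i \<le> j" for i j using that R(2) by (rule lift_Suc_mono_le[of R, rotated])
  define u where "u k x = norm (S (R (Suc k)) x - S (R k) x)" for k x
  have [measurable]: "u k \<in> borel_measurable M" for k unfolding u_def by measurable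
  have "AE x in M. (\<Sum>k. ennreal (2 ^ k * (u k x)\<^sup>2)) \<noteq> \<infinity>"
  proof (rule nn_integral_PInf_AE)
    have "(\<integral>\<^sup>+x. (\<Sum>k. ennreal (2 ^ k * (u k x)\<^sup>2)) \<partial>M) = (\<Sum>k. \<integral>\<^sup>+x. ennreal (2 ^ k * (u k x)\<^sup>2) \<partial>M)"
      by (rule nn_integral_suminf) measurable
    also have "\<dots> \<le> (\<Sum>k. ennreal ((1/2) ^ k))"
    proof (rule suminf_le)
      fix k
      have "(\<integral>\<^sup>+x. ennreal (2 ^ k * (u k x)\<^sup>2) \<partial>M) = ennreal (2 ^ k) * (\<integral>\<^sup>+x. ennreal ((u k x)\<^sup>2) \<partial>M)"
        by (subst nn_integral_cmult[symmetric]) (auto simp: ennreal_mult)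
      also have "(\<integral>\<^sup>+x. ennreal ((u k x)\<^sup>2) \<partial>M) \<le> ennreal ((1/4) ^ k)"
        unfolding u_def nn using r[OF R(3) R(1)] by (intro ennreal_leI) (auto intro: less_imp_le)
      also have "ennreal (2 ^ k) * ennreal ((1/4) ^ k) = ennreal ((1/2) ^ k)"
        by (simp add: ennreal_mult[symmetric] power_mult_distrib[symmetric])
      finally show "(\<integral>\<^sup>+x. ennreal (2 ^ k * (u k x)\<^sup>2) \<partial>M) \<le> ennreal ((1/2) ^ k)" by (simp add: mult_left_mono)
    qed auto
    also have "(\<Sum>k. ennreal ((1/2) ^ k)) = ennreal (\<Sum>k. (1/2) ^ k)"
      by (intro suminf_ennreal2) (auto simp: summable_geometric)
    also have "ennreal (\<Sum>k. (1/2) ^ k) < \<infinity>" by simp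
    finally show "(\<integral>\<^sup>+x. (\<Sum>k. ennreal (2 ^ k * (u k x)\<^sup>2)) \<partial>M) \<noteq> \<infinity>" by (simp add: less_top[symmetric])
  qed measurable
  then have conv: "AE x in M. convergent (\<lambda>k. S (R k) x)"
  proof eventually_elim
    case (elim x)
    then have s: "summable (\<lambda>k. 2 ^ k * (u k x)\<^sup>2)" by (intro summable_suminf_not_top) auto
    have "summable (\<lambda>k. (1/2) ^ k + 2 ^ k * (u k x)\<^sup>2)" by (intro summable_add s summable_geometric) auto
    then have "summable (\<lambda>k. norm (S (R (Suc k)) x - S (R k) x))"
    proof (rule summable_comparison_test'[where N=0])
      fix k :: nat
      have "0 \<le> (2 ^ k * u k x - 1)\<^sup>2" by simp
      then have "2 * (2 ^ k * u k x) \<le> 2 ^ k * 2 ^ k * (u k x)\<^sup>2 + 1" by (simp add: power2_eq_square algebra_simps)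
      moreover have "0 \<le> 2 ^ k * u k x" by (simp add: u_def)
      ultimately have "2 ^ k * u k x \<le> 2 ^ k * ((1/2) ^ k + 2 ^ k * (u k x)\<^sup>2)"
        by (simp add: algebra_simps power_one_over)
      then show "norm (norm (S (R (Suc k)) x - S (R k) x)) \<le> (1/2) ^ k + 2 ^ k * (u k x)\<^sup>2" by (simp add: u_def)
    qed
    then have "summable (\<lambda>k. S (R (Suc k)) x - S (R k) x)" by (rule summable_norm_cancel)
    then have "convergent (\<lambda>k. \<Sum>i<k. S (R (Suc i)) x - S (R i) x)" by (simp add: summable_iff_convergent)
    then have "convergent (\<lambda>k. S (R k) x - S (R 0) x)" by (simp add: sum_lessThan_telescope[of "\<lambda>k. S (R k) x"])
    then have "convergent (\<lambda>k. (S (R k) x - S (R 0) x) + S (R 0) x)" by (intro convergent_add convergent_const)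
    then show ?case by simp
  qed
  define g where "g x = lim (\<lambda>k. S (R k) x)" for x
  have [measurable]: "g \<in> borel_measurable M" unfolding g_def by measurable
  have fatou: "(\<integral>\<^sup>+x. ennreal ((norm (S n x - g x))\<^sup>2) \<partial>M) \<le> ennreal ((1/4) ^ k)" if n: "n \<ge> r k" for n k
  proof -
    have "(\<integral>\<^sup>+x. ennreal ((norm (S n x - g x))\<^sup>2) \<partial>M) = (\<integral>\<^sup>+x. liminf (\<lambda>i. ennreal ((norm (S n x - S (R i) x))\<^sup>2)) \<partial>M)"
    proof (rule nn_integral_cong_AE, use conv in eventually_elim)
      case (elim x)
      then have "(\<lambda>i. S (R i) x) \<longlonglongrightarrow> g x" by (simp add: g_def convergent_LIMSEQ_iff)
      then have "(\<lambda>i. ennreal ((norm (S n x - S (R i) x))\<^sup>2)) \<longlonglongrightarrow> ennreal ((norm (S n x - g x))\<^sup>2)"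
        by (intro tendsto_intros tendsto_ennrealI)
      then show ?case by (metis lim_imp_Liminf trivial_limit_sequentially)
    qed
    also have "\<dots> \<le> liminf (\<lambda>i. \<integral>\<^sup>+x. ennreal ((norm (S n x - S (R i) x))\<^sup>2) \<partial>M)" by (rule nn_integral_liminf) measurable
    also have "\<dots> \<le> liminf (\<lambda>i. ennreal ((1/4) ^ k))"
    proof (rule Liminf_mono, rule eventually_sequentiallyI[of k])
      fix i assume "i \<ge> k"
      then have "R i \<ge> r k" using R_mono[of k i] R(1)[of k] by linarith
      then show "(\<integral>\<^sup>+x. ennreal ((norm (S n x - S (R i) x))\<^sup>2) \<partial>M) \<le> ennreal ((1/4) ^ k)"
        unfolding nn using r[OF n] by (intro ennreal_leI) (auto intro: less_imp_le)
    qed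
    also have "\<dots> = ennreal ((1/4) ^ k)" by (rule Liminf_const) simp
    finally show ?thesis .
  qed
  have diff: "square_integrable M (\<lambda>x. S n x - g x)" if n: "n \<ge> r 0" for n
  proof -
    have "(\<integral>\<^sup>+x. ennreal ((norm (S n x - g x))\<^sup>2) \<partial>M) < \<infinity>" using fatou[OF n] by (simp add: order_le_less_trans)
    then show ?thesis unfolding square_integrable_def by (auto intro!: integrableI_nonneg)
  qed
  have g: "square_integrable M g" using square_integrable_diff[OF S diff, of "r 0" "r 0"] by simp
  have "(\<lambda>n. LINT x|M. (norm (S n x - g x))\<^sup>2) \<longlonglongrightarrow> 0"
  proof (rule LIMSEQ_I)
    fix e :: real assume e: "e > 0"
    then obtain k :: nat where k: "(1/4) ^ k < e" using real_arch_pow_inv[of e "1/4"] by auto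
    have "norm ((LINT x|M. (norm (S n x - g x))\<^sup>2) - 0) < e" if "n \<ge> r k" for n
    proof -
      have "integrable M (\<lambda>x. (norm (S n x - g x))\<^sup>2)"
        using square_integrable_diff[OF S g] by (simp add: square_integrable_def)
      then have "ennreal (LINT x|M. (norm (S n x - g x))\<^sup>2) \<le> ennreal ((1/4) ^ k)"
        using fatou[OF that] by (subst (asm) nn_integral_eq_integral) auto
      then have "(LINT x|M. (norm (S n x - g x))\<^sup>2) \<le> (1/4) ^ k" by (subst (asm) ennreal_le_iff) auto
      moreover have "0 \<le> (LINT x|M. (norm (S n x - g x))\<^sup>2)" by simp
      ultimately show ?thesis using k by simp
    qed
    then show "\<exists>no. \<forall>n\<ge>no. norm ((LINT x|M. (norm (S n x - g x))\<^sup>2) - 0) < e" by blast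
  qed
  with g show ?thesis by (rule that)
qed

lemma integral_cauchy_schwarz:
  fixes f g :: "'x \<Rightarrow> complex"
  assumes f: "square_integrable M f" and g: "square_integrable M g"
  shows "(norm (LINT x|M. f x * cnj (g x)))\<^sup>2 \<le> (LINT x|M. (norm (f x))\<^sup>2) * (LINT x|M. (norm (g x))\<^sup>2)"
proof -
  define c where "c = (LINT x|M. f x * cnj (g x))"
  define A B where "A = (LINT x|M. (norm (f x))\<^sup>2)" and "B = (LINT x|M. (norm (g x))\<^sup>2)"
  have A: "A \<ge> 0" and B: "B \<ge> 0" by (auto simp: A_def B_def)
  have key: "0 \<le> A + s\<^sup>2 * (norm c)\<^sup>2 * B - 2 * s * (norm c)\<^sup>2" for s :: real
  proof -
    have "0 \<le> (LINT x|M. (norm (f x - (of_real s * c) * g x))\<^sup>2)" by simp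
    also have "\<dots> = A + (LINT x|M. (norm (of_real s * c * g x))\<^sup>2) - 2 * Re (LINT x|M. f x * cnj (of_real s * c * g x))"
      unfolding A_def by (rule integral_norm_diff_square[OF f square_integrable_cmult[OF g]])
    also have "(LINT x|M. (norm (of_real s * c * g x))\<^sup>2) = s\<^sup>2 * (norm c)\<^sup>2 * B"
      by (simp add: norm_mult power_mult_distrib B_def)
    also have "(LINT x|M. f x * cnj (of_real s * c * g x)) = (of_real s * cnj c) * c"
    proof -
      have "(LINT x|M. f x * cnj (of_real s * c * g x)) = (LINT x|M. (of_real s * cnj c) * (f x * cnj (g x)))"
        by (intro Bochner_Integration.integral_cong) (auto simp: mult_ac)
      then show ?thesis by (simp add: c_def)
    qed
    also have "Re ((of_real s * cnj c) * c) = s * (norm c)\<^sup>2"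
      unfolding cmod_power2 by (simp add: power2_eq_square algebra_simps)
    finally show ?thesis by simp
  qed
  show ?thesis
  proof (cases "norm c = 0")
    case True
    then show ?thesis using A B by (simp add: A_def[symmetric] B_def[symmetric] c_def[symmetric])
  next
    case False
    then have cp: "(norm c)\<^sup>2 > 0" by simp
    show ?thesis
    proof (cases "B = 0")
      case True
      have "0 \<le> A - 2 * ((A + 1) / (2 * (norm c)\<^sup>2)) * (norm c)\<^sup>2"
        using key[of "(A + 1) / (2 * (norm c)\<^sup>2)"] True by simp
      then show ?thesis using cp by simp
    next
      case False
      then have "B > 0" using B by simp
      have "0 \<le> A + (1/B)\<^sup>2 * (norm c)\<^sup>2 * B - 2 * (1/B) * (norm c)\<^sup>2" by (rule key)
      then have "(norm c)\<^sup>2 / B \<le> A" using \<open>B > 0\<close> by (simp add: power2_eq_square)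
      then show ?thesis using \<open>B > 0\<close> by (simp add: divide_le_eq A_def B_def c_def)
    qed
  qed
qed

section \<open>Spherical harmonics are a complete orthonormal system\<close>

text \<open>Lagrange's identity: the Wronskian, weighted by a power of the sine, vanishes at both ends.\<close>

lemma geg_orthogonal:
  assumes d: "d \<ge> 2" and lm: "l \<noteq> m"
  shows "(LINT \<theta>|angle_measure d. poly (geg d l) (cos \<theta>) * poly (geg d m) (cos \<theta>)) = 0"
proof -
  obtain k where k: "d = k + 2" using d by (metis add.commute le_Suc_ex)
  define p q where "p = geg d l" and "q = geg d m"
  define w where "w \<theta> = sin \<theta> ^ Suc k * poly (pderiv p * q - p * pderiv q) (cos \<theta>)" for \<theta>
  define D where "D = geg_eigen d l - geg_eigen d m"
  have "geg_eigen d a < geg_eigen d b" if "a < b" for a b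
    unfolding geg_eigen_def using that d by (intro mult_strict_mono') auto
  then have D: "D \<noteq> 0" using lm by (metis D_def eq_iff_diff_eq_0 less_irrefl linorder_neqE_nat)
  have deriv: "(w has_real_derivative D * (poly p (cos \<theta>) * poly q (cos \<theta>) * sin \<theta> ^ k)) (at \<theta>)" for \<theta>
  proof -
    define Q where "Q = pderiv p * q - p * pderiv q"
    have s: "((\<lambda>\<theta>. sin \<theta> ^ Suc k) has_real_derivative (1 + real k) * (cos \<theta> * sin \<theta> ^ k)) (at \<theta>)"
      by (rule DERIV_power_Suc[OF DERIV_sin])
    have c: "((\<lambda>\<theta>. poly Q (cos \<theta>)) has_real_derivative poly (pderiv Q) (cos \<theta>) * (- sin \<theta>)) (at \<theta>)"
      by (rule DERIV_chain2[OF poly_DERIV DERIV_cos])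
    have op: "(1 - (cos \<theta>)\<^sup>2) * poly (pderiv (pderiv p)) (cos \<theta>)
        = (real k + 1) * cos \<theta> * poly (pderiv p) (cos \<theta>) - geg_eigen d l * poly p (cos \<theta>)"
      using geg_ode_geg[OF d, of l] unfolding geg_ode_poly p_def k by (simp add: algebra_simps)
    have oq: "(1 - (cos \<theta>)\<^sup>2) * poly (pderiv (pderiv q)) (cos \<theta>)
        = (real k + 1) * cos \<theta> * poly (pderiv q) (cos \<theta>) - geg_eigen d m * poly q (cos \<theta>)"
      using geg_ode_geg[OF d, of m] unfolding geg_ode_poly q_def k by (simp add: algebra_simps)
    have "(sin \<theta>)\<^sup>2 * poly (pderiv Q) (cos \<theta>)
        = (1 - (cos \<theta>)\<^sup>2) * poly (pderiv (pderiv p)) (cos \<theta>) * poly q (cos \<theta>)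
          - poly p (cos \<theta>) * ((1 - (cos \<theta>)\<^sup>2) * poly (pderiv (pderiv q)) (cos \<theta>))"
      unfolding sin_squared_eq Q_def by (simp add: pderiv_diff pderiv_mult algebra_simps)
    also have "\<dots> = (real k + 1) * cos \<theta> * poly Q (cos \<theta>) - D * (poly p (cos \<theta>) * poly q (cos \<theta>))"
      unfolding op oq Q_def D_def by (simp add: algebra_simps)
    finally have sq: "(sin \<theta>)\<^sup>2 * poly (pderiv Q) (cos \<theta>)
        = (real k + 1) * cos \<theta> * poly Q (cos \<theta>) - D * (poly p (cos \<theta>) * poly q (cos \<theta>))" .
    have "(w has_real_derivative ((1 + real k) * (cos \<theta> * sin \<theta> ^ k)) * poly Q (cos \<theta>)
        + (poly (pderiv Q) (cos \<theta>) * (- sin \<theta>)) * sin \<theta> ^ Suc k) (at \<theta>)"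
      unfolding w_def Q_def[symmetric] by (rule DERIV_mult[OF s c])
    also have "((1 + real k) * (cos \<theta> * sin \<theta> ^ k)) * poly Q (cos \<theta>)
        + (poly (pderiv Q) (cos \<theta>) * (- sin \<theta>)) * sin \<theta> ^ Suc k
       = sin \<theta> ^ k * ((real k + 1) * cos \<theta> * poly Q (cos \<theta>) - (sin \<theta>)\<^sup>2 * poly (pderiv Q) (cos \<theta>))"
      by (simp add: power2_eq_square algebra_simps)
    also have "\<dots> = D * (poly p (cos \<theta>) * poly q (cos \<theta>) * sin \<theta> ^ k)" unfolding sq by (simp add: algebra_simps)
    finally show ?thesis .
  qed
  have "(LINT \<theta>|lborel. D * (poly p (cos \<theta>) * poly q (cos \<theta>) * sin \<theta> ^ k) * indicator {0..pi} \<theta>) = w pi - w 0"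
    using deriv by (intro integral_FTC_Icc_real) (auto intro!: continuous_intros)
  also have "\<dots> = 0" by (simp add: w_def)
  also have "(LINT \<theta>|lborel. D * (poly p (cos \<theta>) * poly q (cos \<theta>) * sin \<theta> ^ k) * indicator {0..pi} \<theta>)
     = D * (LINT \<theta>|lborel. poly p (cos \<theta>) * poly q (cos \<theta>) * sin \<theta> ^ k * indicator {0..pi} \<theta>)" by (simp add: mult.assoc)
  finally have z: "(LINT \<theta>|lborel. poly p (cos \<theta>) * poly q (cos \<theta>) * sin \<theta> ^ k * indicator {0..pi} \<theta>) = 0"
    using D by simp
  have "(LINT \<theta>|angle_measure d. poly p (cos \<theta>) * poly q (cos \<theta>))
     = (LINT \<theta>|lborel. sphere_area (d - 1) * (poly p (cos \<theta>) * poly q (cos \<theta>) * sin \<theta> ^ k * indicator {0..pi} \<theta>))"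
    by (subst integral_angle_measure) (auto simp: k mult_ac)
  then show ?thesis using z by (simp add: p_def q_def)
qed

lemma sphere_area_pos: "m \<ge> 1 \<Longrightarrow> sphere_area m > 0" by (simp add: sphere_area_def)

lemma geg_norm_pos:
  assumes d: "d \<ge> 2"
  shows "(LINT \<theta>|angle_measure d. (poly (geg d l) (cos \<theta>))\<^sup>2) > 0"
proof -
  define f where "f \<theta> = (poly (geg d l) (cos \<theta>))\<^sup>2 * (sphere_area (d - 1) * sin \<theta> ^ (d - 2))" for \<theta>
  have f0: "0 \<le> f \<theta> * indicator {0..pi} \<theta>" for \<theta> unfolding f_def by (simp add: sin_ge_zero split: split_indicator)
  have int: "integrable lborel (\<lambda>\<theta>. f \<theta> * indicator {0..pi} \<theta>)"
    unfolding f_def by (intro integrable_continuous_Icc continuous_intros)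
  have eq: "(LINT \<theta>|angle_measure d. (poly (geg d l) (cos \<theta>))\<^sup>2) = (LINT \<theta>|lborel. f \<theta> * indicator {0..pi} \<theta>)"
    by (subst integral_angle_measure) (auto simp: f_def mult_ac)
  have "(LINT \<theta>|lborel. f \<theta> * indicator {0..pi} \<theta>) \<noteq> 0"
  proof
    assume "(LINT \<theta>|lborel. f \<theta> * indicator {0..pi} \<theta>) = 0"
    then have ae: "AE \<theta> in lborel. f \<theta> * indicator {0..pi} \<theta> = 0" using integral_nonneg_eq_0_iff_AE[OF int] f0 by simp
    have apos: "sphere_area (d - 1) > 0" using d by (intro sphere_area_pos) simp
    define Z where "Z = {\<theta> \<in> {0..pi}. poly (geg d l) (cos \<theta>) = 0}"
    have "finite {x. poly (geg d l) x = 0}" using geg_1[OF d, of l] by (intro poly_roots_finite) auto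
    moreover have "cos ` Z \<subseteq> {x. poly (geg d l) x = 0}" by (auto simp: Z_def)
    ultimately have "finite (cos ` Z)" by (rule finite_subset[rotated])
    moreover have "inj_on cos Z" by (rule inj_onI) (auto simp: Z_def intro: cos_inj_pi)
    ultimately have "finite Z" by (rule finite_imageD)
    then have nZ: "Z \<in> null_sets lborel" by (rule finite_imp_null_set_lborel)
    have "AE \<theta> in lborel. \<theta> \<notin> {0<..<pi}" using ae AE_not_in[OF nZ]
    proof eventually_elim
      case (elim \<theta>)
      show ?case
      proof
        assume t: "\<theta> \<in> {0<..<pi}"
        then have "sin \<theta> > 0" by (auto intro: sin_gt_zero)
        then show False using elim t apos by (auto simp: f_def Z_def)
      qed
    qed
    then have "{0<..<pi} \<in> null_sets lborel" by (subst (asm) AE_iff_null_sets[symmetric]) auto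
    then show False by (auto simp: null_sets_def)
  qed
  moreover have "(LINT \<theta>|lborel. f \<theta> * indicator {0..pi} \<theta>) \<ge> 0" using f0 by (intro integral_nonneg_AE) auto
  ultimately show ?thesis unfolding eq by linarith
qed

lemma integrable_angle_poly:
  "integrable (angle_measure d) (\<lambda>\<theta>. poly p (cos \<theta>) :: real)"
proof -
  have "integrable lborel (\<lambda>\<theta>. (sphere_area (d - 1) * sin \<theta> ^ (d - 2) * poly p (cos \<theta>)) * indicator {0..pi} \<theta>)"
    by (intro integrable_continuous_Icc continuous_intros)
  then show ?thesis by (subst integral_angle_measure) (auto simp: mult_ac)
qed

text \<open>
  Zonal convolution with the Gegenbauer polynomial of degree \<open>l\<close> is symmetric; it multiplies
  harmonics of degree \<open>l\<close> by a positive number and kills all others.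
\<close>

lemma spherical_harmonics_orthogonal:
  fixes Y Z :: "'a::euclidean_space \<Rightarrow> complex"
  assumes d: "DIM('a) \<ge> 2" and Y: "spherical_harmonic l Y" and Z: "spherical_harmonic m Z" and lm: "l \<noteq> m"
  shows "(LINT x|surface. Y x * cnj (Z x)) = 0"
proof -
  interpret finite_measure "surface :: 'a measure" by simp
  interpret P: pair_sigma_finite "surface :: 'a measure" "surface :: 'a measure" by standard
  define K where "K = poly (geg DIM('a) l)"
  have Kb [measurable]: "K \<in> borel_measurable borel" unfolding K_def by measurable
  have [measurable]: "Y \<in> borel_measurable surface" "Z \<in> borel_measurable surface"
    by (intro measurable_surface_continuous spherical_harmonic_continuous[OF Y] spherical_harmonic_continuous[OF Z])+
  obtain B where B: "B \<ge> 0" "\<And>x. norm x = 1 \<Longrightarrow> norm (Y x) \<le> B"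
    using continuous_sphere_bounded[OF spherical_harmonic_continuous[OF Y]] by blast
  obtain C where C: "C \<ge> 0" "\<And>x. norm x = 1 \<Longrightarrow> norm (Z x) \<le> C"
    using continuous_sphere_bounded[OF spherical_harmonic_continuous[OF Z]] by blast
  have K1: "\<bar>K (x \<bullet> y)\<bar> \<le> 1" if "norm x = 1" "norm y = 1" for x y :: 'a
    unfolding K_def using Cauchy_Schwarz_ineq2[of x y] that by (intro geg_bound d) auto
  have mi [measurable]: "(\<lambda>(x::'a, y). x \<bullet> y) \<in> borel_measurable (surface \<Otimes>\<^sub>M surface)"
  proof -
    have "(\<lambda>x. x) \<in> borel_measurable (surface :: 'a measure)" by (intro measurable_surface_continuous continuous_intros)
    note [measurable] = this
    show ?thesis by measurable
  qed
  have fubini: "(LINT y|surface. LINT x|surface. Y x * (of_real (K (x \<bullet> y)) * cnj (Z y)))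
     = (LINT x|surface. LINT y|surface. Y x * (of_real (K (x \<bullet> y)) * cnj (Z y)))"
  proof (rule P.Fubini_integral)
    show "integrable (surface \<Otimes>\<^sub>M surface) (\<lambda>(x, y). Y x * (of_real (K (x \<bullet> y)) * cnj (Z y)))"
    proof (rule finite_measure.integrable_const_bound[where B="B * (1 * C)"])
      show "finite_measure (surface \<Otimes>\<^sub>M (surface :: 'a measure))"
        by (intro finite_measure_pair_measure finite_measure_surface)
      show "AE x in surface \<Otimes>\<^sub>M surface. norm (case x of (x, y) \<Rightarrow> Y x * (of_real (K (x \<bullet> y)) * cnj (Z y))) \<le> B * (1 * C)"
      proof (rule AE_I2)
        fix p :: "'a \<times> 'a" assume "p \<in> space (surface \<Otimes>\<^sub>M surface)"
        then obtain x y where p: "p = (x, y)" "norm x = 1" "norm y = 1" by (auto simp: space_pair_measure)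
        have "norm (Y x) * (\<bar>K (x \<bullet> y)\<bar> * norm (Z y)) \<le> B * (1 * C)" using B C K1 p by (intro mult_mono) auto
        then show "norm (case p of (x, y) \<Rightarrow> Y x * (of_real (K (x \<bullet> y)) * cnj (Z y))) \<le> B * (1 * C)"
          using p by (simp add: norm_mult)
      qed
      have "(\<lambda>(x::'a, y). K (x \<bullet> y)) = (\<lambda>p. K (case p of (x, y) \<Rightarrow> x \<bullet> y))" by auto
      then have "(\<lambda>(x::'a, y). K (x \<bullet> y)) \<in> borel_measurable (surface \<Otimes>\<^sub>M surface)"
        by (simp only:) (rule measurable_compose[OF mi Kb])
      then show "(\<lambda>(x, y). Y x * (of_real (K (x \<bullet> y)) * cnj (Z y))) \<in> borel_measurable (surface \<Otimes>\<^sub>M surface)"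
        by measurable
    qed
  qed
  define a b where "a = (LINT \<theta>|angle_measure DIM('a). K (cos \<theta>) * K (cos \<theta>))"
    and "b = (LINT \<theta>|angle_measure DIM('a). poly (geg DIM('a) m) (cos \<theta>) * K (cos \<theta>))"
  have "(LINT x|surface. Y x * of_real (K (x \<bullet> y))) = of_real a * Y y" if "norm y = 1" for y
    using funk_hecke[OF d Y that, of K] integrable_angle_poly[of "DIM('a)" "geg DIM('a) l"]
    by (simp add: a_def K_def inner_commute)
  then have "(LINT y|surface. LINT x|surface. Y x * (of_real (K (x \<bullet> y)) * cnj (Z y))) = (LINT y|surface. of_real a * (Y y * cnj (Z y)))"
    by (intro Bochner_Integration.integral_cong) (auto simp flip: mult.assoc)
  moreover have "(LINT y|surface. of_real (K (x \<bullet> y)) * cnj (Z y)) = cnj (of_real b * Z x)" if "norm x = 1" for x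
  proof -
    have "(LINT y|surface. of_real (K (x \<bullet> y)) * cnj (Z y)) = cnj (LINT y|surface. Z y * of_real (K (x \<bullet> y)))"
      unfolding Bochner_Integration.integral_cnj[symmetric] by (simp add: mult.commute)
    also have "\<dots> = cnj (of_real b * Z x)"
      using funk_hecke[OF d Z that, of K] integrable_angle_poly[of "DIM('a)" "geg DIM('a) l"] by (simp add: b_def K_def)
    finally show ?thesis .
  qed
  then have "(LINT x|surface. LINT y|surface. Y x * (of_real (K (x \<bullet> y)) * cnj (Z y))) = (LINT x|surface. of_real b * (Y x * cnj (Z x)))"
    by (intro Bochner_Integration.integral_cong) (auto simp: mult_ac)
  ultimately have "of_real a * (LINT x|surface. Y x * cnj (Z x)) = of_real b * (LINT x|surface. Y x * cnj (Z x))"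
    using fubini by simp
  moreover have "b = 0" using geg_orthogonal[OF d, of m l] lm by (simp add: b_def K_def)
  moreover have "a \<noteq> 0" using geg_norm_pos[OF d, of l] by (simp add: a_def K_def power2_eq_square)
  ultimately show ?thesis by simp
qed

lemma poly_geg_span:
  assumes d: "d \<ge> 2" and p: "degree p \<le> m"
  shows "\<exists>b. p = (\<Sum>l\<le>m. smult (b l) (geg d l))" using p
proof (induction m arbitrary: p)
  case 0
  then obtain c where "p = [:c:]" by (auto elim: degree_eq_zeroE)
  then show ?case by (intro exI[of _ "\<lambda>_. c"]) (simp add: one_pCons)
next
  case (Suc m)
  define c where "c = coeff p (Suc m) / coeff (geg d (Suc m)) (Suc m)"
  have nz: "coeff (geg d (Suc m)) (Suc m) \<noteq> 0" by (simp add: geg_def coeff_geg_raw geg_raw_1[OF d])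
  have "degree (p - smult c (geg d (Suc m))) \<le> m"
  proof (rule degree_le, intro allI impI)
    fix i assume "m < i"
    then consider "i = Suc m" | "i > Suc m" by linarith
    then show "coeff (p - smult c (geg d (Suc m))) i = 0"
    proof cases
      case 1
      then show ?thesis using nz by (simp add: c_def)
    next
      case 2
      then show ?thesis using Suc.prems degree_geg[OF d, of "Suc m"] by (simp add: coeff_eq_0)
    qed
  qed
  then obtain b where b: "p - smult c (geg d (Suc m)) = (\<Sum>l\<le>m. smult (b l) (geg d l))" using Suc.IH by blast
  have "p = (\<Sum>l\<le>Suc m. smult ((b(Suc m := c)) l) (geg d l))"
  proof -
    have "(\<Sum>l\<le>m. smult ((b(Suc m := c)) l) (geg d l)) = (\<Sum>l\<le>m. smult (b l) (geg d l))" by (intro sum.cong) auto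
    then show ?thesis using b by (simp add: algebra_simps)
  qed
  then show ?case by blast
qed

lemma integral_eq_zero_all_borel:
  fixes h :: "'a::euclidean_space \<Rightarrow> real"
  assumes h: "integrable surface h"
    and z: "\<And>S. S \<in> sets borel \<Longrightarrow> (LINT x|surface. h x * indicator S x) = 0"
  shows "AE x in surface. h x = 0"
proof -
  note [measurable] = borel_measurable_integrable[OF h]
  have *: "AE x in surface. g x \<le> 0" if g: "integrable surface g" and gz: "\<And>S. S \<in> sets borel \<Longrightarrow> (LINT x|surface. g x * indicator S x) = 0"
    for g :: "'a \<Rightarrow> real"
  proof -
    note [measurable] = borel_measurable_integrable[OF g]
    define S where "S = {x \<in> space surface. g x > 0}"
    have S': "S \<in> sets surface" unfolding S_def by measurable
    then have S: "S \<in> sets borel" by (auto simp: sets_surface sets_restrict_space_iff)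
    have "integrable surface (\<lambda>x. g x * indicator S x)" using S' g by (rule integrable_real_mult_indicator)
    moreover have "AE x in surface. 0 \<le> g x * indicator S x" by (intro AE_I2) (auto simp: S_def split: split_indicator)
    ultimately have "AE x in surface. g x * indicator S x = 0" using integral_nonneg_eq_0_iff_AE gz[OF S] by blast
    then show ?thesis by (rule AE_mp) (auto simp: S_def not_less split: split_indicator)
  qed
  have "AE x in surface. h x \<le> 0" using h z by (rule *)
  moreover have "AE x in surface. - h x \<le> 0" by (rule *) (use h z in auto)
  ultimately show ?thesis by eventually_elim auto
qed

text \<open>
  Gegenbauer polynomials span all polynomials, so all moments of \<open>h\<close> along all directions vanish,
  and moments determine an integrable density.
\<close>

lemma zonal_orthogonal_imp_zero:
  fixes h :: "'a::euclidean_space \<Rightarrow> complex"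
  assumes d: "DIM('a) \<ge> 2" and h: "integrable surface h"
    and z: "\<And>\<xi> l. norm \<xi> = 1 \<Longrightarrow> (LINT \<eta>|surface. h \<eta> * of_real (poly (geg DIM('a) l) (\<xi> \<bullet> \<eta>))) = 0"
  shows "AE x in surface. h x = 0"
proof -
  have int: "integrable surface (\<lambda>\<eta>. h \<eta> * of_real (poly p (\<xi> \<bullet> \<eta>)))" for p and \<xi> :: 'a
  proof -
    have cont: "continuous_on (sphere 0 1) (\<lambda>\<eta>. poly p (\<xi> \<bullet> \<eta>))" by (intro continuous_intros)
    then obtain B where B: "\<And>x. norm x = 1 \<Longrightarrow> norm (poly p (\<xi> \<bullet> x)) \<le> B" using continuous_sphere_bounded by blast
    note [measurable] = borel_measurable_integrable[OF h] measurable_surface_continuous[OF cont]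
    have "integrable surface (\<lambda>\<eta>. norm (h \<eta>) * B)" using h by auto
    then show ?thesis by (rule Bochner_Integration.integrable_bound)
        (use B in \<open>auto intro!: AE_I2 mult_left_mono simp: norm_mult abs_mult intro: order.trans[OF _ abs_ge_self]\<close>)
  qed
  have pw: "(LINT \<eta>|surface. h \<eta> * of_real ((\<xi> \<bullet> \<eta>) ^ m)) = 0" if xi: "norm \<xi> = 1" for \<xi> m
  proof -
    obtain b where b: "monom 1 m = (\<Sum>l\<le>m. smult (b l) (geg DIM('a) l))"
      using poly_geg_span[OF d, of "monom 1 m" m] by (auto simp: degree_monom_eq)
    have "x ^ m = (\<Sum>l\<le>m. b l * poly (geg DIM('a) l) x)" for x :: real
      using arg_cong[OF b, of "\<lambda>p. poly p x"] by (simp add: poly_monom poly_sum)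
    then have "(LINT \<eta>|surface. h \<eta> * of_real ((\<xi> \<bullet> \<eta>) ^ m))
       = (LINT \<eta>|surface. (\<Sum>l\<le>m. of_real (b l) * (h \<eta> * of_real (poly (geg DIM('a) l) (\<xi> \<bullet> \<eta>)))))"
      by (simp add: sum_distrib_left mult_ac)
    also have "\<dots> = (\<Sum>l\<le>m. of_real (b l) * (LINT \<eta>|surface. h \<eta> * of_real (poly (geg DIM('a) l) (\<xi> \<bullet> \<eta>))))"
      by (subst Bochner_Integration.integral_sum) (auto intro: int)
    also have "\<dots> = 0" by (simp add: z[OF xi])
    finally show ?thesis .
  qed
  have id_meas: "(\<lambda>x. x) \<in> borel_measurable (surface :: 'a measure)"
    by (intro measurable_surface_continuous continuous_intros)
  interpret moment_match "surface :: 'a measure" "surface :: 'a measure" h "\<lambda>_. 0" "\<lambda>x. x" "\<lambda>x. x" 1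
  proof
    show "(LINT x|surface. h x * complex_of_real ((a \<bullet> x) ^ m)) = (LINT x|surface. 0 * complex_of_real ((a \<bullet> x) ^ m))" for a :: 'a and m
    proof (cases "a = 0")
      case False
      define \<xi> where "\<xi> = a /\<^sub>R norm a"
      have xi: "norm \<xi> = 1" and a: "a = norm a *\<^sub>R \<xi>" using False by (auto simp: \<xi>_def)
      have "(LINT x|surface. h x * complex_of_real ((a \<bullet> x) ^ m)) = (LINT x|surface. of_real (norm a ^ m) * (h x * of_real ((\<xi> \<bullet> x) ^ m)))"
        by (intro Bochner_Integration.integral_cong[OF refl], subst a) (simp add: power_mult_distrib)
      then show ?thesis by (simp only: integral_mult_right_zero pw[OF xi]) simp
    next
      case True
      obtain b :: 'a where "b \<in> Basis" using nonempty_Basis by blast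
      then have "(LINT x|surface. h x * complex_of_real ((b \<bullet> x) ^ 0)) = 0" by (intro pw) simp
      then show ?thesis using True by (cases m) auto
    qed
  qed (use h id_meas in auto)
  have ind: "(LINT x|surface. h x * of_real (indicator S x)) = 0" if "S \<in> sets borel" for S
    using agree_borel[OF that] by (simp add: agree_def)
  have i: "integrable surface (\<lambda>x. h x * of_real (indicator S x))" if "S \<in> sets borel" for S
    by (rule integrable_test(1)[where C=1]) (use that in \<open>auto split: split_indicator\<close>)
  have re: "AE x in surface. Re (h x) = 0"
  proof (rule integral_eq_zero_all_borel)
    show "(LINT x|surface. Re (h x) * indicator S x) = 0" if S: "S \<in> sets borel" for S
    proof -
      have "(LINT x|surface. Re (h x * of_real (indicator S x))) = Re (LINT x|surface. h x * of_real (indicator S x))"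
        by (rule integral_Re[OF i[OF S]])
      then show ?thesis using ind[OF S] by simp
    qed
  qed (use h in auto)
  have im: "AE x in surface. Im (h x) = 0"
  proof (rule integral_eq_zero_all_borel)
    show "(LINT x|surface. Im (h x) * indicator S x) = 0" if S: "S \<in> sets borel" for S
    proof -
      have "(LINT x|surface. Im (h x * of_real (indicator S x))) = Im (LINT x|surface. h x * of_real (indicator S x))"
        by (rule integral_Im[OF i[OF S]])
      then show ?thesis using ind[OF S] by simp
    qed
  qed (use h in auto)
  from re im show ?thesis by eventually_elim (simp add: complex_eq_iff)
qed

lemma square_integrable_surface_integrable:
  fixes f :: "'a::euclidean_space \<Rightarrow> complex"
  assumes f: "square_integrable surface f"
  shows "integrable surface f"
proof -
  interpret finite_measure "surface :: 'a measure" by simp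
  have "square_integrable surface (\<lambda>_::'a. 1 :: complex)" by (simp add: square_integrable_def)
  from square_integrable_mult(1)[OF f this] show ?thesis by simp
qed

lemma square_integrable_surface_continuous:
  fixes f :: "'a::euclidean_space \<Rightarrow> complex"
  assumes "continuous_on (sphere 0 1) f"
  shows "square_integrable surface f" unfolding square_integrable_def using assms
  by (intro conjI measurable_surface_continuous integrable_surface_continuous continuous_intros)

locale harmonic_basis =
  fixes \<nu> :: "nat \<Rightarrow> nat" and Y :: "nat \<Rightarrow> nat \<Rightarrow> 'a::euclidean_space \<Rightarrow> complex"
  assumes d: "DIM('a) \<ge> 2" and onb: "\<And>l. harmonic_onb l (\<nu> l) (Y l)"
begin

lemma Y_harmonic: "j \<in> {1..\<nu> l} \<Longrightarrow> spherical_harmonic l (Y l j)" using onb[of l] by (simp add: harmonic_onb_def)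

lemma Y_continuous: "j \<in> {1..\<nu> l} \<Longrightarrow> continuous_on (sphere 0 1) (Y l j)"
  using Y_harmonic by (rule spherical_harmonic_continuous)

lemma Y_square_integrable: "j \<in> {1..\<nu> l} \<Longrightarrow> square_integrable surface (Y l j)"
  by (intro square_integrable_surface_continuous Y_continuous)

definition coef :: "('a \<Rightarrow> complex) \<Rightarrow> nat \<Rightarrow> nat \<Rightarrow> complex" where
  "coef f l j = (LINT x|surface. f x * cnj (Y l j x))"

lemma Y_orthonormal:
  assumes "j \<in> {1..\<nu> l}" "i \<in> {1..\<nu> m}"
  shows "coef (Y l j) m i = (if l = m \<and> i = j then 1 else 0)"
proof (cases "l = m")
  case True
  have "continuous_on (sphere 0 1) (\<lambda>x. Y l j x * cnj (Y m i x))" by (intro continuous_intros Y_continuous assms)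
  then have "(LINT x|sphere_measure. Y l j x * cnj (Y m i x)) = coef (Y l j) m i"
    unfolding sphere_measure_eq_completion coef_def by (intro integral_completion measurable_surface_continuous)
  then show ?thesis using onb[of l] assms True by (auto simp: harmonic_onb_def)
next
  case False
  then show ?thesis using spherical_harmonics_orthogonal[OF d Y_harmonic[OF assms(1)] Y_harmonic[OF assms(2)]]
    by (simp add: coef_def)
qed

definition partial :: "(nat \<Rightarrow> nat \<Rightarrow> complex) \<Rightarrow> nat \<Rightarrow> nat \<Rightarrow> 'a \<Rightarrow> complex" where
  "partial c m n x = (\<Sum>l\<in>{m..<n}. \<Sum>j=1..\<nu> l. c l j * Y l j x)"

lemma partial_square_integrable: "square_integrable surface (partial c m n)" unfolding partial_def[abs_def]
  by (intro square_integrable_sum square_integrable_cmult Y_square_integrable) auto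

lemma integral_partial:
  assumes f: "square_integrable surface f"
  shows "(LINT x|surface. f x * cnj (partial c m n x)) = (\<Sum>l\<in>{m..<n}. \<Sum>j=1..\<nu> l. coef f l j * cnj (c l j))"
proof -
  have "(LINT x|surface. f x * cnj (partial c m n x))
     = (LINT x|surface. (\<Sum>l\<in>{m..<n}. (\<Sum>j=1..\<nu> l. cnj (c l j) * (f x * cnj (Y l j x)))))"
    by (intro Bochner_Integration.integral_cong) (auto simp: partial_def sum_distrib_left mult_ac)
  also have "\<dots> = (\<Sum>l\<in>{m..<n}. \<Sum>j=1..\<nu> l. cnj (c l j) * coef f l j)" unfolding coef_def
    by (subst Bochner_Integration.integral_sum,
        use f in \<open>auto intro!: Bochner_Integration.integrable_sum integrable_mult_right square_integrable_mult Y_square_integrable\<close>,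
        intro sum.cong refl, subst Bochner_Integration.integral_sum,
        use f in \<open>auto intro!: integrable_mult_right square_integrable_mult Y_square_integrable\<close>)
  finally show ?thesis by (simp add: mult.commute)
qed

lemma coef_partial:
  assumes "j \<in> {1..\<nu> l}"
  shows "coef (partial c m n) l j = (if m \<le> l \<and> l < n then c l j else 0)"
proof -
  have "cnj (coef (partial c m n) l j) = (LINT x|surface. Y l j x * cnj (partial c m n x))"
  proof -
    have "(LINT x|surface. Y l j x * cnj (partial c m n x)) = (LINT x|surface. cnj (partial c m n x * cnj (Y l j x)))"
      by (intro Bochner_Integration.integral_cong) (auto simp: mult.commute)
    then show ?thesis by (simp add: coef_def del: complex_cnj_mult)
  qed
  also have "\<dots> = (\<Sum>l'\<in>{m..<n}. \<Sum>i=1..\<nu> l'. coef (Y l j) l' i * cnj (c l' i))"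
    by (rule integral_partial[OF Y_square_integrable[OF assms]])
  also have "\<dots> = (\<Sum>l'\<in>{m..<n}. \<Sum>i=1..\<nu> l'. if l' = l \<and> i = j then cnj (c l j) else 0)"
    using assms by (intro sum.cong refl) (auto simp: Y_orthonormal)
  also have "\<dots> = (\<Sum>l'\<in>{m..<n}. if l' = l then cnj (c l j) else 0)"
    using assms by (intro sum.cong refl) (auto simp: sum.delta')
  also have "\<dots> = cnj (if m \<le> l \<and> l < n then c l j else 0)" by (simp add: sum.delta')
  finally show ?thesis by simp
qed

lemma norm_partial:
  "(LINT x|surface. (norm (partial c m n x))\<^sup>2) = (\<Sum>l\<in>{m..<n}. \<Sum>j=1..\<nu> l. (norm (c l j))\<^sup>2)"
proof -
  have "complex_of_real (LINT x|surface. (norm (partial c m n x))\<^sup>2) = (LINT x|surface. partial c m n x * cnj (partial c m n x))"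
    unfolding integral_complex_of_real[symmetric] by (simp only: complex_norm_square)
  also have "\<dots> = (\<Sum>l\<in>{m..<n}. \<Sum>j=1..\<nu> l. coef (partial c m n) l j * cnj (c l j))"
    by (rule integral_partial[OF partial_square_integrable])
  also have "\<dots> = (\<Sum>l\<in>{m..<n}. \<Sum>j=1..\<nu> l. of_real ((norm (c l j))\<^sup>2))"
    by (intro sum.cong refl) (simp only: coef_partial complex_norm_square, simp)
  also have "\<dots> = of_real (\<Sum>l\<in>{m..<n}. \<Sum>j=1..\<nu> l. (norm (c l j))\<^sup>2)" by simp
  finally show ?thesis by (simp only: of_real_eq_iff)
qed

lemma bessel:
  assumes f: "square_integrable surface f"
  shows "(\<Sum>l<n. \<Sum>j=1..\<nu> l. (norm (coef f l j))\<^sup>2) \<le> (LINT x|surface. (norm (f x))\<^sup>2)"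
proof -
  have "0 \<le> (LINT x|surface. (norm (f x - partial (coef f) 0 n x))\<^sup>2)" by simp
  also have "\<dots> = (LINT x|surface. (norm (f x))\<^sup>2) + (LINT x|surface. (norm (partial (coef f) 0 n x))\<^sup>2)
      - 2 * Re (LINT x|surface. f x * cnj (partial (coef f) 0 n x))"
    by (rule integral_norm_diff_square[OF f partial_square_integrable])
  also have "Re (LINT x|surface. f x * cnj (partial (coef f) 0 n x)) = (\<Sum>l<n. \<Sum>j=1..\<nu> l. (norm (coef f l j))\<^sup>2)"
    unfolding integral_partial[OF f] complex_norm_square[symmetric] by (simp add: atLeast0LessThan)
  also have "(LINT x|surface. (norm (partial (coef f) 0 n x))\<^sup>2) = (\<Sum>l<n. \<Sum>j=1..\<nu> l. (norm (coef f l j))\<^sup>2)"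
    unfolding norm_partial by (simp add: atLeast0LessThan)
  finally show ?thesis by simp
qed

text \<open>Zonal harmonics lie in the span of the basis.\<close>

lemma complete:
  assumes f: "square_integrable surface f" and z: "\<And>l j. j \<in> {1..\<nu> l} \<Longrightarrow> coef f l j = 0"
  shows "AE x in surface. f x = 0"
proof (rule zonal_orthogonal_imp_zero[OF d square_integrable_surface_integrable[OF f]])
  fix \<xi> :: 'a and l assume xi: "norm \<xi> = 1"
  obtain c where c: "\<And>x. norm x = 1 \<Longrightarrow> of_real (poly (geg DIM('a) l) (\<xi> \<bullet> x)) = (\<Sum>j=1..\<nu> l. c j * Y l j x)"
    using onb[of l] spherical_harmonic_zonal[OF d xi, of l] unfolding harmonic_onb_def by auto
  have "(LINT \<eta>|surface. f \<eta> * of_real (poly (geg DIM('a) l) (\<xi> \<bullet> \<eta>)))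
     = (LINT \<eta>|surface. f \<eta> * cnj (of_real (poly (geg DIM('a) l) (\<xi> \<bullet> \<eta>))))" by simp
  also have "\<dots> = (LINT \<eta>|surface. f \<eta> * cnj (partial (\<lambda>l. c) l (Suc l) \<eta>))"
    by (intro Bochner_Integration.integral_cong[OF refl]) (simp only: c space_surface mem_sphere_0, simp add: partial_def)
  also have "\<dots> = 0" unfolding integral_partial[OF f] using z by simp
  finally show "(LINT \<eta>|surface. f \<eta> * of_real (poly (geg DIM('a) l) (\<xi> \<bullet> \<eta>))) = 0" .
qed

lemma coef_tendsto:
  assumes S: "\<And>n. square_integrable surface (S n)" and g: "square_integrable surface g"
    and lim: "(\<lambda>n. LINT x|surface. (norm (S n x - g x))\<^sup>2) \<longlonglongrightarrow> 0" and j: "j \<in> {1..\<nu> l}"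
  shows "(\<lambda>n. coef (S n) l j) \<longlonglongrightarrow> coef g l j"
proof (rule LIM_zero_cancel, rule tendsto_norm_zero_cancel, rule power_tendsto_0_iff[THEN iffD1, of 2])
  have "coef (S n) l j - coef g l j = (LINT x|surface. (S n x - g x) * cnj (Y l j x))" for n
    unfolding coef_def left_diff_distrib
    by (intro Bochner_Integration.integral_diff[symmetric] square_integrable_mult S g Y_square_integrable j)
  then have le: "(norm (coef (S n) l j - coef g l j))\<^sup>2 \<le> (LINT x|surface. (norm (S n x - g x))\<^sup>2) * (LINT x|surface. (norm (Y l j x))\<^sup>2)" for n
    using integral_cauchy_schwarz[OF square_integrable_diff[OF S g] Y_square_integrable[OF j]] by simp
  have lim': "(\<lambda>n. (LINT x|surface. (norm (S n x - g x))\<^sup>2) * (LINT x|surface. (norm (Y l j x))\<^sup>2)) \<longlonglongrightarrow> 0"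
    by (rule tendsto_mult_left_zero[OF lim])
  show "(\<lambda>n. (norm (coef (S n) l j - coef g l j))\<^sup>2) \<longlonglongrightarrow> 0"
    by (rule Lim_null_comparison[OF _ lim']) (use le in \<open>simp add: always_eventually\<close>)
qed simp

text \<open>By Pythagoras the partial sums form a Cauchy sequence.\<close>

lemma exists_coef:
  assumes c: "summable (\<lambda>l. \<Sum>j=1..\<nu> l. (norm (c l j))\<^sup>2)"
  obtains g where "square_integrable surface g" "\<And>l j. j \<in> {1..\<nu> l} \<Longrightarrow> coef g l j = c l j"
    "(LINT x|surface. (norm (g x))\<^sup>2) \<le> (\<Sum>l. \<Sum>j=1..\<nu> l. (norm (c l j))\<^sup>2)"
proof -
  define w where "w l = (\<Sum>j=1..\<nu> l. (norm (c l j))\<^sup>2)" for l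
  have w: "w l \<ge> 0" for l by (auto simp: w_def intro: sum_nonneg)
  have sw: "summable w" using c by (simp add: w_def[abs_def])
  have diff: "(LINT x|surface. (norm (partial c 0 m x - partial c 0 n x))\<^sup>2) = sum w {min m n..<max m n}" for m n
  proof -
    have *: "partial c 0 n x - partial c 0 m x = partial c m n x" if "m \<le> n" for m n x
      using sum.atLeastLessThan_concat[of 0 m n "\<lambda>l. \<Sum>j=1..\<nu> l. c l j * Y l j x"] that
      by (simp add: partial_def algebra_simps)
    show ?thesis
    proof (cases "m \<le> n")
      case True
      then have "norm (partial c 0 m x - partial c 0 n x) = norm (partial c m n x)" for x
        using *[OF True, of x] by (metis norm_minus_commute)
      then show ?thesis using True by (simp add: norm_partial w_def min_def max_def)
    next
      case False
      then show ?thesis using *[of n m] by (simp add: norm_partial w_def min_def max_def)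
    qed
  qed
  obtain g where g: "square_integrable surface g"
    and lim: "(\<lambda>n. LINT x|surface. (norm (partial c 0 n x - g x))\<^sup>2) \<longlonglongrightarrow> 0"
  proof (rule riesz_fischer[OF partial_square_integrable[of c 0]])
    fix e :: real assume e: "e > 0"
    obtain N where N: "\<And>m n. m \<ge> N \<Longrightarrow> norm (sum w {m..<n}) < e"
      using summable_Cauchy[THEN iffD1, OF sw, rule_format, OF e] by blast
    have "sum w {min m n..<max m n} < e" if "m \<ge> N" "n \<ge> N" for m n
    proof -
      have "norm (sum w {min m n..<max m n}) < e" using that by (intro N) auto
      then show ?thesis by simp
    qed
    then show "\<exists>N. \<forall>m\<ge>N. \<forall>n\<ge>N. (LINT x|surface. (norm (partial c 0 m x - partial c 0 n x))\<^sup>2) < e"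
      unfolding diff by blast
  qed
  have coef: "coef g l j = c l j" if j: "j \<in> {1..\<nu> l}" for l j
  proof -
    have "(\<lambda>n. coef (partial c 0 n) l j) \<longlonglongrightarrow> coef g l j" by (rule coef_tendsto[OF partial_square_integrable g lim j])
    moreover have "\<forall>\<^sub>F n in sequentially. coef (partial c 0 n) l j = c l j"
      using eventually_gt_at_top[of l] by eventually_elim (simp add: coef_partial[OF j])
    then have "(\<lambda>n. coef (partial c 0 n) l j) \<longlonglongrightarrow> c l j" by (rule tendsto_eventually)
    ultimately show ?thesis by (rule LIMSEQ_unique)
  qed
  define A where "A = (LINT x|surface. (norm (g x))\<^sup>2)"
  have eq: "(LINT x|surface. (norm (partial c 0 n x - g x))\<^sup>2) = A - sum w {..<n}" for n
  proof -
    have "(LINT x|surface. (norm (partial c 0 n x - g x))\<^sup>2) = (LINT x|surface. (norm (g x - partial c 0 n x))\<^sup>2)"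
      by (simp add: norm_minus_commute)
    also have "\<dots> = A + (LINT x|surface. (norm (partial c 0 n x))\<^sup>2) - 2 * Re (LINT x|surface. g x * cnj (partial c 0 n x))"
      unfolding A_def by (rule integral_norm_diff_square[OF g partial_square_integrable])
    also have "(LINT x|surface. g x * cnj (partial c 0 n x)) = (\<Sum>l<n. \<Sum>j=1..\<nu> l. of_real ((norm (c l j))\<^sup>2))"
      unfolding integral_partial[OF g] atLeast0LessThan by (intro sum.cong refl) (simp only: coef complex_norm_square)
    also have "Re \<dots> = sum w {..<n}" by (simp add: w_def)
    also have "(LINT x|surface. (norm (partial c 0 n x))\<^sup>2) = sum w {..<n}"
      by (simp add: norm_partial w_def atLeast0LessThan)
    finally show ?thesis by simp
  qed
  have "(\<lambda>n. A - sum w {..<n}) \<longlonglongrightarrow> A - suminf w" by (intro tendsto_intros summable_LIMSEQ sw)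
  then have "A - suminf w = 0" using LIMSEQ_unique lim[unfolded eq] by fast
  then have "A \<le> (\<Sum>l. \<Sum>j=1..\<nu> l. (norm (c l j))\<^sup>2)" by (simp add: w_def[abs_def])
  then show ?thesis using that[OF g coef] by (simp add: A_def)
qed

lemma summable_coef:
  assumes f: "square_integrable surface f"
  shows "summable (\<lambda>l. \<Sum>j=1..\<nu> l. (norm (coef f l j))\<^sup>2)"
  by (rule summableI_nonneg_bounded[OF _ bessel[OF f]]) (auto intro: sum_nonneg)

text \<open>
  The function built from the coefficients of \<open>f\<close> differs from \<open>f\<close> by a function all of whose
  coefficients vanish.
\<close>

theorem parseval:
  assumes f: "square_integrable surface f"
  shows "(\<integral>\<^sup>+x. ennreal ((norm (f x))\<^sup>2) \<partial>surface) = (\<Sum>l. \<Sum>j=1..\<nu> l. ennreal ((norm (coef f l j))\<^sup>2))"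
proof -
  obtain g where g: "square_integrable surface g" "\<And>l j. j \<in> {1..\<nu> l} \<Longrightarrow> coef g l j = coef f l j"
    and le: "(LINT x|surface. (norm (g x))\<^sup>2) \<le> (\<Sum>l. \<Sum>j=1..\<nu> l. (norm (coef f l j))\<^sup>2)"
    using exists_coef[OF summable_coef[OF f]] by blast
  have "AE x in surface. f x - g x = 0"
  proof (rule complete[OF square_integrable_diff[OF f g(1)]])
    fix l j assume j: "j \<in> {1..\<nu> l}"
    have "coef (\<lambda>x. f x - g x) l j = coef f l j - coef g l j" unfolding coef_def left_diff_distrib
      by (intro Bochner_Integration.integral_diff square_integrable_mult f g Y_square_integrable j)
    then show "coef (\<lambda>x. f x - g x) l j = 0" using g(2)[OF j] by simp
  qed
  then have "AE x in surface. f x = g x" by (rule AE_mp) auto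
  note [measurable] = square_integrable_measurable[OF f] square_integrable_measurable[OF g(1)]
  have "(LINT x|surface. (norm (f x))\<^sup>2) = (LINT x|surface. (norm (g x))\<^sup>2)"
    using \<open>AE x in surface. f x = g x\<close> by (intro integral_cong_AE) auto
  moreover have "(\<Sum>l. \<Sum>j=1..\<nu> l. (norm (coef f l j))\<^sup>2) \<le> (LINT x|surface. (norm (f x))\<^sup>2)"
    by (intro suminf_le_const summable_coef[OF f] bessel[OF f])
  ultimately have eq: "(LINT x|surface. (norm (f x))\<^sup>2) = (\<Sum>l. \<Sum>j=1..\<nu> l. (norm (coef f l j))\<^sup>2)" using le by linarith
  have "(\<integral>\<^sup>+x. ennreal ((norm (f x))\<^sup>2) \<partial>surface) = ennreal (LINT x|surface. (norm (f x))\<^sup>2)"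
    using f by (intro nn_integral_eq_integral) (auto simp: square_integrable_def)
  also have "\<dots> = (\<Sum>l. ennreal (\<Sum>j=1..\<nu> l. (norm (coef f l j))\<^sup>2))"
    unfolding eq by (rule suminf_ennreal2[symmetric, OF _ summable_coef[OF f]]) (auto intro: sum_nonneg)
  finally show ?thesis by simp
qed

end

section \<open>Multipliers of the averaging operators\<close>

lemma two_minus_two_cos: "2 - 2 * cos x = 4 * (sin (x / 2))\<^sup>2" for x :: real using cos_double_sin[of "x / 2"] by simp

lemma two_minus_two_cos_le: "2 - 2 * cos x \<le> x\<^sup>2" for x :: real
proof -
  have "\<bar>sin (x / 2)\<bar> \<le> \<bar>x / 2\<bar>" by (rule abs_sin_x_le_abs_x)
  then have "(sin (x / 2))\<^sup>2 \<le> (x / 2)\<^sup>2" by (rule abs_le_square_iff[THEN iffD1])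
  then show ?thesis unfolding two_minus_two_cos by (simp add: power2_eq_square)
qed

lemma sin_ge_jordan:
  assumes "0 \<le> x" "x \<le> pi / 2"
  shows "2 / pi * x \<le> sin x"
proof -
  define f where "f x = sin x - 2 / pi * x" for x :: real
  have f0: "f 0 = 0" "f (pi / 2) = 0" by (simp_all add: f_def)
  have conc: "concave_on {0..pi} sin" by (rule f''_le0_imp_concave[where f' = cos and f'' = "\<lambda>x. - sin x"])
       (auto intro!: derivative_eq_intros sin_ge_zero)
  define u where "u = x / (pi / 2)"
  have u: "0 \<le> u" "u \<le> 1" using assms by (auto simp: u_def)
  have "(1 - u) * sin 0 + u * sin (pi / 2) \<le> sin ((1 - u) *\<^sub>R 0 + u *\<^sub>R (pi / 2))"
    using concave_onD[OF conc u, of 0 "pi / 2"] by simp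
  then show ?thesis by (simp add: u_def mult.commute)
qed

lemma two_minus_two_cos_ge:
  assumes "0 \<le> x" "x \<le> pi"
  shows "4 / pi\<^sup>2 * x\<^sup>2 \<le> 2 - 2 * cos x"
proof -
  have "2 / pi * (x / 2) \<le> sin (x / 2)" using assms by (intro sin_ge_jordan) auto
  then have "(2 / pi * (x / 2))\<^sup>2 \<le> (sin (x / 2))\<^sup>2" using assms by (intro power_mono) auto
  then show ?thesis unfolding two_minus_two_cos by (simp add: power2_eq_square)
qed

text \<open>
  The analysis of the averages needs only the dimension \<open>d\<close> and a Borel representative of the weight,
  extended by zero.
\<close>

locale weight =
  fixes d :: nat and T :: real and \<rho> :: "real \<Rightarrow> real"
  assumes d: "d \<ge> 2" and T: "0 < T" "T \<le> pi"
    and rho_measurable [measurable]: "\<rho> \<in> borel_measurable borel"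
    and rho_nonneg: "\<And>x. \<rho> x \<ge> 0" and rho_support: "\<And>x. x \<notin> {0<..<T} \<Longrightarrow> \<rho> x = 0"
    and rho_sq: "integrable lborel (\<lambda>x. (\<rho> x)\<^sup>2)" and rho_pos: "(LINT x|lborel. \<rho> x) > 0"
begin

text \<open>
  The squared norm over the scales \<open>t\<close> in terms of which the square function is defined.
\<close>

abbreviation scale_energy :: "real \<Rightarrow> (real \<Rightarrow> real) \<Rightarrow> ennreal" where
  "scale_energy p \<phi> \<equiv> \<integral>\<^sup>+t\<in>{0<..<T}. ennreal ((\<phi> t)\<^sup>2 / t powr p) \<partial>lborel"

lemma rho_integrable: "integrable lborel \<rho>"
proof (rule ccontr)
  assume "\<not> ?thesis"
  then show False using rho_pos not_integrable_integral_eq by force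
qed

lemma integrable_mult_rho:
  assumes [measurable]: "\<phi> \<in> borel_measurable borel" and B: "\<And>x. x \<in> {0<..<T} \<Longrightarrow> \<bar>\<phi> x\<bar> \<le> B"
  shows "integrable lborel (\<lambda>x. \<phi> x * \<rho> x)"
proof (rule Bochner_Integration.integrable_bound)
  show "integrable lborel (\<lambda>x. B * \<rho> x)" by (intro integrable_mult_right rho_integrable)
  have "\<bar>\<phi> x\<bar> * \<rho> x \<le> \<bar>B\<bar> * \<rho> x" for x
  proof (cases "x \<in> {0<..<T}")
    case True
    then show ?thesis using B[OF True] rho_nonneg[of x] by (intro mult_right_mono) auto
  qed (simp add: rho_support)
  then show "AE x in lborel. norm (\<phi> x * \<rho> x) \<le> norm (B * \<rho> x)" using rho_nonneg by (intro AE_I2) (simp add: abs_mult)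
qed measurable

lemma integral_mult_rho_pos:
  assumes [measurable]: "\<phi> \<in> borel_measurable borel" and B: "\<And>x. x \<in> {0<..<T} \<Longrightarrow> \<bar>\<phi> x\<bar> \<le> B"
    and pos: "\<And>x. x \<in> {0<..<T} \<Longrightarrow> \<phi> x > 0"
  shows "(LINT x|lborel. \<phi> x * \<rho> x) > 0"
proof -
  have nn: "0 \<le> \<phi> x * \<rho> x" for x using pos[of x] rho_nonneg[of x] rho_support[of x] by (cases "x \<in> {0<..<T}") auto
  have "(LINT x|lborel. \<phi> x * \<rho> x) \<noteq> 0"
  proof
    assume "(LINT x|lborel. \<phi> x * \<rho> x) = 0"
    then have "AE x in lborel. \<phi> x * \<rho> x = 0"
      using integral_nonneg_eq_0_iff_AE[OF integrable_mult_rho[OF assms(1) B]] nn by simp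
    then have "AE x in lborel. \<rho> x = 0"
    proof (rule AE_mp, intro AE_I2 impI)
      fix x assume "\<phi> x * \<rho> x = 0"
      then show "\<rho> x = 0" using pos[of x] rho_support[of x] by (cases "x \<in> {0<..<T}") auto
    qed
    then have "(LINT x|lborel. \<rho> x) = 0" by (subst integral_cong_AE[of _ _ "\<lambda>_. 0"]) auto
    then show False using rho_pos by simp
  qed
  moreover have "(LINT x|lborel. \<phi> x * \<rho> x) \<ge> 0" using nn by (intro integral_nonneg_AE) auto
  ultimately show ?thesis by linarith
qed

definition w :: "real \<Rightarrow> real \<Rightarrow> real" where
  "w t x = sin (t * x / T) ^ (d - 2) * \<rho> x"

definition Z :: "real \<Rightarrow> real" where
  "Z t = (LINT x|lborel. w t x)"

text \<open>
  The average over a cap of radius \<open>t\<close> of a function of the angle \<open>\<theta>\<close> to its centre, after the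
  substitution \<open>\<theta> = t x / T\<close>.
\<close>

definition av :: "real \<Rightarrow> (real \<Rightarrow> real) \<Rightarrow> real" where
  "av t \<phi> = (LINT x|lborel. \<phi> (t * x / T) * w t x) / Z t"

lemma angle_range:
  assumes t: "0 < t" "t \<le> T" and x: "x \<in> {0<..<T}"
  shows "0 < t * x / T" "t * x / T < t" "t * x / T < pi"
proof -
  show "0 < t * x / T" using t x T by simp
  show *: "t * x / T < t" using t x T by (simp add: divide_less_eq)
  show "t * x / T < pi" using * t T by linarith
qed

lemma w_nonneg: "0 < t \<Longrightarrow> t \<le> T \<Longrightarrow> 0 \<le> w t x" unfolding w_def using angle_range[of t x] rho_nonneg[of x] rho_support[of x]
  by (cases "x \<in> {0<..<T}") (auto intro!: mult_nonneg_nonneg zero_le_power sin_ge_zero)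

lemma w_measurable [measurable]: "w t \<in> borel_measurable borel" unfolding w_def by measurable

lemma av_integrable:
  assumes t: "0 < t" "t \<le> T" and \<phi>: "continuous_on UNIV \<phi>"
  shows "integrable lborel (\<lambda>x. \<phi> (t * x / T) * w t x)"
proof -
  have "compact (\<phi> ` {0..pi})" by (intro compact_continuous_image continuous_on_subset[OF \<phi>]) auto
  then obtain B where B: "\<And>y. y \<in> {0..pi} \<Longrightarrow> \<bar>\<phi> y\<bar> \<le> B"
    using compact_imp_bounded bounded_iff by (metis imageI real_norm_def)
  have [measurable]: "\<phi> \<in> borel_measurable borel" using \<phi> by (rule borel_measurable_continuous_onI)
  have "integrable lborel (\<lambda>x. (\<phi> (t * x / T) * sin (t * x / T) ^ (d - 2)) * \<rho> x)"
  proof (rule integrable_mult_rho)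
    fix x assume x: "x \<in> {0<..<T}"
    note r = angle_range[OF t x]
    have "\<bar>\<phi> (t * x / T)\<bar> * \<bar>sin (t * x / T)\<bar> ^ (d - 2) \<le> B * 1"
      using r B[of "t * x / T"] by (intro mult_mono power_le_one) auto
    then show "\<bar>\<phi> (t * x / T) * sin (t * x / T) ^ (d - 2)\<bar> \<le> B" by (simp add: abs_mult power_abs)
  qed measurable
  then show ?thesis by (simp add: w_def mult.assoc)
qed

lemma w_integrable: "0 < t \<Longrightarrow> t \<le> T \<Longrightarrow> integrable lborel (w t)" using av_integrable[of t "\<lambda>_. 1"] by simp

lemma Z_pos:
  assumes t: "0 < t" "t \<le> T"
  shows "Z t > 0" unfolding Z_def w_def
proof (rule integral_mult_rho_pos)
  fix x assume "x \<in> {0<..<T}"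
  note r = angle_range[OF t this]
  then show "0 < sin (t * x / T) ^ (d - 2)" by (intro zero_less_power sin_gt_zero) auto
  show "\<bar>sin (t * x / T) ^ (d - 2)\<bar> \<le> 1" by (simp add: power_abs power_le_one)
qed measurable

lemma av_cmult: "av t (\<lambda>x. c * \<phi> x) = c * av t \<phi>" unfolding av_def by (simp add: mult.assoc)

lemma av_diff:
  assumes "0 < t" "t \<le> T" "continuous_on UNIV \<phi>" "continuous_on UNIV \<psi>"
  shows "av t (\<lambda>x. \<phi> x - \<psi> x) = av t \<phi> - av t \<psi>"
  unfolding av_def left_diff_distrib using av_integrable[OF assms(1,2)] assms(3,4)
  by (subst Bochner_Integration.integral_diff) (auto simp: diff_divide_distrib)

lemma av_sum:
  assumes "0 < t" "t \<le> T" "\<And>k. k \<in> I \<Longrightarrow> continuous_on UNIV (\<phi> k)"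
  shows "av t (\<lambda>x. \<Sum>k\<in>I. \<phi> k x) = (\<Sum>k\<in>I. av t (\<phi> k))"
  unfolding av_def sum_distrib_right using av_integrable[OF assms(1,2)] assms(3)
  by (subst Bochner_Integration.integral_sum) (auto simp: sum_divide_distrib)

lemma av_const: "0 < t \<Longrightarrow> t \<le> T \<Longrightarrow> av t (\<lambda>x. c) = c" using Z_pos[of t] by (simp add: av_def Z_def)

lemma av_mono:
  assumes t: "0 < t" "t \<le> T" and c: "continuous_on UNIV \<phi>" "continuous_on UNIV \<psi>"
    and le: "\<And>x. 0 < x \<Longrightarrow> x < t \<Longrightarrow> \<phi> x \<le> \<psi> x"
  shows "av t \<phi> \<le> av t \<psi>"
proof -
  have "(LINT x|lborel. \<phi> (t * x / T) * w t x) \<le> (LINT x|lborel. \<psi> (t * x / T) * w t x)"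
  proof (rule integral_mono[OF av_integrable[OF t c(1)] av_integrable[OF t c(2)]])
    fix x
    show "\<phi> (t * x / T) * w t x \<le> \<psi> (t * x / T) * w t x"
    proof (cases "x \<in> {0<..<T}")
      case True
      then show ?thesis using angle_range[OF t True] le w_nonneg[OF t] by (intro mult_right_mono) auto
    qed (simp add: w_def rho_support)
  qed
  then show ?thesis unfolding av_def using Z_pos[OF t] by (intro divide_right_mono) auto
qed

lemma av_abs_le:
  assumes t: "0 < t" "t \<le> T" and c: "continuous_on UNIV \<phi>" "continuous_on UNIV \<psi>"
    and le: "\<And>x. 0 < x \<Longrightarrow> x < t \<Longrightarrow> \<bar>\<phi> x\<bar> \<le> \<psi> x"
  shows "\<bar>av t \<phi>\<bar> \<le> av t \<psi>"
proof -
  have "av t \<phi> \<le> av t \<psi>" "av t (\<lambda>x. (-1) * \<phi> x) \<le> av t \<psi>" by (intro av_mono t c continuous_intros; use le in force)+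
  then show ?thesis unfolding av_cmult by simp
qed

text \<open>
  By the Funk--Hecke formula the average over caps multiplies harmonics of degree \<open>l\<close> by \<open>mult l t\<close>.
  The average of the \<open>k\<close>-th power of the squared distance \<open>2 - 2 cos \<theta>\<close> to the centre is \<open>adist k t\<close>, so
  \<open>rem n l t\<close> is the average of the Taylor remainder of the Gegenbauer polynomial.
\<close>

definition mult :: "nat \<Rightarrow> real \<Rightarrow> real" where
  "mult l t = av t (\<lambda>x. poly (geg d l) (cos x))"

definition adist :: "nat \<Rightarrow> real \<Rightarrow> real" where
  "adist k t = av t (\<lambda>x. (2 - 2 * cos x) ^ k)"

definition rem :: "nat \<Rightarrow> nat \<Rightarrow> real \<Rightarrow> real" where
  "rem n l t = mult l t - (\<Sum>k<n. geg_taylor d l k * adist k t)"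

lemma continuous_poly_cos: "continuous_on UNIV (\<lambda>x::real. poly p (cos x))" by (intro continuous_intros)

lemma continuous_dist_power: "continuous_on UNIV (\<lambda>x::real. (2 - 2 * cos x) ^ k)" by (intro continuous_intros)

lemma adist_0: "0 < t \<Longrightarrow> t \<le> T \<Longrightarrow> adist 0 t = 1" by (simp add: adist_def av_const)

lemma adist_upper:
  assumes t: "0 < t" "t \<le> T"
  shows "0 \<le> adist k t" "adist k t \<le> t ^ (2 * k)"
proof -
  have cl: "2 - 2 * cos x \<ge> 0" for x :: real by simp
  have "av t (\<lambda>_. 0) \<le> adist k t"
    unfolding adist_def by (intro av_mono t continuous_dist_power continuous_intros zero_le_power cl)
  then show "0 \<le> adist k t" by (simp add: av_const t)
  have "adist k t \<le> av t (\<lambda>_. t ^ (2 * k))" unfolding adist_def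
  proof (intro av_mono t continuous_dist_power continuous_intros)
    fix x :: real assume x: "0 < x" "x < t"
    have "x\<^sup>2 \<le> t\<^sup>2" using x by (intro power_mono) auto
    then have "2 - 2 * cos x \<le> t\<^sup>2" using two_minus_two_cos_le[of x] by linarith
    then show "(2 - 2 * cos x) ^ k \<le> t ^ (2 * k)" unfolding power_mult using cl by (intro power_mono)
  qed
  then show "adist k t \<le> t ^ (2 * k)" by (simp add: av_const t)
qed

lemma mult_le_1: "0 < t \<Longrightarrow> t \<le> T \<Longrightarrow> \<bar>mult l t\<bar> \<le> 1"
  using av_abs_le[of t "\<lambda>x. poly (geg d l) (cos x)" "\<lambda>_. 1"] geg_bound[OF d]
  by (simp add: mult_def av_const continuous_poly_cos)

lemma rem_bound:
  assumes t: "0 < t" "t \<le> T"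
  shows "\<bar>rem n l t\<bar> \<le> (geg_eigen d l * t\<^sup>2) ^ n"
proof -
  have "rem n l t = av t (\<lambda>x. poly (geg d l) (cos x) - (\<Sum>k<n. geg_taylor d l k * (2 - 2 * cos x) ^ k))"
    unfolding rem_def mult_def adist_def by (subst av_diff[OF t], intro continuous_intros, intro continuous_intros,
        subst av_sum[OF t], intro continuous_intros, simp only: av_cmult)
  also have "\<bar>\<dots>\<bar> \<le> av t (\<lambda>x. \<bar>geg_taylor d l n\<bar> * (2 - 2 * cos x) ^ n)"
    by (intro av_abs_le t continuous_intros geg_taylor_remainder[OF d]) auto
  also have "\<dots> = \<bar>geg_taylor d l n\<bar> * adist n t" unfolding av_cmult adist_def ..
  also have "\<dots> \<le> geg_eigen d l ^ n * t ^ (2 * n)"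
    using geg_taylor_upper[OF d, of l n] adist_upper[OF t, of n] geg_eigen_nonneg[OF d, of l] by (intro mult_mono) auto
  finally show ?thesis by (simp add: power_mult_distrib power_mult)
qed

lemma rem_Suc: "rem (Suc n) l t = rem n l t - geg_taylor d l n * adist n t" by (simp add: rem_def)

lemma taylor_adist_bound:
  assumes t: "0 < t" "t \<le> T"
  shows "\<bar>geg_taylor d l n * adist n t\<bar> \<le> (geg_eigen d l * t\<^sup>2) ^ n"
proof -
  have "\<bar>geg_taylor d l n * adist n t\<bar> \<le> geg_eigen d l ^ n * t ^ (2 * n)"
    unfolding abs_mult using geg_taylor_upper[OF d, of l n] adist_upper[OF t, of n] geg_eigen_nonneg[OF d, of l]
    by (intro mult_mono) auto
  then show ?thesis by (simp add: power_mult_distrib power_mult)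
qed

lemma rem_Suc_bound:
  assumes t: "0 < t" "t \<le> T"
  shows "\<bar>rem (Suc n) l t\<bar> \<le> 2 * (geg_eigen d l * t\<^sup>2) ^ n"
  using rem_bound[OF t, of n l] taylor_adist_bound[OF t, of l n] unfolding rem_Suc by linarith

text \<open>
  For \<open>t \<le> T/2\<close> the angles stay below \<open>\<pi>/2\<close>, where the sine is comparable to its argument.
\<close>

definition jac_const :: real where
  "jac_const = (2 / pi) ^ (d - 2)"

lemma jac_const_pos: "jac_const > 0" by (simp add: jac_const_def)

lemma sin_power_bounds:
  assumes t: "0 < t" "t \<le> T / 2" and x: "x \<in> {0<..<T}"
  shows "jac_const * (t * x / T) ^ (d - 2) \<le> sin (t * x / T) ^ (d - 2)"
    and "sin (t * x / T) ^ (d - 2) \<le> (t * x / T) ^ (d - 2)"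
proof -
  have t': "t \<le> T" using t by simp
  note r = angle_range[OF t(1) t' x]
  have half: "t * x / T \<le> pi / 2" using r t T by linarith
  have s0: "0 \<le> sin (t * x / T)" using r by (intro sin_ge_zero) auto
  show "sin (t * x / T) ^ (d - 2) \<le> (t * x / T) ^ (d - 2)"
    using r s0 sin_x_le_x[of "t * x / T"] by (intro power_mono) auto
  have "jac_const * (t * x / T) ^ (d - 2) = (2 / pi * (t * x / T)) ^ (d - 2)"
    by (simp only: jac_const_def power_mult_distrib)
  also have "\<dots> \<le> sin (t * x / T) ^ (d - 2)" using r half by (intro power_mono sin_ge_jordan mult_nonneg_nonneg) auto
  finally show "jac_const * (t * x / T) ^ (d - 2) \<le> sin (t * x / T) ^ (d - 2)" .
qed

lemma integrable_power_rho: "integrable lborel (\<lambda>x. x ^ j * \<rho> x)"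
  by (rule integrable_mult_rho[where B="T ^ j"]) (auto intro: power_mono simp: power_abs)

lemma moment_pos: "(LINT x|lborel. x ^ j * \<rho> x) > 0"
  by (rule integral_mult_rho_pos[where B="T ^ j"]) (auto intro: power_mono simp: power_abs)

lemma Z_upper:
  assumes t: "0 < t" "t \<le> T / 2"
  shows "Z t \<le> (t / T) ^ (d - 2) * (LINT x|lborel. x ^ (d - 2) * \<rho> x)"
proof -
  have "Z t \<le> (LINT x|lborel. (t / T) ^ (d - 2) * (x ^ (d - 2) * \<rho> x))" unfolding Z_def
  proof (rule integral_mono)
    show "integrable lborel (w t)" using t by (intro w_integrable) auto
    show "integrable lborel (\<lambda>x. (t / T) ^ (d - 2) * (x ^ (d - 2) * \<rho> x))"
      by (intro integrable_mult_right integrable_power_rho)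
    fix x
    show "w t x \<le> (t / T) ^ (d - 2) * (x ^ (d - 2) * \<rho> x)"
    proof (cases "x \<in> {0<..<T}")
      case True
      have "w t x \<le> (t * x / T) ^ (d - 2) * \<rho> x"
        unfolding w_def using sin_power_bounds(2)[OF t True] rho_nonneg by (intro mult_right_mono)
      also have "(t * x / T) ^ (d - 2) = (t / T) ^ (d - 2) * x ^ (d - 2)" by (simp add: power_mult_distrib[symmetric])
      finally show ?thesis by (simp add: mult.assoc)
    qed (simp add: w_def rho_support)
  qed
  then show ?thesis by simp
qed

lemma Z_lower:
  assumes t: "0 < t" "t \<le> T / 2"
  shows "jac_const * (t / T) ^ (d - 2) * (LINT x|lborel. x ^ (d - 2) * \<rho> x) \<le> Z t"
proof -
  have "(LINT x|lborel. (jac_const * (t / T) ^ (d - 2)) * (x ^ (d - 2) * \<rho> x)) \<le> Z t" unfolding Z_def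
  proof (rule integral_mono)
    show "integrable lborel (w t)" using t by (intro w_integrable) auto
    show "integrable lborel (\<lambda>x. (jac_const * (t / T) ^ (d - 2)) * (x ^ (d - 2) * \<rho> x))"
      by (intro integrable_mult_right integrable_power_rho)
    fix x
    show "(jac_const * (t / T) ^ (d - 2)) * (x ^ (d - 2) * \<rho> x) \<le> w t x"
    proof (cases "x \<in> {0<..<T}")
      case True
      have "jac_const * (t * x / T) ^ (d - 2) * \<rho> x \<le> w t x"
        unfolding w_def using sin_power_bounds(1)[OF t True] rho_nonneg by (intro mult_right_mono) auto
      moreover have "(t * x / T) ^ (d - 2) = (t / T) ^ (d - 2) * x ^ (d - 2)"
        by (simp add: power_mult_distrib[symmetric])
      ultimately show ?thesis by (simp add: mult.assoc)
    qed (simp add: w_def rho_support)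
  qed
  then show ?thesis by simp
qed

lemma adist_lower:
  obtains c where "c > 0" "\<And>t. 0 < t \<Longrightarrow> t \<le> T / 2 \<Longrightarrow> c * t ^ (2 * k) \<le> adist k t"
proof -
  define I where "I j = (LINT x|lborel. x ^ j * \<rho> x)" for j
  have I: "I j > 0" for j unfolding I_def by (rule moment_pos)
  define c where "c = (4 / pi\<^sup>2) ^ k * (1 / T) ^ (2 * k) * jac_const * I (2 * k + (d - 2)) / I (d - 2)"
  have c: "c > 0" unfolding c_def using T jac_const_pos I by simp
  have "c * t ^ (2 * k) \<le> adist k t" if t: "0 < t" "t \<le> T / 2" for t
  proof -
    have t': "t \<le> T" using t by simp
    define A where "A = (4 / pi\<^sup>2) ^ k * (t / T) ^ (2 * k) * jac_const * (t / T) ^ (d - 2)"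
    have A: "A > 0" unfolding A_def using t T jac_const_pos by simp
    have "A * I (2 * k + (d - 2)) = (LINT x|lborel. A * (x ^ (2 * k + (d - 2)) * \<rho> x))" by (simp add: I_def)
    also have "\<dots> \<le> (LINT x|lborel. (2 - 2 * cos (t * x / T)) ^ k * w t x)"
    proof (rule integral_mono)
      show "integrable lborel (\<lambda>x. A * (x ^ (2 * k + (d - 2)) * \<rho> x))"
        by (intro integrable_mult_right integrable_power_rho)
      show "integrable lborel (\<lambda>x. (2 - 2 * cos (t * x / T)) ^ k * w t x)"
        by (rule av_integrable[OF t(1) t' continuous_dist_power])
      fix x
      show "A * (x ^ (2 * k + (d - 2)) * \<rho> x) \<le> (2 - 2 * cos (t * x / T)) ^ k * w t x"
      proof (cases "x \<in> {0<..<T}")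
        case True
        note r = angle_range[OF t(1) t' True]
        have 1: "(4 / pi\<^sup>2 * (t * x / T)\<^sup>2) ^ k \<le> (2 - 2 * cos (t * x / T)) ^ k"
          using r by (intro power_mono two_minus_two_cos_ge) auto
        have 2: "jac_const * (t * x / T) ^ (d - 2) * \<rho> x \<le> w t x"
          unfolding w_def using sin_power_bounds(1)[OF t True] rho_nonneg by (intro mult_right_mono) auto
        have "A * (x ^ (2 * k + (d - 2)) * \<rho> x)
            = (4 / pi\<^sup>2 * (t * x / T)\<^sup>2) ^ k * (jac_const * (t * x / T) ^ (d - 2) * \<rho> x)"
        proof -
          have "(4 / pi\<^sup>2 * (t * x / T)\<^sup>2) ^ k = (4 / pi\<^sup>2) ^ k * ((t / T) ^ (2 * k) * x ^ (2 * k))"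
            by (simp only: power_mult_distrib[symmetric] power_mult times_divide_eq_left)
          moreover have "(t * x / T) ^ (d - 2) = (t / T) ^ (d - 2) * x ^ (d - 2)"
            by (simp only: power_mult_distrib[symmetric] times_divide_eq_left)
          ultimately show ?thesis unfolding A_def power_add by (simp only: mult_ac)
        qed
        also have "\<dots> \<le> (2 - 2 * cos (t * x / T)) ^ k * w t x" using 1 2 r rho_nonneg[of x] jac_const_pos
          by (intro mult_mono) (auto intro!: mult_nonneg_nonneg)
        finally show ?thesis .
      qed (simp add: w_def rho_support)
    qed
    finally have num: "A * I (2 * k + (d - 2)) \<le> adist k t * Z t"
      using Z_pos[OF t(1) t'] by (simp add: adist_def av_def)
    have "adist k t * Z t \<le> adist k t * ((t / T) ^ (d - 2) * I (d - 2))"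
      using Z_upper[OF t] adist_upper[OF t(1) t'] unfolding I_def by (intro mult_left_mono)
    then have le: "A * I (2 * k + (d - 2)) \<le> adist k t * ((t / T) ^ (d - 2) * I (d - 2))" using num by linarith
    have p: "(t / T) ^ (d - 2) * I (d - 2) > 0" using t T I by simp
    have "c * t ^ (2 * k) = A * I (2 * k + (d - 2)) / ((t / T) ^ (d - 2) * I (d - 2))"
    proof -
      have "(t / T) ^ (2 * k) = (1 / T) ^ (2 * k) * t ^ (2 * k)" by (simp only: power_mult_distrib[symmetric]) simp
      moreover have "(t / T) ^ (d - 2) \<noteq> 0" using t T by simp
      moreover have "x1 * x2 * x3 * x4 / x5 * y = x1 * (x2 * y) * x3 * q * x4 / (q * x5)"
        if "q \<noteq> 0" for x1 x2 x3 x4 x5 y q :: real using that by (simp add: mult_ac)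
      ultimately show ?thesis unfolding A_def c_def by metis
    qed
    also have "\<dots> \<le> adist k t" using le p by (simp add: divide_le_eq)
    finally show ?thesis .
  qed
  then show ?thesis using that c by blast
qed

end

lemma nn_integral_powr_near_0:
  assumes "p > 0" "s \<ge> 0"
  shows "(\<integral>\<^sup>+t. ennreal (t powr (p - 1)) * indicator {0..s} t \<partial>lborel) = ennreal (s powr p / p)"
proof -
  have "((\<lambda>t. t powr (p - 1)) has_integral (s powr (p - 1 + 1) / (p - 1 + 1))) {0..s}"
    using assms by (intro has_integral_powr_from_0) auto
  then show ?thesis by (subst nn_integral_has_integral_lebesgue') auto
qed

lemma nn_integral_powr_near_infinity:
  assumes "p > 0" "s > 0"
  shows "(\<integral>\<^sup>+t. ennreal (t powr (- p - 1)) * indicator {s..} t \<partial>lborel) = ennreal (s powr (- p) / p)"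
proof -
  have "((\<lambda>t. t powr (- p - 1)) has_integral (- (s powr (- p - 1 + 1)) / (- p - 1 + 1))) {s..}"
    using assms by (intro has_integral_powr_to_inf) auto
  moreover have "- (s powr (- p - 1 + 1)) / (- p - 1 + 1) = s powr (- p) / p" by simp
  ultimately show ?thesis by (subst nn_integral_has_integral_lebesgue') auto
qed

lemma nn_integral_inverse_near_0:
  assumes "s > 0"
  shows "(\<integral>\<^sup>+t. ennreal (1 / t) * indicator {0<..s} t \<partial>lborel) = \<infinity>"
proof (rule ccontr)
  assume "\<not> ?thesis"
  then obtain r where r: "(\<integral>\<^sup>+t. ennreal (1 / t) * indicator {0<..s} t \<partial>lborel) = ennreal r" "r \<ge> 0"
    by (metis ennreal_cases infinity_ennreal_def)
  define e where "e = s * exp (- (r + 1))"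
  have e: "0 < e" "e \<le> s" using assms r by (auto simp: e_def mult_le_cancel_left1)
  have "(\<integral>\<^sup>+t. ennreal (1 / t) * indicator {e..s} t \<partial>lborel) = ennreal (ln s - ln e)"
    using e by (intro nn_integral_FTC_Icc) (auto intro!: derivative_eq_intros)
  also have "ln s - ln e = r + 1" using assms by (simp add: e_def ln_mult)
  finally have "ennreal (r + 1) = (\<integral>\<^sup>+t. ennreal (1 / t) * indicator {e..s} t \<partial>lborel)" ..
  also have "\<dots> \<le> (\<integral>\<^sup>+t. ennreal (1 / t) * indicator {0<..s} t \<partial>lborel)"
    using e by (intro nn_integral_mono) (auto split: split_indicator)
  finally show False using r by (simp add: ennreal_le_iff)
qed

context weight
begin

text \<open>The two bounds for the remainder balance at \<open>t = \<lambda>\<^sup>-\<^sup>1\<^sup>/\<^sup>2\<close>.\<close>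

lemma rem_integral_upper:
  assumes \<alpha>: "2 * real n < \<alpha>" "\<alpha> < 2 * real n + 2"
  obtains C where "C \<ge> 0" "\<And>l. scale_energy (2 * \<alpha> + 1) (rem (Suc n) l)
      \<le> ennreal (C * geg_eigen d l powr \<alpha>)"
proof -
  define p where "p = 4 * real n + 4 - 2 * \<alpha>"
  define q where "q = 2 * \<alpha> - 4 * real n"
  have pq: "p > 0" "q > 0" using \<alpha> by (auto simp: p_def q_def)
  define C where "C = 1 / p + 4 / q"
  have "scale_energy (2 * \<alpha> + 1) (rem (Suc n) l)
      \<le> ennreal (C * geg_eigen d l powr \<alpha>)" for l
  proof -
    define L where "L = geg_eigen d l"
    have L0: "L \<ge> 0" unfolding L_def by (rule geg_eigen_nonneg[OF d])
    show ?thesis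
    proof (cases "L = 0")
      case True
      have "scale_energy (2 * \<alpha> + 1) (rem (Suc n) l) = (\<integral>\<^sup>+t. 0 \<partial>(lborel :: real measure))"
      proof (rule nn_integral_cong)
        fix t :: real
        have "rem (Suc n) l t = 0" if "t \<in> {0<..<T}" using rem_bound[of t "Suc n" l] that True by (simp add: L_def)
        then show "ennreal ((rem (Suc n) l t)\<^sup>2 / t powr (2 * \<alpha> + 1)) * indicator {0<..<T} t = 0"
          by (auto split: split_indicator)
      qed
      then show ?thesis by simp
    next
      case False
      then have L: "L > 0" using L0 by simp
      define s where "s = L powr (- (1/2))"
      have s: "s > 0" using L by (simp add: s_def)
      have pt: "ennreal ((rem (Suc n) l t)\<^sup>2 / t powr (2 * \<alpha> + 1)) * indicator {0<..<T} t
        \<le> ennreal (L powr (2 * real n + 2)) * (ennreal (t powr (p - 1)) * indicator {0..s} t)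
          + ennreal (4 * L powr (2 * real n)) * (ennreal (t powr (- q - 1)) * indicator {s..} t)" for t
      proof (cases "t \<in> {0<..<T}")
        case True
        then have t: "0 < t" "t \<le> T" by auto
        have X: "(L * t\<^sup>2) ^ k = L powr real k * t powr (2 * real k)" for k
        proof -
          have "(L * t\<^sup>2) ^ k = L ^ k * t ^ (2 * k)" by (simp only: power_mult_distrib power_mult)
          moreover have "L powr real k = L ^ k" by (rule powr_realpow[OF L])
          moreover have "t powr real (2 * k) = t ^ (2 * k)" by (rule powr_realpow[OF t(1)])
          ultimately show ?thesis by simp
        qed
        show ?thesis
        proof (cases "t \<le> s")
          case ts: True
          have "(rem (Suc n) l t)\<^sup>2 \<le> ((L * t\<^sup>2) ^ Suc n)\<^sup>2"
            using rem_bound[OF t, of "Suc n" l] L by (intro abs_le_square_iff[THEN iffD1]) (auto simp: L_def)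
          also have "\<dots> = (L * t\<^sup>2) ^ (2 * n + 2)" by (simp only: power_mult[symmetric]) (simp add: mult.commute)
          also have "\<dots> = L powr (2 * real n + 2) * t powr (4 * real n + 4)" unfolding X by (simp add: algebra_simps)
          finally have "(rem (Suc n) l t)\<^sup>2 / t powr (2 * \<alpha> + 1) \<le> L powr (2 * real n + 2) * t powr (4 * real n + 4) / t powr (2 * \<alpha> + 1)"
            by (intro divide_right_mono) auto
          also have "\<dots> = L powr (2 * real n + 2) * t powr (p - 1)"
          proof -
            have "p - 1 = (4 * real n + 4) - (2 * \<alpha> + 1)" by (simp add: p_def)
            then have "t powr (p - 1) = t powr (4 * real n + 4) / t powr (2 * \<alpha> + 1)" by (simp only: powr_diff)
            then show ?thesis by simp
          qed
          finally have "ennreal ((rem (Suc n) l t)\<^sup>2 / t powr (2 * \<alpha> + 1)) \<le> ennreal (L powr (2 * real n + 2)) * ennreal (t powr (p - 1))"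
            by (simp add: ennreal_mult[symmetric] ennreal_leI)
          then show ?thesis using True ts by (auto split: split_indicator intro: add_increasing2)
        next
          case ts: False
          have "(rem (Suc n) l t)\<^sup>2 \<le> (2 * (L * t\<^sup>2) ^ n)\<^sup>2"
            using rem_Suc_bound[OF t, of n l] L by (intro abs_le_square_iff[THEN iffD1]) (auto simp: L_def)
          also have "\<dots> = 4 * (L * t\<^sup>2) ^ (2 * n)" by (simp add: power_mult_distrib power_mult[symmetric] mult.commute)
          also have "\<dots> = 4 * L powr (2 * real n) * t powr (4 * real n)" unfolding X by (simp add: algebra_simps)
          finally have "(rem (Suc n) l t)\<^sup>2 / t powr (2 * \<alpha> + 1) \<le> 4 * L powr (2 * real n) * t powr (4 * real n) / t powr (2 * \<alpha> + 1)"
            by (intro divide_right_mono) auto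
          also have "\<dots> = 4 * L powr (2 * real n) * t powr (- q - 1)"
          proof -
            have "- q - 1 = 4 * real n - (2 * \<alpha> + 1)" by (simp add: q_def)
            then have "t powr (- q - 1) = t powr (4 * real n) / t powr (2 * \<alpha> + 1)" by (simp only: powr_diff)
            then show ?thesis by simp
          qed
          finally have "ennreal ((rem (Suc n) l t)\<^sup>2 / t powr (2 * \<alpha> + 1)) \<le> ennreal (4 * L powr (2 * real n)) * ennreal (t powr (- q - 1))"
            by (simp add: ennreal_mult[symmetric] ennreal_leI)
          then show ?thesis using True ts by (auto split: split_indicator)
        qed
      qed simp
      have "scale_energy (2 * \<alpha> + 1) (rem (Suc n) l)
        \<le> (\<integral>\<^sup>+t. ennreal (L powr (2 * real n + 2)) * (ennreal (t powr (p - 1)) * indicator {0..s} t)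
          + ennreal (4 * L powr (2 * real n)) * (ennreal (t powr (- q - 1)) * indicator {s..} t) \<partial>lborel)"
        by (intro nn_integral_mono pt)
      also have "\<dots> = ennreal (L powr (2 * real n + 2)) * ennreal (s powr p / p) + ennreal (4 * L powr (2 * real n)) * ennreal (s powr (- q) / q)"
        using s pq by (simp add: nn_integral_add nn_integral_cmult nn_integral_powr_near_0 nn_integral_powr_near_infinity)
      also have "\<dots> = ennreal (L powr (2 * real n + 2) * (s powr p / p) + 4 * L powr (2 * real n) * (s powr (- q) / q))"
        using pq by (simp add: ennreal_mult[symmetric] ennreal_plus[symmetric] del: ennreal_plus)
      also have "L powr (2 * real n + 2) * (s powr p / p) = L powr \<alpha> / p"
        using L by (simp add: s_def powr_powr powr_add[symmetric] p_def field_simps)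
      also have "4 * L powr (2 * real n) * (s powr (- q) / q) = 4 * L powr \<alpha> / q"
        using L by (simp add: s_def powr_powr powr_add[symmetric] q_def field_simps)
      finally show ?thesis by (simp add: C_def L_def algebra_simps)
    qed
  qed
  then show ?thesis using that[of C] pq by (simp add: C_def)
qed

lemma geg_eigen_ge_1:
  assumes "l \<ge> 1" shows "geg_eigen d l \<ge> 1" using geg_eigen_mono[OF d assms] d by simp

text \<open>
  For \<open>\<lambda> t\<^sup>2\<close> small the remainder is dominated by its leading term, which is bounded below.
\<close>

lemma rem_integral_lower:
  assumes \<alpha>: "\<alpha> > 0"
  obtains c where "c > 0" "\<And>l. l \<ge> Suc n \<Longrightarrow> ennreal (c * geg_eigen d l powr \<alpha>)
     \<le> scale_energy (2 * \<alpha> + 1) (rem (Suc n) l)"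
proof -
  obtain c1 where c1: "c1 > 0" "\<And>l. l \<ge> Suc n \<Longrightarrow> c1 * geg_eigen d l ^ Suc n \<le> \<bar>geg_taylor d l (Suc n)\<bar>"
    using geg_taylor_lower[OF d] by blast
  obtain c2 where c2: "c2 > 0" "\<And>t. 0 < t \<Longrightarrow> t \<le> T / 2 \<Longrightarrow> c2 * t ^ (2 * Suc n) \<le> adist (Suc n) t"
    using adist_lower by blast
  \<comment> \<open>For \<open>\<lambda> t\<^sup>2 \<le> e\<^sup>2\<close> the next remainder is at most half of the leading term.\<close>
  define e where "e = min (sqrt (c1 * c2 / 2)) (T / 2)"
  have e: "e > 0" "e\<^sup>2 \<le> c1 * c2 / 2" "e \<le> T / 2"
  proof -
    show "e > 0" "e \<le> T / 2" using c1 c2 T by (auto simp: e_def)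
    have "e\<^sup>2 \<le> (sqrt (c1 * c2 / 2))\<^sup>2" using \<open>e > 0\<close> by (intro power_mono) (auto simp: e_def)
    then show "e\<^sup>2 \<le> c1 * c2 / 2" using c1 c2 by simp
  qed
  define c where "c = (c1 * c2 / 2 * (e\<^sup>2 / 4) ^ Suc n)\<^sup>2 * e powr (- (2 * \<alpha> + 1)) * (e / 2)"
  have c: "c > 0" using e c1 c2 by (auto simp: c_def)
  have "ennreal (c * geg_eigen d l powr \<alpha>) \<le> scale_energy (2 * \<alpha> + 1) (rem (Suc n) l)"
    if l: "l \<ge> Suc n" for l
  proof -
    define L where "L = geg_eigen d l"
    have L: "L \<ge> 1" unfolding L_def using l by (intro geg_eigen_ge_1) simp
    define s where "s = L powr (- (1/2))"
    have s: "0 < s" "s \<le> 1" "L * s\<^sup>2 = 1"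
      using L powr_mono[of "-(1/2)" 0 L] by (auto simp: s_def power2_eq_square powr_add[symmetric] powr_minus field_simps)
    \<comment> \<open>On \<open>[a, b]\<close> the product \<open>\<lambda> t\<^sup>2\<close> lies between \<open>e\<^sup>2 / 4\<close> and \<open>e\<^sup>2\<close>.\<close>
    define a b where "a = e * s / 2" and "b = e * s"
    define v where "v = (c1 * c2 / 2 * (e\<^sup>2 / 4) ^ Suc n)\<^sup>2 / b powr (2 * \<alpha> + 1)"
    have ab: "0 < a" "a < b" "b \<le> T / 2"
    proof -
      have "e * s \<le> e * 1" using e s by (intro mult_left_mono) auto
      then show "b \<le> T / 2" using e(3) unfolding b_def by linarith
    qed (use e s in \<open>auto simp: a_def b_def\<close>)
    have pt: "v \<le> (rem (Suc n) l t)\<^sup>2 / t powr (2 * \<alpha> + 1)" if t: "a \<le> t" "t \<le> b" for t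
    proof -
      have t': "0 < t" "t \<le> T" "t \<le> T / 2" using t ab by auto
      define X where "X = L * t\<^sup>2"
      have X: "e\<^sup>2 / 4 \<le> X" "X \<le> e\<^sup>2"
      proof -
        have "a\<^sup>2 \<le> t\<^sup>2" "t\<^sup>2 \<le> b\<^sup>2" using t ab by (auto intro: power_mono)
        then have "L * a\<^sup>2 \<le> X" "X \<le> L * b\<^sup>2" using L by (auto simp: X_def)
        moreover have "L * a\<^sup>2 = e\<^sup>2 / 4 * (L * s\<^sup>2)" "L * b\<^sup>2 = e\<^sup>2 * (L * s\<^sup>2)"
          by (simp_all add: a_def b_def power2_eq_square)
        ultimately show "e\<^sup>2 / 4 \<le> X" "X \<le> e\<^sup>2" using s by auto
      qed
      have X0: "X \<ge> 0" using L by (simp add: X_def)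
      have "c1 * c2 * X ^ Suc n = (c1 * L ^ Suc n) * (c2 * t ^ (2 * Suc n))"
        by (simp only: X_def power_mult_distrib power_mult[symmetric] mult_ac)
      also have "\<dots> \<le> \<bar>geg_taylor d l (Suc n)\<bar> * adist (Suc n) t"
        using c1(2)[OF l] c2(2)[OF t'(1,3)] c1(1) c2(1) L t' by (intro mult_mono) (auto simp: L_def)
      also have "\<dots> = \<bar>geg_taylor d l (Suc n) * adist (Suc n) t\<bar>" using adist_upper[OF t'(1,2)] by (simp add: abs_mult)
      finally have main: "c1 * c2 * X ^ Suc n \<le> \<bar>geg_taylor d l (Suc n) * adist (Suc n) t\<bar>" .
      have err: "\<bar>rem (Suc (Suc n)) l t\<bar> \<le> X * X ^ Suc n"
        using rem_bound[OF t'(1,2), of "Suc (Suc n)" l] by (simp add: X_def L_def)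
      have "X * X ^ Suc n \<le> c1 * c2 / 2 * X ^ Suc n" using X e X0 by (intro mult_right_mono) auto
      then have "c1 * c2 / 2 * X ^ Suc n \<le> \<bar>rem (Suc n) l t\<bar>"
      proof -
        have half: "c1 * c2 / 2 * X ^ Suc n = (c1 * c2 * X ^ Suc n) / 2" by simp
        have "A / 2 \<le> \<bar>R\<bar>" if "E \<le> A / 2" "A \<le> \<bar>M\<bar>" "\<bar>S\<bar> \<le> E" "S = R - M" for A E M R S :: real using that by linarith
        from this[OF \<open>X * X ^ Suc n \<le> c1 * c2 / 2 * X ^ Suc n\<close>[unfolded half] main err rem_Suc]
        show ?thesis unfolding half .
      qed
      moreover have "c1 * c2 / 2 * (e\<^sup>2 / 4) ^ Suc n \<le> c1 * c2 / 2 * X ^ Suc n"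
        using X c1 c2 by (intro mult_left_mono power_mono) auto
      ultimately have "c1 * c2 / 2 * (e\<^sup>2 / 4) ^ Suc n \<le> \<bar>rem (Suc n) l t\<bar>" by linarith
      moreover have "0 \<le> c1 * c2 / 2 * (e\<^sup>2 / 4) ^ Suc n" using c1 c2 by simp
      ultimately have "(c1 * c2 / 2 * (e\<^sup>2 / 4) ^ Suc n)\<^sup>2 \<le> (rem (Suc n) l t)\<^sup>2"
        by (intro abs_le_square_iff[THEN iffD1]) linarith
      moreover have "t powr (2 * \<alpha> + 1) \<le> b powr (2 * \<alpha> + 1)" using t t' \<alpha> by (intro powr_mono2) auto
      ultimately show ?thesis unfolding v_def using t' by (intro frac_le) auto
    qed
    have v0: "v \<ge> 0" by (simp add: v_def)
    have "v * (b - a) = c * L powr \<alpha>"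
    proof -
      define A where "A = (c1 * c2 / 2 * (e\<^sup>2 / 4) ^ Suc n)\<^sup>2"
      have 1: "b powr (- (2 * \<alpha> + 1)) = e powr (- (2 * \<alpha> + 1)) * s powr (- (2 * \<alpha> + 1))"
        unfolding b_def by (intro powr_mult)
      have "s powr (- (2 * \<alpha> + 1)) * s powr 1 = s powr (- 2 * \<alpha>)" by (simp only: powr_add[symmetric]) simp
      also have "\<dots> = L powr \<alpha>" by (simp add: s_def powr_powr)
      finally have 2: "s powr (- (2 * \<alpha> + 1)) * s = L powr \<alpha>" using s by simp
      have 3: "b - a = (e / 2) * s" by (simp add: a_def b_def)
      have 4: "v = A * b powr (- (2 * \<alpha> + 1))" unfolding v_def A_def powr_minus divide_inverse ..
      have "v * (b - a) = A * e powr (- (2 * \<alpha> + 1)) * (e / 2) * (s powr (- (2 * \<alpha> + 1)) * s)"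
        unfolding 4 1 3 by (simp only: mult_ac)
      then show ?thesis unfolding 2 c_def A_def .
    qed
    then have "ennreal (c * L powr \<alpha>) = ennreal v * ennreal (b - a)"
      using v0 ab by (metis ennreal_mult less_imp_le diff_ge_0_iff_ge)
    also have "\<dots> = (\<integral>\<^sup>+t. ennreal v * indicator {a..b} t \<partial>lborel)" using ab by (subst nn_integral_cmult_indicator) auto
    also have "\<dots> \<le> scale_energy (2 * \<alpha> + 1) (rem (Suc n) l)"
      using pt ab T by (intro nn_integral_mono) (auto split: split_indicator intro!: ennreal_leI)
    finally show ?thesis by (simp add: L_def)
  qed
  then show ?thesis using that c by blast
qed

text \<open>
  Since \<open>adist k t\<close> is of exact order \<open>t\<^sup>2\<^sup>k\<close>, the first nonzero term of the sum prevents it from being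
  square integrable against \<open>t\<^sup>-\<^sup>4\<^sup>n\<^sup>-\<^sup>1\<close> near \<open>0\<close>, whatever the terms of higher order are.
\<close>

lemma expansion_coefficients_zero:
  fixes e :: "nat \<Rightarrow> complex" and r :: "real \<Rightarrow> complex"
  assumes fin: "scale_energy (4 * real n + 1) (\<lambda>t. norm ((\<Sum>k=1..n. e k * of_real (adist k t)) + r t)) < \<infinity>"
    and r: "\<And>t. 0 < t \<Longrightarrow> t < T \<Longrightarrow> norm (r t) \<le> C * t ^ (2 * n + 2)"
    and k: "k \<in> {1..n}"
  shows "e k = 0"
proof (rule ccontr)
  assume "e k \<noteq> 0"
  \<comment> \<open>The first nonzero term would dominate all others near \<open>0\<close>.\<close>
  define k0 where "k0 = (LEAST k. k \<in> {1..n} \<and> e k \<noteq> 0)"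
  have k0: "k0 \<in> {1..n} \<and> e k0 \<noteq> 0" unfolding k0_def by (rule LeastI[of _ k]) (use k \<open>e k \<noteq> 0\<close> in auto)
  have least: "e k = 0" if "k \<in> {1..n}" "k < k0" for k
    using not_less_Least[of k "\<lambda>k. k \<in> {1..n} \<and> e k \<noteq> 0"] that by (auto simp: k0_def)
  obtain c where c: "c > 0" "\<And>t. 0 < t \<Longrightarrow> t \<le> T / 2 \<Longrightarrow> c * t ^ (2 * k0) \<le> adist k0 t" using adist_lower by blast
  define K where "K = (\<Sum>k\<in>{1..n}. norm (e k)) + \<bar>C\<bar>"
  have K: "K \<ge> 0" unfolding K_def by (intro add_nonneg_nonneg sum_nonneg) auto
  define b where "b = c * norm (e k0)"
  have b: "b > 0" using c k0 by (simp add: b_def)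
  \<comment> \<open>For \<open>t \<le> \<tau>\<close> the other terms amount to at most half of the first.\<close>
  define \<tau> where "\<tau> = min (min 1 (T / 2)) (sqrt (b / (2 * (K + 1))))"
  have tau: "\<tau> > 0" "\<tau> \<le> 1" "\<tau> \<le> T / 2" using b K T by (auto simp: \<tau>_def)
  have tau_sq: "K * t\<^sup>2 \<le> b / 2" if "0 < t" "t \<le> \<tau>" for t
  proof -
    have "t\<^sup>2 \<le> (sqrt (b / (2 * (K + 1))))\<^sup>2" using that by (intro power_mono) (auto simp: \<tau>_def)
    also have "\<dots> = b / (2 * (K + 1))" using b K by simp
    finally have "K * t\<^sup>2 \<le> K * (b / (2 * (K + 1)))" using K by (intro mult_left_mono)
    also have "\<dots> \<le> b / 2" using K b by (simp add: field_simps)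
    finally show ?thesis .
  qed
  define h where "h t = (\<Sum>k=1..n. e k * of_real (adist k t)) + r t" for t
  have lower: "b / 2 * t ^ (2 * k0) \<le> norm (h t)" if t: "0 < t" "t \<le> \<tau>" for t
  proof -
    have t': "t \<le> 1" "t < T" "t \<le> T" "t \<le> T / 2" using t tau T by auto
    have "(\<Sum>k=1..n. e k * of_real (adist k t)) = e k0 * of_real (adist k0 t) + (\<Sum>k\<in>{1..n} - {k0}. e k * of_real (adist k t))"
      using k0 by (intro sum.remove) auto
    then have h_eq: "e k0 * of_real (adist k0 t) = h t - ((\<Sum>k\<in>{1..n} - {k0}. e k * of_real (adist k t)) + r t)"
      by (simp add: h_def)
    have "norm (\<Sum>k\<in>{1..n} - {k0}. e k * of_real (adist k t)) \<le> (\<Sum>k\<in>{1..n} - {k0}. norm (e k) * (t\<^sup>2 * t ^ (2 * k0)))"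
    proof (rule sum_norm_le)
      fix k assume k: "k \<in> {1..n} - {k0}"
      show "norm (e k * of_real (adist k t)) \<le> norm (e k) * (t\<^sup>2 * t ^ (2 * k0))"
      proof (cases "k < k0")
        case True
        then show ?thesis using least k by simp
      next
        case False
        then have "2 + 2 * k0 \<le> 2 * k" using k by auto
        then have "t ^ (2 * k) \<le> t ^ (2 + 2 * k0)" using t t' by (intro power_decreasing) auto
        then have "adist k t \<le> t\<^sup>2 * t ^ (2 * k0)" using adist_upper(2)[OF t(1) t'(3), of k] unfolding power_add by linarith
        then show ?thesis using adist_upper(1)[OF t(1) t'(3), of k] by (simp add: norm_mult mult_left_mono)
      qed
    qed
    also have "\<dots> \<le> (\<Sum>k\<in>{1..n}. norm (e k) * (t\<^sup>2 * t ^ (2 * k0)))" using t by (intro sum_mono2) auto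
    finally have s: "norm (\<Sum>k\<in>{1..n} - {k0}. e k * of_real (adist k t)) \<le> (\<Sum>k\<in>{1..n}. norm (e k)) * (t\<^sup>2 * t ^ (2 * k0))"
      by (simp add: sum_distrib_right)
    have "norm (r t) \<le> C * t ^ (2 * n + 2)" by (rule r[OF t(1) t'(2)])
    also have "\<dots> \<le> \<bar>C\<bar> * t ^ (2 * n + 2)" using t by (intro mult_right_mono) auto
    also have "\<dots> \<le> \<bar>C\<bar> * (t\<^sup>2 * t ^ (2 * k0))"
    proof -
      have "t ^ (2 * n + 2) \<le> t ^ (2 + 2 * k0)" using t t' k0 by (intro power_decreasing) auto
      then show ?thesis unfolding power_add[of t 2 "2 * k0"] by (rule mult_left_mono) simp
    qed
    finally have "norm ((\<Sum>k\<in>{1..n} - {k0}. e k * of_real (adist k t)) + r t) \<le> K * (t\<^sup>2 * t ^ (2 * k0))"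
      using s norm_triangle_ineq[of "\<Sum>k\<in>{1..n} - {k0}. e k * of_real (adist k t)" "r t"]
      by (simp add: K_def distrib_right)
    also have "\<dots> = K * t\<^sup>2 * t ^ (2 * k0)" by simp
    also have "\<dots> \<le> b / 2 * t ^ (2 * k0)" using tau_sq[OF t] t by (intro mult_right_mono) auto
    finally have e1: "norm ((\<Sum>k\<in>{1..n} - {k0}. e k * of_real (adist k t)) + r t) \<le> b / 2 * t ^ (2 * k0)" .
    have "b * t ^ (2 * k0) = norm (e k0) * (c * t ^ (2 * k0))" by (simp add: b_def)
    also have "\<dots> \<le> norm (e k0) * adist k0 t" using c(2)[OF t(1) t'(4)] by (intro mult_left_mono) auto
    also have "\<dots> = norm (e k0 * of_real (adist k0 t))"
      using adist_upper(1)[OF t(1) t'(3), of k0] by (simp add: norm_mult)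
    also have "\<dots> \<le> norm (h t) + norm ((\<Sum>k\<in>{1..n} - {k0}. e k * of_real (adist k t)) + r t)"
      unfolding h_eq by (rule norm_triangle_ineq4)
    finally show ?thesis using e1 by linarith
  qed
  have "ennreal ((b / 2)\<^sup>2) * (ennreal (1 / t) * indicator {0<..\<tau>} t)
     \<le> ennreal ((norm (h t))\<^sup>2 / t powr (4 * real n + 1)) * indicator {0<..<T} t" for t
  proof (cases "t \<in> {0<..\<tau>}")
    case True
    then have t: "0 < t" "t \<le> \<tau>" "t < T" "t \<le> 1" using tau T by auto
    have "t powr (4 * real n) \<le> t powr (4 * real k0)" using t k0 by (intro powr_mono') auto
    then have "(b / 2)\<^sup>2 * t powr (4 * real n) \<le> (b / 2)\<^sup>2 * t powr (4 * real k0)" by (intro mult_left_mono) auto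
    also have "t powr (4 * real k0) = (t ^ (2 * k0))\<^sup>2"
    proof -
      have "t powr (4 * real k0) = t ^ (4 * k0)" using t powr_realpow[of t "4 * k0"] by simp
      also have "\<dots> = (t ^ (2 * k0))\<^sup>2" by (simp add: power_mult[symmetric])
      finally show ?thesis .
    qed
    also have "(b / 2)\<^sup>2 * (t ^ (2 * k0))\<^sup>2 = (b / 2 * t ^ (2 * k0))\<^sup>2" by (simp only: power_mult_distrib)
    also have "\<dots> \<le> (norm (h t))\<^sup>2" using lower[OF t(1,2)] b t by (intro power_mono) auto
    finally have "(b / 2)\<^sup>2 * t powr (4 * real n) / t powr (4 * real n + 1) \<le> (norm (h t))\<^sup>2 / t powr (4 * real n + 1)"
      by (intro divide_right_mono) auto
    also have "(b / 2)\<^sup>2 * t powr (4 * real n) / t powr (4 * real n + 1) = (b / 2)\<^sup>2 * (1 / t)"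
      using t by (simp add: powr_add)
    finally have "ennreal ((b / 2)\<^sup>2 * (1 / t)) \<le> ennreal ((norm (h t))\<^sup>2 / t powr (4 * real n + 1))"
      by (rule ennreal_leI)
    then have "ennreal ((b / 2)\<^sup>2) * ennreal (1 / t) \<le> ennreal ((norm (h t))\<^sup>2 / t powr (4 * real n + 1))"
      using t by (subst ennreal_mult[symmetric]) auto
    then show ?thesis using True t by simp
  qed simp
  then have "(\<integral>\<^sup>+t. ennreal ((b / 2)\<^sup>2) * (ennreal (1 / t) * indicator {0<..\<tau>} t) \<partial>lborel)
     \<le> scale_energy (4 * real n + 1) (\<lambda>t. norm (h t))" by (intro nn_integral_mono)
  also have "\<dots> < \<infinity>" using fin by (simp add: h_def)
  finally show False
    using nn_integral_inverse_near_0[OF tau(1)] b by (subst (asm) nn_integral_cmult) (auto simp: ennreal_mult_top)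
qed

end

section \<open>Decay of the multipliers\<close>

text \<open>
  On \<open>(0, \<pi>/2)\<close> the function \<open>p(\<theta>) = P(cos \<theta>)\<close> solves \<open>p'' + \<kappa> cot \<theta> p' + \<lambda> p = 0\<close> with
  \<open>\<kappa> = d - 2\<close>. The damped energy
  \<open>G = sin\<^sup>\<kappa> \<theta> (p\<^sup>2 + p'\<^sup>2/\<lambda> + \<kappa> cot \<theta> p p'/\<lambda>)\<close> satisfies
  \<open>G' = - \<kappa> sin\<^sup>\<kappa>\<^sup>-\<^sup>2 \<theta> p p'/\<lambda>\<close>, so \<open>G\<close> changes by a bounded factor once \<open>\<lambda>\<^sup>1\<^sup>/\<^sup>2 \<theta>\<close> is
  bounded below.
\<close>

lemma geg_decay:
  assumes d: "d \<ge> 3" and l: "geg_eigen d l > 0" and \<theta>: "0 < \<theta>" "\<theta> < pi / 2"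
  shows "(poly (geg d l) (cos \<theta>))\<^sup>2 * sin \<theta> ^ (d - 2) \<le> 9 * ((real d - 2) / sqrt (geg_eigen d l)) ^ (d - 2)"
proof -
  obtain k where k: "d = k + 3" using d by (metis add.commute le_Suc_ex)
  have d2: "d \<ge> 2" using d by simp
  define \<kappa> where "\<kappa> = real k + 1"
  define L where "L = geg_eigen d l"
  define \<Lambda> where "\<Lambda> = sqrt L"
  have L: "L > 0" "\<Lambda> > 0" "\<Lambda>\<^sup>2 = L" using l by (auto simp: L_def \<Lambda>_def)
  define p where "p = geg d l"
  define u where "u \<theta> = poly p (cos \<theta>)" for \<theta>
  define u1 where "u1 \<theta> = poly (pderiv p) (cos \<theta>)" for \<theta>
  define u2 where "u2 \<theta> = poly (pderiv (pderiv p)) (cos \<theta>)" for \<theta>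
  define E where "E \<theta> = (u \<theta>)\<^sup>2 + (sin \<theta> * u1 \<theta> / \<Lambda>)\<^sup>2" for \<theta>
  define \<nu> where "\<nu> = 1 / L"
  have nu: "\<nu> * L = 1" "\<nu> = (1 / \<Lambda>) * (1 / \<Lambda>)" using L(1) by (auto simp: \<nu>_def power2_eq_square simp flip: L(3))
  define Q where "Q \<theta> = (u \<theta>)\<^sup>2 + \<nu> * ((sin \<theta>)\<^sup>2 * (u1 \<theta>)\<^sup>2) - \<kappa> * \<nu> * (cos \<theta> * (u \<theta> * u1 \<theta>))" for \<theta>
  define G where "G \<theta> = sin \<theta> ^ Suc k * Q \<theta>" for \<theta>
  define H where "H \<theta> = G \<theta> * exp (\<kappa> / \<Lambda> * cot \<theta>)" for \<theta>
  have kap: "\<kappa> \<ge> 1" by (simp add: \<kappa>_def)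
  have ode: "(sin \<theta>)\<^sup>2 * u2 \<theta> = (\<kappa> + 1) * cos \<theta> * u1 \<theta> - L * u \<theta>" for \<theta>
    using geg_ode_geg[OF d2, of l] unfolding geg_ode_poly p_def[symmetric] sin_squared_eq u_def u1_def u2_def
    by (simp add: L_def k \<kappa>_def algebra_simps)
  have E1: "E \<theta> \<le> 1" if "0 < \<theta>" "\<theta> < pi / 2" for \<theta>
  proof -
    have "0 \<le> cos \<theta>" "cos \<theta> \<le> 1" using that by (auto intro: cos_ge_zero)
    then have "(poly p (cos \<theta>))\<^sup>2 + (1 - (cos \<theta>)\<^sup>2) * (poly (pderiv p) (cos \<theta>))\<^sup>2 / L \<le> (poly p 1)\<^sup>2"
      unfolding p_def L_def using d l by (intro geg_ode_bound_pos[OF geg_ode_geg[OF d2]]) auto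
    then show ?thesis
      using d2 L by (simp add: E_def u_def u1_def p_def sin_squared_eq[symmetric] power_mult_distrib power_divide)
  qed
  have cross: "\<bar>u \<theta> * (sin \<theta> * u1 \<theta> / \<Lambda>)\<bar> \<le> E \<theta> / 2" for \<theta>
  proof -
    have "\<bar>a * b\<bar> \<le> (a\<^sup>2 + b\<^sup>2) / 2" for a b :: real using sum_squares_bound[of "\<bar>a\<bar>" "\<bar>b\<bar>"] by (simp add: abs_mult)
    from this[of "u \<theta>" "sin \<theta> * u1 \<theta> / \<Lambda>"] show ?thesis unfolding E_def .
  qed
  have Q_bounds: "E \<theta> / 2 \<le> Q \<theta>" "Q \<theta> \<le> 3 / 2 * E \<theta>"
    if \<theta>: "0 < \<theta>" "\<theta> < pi / 2" and cot: "\<kappa> * cos \<theta> \<le> \<Lambda> * sin \<theta>" for \<theta>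
  proof -
    have s: "sin \<theta> > 0" using \<theta> by (intro sin_gt_zero) auto
    have c: "cos \<theta> \<ge> 0" using \<theta> by (intro cos_ge_zero) auto
    define r where "r = \<kappa> * cos \<theta> / (\<Lambda> * sin \<theta>)"
    have r: "0 \<le> r" "r \<le> 1" using s c L kap cot by (auto simp: r_def divide_le_eq)
    have eq: "Q \<theta> = E \<theta> - r * (u \<theta> * (sin \<theta> * u1 \<theta> / \<Lambda>))"
    proof -
      have "(sin \<theta> * u1 \<theta> / \<Lambda>)\<^sup>2 = \<nu> * ((sin \<theta>)\<^sup>2 * (u1 \<theta>)\<^sup>2)" by (simp add: power_mult_distrib power_divide L \<nu>_def)
      moreover have "r * (u \<theta> * (sin \<theta> * u1 \<theta> / \<Lambda>)) = \<kappa> * \<nu> * (cos \<theta> * (u \<theta> * u1 \<theta>))"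
        using s L(2) unfolding r_def nu(2) by simp
      ultimately show ?thesis by (simp add: Q_def E_def)
    qed
    have "\<bar>r * (u \<theta> * (sin \<theta> * u1 \<theta> / \<Lambda>))\<bar> \<le> 1 * (E \<theta> / 2)"
      unfolding abs_mult[of r] using r cross by (intro mult_mono) auto
    then show "E \<theta> / 2 \<le> Q \<theta>" "Q \<theta> \<le> 3 / 2 * E \<theta>" unfolding eq by linarith+
  qed
  \<comment> \<open>The exponential absorbs the derivative of \<open>G\<close>.\<close>
  have dH: "\<exists>D. (H has_real_derivative D) (at \<theta>) \<and> D \<le> 0"
    if \<theta>: "0 < \<theta>" "\<theta> < pi / 2" and cot: "\<kappa> * cos \<theta> \<le> \<Lambda> * sin \<theta>" for \<theta>
  proof -
    have s: "sin \<theta> > 0" using \<theta> by (intro sin_gt_zero) auto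
    have du: "(u has_real_derivative u1 \<theta> * (- sin \<theta>)) (at \<theta>)" "(u1 has_real_derivative u2 \<theta> * (- sin \<theta>)) (at \<theta>)"
      unfolding u_def[abs_def] u1_def[abs_def] u2_def by (rule DERIV_chain2[OF poly_DERIV DERIV_cos])+
    have dQ: "(Q has_real_derivative (2 * u \<theta> * (u1 \<theta> * (- sin \<theta>)) + \<nu> * (2 * sin \<theta> * cos \<theta> * (u1 \<theta>)\<^sup>2 + (sin \<theta>)\<^sup>2 * (2 * u1 \<theta> * (u2 \<theta> * (- sin \<theta>))))
        - \<kappa> * \<nu> * (- sin \<theta> * (u \<theta> * u1 \<theta>) + cos \<theta> * (u1 \<theta> * (- sin \<theta>) * u1 \<theta> + u \<theta> * (u2 \<theta> * (- sin \<theta>)))))) (at \<theta>)"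
      unfolding Q_def by (auto intro!: derivative_eq_intros du simp: algebra_simps)
    have ds: "((\<lambda>\<theta>. sin \<theta> ^ Suc k) has_real_derivative (1 + real k) * (cos \<theta> * sin \<theta> ^ k)) (at \<theta>)"
      by (rule DERIV_power_Suc[OF DERIV_sin])
    have dG: "(G has_real_derivative \<kappa> * \<nu> * sin \<theta> ^ k * (u \<theta> * u1 \<theta>)) (at \<theta>)"
    proof -
      define S C U V W where "S = sin \<theta>" and "C = cos \<theta>" and "U = u \<theta>" and "V = u1 \<theta>" and "W = u2 \<theta>"
      have C2: "S\<^sup>2 + C\<^sup>2 = 1" unfolding C_def S_def by simp
      have "S\<^sup>2 * W = (\<kappa> + 1) * C * V - L * U" using ode[of \<theta>] by (simp only: S_def C_def U_def V_def W_def)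
      then have "\<nu> * (S\<^sup>2 * W) = \<nu> * ((\<kappa> + 1) * C * V) - (\<nu> * L) * U" by (simp only: right_diff_distrib mult.assoc)
      then have W: "\<nu> * (S\<^sup>2 * W) = \<nu> * ((\<kappa> + 1) * C * V) - U" by (simp add: nu(1))
      have "(1 + real k) * (C * S ^ k) * (U\<^sup>2 + \<nu> * (S\<^sup>2 * V\<^sup>2) - \<kappa> * \<nu> * (C * (U * V)))
         + (2 * U * (V * (- S)) + \<nu> * (2 * S * C * V\<^sup>2 + S\<^sup>2 * (2 * V * (W * (- S))))
            - \<kappa> * \<nu> * (- S * (U * V) + C * (V * (- S) * V + U * (W * (- S))))) * S ^ Suc k
        = S ^ k * (\<kappa> * C * U\<^sup>2 + \<kappa> * \<nu> * C * S\<^sup>2 * V\<^sup>2 - \<kappa> * \<kappa> * \<nu> * C\<^sup>2 * (U * V)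
           - 2 * S\<^sup>2 * U * V + 2 * \<nu> * S\<^sup>2 * C * V\<^sup>2 - 2 * S\<^sup>2 * V * (\<nu> * (S\<^sup>2 * W))
           + \<kappa> * \<nu> * S\<^sup>2 * (U * V) + \<kappa> * \<nu> * C * S\<^sup>2 * V\<^sup>2 + \<kappa> * C * U * (\<nu> * (S\<^sup>2 * W)))"
        by (simp add: \<kappa>_def power2_eq_square algebra_simps)
      also have "\<dots> = S ^ k * (\<kappa> * \<nu> * (U * V) * (S\<^sup>2 + C\<^sup>2))" unfolding W by (simp add: power2_eq_square algebra_simps)
      also have "\<dots> = \<kappa> * \<nu> * S ^ k * (U * V)" unfolding C2 by simp
      finally show ?thesis unfolding G_def using DERIV_mult[OF ds dQ]
        by (simp only: Q_def S_def C_def U_def V_def W_def)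
    qed
    have dc: "((\<lambda>\<theta>. \<kappa> / \<Lambda> * cot \<theta>) has_real_derivative \<kappa> / \<Lambda> * (- inverse ((sin \<theta>)\<^sup>2))) (at \<theta>)"
      using s by (intro DERIV_cmult DERIV_cot) auto
    have dHD: "(H has_real_derivative (\<kappa> * \<nu> * sin \<theta> ^ k * (u \<theta> * u1 \<theta>)) * exp (\<kappa> / \<Lambda> * cot \<theta>)
        + (exp (\<kappa> / \<Lambda> * cot \<theta>) * (\<kappa> / \<Lambda> * (- inverse ((sin \<theta>)\<^sup>2)))) * G \<theta>) (at \<theta>)"
      unfolding H_def by (intro DERIV_mult dG DERIV_fun_exp dc)
    have alg: "(\<kappa> * (i * i) * (J * P * S) * (U * V)) * x + (x * (\<kappa> * i * (- J))) * (P * q)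
        = x * (\<kappa> * i) * (J * P) * (U * (S * V * i) - q)" for i J P S U V x q :: real by (simp add: algebra_simps)
    have sk: "sin \<theta> ^ k = inverse ((sin \<theta>)\<^sup>2) * sin \<theta> ^ Suc k * sin \<theta>"
      using s by (simp add: power2_eq_square field_simps)
    have "(\<kappa> * \<nu> * sin \<theta> ^ k * (u \<theta> * u1 \<theta>)) * exp (\<kappa> / \<Lambda> * cot \<theta>)
        + (exp (\<kappa> / \<Lambda> * cot \<theta>) * (\<kappa> / \<Lambda> * (- inverse ((sin \<theta>)\<^sup>2)))) * G \<theta>
       = exp (\<kappa> / \<Lambda> * cot \<theta>) * (\<kappa> / \<Lambda>) * (inverse ((sin \<theta>)\<^sup>2) * sin \<theta> ^ Suc k) * (u \<theta> * (sin \<theta> * u1 \<theta> / \<Lambda>) - Q \<theta>)"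
      using alg[of "1 / \<Lambda>" "inverse ((sin \<theta>)\<^sup>2)" "sin \<theta> ^ Suc k" "sin \<theta>" "u \<theta>" "u1 \<theta>" "exp (\<kappa> / \<Lambda> * cot \<theta>)" "Q \<theta>"]
      unfolding G_def sk[symmetric] nu(2)[symmetric] by (simp only: times_divide_eq_right mult_1_right)
    also have "\<dots> \<le> 0"
    proof (rule mult_nonneg_nonpos)
      have "u \<theta> * (sin \<theta> * u1 \<theta> / \<Lambda>) \<le> E \<theta> / 2" by (rule abs_le_D1[OF cross])
      also have "\<dots> \<le> Q \<theta>" by (rule Q_bounds(1)[OF that])
      finally show "u \<theta> * (sin \<theta> * u1 \<theta> / \<Lambda>) - Q \<theta> \<le> 0" by (rule le_iff_diff_le_0[THEN iffD1])
      show "0 \<le> exp (\<kappa> / \<Lambda> * cot \<theta>) * (\<kappa> / \<Lambda>) * (inverse ((sin \<theta>)\<^sup>2) * sin \<theta> ^ Suc k)"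
        using kap L(2) s by (intro mult_nonneg_nonneg divide_nonneg_nonneg) auto
    qed
    finally show ?thesis using dHD by blast
  qed
  have e: "(real d - 2) / sqrt (geg_eigen d l) = \<kappa> / \<Lambda>" "d - 2 = Suc k" by (auto simp: \<kappa>_def \<Lambda>_def L_def k)
  have s: "sin \<theta> > 0" and c: "cos \<theta> > 0" using \<theta> by (auto intro: sin_gt_zero cos_gt_zero)
  have sin_le: "sin x ^ Suc k \<le> (\<kappa> / \<Lambda>) ^ Suc k" if x: "0 < x" "x < pi / 2" "\<Lambda> * sin x \<le> \<kappa> * cos x" for x
  proof -
    have "\<kappa> * cos x \<le> \<kappa> * 1" using kap by (intro mult_left_mono) auto
    then have "\<Lambda> * sin x \<le> \<kappa>" using x(3) by linarith
    then have "sin x \<le> \<kappa> / \<Lambda>" using L by (simp add: field_simps)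
    then show ?thesis using x by (intro power_mono sin_ge_zero) auto
  qed
  have kL: "(\<kappa> / \<Lambda>) ^ Suc k \<ge> 0" using kap L by (intro zero_le_power) auto
  have "(u \<theta>)\<^sup>2 * sin \<theta> ^ Suc k \<le> 9 * (\<kappa> / \<Lambda>) ^ Suc k"
  proof (cases "\<Lambda> * sin \<theta> \<le> \<kappa> * cos \<theta>")
    case True
    have "(u \<theta>)\<^sup>2 \<le> E \<theta>" by (simp add: E_def)
    then have "(u \<theta>)\<^sup>2 * sin \<theta> ^ Suc k \<le> 1 * (\<kappa> / \<Lambda>) ^ Suc k"
      using E1[OF \<theta>] sin_le[OF \<theta> True] s by (intro mult_mono) auto
    then show ?thesis using kL by linarith
  next
    case False
    \<comment> \<open>The angle from which on \<open>G\<close> is comparable to the undamped energy \<open>E\<close>.\<close>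
    define \<theta>0 where "\<theta>0 = arctan (\<kappa> / \<Lambda>)"
    have t0: "0 < \<theta>0" "\<theta>0 < pi / 2" using kap L arctan_ubound by (auto simp: \<theta>0_def)
    have tan0: "tan \<theta>0 = \<kappa> / \<Lambda>" unfolding \<theta>0_def by (rule arctan[THEN conjunct2, THEN conjunct2])
    have "\<kappa> / \<Lambda> < tan \<theta>" using False L c by (simp add: tan_def field_simps not_le)
    then have "\<theta>0 < \<theta>" unfolding tan0[symmetric] using t0 \<theta> tan_monotone'[of \<theta>0 \<theta>] by simp
    have cot: "\<kappa> * cos x \<le> \<Lambda> * sin x" if "\<theta>0 \<le> x" "x \<le> \<theta>" for x
    proof -
      have x: "0 < x" "x < pi / 2" using that t0 \<theta> by auto
      have "tan \<theta>0 \<le> tan x" using that t0 x by (intro tan_mono_le) auto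
      moreover have "cos x > 0" using x by (intro cos_gt_zero) auto
      ultimately show ?thesis unfolding tan0 using L by (simp add: tan_def field_simps)
    qed
    have "H \<theta> \<le> H \<theta>0"
    proof (rule DERIV_nonpos_imp_nonincreasing[where f=H])
      show "\<theta>0 \<le> \<theta>" using \<open>\<theta>0 < \<theta>\<close> by simp
      fix x assume "\<theta>0 \<le> x" "x \<le> \<theta>"
      then show "\<exists>y. (H has_real_derivative y) (at x) \<and> y \<le> 0" using t0 \<theta> by (intro dH cot) auto
    qed
    have s0: "sin \<theta>0 > 0" "cos \<theta>0 > 0" using t0 by (auto intro: sin_gt_zero cos_gt_zero)
    have "\<Lambda> * sin \<theta>0 = \<kappa> * cos \<theta>0" using tan0 s0 L by (simp add: tan_def field_simps)
    then have "sin \<theta>0 ^ Suc k \<le> (\<kappa> / \<Lambda>) ^ Suc k" by (intro sin_le t0) simp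
    moreover have "Q \<theta>0 \<le> 3 / 2" using Q_bounds(2)[OF t0 cot] E1[OF t0] \<open>\<theta>0 < \<theta>\<close> by simp
    moreover have "0 \<le> E \<theta>0" by (simp add: E_def)
    then have "0 \<le> Q \<theta>0" using Q_bounds(1)[OF t0 cot] \<open>\<theta>0 < \<theta>\<close> by simp
    ultimately have "G \<theta>0 \<le> (\<kappa> / \<Lambda>) ^ Suc k * (3 / 2)" unfolding G_def using s0 kL by (intro mult_mono) auto
    moreover have "\<kappa> / \<Lambda> * cot \<theta>0 = 1"
    proof -
      have "\<kappa> / \<Lambda> * cot \<theta>0 = (\<kappa> * cos \<theta>0) / (\<Lambda> * sin \<theta>0)" by (simp add: cot_def)
      moreover have "\<Lambda> * sin \<theta>0 > 0" using s0(1) L(2) by (rule mult_pos_pos[rotated])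
      ultimately show ?thesis using \<open>\<Lambda> * sin \<theta>0 = \<kappa> * cos \<theta>0\<close> by (metis divide_self less_irrefl)
    qed
    ultimately have "H \<theta>0 \<le> (\<kappa> / \<Lambda>) ^ Suc k * (3 / 2) * exp 1" unfolding H_def by (metis exp_ge_zero mult_right_mono)
    also have "\<dots> \<le> (\<kappa> / \<Lambda>) ^ Suc k * (3 / 2) * 3" using exp_le kL by (intro mult_left_mono) auto
    finally have H0: "H \<theta> \<le> 9 / 2 * (\<kappa> / \<Lambda>) ^ Suc k" using \<open>H \<theta> \<le> H \<theta>0\<close> by simp
    have Qt: "E \<theta> / 2 \<le> Q \<theta>" by (rule Q_bounds(1)[OF \<theta> cot]) (use \<open>\<theta>0 < \<theta>\<close> in auto)
    have "0 \<le> E \<theta>" by (simp add: E_def)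
    then have "0 \<le> G \<theta>" unfolding G_def using Qt s by (intro mult_nonneg_nonneg) auto
    moreover have "cot \<theta> \<ge> 0" using s c by (simp add: cot_def)
    ultimately have "G \<theta> * 1 \<le> H \<theta>" unfolding H_def using kap L by (intro mult_left_mono) auto
    moreover have "(u \<theta>)\<^sup>2 / 2 * sin \<theta> ^ Suc k \<le> G \<theta>"
    proof -
      have "(u \<theta>)\<^sup>2 / 2 \<le> Q \<theta>" using Qt by (simp add: E_def) (smt (verit) zero_le_power2 divide_nonneg_pos)
      then have "sin \<theta> ^ Suc k * ((u \<theta>)\<^sup>2 / 2) \<le> G \<theta>" unfolding G_def using s by (intro mult_left_mono) auto
      then show ?thesis by (simp add: mult.commute)
    qed
    ultimately show ?thesis using H0 by simp
  qed
  then show ?thesis unfolding e u_def p_def .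
qed

lemma geg_2_cos:
  assumes "l \<ge> 1"
  shows "poly (geg 2 l) (cos \<theta>) = cos (real l * \<theta>)"
proof -
  define L where "L = real l"
  have L: "L > 0" using assms by (simp add: L_def)
  have eig: "geg_eigen 2 l = L\<^sup>2" by (simp add: geg_eigen_def L_def power2_eq_square)
  define p where "p = geg 2 l"
  define D where "D \<theta> = poly p (cos \<theta>) - cos (L * \<theta>)" for \<theta>
  define D1 where "D1 \<theta> = poly (pderiv p) (cos \<theta>) * (- sin \<theta>) + L * sin (L * \<theta>)" for \<theta>
  have d0: "(D has_real_derivative D1 \<theta>) (at \<theta>)" for \<theta> unfolding D_def D1_def
    by (rule DERIV_diff[THEN DERIV_cong], rule DERIV_chain2[OF poly_DERIV DERIV_cos])
       (auto intro!: derivative_eq_intros)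
  have d1: "(D1 has_real_derivative - (L\<^sup>2) * D \<theta>) (at \<theta>)" for \<theta>
  proof -
    have ode: "(1 - (cos \<theta>)\<^sup>2) * poly (pderiv (pderiv p)) (cos \<theta>) = cos \<theta> * poly (pderiv p) (cos \<theta>) - L\<^sup>2 * poly p (cos \<theta>)"
      using geg_ode_geg[of 2 l] unfolding geg_ode_poly eig p_def[symmetric] by (simp add: algebra_simps)
    have "((\<lambda>\<theta>. poly (pderiv p) (cos \<theta>)) has_real_derivative poly (pderiv (pderiv p)) (cos \<theta>) * (- sin \<theta>)) (at \<theta>)"
      by (rule DERIV_chain2[OF poly_DERIV DERIV_cos])
    then have "(D1 has_real_derivative (poly (pderiv (pderiv p)) (cos \<theta>) * (- sin \<theta>)) * (- sin \<theta>)
        + (- cos \<theta>) * poly (pderiv p) (cos \<theta>) + L * (cos (L * \<theta>) * L)) (at \<theta>)"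
      unfolding D1_def by (auto intro!: derivative_eq_intros)
    also have "(poly (pderiv (pderiv p)) (cos \<theta>) * (- sin \<theta>)) * (- sin \<theta>) + (- cos \<theta>) * poly (pderiv p) (cos \<theta>) + L * (cos (L * \<theta>) * L)
      = (1 - (cos \<theta>)\<^sup>2) * poly (pderiv (pderiv p)) (cos \<theta>) - cos \<theta> * poly (pderiv p) (cos \<theta>) + L\<^sup>2 * cos (L * \<theta>)"
      unfolding sin_squared_eq[symmetric] by (simp add: power2_eq_square algebra_simps)
    also have "\<dots> = - (L\<^sup>2) * D \<theta>" unfolding ode D_def by (simp add: algebra_simps)
    finally show ?thesis .
  qed
  have "((\<lambda>\<theta>. (D1 \<theta>)\<^sup>2 + L\<^sup>2 * (D \<theta>)\<^sup>2) has_real_derivative 0) (at \<theta>)" for \<theta>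
    by (auto intro!: derivative_eq_intros d0 d1 simp: algebra_simps)
  then have "(D1 \<theta>)\<^sup>2 + L\<^sup>2 * (D \<theta>)\<^sup>2 = (D1 0)\<^sup>2 + L\<^sup>2 * (D 0)\<^sup>2"
    by (intro DERIV_isconst_all[of "\<lambda>\<theta>. (D1 \<theta>)\<^sup>2 + L\<^sup>2 * (D \<theta>)\<^sup>2"]) auto
  also have "\<dots> = 0" by (simp add: D_def D1_def p_def)
  finally have "L\<^sup>2 * (D \<theta>)\<^sup>2 = 0"
    using zero_le_power2[of "D1 \<theta>"] zero_le_power2[of "D \<theta>"] L by (smt (verit) mult_nonneg_nonneg zero_le_power2)
  then show ?thesis using L by (simp add: D_def p_def L_def)
qed

text \<open>The Fejer kernel of the interval \<open>[0, B]\<close>, up to normalisation.\<close>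

lemma fejer_bound:
  fixes B u :: real
  assumes B: "B > 0"
  shows "\<bar>LINT t|lborel. ((B - t) * cos (u * t)) * indicator {0..B} t\<bar> \<le> (B\<^sup>2 / 2 + 2) / (1 + u\<^sup>2)"
proof -
  define k where "k = (LINT t|lborel. ((B - t) * cos (u * t)) * indicator {0..B} t)"
  have "\<bar>k\<bar> \<le> (LINT t|lborel. \<bar>((B - t) * cos (u * t)) * indicator {0..B} t\<bar>)"
    unfolding k_def by (rule integral_abs_bound)
  also have "\<dots> \<le> (LINT t|lborel. (B - t) * indicator {0..B} t)"
  proof (rule integral_mono)
    show "integrable lborel (\<lambda>t. \<bar>(B - t) * cos (u * t) * indicat_real {0..B} t\<bar>)"
      by (intro integrable_abs integrable_continuous_Icc continuous_intros)
    show "integrable lborel (\<lambda>t. (B - t) * indicator {0..B} t)" by (intro integrable_continuous_Icc continuous_intros)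
    show "\<bar>(B - t) * cos (u * t) * indicat_real {0..B} t\<bar> \<le> (B - t) * indicator {0..B} t" for t
      by (auto simp: abs_mult intro!: mult_left_le split: split_indicator)
  qed
  also have "\<dots> = (B * B - B\<^sup>2 / 2) - (B * 0 - 0\<^sup>2 / 2)"
    using B by (intro integral_FTC_Icc_real) (auto intro!: derivative_eq_intros)
  finally have 1: "\<bar>k\<bar> \<le> B\<^sup>2 / 2" by (simp add: power2_eq_square)
  have 2: "u\<^sup>2 * \<bar>k\<bar> \<le> 2"
  proof (cases "u = 0")
    case False
    have "k = ((B - B) * sin (u * B) / u - cos (u * B) / u\<^sup>2) - ((B - 0) * sin (u * 0) / u - cos (u * 0) / u\<^sup>2)"
      unfolding k_def
    proof (rule integral_FTC_Icc_real)
      show "((\<lambda>t. (B - t) * sin (u * t) / u - cos (u * t) / u\<^sup>2) has_real_derivative (B - t) * cos (u * t)) (at t)" for t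
      proof -
        have "((\<lambda>t. (B - t) * sin (u * t) / u - cos (u * t) / u\<^sup>2) has_real_derivative
          ((0 - 1) * sin (u * t) + (cos (u * t) * u) * (B - t)) / u - (- sin (u * t) * u) / u\<^sup>2) (at t)"
          by (intro DERIV_diff DERIV_cdivide DERIV_mult DERIV_const DERIV_ident) (auto intro!: derivative_eq_intros)
        moreover have "((0 - 1) * sin (u * t) + (cos (u * t) * u) * (B - t)) / u - (- sin (u * t) * u) / u\<^sup>2 = (B - t) * cos (u * t)"
          using False by (simp add: power2_eq_square field_simps)
        ultimately show ?thesis by (simp only:)
      qed
    qed (use B in \<open>auto intro!: continuous_intros\<close>)
    then have "u\<^sup>2 * k = 1 - cos (u * B)" using False by (simp add: field_simps)
    moreover have "\<bar>1 - cos (u * B)\<bar> \<le> 2" using cos_ge_minus_one[of "u * B"] cos_le_one[of "u * B"] by linarith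
    ultimately show ?thesis by (metis abs_mult abs_power2)
  qed simp
  have "\<bar>k\<bar> * (1 + u\<^sup>2) \<le> B\<^sup>2 / 2 + 2" using 1 2 by (simp add: algebra_simps)
  moreover have "1 + u\<^sup>2 > 0" by (simp add: add_pos_nonneg)
  ultimately show ?thesis unfolding k_def[symmetric] by (simp add: pos_le_divide_eq)
qed

lemma powr_minus_half:
  fixes L :: real
  assumes "L > 0"
  shows "L powr (-1/2) = 1 / sqrt L"
proof -
  have "L powr (-1/2) = L powr (- (1/2))" by simp
  also have "\<dots> = inverse (L powr (1/2))" by (rule powr_minus)
  also have "L powr (1/2) = sqrt L" using assms by (intro powr_half_sqrt) simp
  finally show ?thesis by (simp only: inverse_eq_divide)
qed

context weight
begin

abbreviation mult_tail :: "nat \<Rightarrow> ennreal" where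
  "mult_tail l \<equiv> \<integral>\<^sup>+t\<in>{geg_eigen d l powr (-1/2)<..<T}. ennreal ((mult l t)\<^sup>2 / t) \<partial>lborel"

lemma mult_sq_le: "0 < t \<Longrightarrow> t \<le> T \<Longrightarrow> (mult l t)\<^sup>2 \<le> av t (\<lambda>x. (poly (geg d l) (cos x))\<^sup>2)"
proof -
  assume t: "0 < t" "t \<le> T"
  define m where "m = mult l t"
  have "0 = av t (\<lambda>_. 0)" by (simp add: av_const t)
  also have "\<dots> \<le> av t (\<lambda>x. (poly (geg d l) (cos x))\<^sup>2 - ((2 * m) * poly (geg d l) (cos x) - m\<^sup>2))"
  proof (intro av_mono t continuous_intros)
    fix x :: real
    have "(poly (geg d l) (cos x))\<^sup>2 - ((2 * m) * poly (geg d l) (cos x) - m\<^sup>2) = (poly (geg d l) (cos x) - m)\<^sup>2"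
      by (simp add: power2_diff)
    then show "0 \<le> (poly (geg d l) (cos x))\<^sup>2 - ((2 * m) * poly (geg d l) (cos x) - m\<^sup>2)" by simp
  qed
  also have "\<dots> = av t (\<lambda>x. (poly (geg d l) (cos x))\<^sup>2) - (2 * m * m - m\<^sup>2)"
    by (subst av_diff[OF t], intro continuous_intros, intro continuous_intros,
        subst av_diff[OF t], intro continuous_intros, intro continuous_intros,
        simp add: av_cmult av_const t mult_def[symmetric] m_def)
  finally show ?thesis by (simp add: m_def power2_eq_square)
qed

text \<open>
  In dimension at least \<open>3\<close> the Gegenbauer polynomials themselves decay, and so do their averages
  for \<open>t \<le> T/2\<close>; the remaining \<open>t\<close> contribute a constant.
\<close>

lemma mult_decay_high:
  assumes d3: "d \<ge> 3"
  obtains C where "C \<ge> 0" "\<And>l. l \<ge> 1 \<Longrightarrow>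
    mult_tail l \<le> ennreal C"
proof -
  define I where "I = (LINT x|lborel. x ^ (d - 2) * \<rho> x)"
  define I0 where "I0 = (LINT x|lborel. \<rho> x)"
  have I: "I > 0" "I0 > 0" unfolding I_def I0_def by (rule moment_pos, rule rho_pos)
  define C1 where "C1 = 9 * ((real d - 2) * T) ^ (d - 2) * I0 / (jac_const * I)"
  have C1: "C1 \<ge> 0" unfolding C1_def using I jac_const_pos T d3 by (intro divide_nonneg_pos mult_nonneg_nonneg zero_le_power) auto
  have "mult_tail l \<le> ennreal (C1 + 1)"
    if l: "l \<ge> 1" for l
  proof -
    define L where "L = geg_eigen d l"
    have L: "L \<ge> 1" unfolding L_def by (rule geg_eigen_ge_1[OF l])
    define s where "s = L powr (-1/2)"
    have s: "s > 0" using L by (simp add: s_def)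
    have s_eq: "s = 1 / sqrt L" unfolding s_def using L by (intro powr_minus_half) simp
    have small: "(mult l t)\<^sup>2 \<le> C1 * (s / t)" if t: "s < t" "t \<le> T / 2" for t
    proof -
      have t': "0 < t" "t \<le> T" using t s T by auto
      have "(mult l t)\<^sup>2 \<le> av t (\<lambda>x. (poly (geg d l) (cos x))\<^sup>2)" by (rule mult_sq_le[OF t'])
      also have "\<dots> = (LINT x|lborel. (poly (geg d l) (cos (t * x / T)))\<^sup>2 * w t x) / Z t" by (simp add: av_def)
      also have "\<dots> \<le> (9 * ((real d - 2) / sqrt L) ^ (d - 2) * I0) / Z t"
      proof (rule divide_right_mono)
        have "(LINT x|lborel. (poly (geg d l) (cos (t * x / T)))\<^sup>2 * w t x) \<le> (LINT x|lborel. 9 * ((real d - 2) / sqrt L) ^ (d - 2) * \<rho> x)"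
        proof (rule integral_mono)
          show "integrable lborel (\<lambda>x. (poly (geg d l) (cos (t * x / T)))\<^sup>2 * w t x)"
            by (rule av_integrable[OF t', of "\<lambda>x. (poly (geg d l) (cos x))\<^sup>2"]) (intro continuous_intros)
          show "integrable lborel (\<lambda>x. 9 * ((real d - 2) / sqrt L) ^ (d - 2) * \<rho> x)"
            by (intro integrable_mult_right rho_integrable)
          fix x
          show "(poly (geg d l) (cos (t * x / T)))\<^sup>2 * w t x \<le> 9 * ((real d - 2) / sqrt L) ^ (d - 2) * \<rho> x"
          proof (cases "x \<in> {0<..<T}")
            case True
            note r = angle_range[OF t' True]
            have "t * x / T < pi / 2" using r t T by linarith
            then have "(poly (geg d l) (cos (t * x / T)))\<^sup>2 * sin (t * x / T) ^ (d - 2) \<le> 9 * ((real d - 2) / sqrt L) ^ (d - 2)"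
              unfolding L_def using L r by (intro geg_decay[OF d3]) (auto simp: L_def)
            from mult_right_mono[OF this rho_nonneg[of x]] show ?thesis by (simp add: w_def mult.assoc)
          qed (simp add: w_def rho_support)
        qed
        then show "(LINT x|lborel. (poly (geg d l) (cos (t * x / T)))\<^sup>2 * w t x) \<le> 9 * ((real d - 2) / sqrt L) ^ (d - 2) * I0"
          by (simp add: I0_def)
      qed (use Z_pos[OF t'] in simp)
      also have "\<dots> \<le> (9 * ((real d - 2) / sqrt L) ^ (d - 2) * I0) / (jac_const * (t / T) ^ (d - 2) * I)"
        using Z_lower[OF t'(1) t(2)] L I jac_const_pos t' T d3 unfolding I_def[symmetric]
        by (intro divide_left_mono mult_nonneg_nonneg mult_pos_pos zero_less_power zero_le_power Z_pos) auto
      also have "\<dots> = C1 * (s / t) ^ (d - 2)"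
      proof -
        have "((real d - 2) / sqrt L) ^ (d - 2) = (real d - 2) ^ (d - 2) * s ^ (d - 2)"
          unfolding s_eq by (simp only: power_mult_distrib[symmetric] times_divide_eq_right mult_1_right)
        then show ?thesis
          using T t' I jac_const_pos unfolding C1_def power_divide power_mult_distrib by simp (simp only: mult_ac)
      qed
      also have "(s / t) ^ (d - 2) \<le> (s / t) ^ 1" using t t' s d3 by (intro power_decreasing) auto
      finally show ?thesis using C1 by (simp add: mult_left_mono)
    qed
    have pt: "ennreal ((mult l t)\<^sup>2 / t) * indicator {s<..<T} t
      \<le> ennreal (C1 * s) * (ennreal (t powr (- 1 - 1)) * indicator {s..} t) + ennreal (2 / T) * indicator {T / 2..T} t" for t
    proof (cases "t \<in> {s<..<T}")
      case True
      then have t: "0 < t" "t \<le> T" "s < t" using s by auto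
      show ?thesis
      proof (cases "t \<le> T / 2")
        case le: True
        have "(mult l t)\<^sup>2 / t \<le> C1 * (s / t) / t" using small[OF t(3) le] t by (intro divide_right_mono) auto
        also have "\<dots> = (C1 * s) * t powr (- 1 - 1)"
          using t by (simp add: powr_minus powr_numeral power2_eq_square divide_inverse)
        finally have "ennreal ((mult l t)\<^sup>2 / t) \<le> ennreal (C1 * s) * ennreal (t powr (- 1 - 1))"
          using C1 s by (simp add: ennreal_mult[symmetric] ennreal_leI)
        then show ?thesis using True by (auto split: split_indicator intro: add_increasing2)
      next
        case gt: False
        have "(mult l t)\<^sup>2 \<le> 1" using mult_le_1[OF t(1,2), of l] by (simp add: abs_square_le_1)
        then have "(mult l t)\<^sup>2 / t \<le> 1 / (T / 2)" using gt t T by (intro frac_le) auto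
        then have "ennreal ((mult l t)\<^sup>2 / t) \<le> ennreal (2 / T)" by (intro ennreal_leI) simp
        then show ?thesis using True gt by (auto split: split_indicator intro: add_increasing)
      qed
    qed simp
    have "(\<integral>\<^sup>+t\<in>{s<..<T}. ennreal ((mult l t)\<^sup>2 / t) \<partial>lborel)
      \<le> (\<integral>\<^sup>+t. ennreal (C1 * s) * (ennreal (t powr (- 1 - 1)) * indicator {s..} t) + ennreal (2 / T) * indicator {T / 2..T} t \<partial>lborel)"
      by (intro nn_integral_mono pt)
    also have "\<dots> = ennreal (C1 * s) * ennreal (s powr (- 1) / 1) + ennreal (2 / T) * ennreal (T - T / 2)"
    proof -
      have "(\<integral>\<^sup>+t. ennreal (2 / T) * indicator {T / 2..T} t \<partial>lborel) = ennreal (2 / T) * ennreal (T - T / 2)"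
        using T by (subst nn_integral_cmult_indicator) auto
      then show ?thesis using s nn_integral_powr_near_infinity[of 1 s] by (simp add: nn_integral_add nn_integral_cmult)
    qed
    also have "\<dots> = ennreal (C1 + 1)"
    proof -
      have "C1 * s * (s powr (- 1) / 1) = C1" using s by (simp add: powr_minus divide_inverse)
      then have e1: "ennreal (C1 * s) * ennreal (s powr (- 1) / 1) = ennreal C1"
        using C1 s by (subst ennreal_mult[symmetric]) auto
      have "2 / T * (T - T / 2) = 1" using T by (simp add: field_simps)
      then have e2: "ennreal (2 / T) * ennreal (T - T / 2) = ennreal 1" using T by (subst ennreal_mult[symmetric]) auto
      show ?thesis unfolding e1 e2 by (rule ennreal_plus[symmetric]) (use C1 in auto)
    qed
    finally show ?thesis by (simp add: s_def L_def)
  qed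
  then show ?thesis using that[of "C1 + 1"] C1 by simp
qed

lemma fubini_rho:
  fixes g :: "real \<Rightarrow> real \<Rightarrow> real"
  assumes V: "integrable lborel V" and g [measurable]: "(\<lambda>(t, x). g t x) \<in> borel_measurable (borel \<Otimes>\<^sub>M borel)"
    and g1: "\<And>t x. \<bar>g t x\<bar> \<le> 1"
  shows "(LINT t|lborel. V t * (LINT x|lborel. g t x * \<rho> x)) = (LINT x|lborel. \<rho> x * (LINT t|lborel. V t * g t x))"
proof -
  note [measurable] = borel_measurable_integrable[OF V]
  have "integrable (lborel \<Otimes>\<^sub>M lborel) (\<lambda>(t, x). V t * (g t x * \<rho> x))"
  proof (rule Bochner_Integration.integrable_bound)
    show "integrable (lborel \<Otimes>\<^sub>M lborel) (\<lambda>(t, x). V t * \<rho> x)"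
    proof (rule lborel_pair.Fubini_integrable)
      have "(LINT x|lborel. norm (case (t, x) of (t, x) \<Rightarrow> V t * \<rho> x)) = \<bar>V t\<bar> * (LINT x|lborel. \<rho> x)" for t
        using rho_nonneg by (simp add: abs_mult)
      then show "integrable lborel (\<lambda>t. LINT x|lborel. norm (case (t, x) of (t, x) \<Rightarrow> V t * \<rho> x))" using V by simp
      show "AE t in lborel. integrable lborel (\<lambda>x. case (t, x) of (t, x) \<Rightarrow> V t * \<rho> x)" using rho_integrable by simp
    qed measurable
    show "AE x in lborel \<Otimes>\<^sub>M lborel. norm (case x of (t, x) \<Rightarrow> V t * (g t x * \<rho> x)) \<le> norm (case x of (t, x) \<Rightarrow> V t * \<rho> x)"
    proof (rule AE_I2, clarify)
      fix t x
      have "\<bar>g t x\<bar> * \<bar>\<rho> x\<bar> \<le> 1 * \<bar>\<rho> x\<bar>" by (intro mult_right_mono g1) auto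
      then show "norm (V t * (g t x * \<rho> x)) \<le> norm (V t * \<rho> x)" by (simp add: abs_mult mult_left_mono)
    qed
  qed measurable
  then have "(LINT x|lborel. LINT t|lborel. V t * (g t x * \<rho> x)) = (LINT t|lborel. LINT x|lborel. V t * (g t x * \<rho> x))"
    by (rule lborel_pair.Fubini_integral[of "\<lambda>t x. V t * (g t x * \<rho> x)"])
  moreover have "(LINT t|lborel. V t * (g t x * \<rho> x)) = \<rho> x * (LINT t|lborel. V t * g t x)" for x
    by (subst integral_mult_right_zero[symmetric]) (simp add: mult_ac)
  ultimately show ?thesis by simp
qed

text \<open>Up to normalisation, the Poisson kernel of the half plane at height \<open>1 / c\<close>.\<close>

definition poisson :: "real \<Rightarrow> real \<Rightarrow> real \<Rightarrow> real" where
  "poisson c x y = 1 / (1 + (c * (x - y))\<^sup>2)"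

lemma poisson_nonneg: "0 \<le> poisson c x y" by (simp add: poisson_def)

text \<open>Schur's test: the kernel has mass at most \<open>\<pi> / c\<close> in each variable.\<close>

lemma poisson_schur:
  assumes c: "c > 0"
  shows "(LINT x|lborel. \<rho> x * (LINT y|lborel. \<rho> y * poisson c x y)) \<le> pi / c * (LINT x|lborel. (\<rho> x)\<^sup>2)"
    and "integrable lborel (\<lambda>x. \<rho> x * (LINT y|lborel. \<rho> y * poisson c x y))"
    and "integrable lborel (\<lambda>y. \<rho> y * poisson c x y)"
proof -
  define h where "h = poisson c"
  have h_meas [measurable]: "(\<lambda>(x, y). h x y) \<in> borel_measurable (borel \<Otimes>\<^sub>M borel)"
    unfolding h_def poisson_def by measurable
  let ?D = "\<integral>\<^sup>+x. \<integral>\<^sup>+y. ennreal ((\<rho> x)\<^sup>2) * (ennreal (h x y) * indicator {0..T} y) \<partial>lborel \<partial>lborel"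
  have pos: "1 + (c * (x - y))\<^sup>2 > 0" for x y by (simp add: add_pos_nonneg)
  have h: "0 \<le> h x y" "h x y \<le> 1" for x y using pos[of x y] by (auto simp: h_def poisson_def divide_le_eq)
  have h_sym: "h x y = h y x" for x y by (simp add: h_def poisson_def power2_commute power_mult_distrib)
  show int1: "integrable lborel (\<lambda>y. \<rho> y * poisson c x y)" for x
  proof -
    have "(\<lambda>y. h x y) \<in> borel_measurable borel" by measurable
    from integrable_mult_rho[OF this, of 1] show ?thesis using h by (simp add: h_def mult.commute)
  qed
  then have int1': "integrable lborel (\<lambda>y. \<rho> y * h x y)" for x by (simp add: h_def)
  define g where "g x = (LINT y|lborel. \<rho> y * h x y)" for x
  have g_meas [measurable]: "g \<in> borel_measurable borel" unfolding g_def by measurable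
  have g: "0 \<le> g x" "g x \<le> (LINT y|lborel. \<rho> y)" for x
  proof -
    show "0 \<le> g x" unfolding g_def using h rho_nonneg by (intro integral_nonneg_AE) auto
    show "g x \<le> (LINT y|lborel. \<rho> y)" unfolding g_def
      by (intro integral_mono int1' rho_integrable) (use h rho_nonneg in \<open>auto intro: mult_left_le\<close>)
  qed
  have int2: "integrable lborel (\<lambda>x. \<rho> x * g x)"
    using integrable_mult_rho[of g "LINT y|lborel. \<rho> y"] g by (simp add: mult.commute)
  then show "integrable lborel (\<lambda>x. \<rho> x * (LINT y|lborel. \<rho> y * poisson c x y))" by (simp add: g_def h_def)
  have arct: "(\<integral>\<^sup>+y. ennreal (h x y) * indicator {0..T} y \<partial>lborel) \<le> ennreal (pi / c)" for x
  proof -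
    have "(\<integral>\<^sup>+y. ennreal (h x y) * indicator {0..T} y \<partial>lborel) = ennreal (arctan (c * (T - x)) / c - arctan (c * (0 - x)) / c)"
    proof (rule nn_integral_FTC_Icc)
      show "((\<lambda>y. arctan (c * (y - x)) / c) has_real_derivative h x y) (at y)" for y
      proof -
        have "((\<lambda>y. arctan (c * (y - x)) / c) has_real_derivative (inverse (1 + (c * (y - x))\<^sup>2) * (c * (1 - 0))) / c) (at y)"
          by (intro DERIV_cdivide DERIV_chain2[OF DERIV_arctan] DERIV_cmult DERIV_diff DERIV_ident DERIV_const)
        moreover have "(inverse (1 + (c * (y - x))\<^sup>2) * (c * (1 - 0))) / c = h x y"
          using c unfolding h_sym[of x y] by (simp add: h_def poisson_def divide_inverse)
        ultimately show ?thesis by (simp only:)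
      qed
    qed (use T h in auto)
    also have "\<dots> \<le> ennreal (pi / c)"
    proof (rule ennreal_leI)
      have "arctan (c * (T - x)) - arctan (c * (0 - x)) \<le> pi"
        using arctan_bounded[of "c * (T - x)"] arctan_bounded[of "c * (0 - x)"] by linarith
      then show "arctan (c * (T - x)) / c - arctan (c * (0 - x)) / c \<le> pi / c"
        unfolding diff_divide_distrib[symmetric] using c by (intro divide_right_mono) auto
    qed
    finally show ?thesis .
  qed
  have part: "?D
      \<le> ennreal (pi / c * (LINT x|lborel. (\<rho> x)\<^sup>2))"
  proof -
    have "?D
      = (\<integral>\<^sup>+x. ennreal ((\<rho> x)\<^sup>2) * (\<integral>\<^sup>+y. ennreal (h x y) * indicator {0..T} y \<partial>lborel) \<partial>lborel)"
      by (intro nn_integral_cong nn_integral_cmult) measurable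
    also have "\<dots> \<le> (\<integral>\<^sup>+x. ennreal ((\<rho> x)\<^sup>2) * ennreal (pi / c) \<partial>lborel)"
      by (intro nn_integral_mono mult_left_mono arct) auto
    also have "\<dots> = (\<integral>\<^sup>+x. ennreal ((\<rho> x)\<^sup>2) \<partial>lborel) * ennreal (pi / c)" by (rule nn_integral_multc) measurable
    also have "(\<integral>\<^sup>+x. ennreal ((\<rho> x)\<^sup>2) \<partial>lborel) = ennreal (LINT x|lborel. (\<rho> x)\<^sup>2)"
      by (rule nn_integral_eq_integral[OF rho_sq]) auto
    finally show ?thesis using c by (simp add: ennreal_mult[symmetric] mult.commute)
  qed
  have "ennreal (LINT x|lborel. \<rho> x * g x) = (\<integral>\<^sup>+x. ennreal (\<rho> x * g x) \<partial>lborel)"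
    using g rho_nonneg by (intro nn_integral_eq_integral[symmetric] int2) auto
  also have "\<dots> = (\<integral>\<^sup>+x. \<integral>\<^sup>+y. ennreal (\<rho> x) * ennreal (\<rho> y * h x y) \<partial>lborel \<partial>lborel)"
  proof (intro nn_integral_cong)
    fix x
    have "(\<integral>\<^sup>+y. ennreal (\<rho> y * h x y) \<partial>lborel) = ennreal (g x)"
      unfolding g_def using h rho_nonneg by (intro nn_integral_eq_integral int1') auto
    then show "ennreal (\<rho> x * g x) = (\<integral>\<^sup>+y. ennreal (\<rho> x) * ennreal (\<rho> y * h x y) \<partial>lborel)"
      using rho_nonneg g by (subst nn_integral_cmult) (auto simp: ennreal_mult)
  qed
  also have "\<dots> \<le> (\<integral>\<^sup>+x. \<integral>\<^sup>+y. ennreal (1/2) * (ennreal ((\<rho> x)\<^sup>2) * (ennreal (h x y) * indicator {0..T} y))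
      + ennreal (1/2) * (ennreal ((\<rho> y)\<^sup>2) * (ennreal (h y x) * indicator {0..T} x)) \<partial>lborel \<partial>lborel)"
  proof (intro nn_integral_mono)
    fix x y
    show "ennreal (\<rho> x) * ennreal (\<rho> y * h x y) \<le> ennreal (1/2) * (ennreal ((\<rho> x)\<^sup>2) * (ennreal (h x y) * indicator {0..T} y))
      + ennreal (1/2) * (ennreal ((\<rho> y)\<^sup>2) * (ennreal (h y x) * indicator {0..T} x))"
    proof (cases "x \<in> {0<..<T} \<and> y \<in> {0<..<T}")
      case True
      have "\<rho> x * \<rho> y * h x y \<le> ((\<rho> x)\<^sup>2 + (\<rho> y)\<^sup>2) / 2 * h x y"
        using sum_squares_bound[of "\<rho> x" "\<rho> y"] h by (intro mult_right_mono) auto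
      then have "ennreal (\<rho> x * (\<rho> y * h x y)) \<le> ennreal (1/2 * ((\<rho> x)\<^sup>2 * h x y) + 1/2 * ((\<rho> y)\<^sup>2 * h y x))"
        unfolding h_sym[of y x] by (intro ennreal_leI) (simp add: field_simps)
      also have "\<dots> = ennreal (1/2) * (ennreal ((\<rho> x)\<^sup>2) * ennreal (h x y)) + ennreal (1/2) * (ennreal ((\<rho> y)\<^sup>2) * ennreal (h y x))"
        using h by (simp only: ennreal_plus ennreal_mult mult_nonneg_nonneg zero_le_power2 zero_le_divide_1_iff zero_le_numeral)
      finally have "ennreal (\<rho> x * (\<rho> y * h x y)) \<le> \<dots>" .
      then show ?thesis using True h rho_nonneg by (simp add: ennreal_mult[symmetric] mult_nonneg_nonneg)
    next
      case False
      then have "\<rho> x = 0 \<or> \<rho> y = 0" using rho_support by blast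
      then show ?thesis by auto
    qed
  qed
  also have "\<dots> = ennreal (1/2) * ?D
      + ennreal (1/2) * (\<integral>\<^sup>+x. \<integral>\<^sup>+y. ennreal ((\<rho> y)\<^sup>2) * (ennreal (h y x) * indicator {0..T} x) \<partial>lborel \<partial>lborel)"
    by (simp add: nn_integral_add nn_integral_cmult del: ennreal_1 ennreal_half)
  also have "(\<integral>\<^sup>+x. \<integral>\<^sup>+y. ennreal ((\<rho> y)\<^sup>2) * (ennreal (h y x) * indicator {0..T} x) \<partial>lborel \<partial>lborel)
     = ?D"
    by (rule lborel_pair.Fubini'[of "\<lambda>x y. ennreal ((\<rho> y)\<^sup>2) * (ennreal (h y x) * indicator {0..T} x)", symmetric]) measurable
  also have "ennreal (1/2) * ?D
      + ennreal (1/2) * ?D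
    = ?D"
  proof -
    have "ennreal (1/2) + ennreal (1/2) = ennreal (1/2 + 1/2)" by (rule ennreal_plus[symmetric]) auto
    then have half: "ennreal (1/2) + ennreal (1/2) = 1" by (simp only: field_sum_of_halves ennreal_1)
    have "ennreal (1/2) * X + ennreal (1/2) * X = X" for X :: ennreal
      unfolding distrib_right[symmetric] half by (rule mult_1)
    then show ?thesis .
  qed
  also have "\<dots> \<le> ennreal (pi / c * (LINT x|lborel. (\<rho> x)\<^sup>2))" by (rule part)
  finally have "(LINT x|lborel. \<rho> x * g x) \<le> pi / c * (LINT x|lborel. (\<rho> x)\<^sup>2)"
    using c by (subst (asm) ennreal_le_iff) (auto intro!: mult_nonneg_nonneg)
  then show "(LINT x|lborel. \<rho> x * (LINT y|lborel. \<rho> y * poisson c x y)) \<le> pi / c * (LINT x|lborel. (\<rho> x)\<^sup>2)"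
    by (simp add: g_def h_def)
qed

text \<open>
  On the circle there is no pointwise decay; instead, the mean square of a Fourier transform over
  an interval of length about \<open>l\<close> is bounded by Schur's test for the Fejer kernel of that interval.
\<close>

lemma mult_decay_circle:
  assumes d2: "d = 2"
  obtains C where "C \<ge> 0" "\<And>l. l \<ge> 1 \<Longrightarrow>
    mult_tail l \<le> ennreal C"
proof -
  define I where "I = (LINT x|lborel. \<rho> x)"
  have I: "I > 0" unfolding I_def by (rule rho_pos)
  \<comment> \<open>A Fejer window of length \<open>2 T\<close> is at least \<open>T\<close> on \<open>[0, T]\<close>.\<close>
  define B where "B = 2 * T"
  have B: "B > 0" using T by (simp add: B_def)
  define A where "A = B\<^sup>2 / 2 + 2"
  have A: "A > 0" by (simp add: A_def add_nonneg_pos)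
  define N where "N = (LINT x|lborel. (\<rho> x)\<^sup>2)"
  have N: "N \<ge> 0" by (simp add: N_def)
  define C where "C = A * pi * N / I\<^sup>2"
  have C: "C \<ge> 0" unfolding C_def using A N I by simp
  have "mult_tail l \<le> ennreal C"
    if l: "l \<ge> 1" for l
  proof -
    define c where "c = real l / T"
    have c: "c > 0" using l T by (simp add: c_def)
    define F where "F t = (LINT x|lborel. cos (c * x * t) * \<rho> x)" for t
    have mult_eq: "mult l t = F t / I" for t unfolding mult_def av_def F_def I_def w_def[abs_def] Z_def unfolding d2
      using geg_2_cos[OF l] by (simp add: c_def mult_ac)
    have F_meas [measurable]: "F \<in> borel_measurable borel" unfolding F_def by measurable
    define W where "W t = (B - t) * indicator {0..B} t" for t
    have W_int: "integrable lborel W" unfolding W_def by (intro integrable_continuous_Icc continuous_intros)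
    have W_meas [measurable]: "W \<in> borel_measurable borel" using W_int by auto
    have F_le: "\<bar>F t\<bar> \<le> I" for t
    proof -
      have "\<bar>F t\<bar> \<le> (LINT x|lborel. \<bar>cos (c * x * t) * \<rho> x\<bar>)" unfolding F_def by (rule integral_abs_bound)
      also have "\<dots> \<le> (LINT x|lborel. \<rho> x)"
      proof (rule integral_mono)
        show "integrable lborel (\<lambda>x. \<bar>cos (c * x * t) * \<rho> x\<bar>)"
          by (intro integrable_abs integrable_mult_rho[where B=1]) auto
        show "\<bar>cos (c * x * t) * \<rho> x\<bar> \<le> \<rho> x" for x
          using mult_right_mono[OF abs_cos_le_one[of "c * x * t"] rho_nonneg[of x]] rho_nonneg[of x] by (simp add: abs_mult)
      qed (rule rho_integrable)
      finally show ?thesis by (simp add: I_def)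
    qed
    have WF_int: "integrable lborel (\<lambda>t. W t * F t)"
    proof (rule Bochner_Integration.integrable_bound)
      show "integrable lborel (\<lambda>t. W t * I)" using W_int by simp
      show "AE t in lborel. norm (W t * F t) \<le> norm (W t * I)"
        using F_le I by (intro AE_I2) (auto simp: abs_mult intro!: mult_left_mono)
    qed measurable
    define K where "K x y = (LINT t|lborel. (W t * cos (c * x * t)) * cos (c * y * t))" for x y
    have K: "K x y \<le> A * poisson c x y" if xy: "x > 0" "y > 0" for x y
    proof -
      have "K x y = (LINT t|lborel. (1/2) * (((B - t) * cos ((c * (x - y)) * t)) * indicator {0..B} t)
          + (1/2) * (((B - t) * cos ((c * (x + y)) * t)) * indicator {0..B} t))" unfolding K_def W_def
      proof (intro Bochner_Integration.integral_cong refl)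
        fix t
        have "cos (c * x * t) * cos (c * y * t) = (cos ((c * (x - y)) * t) + cos ((c * (x + y)) * t)) / 2"
          using cos_times_cos[of "c * x * t" "c * y * t"] by (simp add: algebra_simps)
        then show "(B - t) * indicator {0..B} t * cos (c * x * t) * cos (c * y * t)
          = (1/2) * (((B - t) * cos ((c * (x - y)) * t)) * indicator {0..B} t) + (1/2) * (((B - t) * cos ((c * (x + y)) * t)) * indicator {0..B} t)"
          by (simp add: algebra_simps split: split_indicator) (simp add: field_simps)
      qed
      also have "\<dots> = (1/2) * (LINT t|lborel. ((B - t) * cos ((c * (x - y)) * t)) * indicator {0..B} t)
          + (1/2) * (LINT t|lborel. ((B - t) * cos ((c * (x + y)) * t)) * indicator {0..B} t)"
        by (subst Bochner_Integration.integral_add) (auto intro!: integrable_mult_right integrable_continuous_Icc continuous_intros)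
      also have "\<dots> \<le> (1/2) * (A / (1 + (c * (x - y))\<^sup>2)) + (1/2) * (A / (1 + (c * (x + y))\<^sup>2))"
        unfolding A_def using fejer_bound[OF B, of "c * (x - y)"] fejer_bound[OF B, of "c * (x + y)"]
        by (intro add_mono mult_left_mono) auto
      also have "A / (1 + (c * (x + y))\<^sup>2) \<le> A / (1 + (c * (x - y))\<^sup>2)"
      proof (rule divide_left_mono)
        have "(x - y)\<^sup>2 \<le> (x + y)\<^sup>2" using xy by (simp add: power2_diff power2_sum)
        then show "1 + (c * (x - y))\<^sup>2 \<le> 1 + (c * (x + y))\<^sup>2"
          unfolding power_mult_distrib by (intro add_left_mono mult_left_mono) auto
      qed (use A in \<open>auto intro!: mult_pos_pos add_pos_nonneg\<close>)
      finally show ?thesis unfolding poisson_def times_divide_eq_right mult_1_right by linarith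
    qed
    have J: "(LINT t|lborel. W t * (F t)\<^sup>2) \<le> A * (pi / c * N)"
    proof -
      have m1 [measurable]: "(\<lambda>(t, x). cos (c * x * t)) \<in> borel_measurable (borel \<Otimes>\<^sub>M borel)" by measurable
      have "(LINT t|lborel. W t * (F t)\<^sup>2) = (LINT t|lborel. (W t * F t) * (LINT x|lborel. cos (c * x * t) * \<rho> x))"
        unfolding F_def[symmetric] by (simp add: power2_eq_square mult.assoc)
      also have "\<dots> = (LINT x|lborel. \<rho> x * (LINT t|lborel. (W t * F t) * cos (c * x * t)))"
        by (rule fubini_rho[OF WF_int, of "\<lambda>t x. cos (c * x * t)"]) auto
      also have "\<dots> = (LINT x|lborel. \<rho> x * (LINT y|lborel. \<rho> y * K x y))"
      proof -
        have "(LINT t|lborel. (W t * F t) * cos (c * x * t)) = (LINT y|lborel. \<rho> y * K x y)" for x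
        proof -
        have i: "integrable lborel (\<lambda>t. W t * cos (c * x * t))"
          by (rule Bochner_Integration.integrable_bound[OF W_int]) (auto simp: abs_mult mult_left_le)
        have "(LINT t|lborel. (W t * F t) * cos (c * x * t)) = (LINT t|lborel. (W t * cos (c * x * t)) * (LINT y|lborel. cos (c * y * t) * \<rho> y))"
          unfolding F_def[symmetric] by (simp add: mult_ac)
        also have "\<dots> = (LINT y|lborel. \<rho> y * K x y)"
          unfolding K_def by (rule fubini_rho[OF i, of "\<lambda>t y. cos (c * y * t)"]) auto
        finally show ?thesis .
        qed
        then show ?thesis by (simp only:)
      qed
      also have "\<dots> \<le> (LINT x|lborel. A * (\<rho> x * (LINT y|lborel. \<rho> y * poisson c x y)))"
      proof (rule integral_mono')
        show "integrable lborel (\<lambda>x. A * (\<rho> x * (LINT y|lborel. \<rho> y * poisson c x y)))"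
          by (intro integrable_mult_right poisson_schur(2)[OF c])
        fix x
        have nn: "0 \<le> (LINT y|lborel. \<rho> y * poisson c x y)"
          by (intro integral_nonneg_AE AE_I2 mult_nonneg_nonneg rho_nonneg poisson_nonneg)
        then show "0 \<le> A * (\<rho> x * (LINT y|lborel. \<rho> y * poisson c x y))"
          using A rho_nonneg by (intro mult_nonneg_nonneg) auto
        show "\<rho> x * (LINT y|lborel. \<rho> y * K x y) \<le> A * (\<rho> x * (LINT y|lborel. \<rho> y * poisson c x y))"
        proof (cases "x \<in> {0<..<T}")
          case True
          have "(LINT y|lborel. \<rho> y * K x y) \<le> (LINT y|lborel. A * (\<rho> y * poisson c x y))"
          proof (rule integral_mono')
            show "integrable lborel (\<lambda>y. A * (\<rho> y * poisson c x y))"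
              by (intro integrable_mult_right poisson_schur(3)[OF c])
            fix y
            show "0 \<le> A * (\<rho> y * poisson c x y)" using A rho_nonneg by (intro mult_nonneg_nonneg poisson_nonneg) auto
            show "\<rho> y * K x y \<le> A * (\<rho> y * poisson c x y)"
            proof (cases "y \<in> {0<..<T}")
              case y: True
              show ?thesis using mult_left_mono[OF K[of x y] rho_nonneg[of y]] True y by (simp add: mult_ac)
            qed (simp add: rho_support)
          qed
          then have "(LINT y|lborel. \<rho> y * K x y) \<le> A * (LINT y|lborel. \<rho> y * poisson c x y)"
            by (simp only: integral_mult_right_zero)
          from mult_left_mono[OF this rho_nonneg[of x]] show ?thesis by (simp only: mult.left_commute)
        qed (simp add: rho_support)
      qed
      also have "\<dots> = A * (LINT x|lborel. \<rho> x * (LINT y|lborel. \<rho> y * poisson c x y))" by (rule integral_mult_right_zero)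
      also have "\<dots> \<le> A * (pi / c * N)" unfolding N_def using A by (intro mult_left_mono poisson_schur(1)[OF c]) auto
      finally show ?thesis .
    qed
    have eig: "geg_eigen d l powr (-1/2) = 1 / real l"
    proof -
      have "geg_eigen d l = real l ^ 2" by (simp add: geg_eigen_def d2 power2_eq_square)
      then show ?thesis using l by (simp add: powr_minus_half[unfolded minus_divide_left[symmetric]] powr_minus_half)
    qed
    have WF2_int: "integrable lborel (\<lambda>t. W t * (F t)\<^sup>2)"
    proof (rule Bochner_Integration.integrable_bound)
      show "integrable lborel (\<lambda>t. W t * I\<^sup>2)" using W_int by simp
      show "AE t in lborel. norm (W t * (F t)\<^sup>2) \<le> norm (W t * I\<^sup>2)"
        using F_le I by (intro AE_I2) (auto simp: abs_mult intro!: mult_left_mono power2_le_iff_abs_le[THEN iffD2])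
    qed measurable
    have W0: "W t \<ge> 0" for t by (auto simp: W_def split: split_indicator)
    have "(\<integral>\<^sup>+t\<in>{1 / real l<..<T}. ennreal ((mult l t)\<^sup>2 / t) \<partial>lborel)
       \<le> (\<integral>\<^sup>+t. ennreal ((c / I\<^sup>2) * (W t * (F t)\<^sup>2)) \<partial>lborel)"
    proof (rule nn_integral_mono)
      fix t
      show "ennreal ((mult l t)\<^sup>2 / t) * indicator {1 / real l<..<T} t \<le> ennreal ((c / I\<^sup>2) * (W t * (F t)\<^sup>2))"
      proof (cases "t \<in> {1 / real l<..<T}")
        case True
        have "1 / real l > 0" using l by simp
        moreover have t': "t < T" "1 / real l < t" using True by simp_all
        ultimately have t: "0 < t" "t < T" "1 / real l < t" by (blast intro: less_trans)+
        have "T \<le> W t" using t T by (simp add: W_def B_def)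
        have "1 / t \<le> real l" using t l by (simp add: field_simps)
        also have "\<dots> = c * T" using T by (simp add: c_def)
        also have "\<dots> \<le> c * W t" using c \<open>T \<le> W t\<close> by (intro mult_left_mono) auto
        finally have "(F t / I)\<^sup>2 * (1 / t) \<le> (F t / I)\<^sup>2 * (c * W t)" by (intro mult_left_mono) auto
        then have "(mult l t)\<^sup>2 / t \<le> (c / I\<^sup>2) * (W t * (F t)\<^sup>2)" unfolding mult_eq by (simp add: power_divide mult_ac)
        then show ?thesis using True by (simp add: ennreal_leI)
      qed simp
    qed
    also have "\<dots> = ennreal (LINT t|lborel. (c / I\<^sup>2) * (W t * (F t)\<^sup>2))"
      using W0 c by (intro nn_integral_eq_integral integrable_mult_right WF2_int) auto
    also have "(LINT t|lborel. (c / I\<^sup>2) * (W t * (F t)\<^sup>2)) = (c / I\<^sup>2) * (LINT t|lborel. W t * (F t)\<^sup>2)"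
      by (rule integral_mult_right_zero)
    also have "ennreal \<dots> \<le> ennreal ((c / I\<^sup>2) * (A * (pi / c * N)))"
      using J c by (intro ennreal_leI mult_left_mono) auto
    also have "(c / I\<^sup>2) * (A * (pi / c * N)) = C" using c by (simp add: C_def)
    finally show ?thesis unfolding eig .
  qed
  then show ?thesis using that C by blast
qed

text \<open>
  For \<open>\<lambda> t\<^sup>2 \<ge> 1\<close> the term \<open>\<lambda>\<^sup>n t\<^sup>2\<^sup>n mult l t\<close> of the square function of order \<open>2n\<close> has exactly the critical
  size, so boundedness of the multiplier would lose a logarithm of \<open>\<lambda>\<close>.
\<close>

lemma mult_decay:
  obtains C where "C \<ge> 0" "\<And>l. l \<ge> 1 \<Longrightarrow>
    mult_tail l \<le> ennreal C"
proof (cases "d = 2")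
  case True
  then show ?thesis using mult_decay_circle that by blast
next
  case False
  then have "d \<ge> 3" using d by simp
  then show ?thesis using mult_decay_high that by blast
qed

text \<open>The multiplier of the square function at the even integer order \<open>2n\<close>.\<close>

definition rem' :: "nat \<Rightarrow> nat \<Rightarrow> real \<Rightarrow> real" where
  "rem' n l t = rem n l t - geg_taylor d l n * adist n t * mult l t"

lemma rem'_eq: "rem' n l t = rem (Suc n) l t + geg_taylor d l n * adist n t * (1 - mult l t)"
  by (simp add: rem'_def rem_Suc algebra_simps)

lemma one_minus_mult_bound:
  assumes t: "0 < t" "t \<le> T"
  shows "\<bar>1 - mult l t\<bar> \<le> geg_eigen d l * t\<^sup>2"
proof -
  have "rem 1 l t = mult l t - 1" using adist_0[OF t] by (simp add: rem_def geg_taylor_def geg_d1_0 d)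
  then show ?thesis using rem_bound[OF t, of 1 l] by (simp add: abs_minus_commute)
qed

lemma rem'_bound:
  assumes t: "0 < t" "t \<le> T"
  shows "\<bar>rem' n l t\<bar> \<le> 2 * (geg_eigen d l * t\<^sup>2) ^ Suc n"
proof -
  have "\<bar>geg_taylor d l n * adist n t * (1 - mult l t)\<bar> \<le> (geg_eigen d l * t\<^sup>2) ^ n * (geg_eigen d l * t\<^sup>2)"
    unfolding abs_mult[of "geg_taylor d l n * adist n t"]
    using taylor_adist_bound[OF t, of l n] one_minus_mult_bound[OF t, of l] geg_eigen_nonneg[OF d, of l]
    by (intro mult_mono) auto
  then show ?thesis using rem_bound[OF t, of "Suc n" l] unfolding rem'_eq by (simp add: mult.commute)
qed

lemma rem'_integral_upper:
  assumes n: "n \<ge> 1"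
  obtains C where "C \<ge> 0" "\<And>l. scale_energy (4 * real n + 1) (rem' n l)
      \<le> ennreal (C * geg_eigen d l powr (2 * real n))"
proof -
  obtain C0 where C0: "C0 \<ge> 0" "\<And>l. l \<ge> 1 \<Longrightarrow>
    mult_tail l \<le> ennreal C0" using mult_decay by blast
  define C where "C = 1 + 2 + 2 * C0"
  have "scale_energy (4 * real n + 1) (rem' n l)
      \<le> ennreal (C * geg_eigen d l powr (2 * real n))" for l
  proof (cases "l = 0")
    case True
    have "scale_energy (4 * real n + 1) (rem' n l) = (\<integral>\<^sup>+t. 0 \<partial>(lborel :: real measure))"
    proof (rule nn_integral_cong)
      fix t :: real
      have "rem' n l t = 0" if "t \<in> {0<..<T}" using rem'_bound[of t n l] that True by (simp add: geg_eigen_def)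
      then show "ennreal ((rem' n l t)\<^sup>2 / t powr (4 * real n + 1)) * indicator {0<..<T} t = 0"
        by (auto split: split_indicator)
    qed
    then show ?thesis by simp
  next
    case False
    then have l: "l \<ge> 1" by simp
    define L where "L = geg_eigen d l"
    have L: "L \<ge> 1" unfolding L_def by (rule geg_eigen_ge_1[OF l])
    then have L0: "L > 0" by simp
    define s where "s = L powr (-1/2)"
    have s: "s > 0" using L0 by (simp add: s_def)
    have X: "(L * t\<^sup>2) ^ k = L powr real k * t powr (2 * real k)" if "t > 0" for k t
    proof -
      have "(L * t\<^sup>2) ^ k = L ^ k * t ^ (2 * k)" by (simp only: power_mult_distrib power_mult)
      moreover have "L powr real k = L ^ k" by (rule powr_realpow[OF L0])
      moreover have "t powr real (2 * k) = t ^ (2 * k)" by (rule powr_realpow[OF that])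
      ultimately show ?thesis by simp
    qed
    \<comment> \<open>Up to \<open>s\<close> the remainder of order \<open>n + 1\<close> counts, beyond \<open>s\<close> that of order \<open>n\<close> and the critical term.\<close>
    have pt: "ennreal ((rem' n l t)\<^sup>2 / t powr (4 * real n + 1)) * indicator {0<..<T} t
      \<le> ennreal (4 * L powr (2 * real n + 2)) * (ennreal (t powr (4 - 1)) * indicator {0..s} t)
        + (ennreal (8 * L powr (2 * real n - 2)) * (ennreal (t powr (- 4 - 1)) * indicator {s..} t)
        + ennreal (2 * L powr (2 * real n)) * (ennreal ((mult l t)\<^sup>2 / t) * indicator {s<..<T} t))" for t
    proof (cases "t \<in> {0<..<T}")
      case True
      then have t: "0 < t" "t \<le> T" by auto
      show ?thesis
      proof (cases "t \<le> s")
        case ts: True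
        have "(rem' n l t)\<^sup>2 \<le> (2 * (L * t\<^sup>2) ^ Suc n)\<^sup>2"
          using rem'_bound[OF t, of n l] L0 by (intro abs_le_square_iff[THEN iffD1]) (auto simp: L_def)
        also have "\<dots> = 4 * (L * t\<^sup>2) ^ (2 * n + 2)"
        proof -
          have "((L * t\<^sup>2) ^ Suc n)\<^sup>2 = (L * t\<^sup>2) ^ (2 * n + 2)"
            by (simp only: power_mult[symmetric]) (simp add: mult.commute)
          then show ?thesis by (simp only: power_mult_distrib[of 2]) simp
        qed
        also have "\<dots> = 4 * L powr (2 * real n + 2) * t powr (4 * real n + 4)"
          unfolding X[OF t(1)] by (simp add: algebra_simps)
        finally have "(rem' n l t)\<^sup>2 / t powr (4 * real n + 1) \<le> 4 * L powr (2 * real n + 2) * t powr (4 * real n + 4) / t powr (4 * real n + 1)"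
          by (intro divide_right_mono) auto
        also have "\<dots> = 4 * L powr (2 * real n + 2) * t powr (4 - 1)"
        proof -
          have "4 - 1 = (4 * real n + 4) - (4 * real n + 1)" by simp
          then have "t powr (4 - 1) = t powr (4 * real n + 4) / t powr (4 * real n + 1)" by (simp only: powr_diff)
          then show ?thesis by simp
        qed
        finally have "ennreal ((rem' n l t)\<^sup>2 / t powr (4 * real n + 1)) \<le> ennreal (4 * L powr (2 * real n + 2)) * ennreal (t powr (4 - 1))"
          by (simp add: ennreal_mult[symmetric] ennreal_leI)
        then show ?thesis using True ts by (auto split: split_indicator intro: add_increasing2)
      next
        case ts: False
        obtain m where m: "n = Suc m" using n by (cases n) auto
        define a where "a = 2 * (L * t\<^sup>2) ^ m"
        define b where "b = (L * t\<^sup>2) ^ n * \<bar>mult l t\<bar>"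
        have ab: "0 \<le> a" "0 \<le> b" using L0 by (auto simp: a_def b_def)
        have "\<bar>rem n l t\<bar> \<le> a" using rem_Suc_bound[OF t, of m l] by (simp add: m a_def L_def)
        moreover have "\<bar>geg_taylor d l n * adist n t * mult l t\<bar> \<le> b"
          unfolding abs_mult[of "geg_taylor d l n * adist n t"] b_def
          using taylor_adist_bound[OF t, of l n] by (intro mult_right_mono) (auto simp: L_def)
        ultimately have "\<bar>rem' n l t\<bar> \<le> a + b" unfolding rem'_def by linarith
        then have "(rem' n l t)\<^sup>2 \<le> (a + b)\<^sup>2" using ab by (intro abs_le_square_iff[THEN iffD1]) auto
        also have "\<dots> \<le> 2 * a\<^sup>2 + 2 * b\<^sup>2" using sum_squares_bound[of a b] by (simp add: power2_sum)
        also have "a\<^sup>2 = 4 * (L powr (2 * real n - 2) * t powr (4 * real n - 4))"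
        proof -
          have "a\<^sup>2 = 4 * (L * t\<^sup>2) ^ (m * 2)" unfolding a_def power_mult_distrib[of 2] by (simp add: power_mult)
          then show ?thesis unfolding X[OF t(1)] by (simp add: m algebra_simps)
        qed
        also have "b\<^sup>2 = L powr (2 * real n) * t powr (4 * real n) * (mult l t)\<^sup>2"
        proof -
          have "b\<^sup>2 = (L * t\<^sup>2) ^ (n * 2) * (mult l t)\<^sup>2" unfolding b_def power_mult_distrib[of "(L * t\<^sup>2) ^ n"] by (simp add: power_mult)
          then show ?thesis unfolding X[OF t(1)] by (simp add: algebra_simps)
        qed
        finally have "(rem' n l t)\<^sup>2 / t powr (4 * real n + 1) \<le> (2 * (4 * (L powr (2 * real n - 2) * t powr (4 * real n - 4)))
            + 2 * (L powr (2 * real n) * t powr (4 * real n) * (mult l t)\<^sup>2)) / t powr (4 * real n + 1)"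
          by (intro divide_right_mono) auto
        also have "\<dots> = 8 * L powr (2 * real n - 2) * t powr (- 4 - 1) + 2 * L powr (2 * real n) * ((mult l t)\<^sup>2 / t)"
        proof -
          have "- 4 - 1 = (4 * real n - 4) - (4 * real n + 1)" by simp
          then have 1: "t powr (- 4 - 1) = t powr (4 * real n - 4) / t powr (4 * real n + 1)" by (simp only: powr_diff)
          have 2: "t powr (4 * real n) / t powr (4 * real n + 1) = 1 / t" using t by (simp add: powr_add)
          have "(2 * (4 * (p * q)) + 2 * (r * v * y)) / z = 8 * p * (q / z) + 2 * r * (y * (v / z))" for p q r v y z :: real
            by (simp add: add_divide_distrib mult_ac)
          from this[of "L powr (2 * real n - 2)" "t powr (4 * real n - 4)" "L powr (2 * real n)" "t powr (4 * real n)" "(mult l t)\<^sup>2" "t powr (4 * real n + 1)"]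
          show ?thesis unfolding 1[symmetric] 2 by simp
        qed
        finally have "ennreal ((rem' n l t)\<^sup>2 / t powr (4 * real n + 1))
          \<le> ennreal (8 * L powr (2 * real n - 2) * t powr (- 4 - 1) + 2 * L powr (2 * real n) * ((mult l t)\<^sup>2 / t))"
          by (rule ennreal_leI)
        also have "\<dots> = ennreal (8 * L powr (2 * real n - 2)) * ennreal (t powr (- 4 - 1)) + ennreal (2 * L powr (2 * real n)) * ennreal ((mult l t)\<^sup>2 / t)"
          using t by (subst ennreal_plus) (auto simp: ennreal_mult[symmetric])
        finally show ?thesis using True ts by (auto split: split_indicator)
      qed
    qed simp
    have meas: "(\<lambda>t. ennreal ((mult l t)\<^sup>2 / t) * indicator {s<..<T} t) \<in> borel_measurable lborel"
      unfolding mult_def av_def Z_def w_def by measurable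
    have "scale_energy (4 * real n + 1) (rem' n l)
      \<le> (\<integral>\<^sup>+t. ennreal (4 * L powr (2 * real n + 2)) * (ennreal (t powr (4 - 1)) * indicator {0..s} t)
        + (ennreal (8 * L powr (2 * real n - 2)) * (ennreal (t powr (- 4 - 1)) * indicator {s..} t)
        + ennreal (2 * L powr (2 * real n)) * (ennreal ((mult l t)\<^sup>2 / t) * indicator {s<..<T} t)) \<partial>lborel)"
      by (intro nn_integral_mono pt)
    also have "\<dots> = ennreal (4 * L powr (2 * real n + 2)) * (\<integral>\<^sup>+t. ennreal (t powr (4 - 1)) * indicator {0..s} t \<partial>lborel)
        + (ennreal (8 * L powr (2 * real n - 2)) * (\<integral>\<^sup>+t. ennreal (t powr (- 4 - 1)) * indicator {s..} t \<partial>lborel)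
        + ennreal (2 * L powr (2 * real n)) * (\<integral>\<^sup>+t. ennreal ((mult l t)\<^sup>2 / t) * indicator {s<..<T} t \<partial>lborel))"
    proof -
      have m1: "(\<lambda>t. ennreal (t powr (4 - 1)) * indicator {0..s} t) \<in> borel_measurable lborel"
        "(\<lambda>t. ennreal (t powr (- 4 - 1)) * indicator {s..} t) \<in> borel_measurable lborel" by measurable
      show ?thesis
        by (subst nn_integral_add, use m1 meas in measurable, subst nn_integral_add, use m1 meas in measurable,
            subst nn_integral_cmult[OF m1(1)], subst nn_integral_cmult[OF m1(2)], subst nn_integral_cmult[OF meas], rule refl)
    qed
    also have "\<dots> \<le> ennreal (4 * L powr (2 * real n + 2)) * ennreal (s powr 4 / 4)
        + (ennreal (8 * L powr (2 * real n - 2)) * ennreal (s powr (- 4) / 4)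
        + ennreal (2 * L powr (2 * real n)) * ennreal C0)"
      using s C0(2)[OF l] nn_integral_powr_near_0[of 4 s] nn_integral_powr_near_infinity[of 4 s]
      by (intro add_mono mult_left_mono) (auto simp: s_def L_def)
    also have "\<dots> = ennreal (4 * L powr (2 * real n + 2) * (s powr 4 / 4)
        + (8 * L powr (2 * real n - 2) * (s powr (- 4) / 4) + 2 * L powr (2 * real n) * C0))"
      using C0(1) by (simp add: ennreal_mult[symmetric] ennreal_plus[symmetric] del: ennreal_plus)
    also have "4 * L powr (2 * real n + 2) * (s powr 4 / 4) = L powr (2 * real n)"
      using L0 by (simp add: s_def powr_powr powr_add[symmetric])
    also have "8 * L powr (2 * real n - 2) * (s powr (- 4) / 4) = 2 * L powr (2 * real n)"
    proof -
      have "s powr (- 4) * L powr (2 * real n - 2) = L powr (2 * real n)"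
        unfolding s_def powr_powr powr_add[symmetric] by (rule arg_cong[where f="\<lambda>e. L powr e"]) simp
      then show ?thesis by simp
    qed
    finally show ?thesis by (simp add: C_def L_def algebra_simps)
  qed
  then show ?thesis using that[of C] C0 by (simp add: C_def)
qed

end

section \<open>Spherical averages as zonal multipliers\<close>

text \<open>
  Measurability with respect to a completion survives changes on null sets, which lets all functions
  be replaced by Borel representatives.
\<close>

lemma measurable_completion_AE:
  assumes f: "AE x in M. f x = g x" and g: "g \<in> measurable M N" and sp: "\<And>x. x \<in> space M \<Longrightarrow> f x \<in> space N"
  shows "f \<in> measurable (completion M) N"
proof (rule measurableI)
  fix A assume A: "A \<in> sets N"
  obtain E where E: "E \<in> null_sets M" "{x \<in> space M. f x \<noteq> g x} \<subseteq> E" using f by (auto simp: eventually_ae_filter)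
  have "f -` A \<inter> space M = ((g -` A \<inter> space M) - E) \<union> (f -` A \<inter> space M \<inter> E)" using E(2) by auto
  moreover have "(g -` A \<inter> space M) - E \<in> sets M" using measurable_sets[OF g A] E(1) by auto
  ultimately show "f -` A \<inter> space (completion M) \<in> sets (completion M)"
    using E(1) by (intro sets_completionI[of _ "(g -` A \<inter> space M) - E" "f -` A \<inter> space M \<inter> E" E]) auto
qed (use sp in simp)

lemma completion_ex_borel_measurable_complex:
  fixes f :: "'x \<Rightarrow> complex"
  assumes f: "f \<in> borel_measurable (completion M)"
  obtains g where "g \<in> borel_measurable M" "AE x in M. f x = g x"
proof -
  obtain a where a: "a \<in> borel_measurable M" "AE x in M. Re (f x) = a x"
    using completion_ex_borel_measurable_real[of "\<lambda>x. Re (f x)" M] f by auto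
  obtain b where b: "b \<in> borel_measurable M" "AE x in M. Im (f x) = b x"
    using completion_ex_borel_measurable_real[of "\<lambda>x. Im (f x)" M] f by auto
  note [measurable] = a(1) b(1)
  have "(\<lambda>x. Complex (a x) (b x)) \<in> borel_measurable M" unfolding Complex_eq by measurable
  moreover have "AE x in M. f x = Complex (a x) (b x)" using a(2) b(2) by eventually_elim (simp add: complex_eq_iff)
  ultimately show ?thesis by (rule that)
qed

lemma integral_completion_AE:
  fixes f g :: "'x \<Rightarrow> 'b::{banach, second_countable_topology}"
  assumes f: "AE x in M. f x = g x" and g: "g \<in> borel_measurable M"
  shows "(LINT x|completion M. f x) = (LINT x|M. g x)"
proof -
  have "(LINT x|completion M. f x) = (LINT x|completion M. g x)"
    using measurable_completion_AE[OF f g] measurable_completion[OF g] AE_completion[OF f]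
    by (intro integral_cong_AE) auto
  then show ?thesis using integral_completion[OF g] by simp
qed

lemma square_integrable_completion_AE:
  fixes f g :: "'x \<Rightarrow> complex"
  assumes f: "AE x in M. f x = g x" and g: "g \<in> borel_measurable M"
  shows "square_integrable (completion M) f \<longleftrightarrow> square_integrable M g"
proof -
  note fm = measurable_completion_AE[OF f g]
  have "(\<integral>\<^sup>+x. ennreal ((norm (f x))\<^sup>2) \<partial>completion M) = (\<integral>\<^sup>+x. ennreal ((norm (g x))\<^sup>2) \<partial>M)"
    unfolding nn_integral_completion using f by (intro nn_integral_cong_AE) auto
  then show ?thesis unfolding square_integrable_def using fm g by (auto simp: integrable_iff_bounded)
qed

text \<open>The inverse cosine, extended by constants so that it is continuous on the whole line.\<close>

definition angle :: "real \<Rightarrow> real" where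
  "angle x = arccos (max (-1) (min 1 x))"

lemma angle_measurable [measurable]: "angle \<in> borel_measurable borel" unfolding angle_def
  by (intro borel_measurable_continuous_onI continuous_on_compose2[OF continuous_on_arccos'] continuous_intros) auto

lemma angle_cos: "\<theta> \<in> {0..pi} \<Longrightarrow> angle (cos \<theta>) = \<theta>" by (simp add: angle_def arccos_cos)

lemma angle_inner:
  assumes "norm (\<xi> :: 'a::euclidean_space) = 1" "norm \<eta> = 1"
  shows "angle (\<xi> \<bullet> \<eta>) = arccos (\<xi> \<bullet> \<eta>)" "\<bar>\<xi> \<bullet> \<eta>\<bar> \<le> 1"
proof -
  show "\<bar>\<xi> \<bullet> \<eta>\<bar> \<le> 1" using Cauchy_Schwarz_ineq2[of \<xi> \<eta>] assms by simp
  then have "max (-1) (min 1 (\<xi> \<bullet> \<eta>)) = \<xi> \<bullet> \<eta>" by (auto simp: max_def min_def)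
  then show "angle (\<xi> \<bullet> \<eta>) = arccos (\<xi> \<bullet> \<eta>)" by (simp add: angle_def)
qed

text \<open>
  The angle to a fixed point has an absolutely continuous distribution on the sphere, so null
  sets of angles may be ignored.
\<close>

lemma AE_angle_notin_null:
  assumes d: "DIM('a::euclidean_space) \<ge> 2" and xi: "norm (\<xi>::'a) = 1" and c: "c > 0"
    and N: "N \<in> null_sets lborel"
  shows "AE \<eta> in surface. c * angle (\<xi> \<bullet> \<eta>) \<notin> N"
proof -
  have [measurable]: "N \<in> sets borel" using N by auto
  have "(\<integral>\<^sup>+x. indicator N x \<partial>lborel) = ennreal \<bar>c\<bar> * (\<integral>\<^sup>+x. indicator N (0 + c * x) \<partial>lborel)"
    using c by (intro nn_integral_real_affine) auto
  moreover have "(\<integral>\<^sup>+x. indicator N x \<partial>lborel) = 0" using N by auto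
  ultimately have "(\<integral>\<^sup>+x. indicator N (c * x) \<partial>lborel) = 0" using c by auto
  then have "AE x in lborel. indicator N (c * x) = (0::ennreal)" by (subst (asm) nn_integral_0_iff_AE) auto
  then have "AE x in lborel. c * x \<notin> N" by eventually_elim (auto split: split_indicator_asm)
  then have "AE \<theta> in angle_measure DIM('a). c * angle (cos \<theta>) \<notin> N" unfolding angle_measure_def
    by (subst AE_density) (auto elim!: eventually_mono simp: angle_cos split: split_indicator_asm)
  then show ?thesis by (subst AE_zonal[OF d xi]) measurable
qed

locale cap_average = harmonic_basis \<nu> Y + weight "DIM('a)" T \<rho>
  for \<nu> :: "nat \<Rightarrow> nat" and Y :: "nat \<Rightarrow> nat \<Rightarrow> 'a::euclidean_space \<Rightarrow> complex"
    and T :: real and \<rho> :: "real \<Rightarrow> real"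
begin

definition kernel :: "real \<Rightarrow> real \<Rightarrow> real" where
  "kernel t x = \<rho> (T / t * angle x)"

definition cap_mass :: "real \<Rightarrow> real" where
  "cap_mass t = sphere_area (DIM('a) - 1) * (t / T) * Z t"

definition cap_av :: "real \<Rightarrow> ('a \<Rightarrow> complex) \<Rightarrow> 'a \<Rightarrow> complex" where
  "cap_av t f \<xi> = (LINT \<eta>|surface. f \<eta> * of_real (kernel t (\<xi> \<bullet> \<eta>))) / of_real (cap_mass t)"

lemma kernel_measurable [measurable]: "kernel t \<in> borel_measurable borel" unfolding kernel_def by measurable

lemma kernel_nonneg: "kernel t x \<ge> 0" by (simp add: kernel_def rho_nonneg)

lemma kernel_cos: "\<theta> \<in> {0..pi} \<Longrightarrow> kernel t (cos \<theta>) = \<rho> (T / t * \<theta>)" by (simp add: kernel_def angle_cos)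

lemma cap_mass_pos: "0 < t \<Longrightarrow> t \<le> T \<Longrightarrow> cap_mass t > 0"
  unfolding cap_mass_def using Z_pos[of t] T sphere_area_pos[of "DIM('a) - 1"] d by simp

text \<open>The substitution \<open>\<theta> = t x / T\<close>.\<close>

lemma integral_angle_kernel:
  assumes t: "0 < t" "t \<le> T" and [measurable]: "\<phi> \<in> borel_measurable borel"
  shows "(LINT \<theta>|angle_measure DIM('a). \<phi> \<theta> * kernel t (cos \<theta>)) = cap_mass t * av t \<phi>"
proof -
  define A where "A = sphere_area (DIM('a) - 1)"
  define g where "g \<theta> = A * sin \<theta> ^ (DIM('a) - 2) * indicator {0..pi} \<theta> * (\<phi> \<theta> * \<rho> (T / t * \<theta>))" for \<theta>
  have "(LINT \<theta>|angle_measure DIM('a). \<phi> \<theta> * kernel t (cos \<theta>)) = (LINT \<theta>|lborel. g \<theta>)"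
    by (subst integral_angle_measure, measurable, intro Bochner_Integration.integral_cong)
       (auto simp: g_def A_def kernel_cos split: split_indicator)
  also have "\<dots> = \<bar>t / T\<bar> *\<^sub>R (LINT x|lborel. g (0 + t / T * x))" using t T by (intro lborel_integral_real_affine) auto
  also have "(LINT x|lborel. g (0 + t / T * x)) = (LINT x|lborel. A * (\<phi> (t * x / T) * w t x))"
  proof (intro Bochner_Integration.integral_cong refl)
    fix x
    show "g (0 + t / T * x) = A * (\<phi> (t * x / T) * w t x)"
    proof (cases "x \<in> {0<..<T}")
      case True
      then show ?thesis using angle_range[OF t True] t T by (simp add: g_def w_def)
    next
      case False
      then show ?thesis using rho_support[OF False] t T by (simp add: g_def w_def)
    qed
  qed
  also have "\<bar>t / T\<bar> *\<^sub>R \<dots> = cap_mass t * av t \<phi>" using t T Z_pos[OF t] by (simp add: cap_mass_def av_def A_def)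
  finally show ?thesis .
qed

lemma integrable_kernel_square:
  assumes t: "0 < t" "t \<le> T"
  shows "integrable (angle_measure DIM('a)) (\<lambda>\<theta>. (kernel t (cos \<theta>))\<^sup>2)"
proof -
  define A where "A = sphere_area (DIM('a) - 1)"
  have A: "A \<ge> 0" by (simp add: A_def)
  have "integrable lborel (\<lambda>\<theta>. (\<rho> (0 + T / t * \<theta>))\<^sup>2)"
    using lborel_integrable_real_affine[OF rho_sq, of "T / t" 0] t T by simp
  then have i: "integrable lborel (\<lambda>\<theta>. A * (\<rho> (T / t * \<theta>))\<^sup>2)" by simp
  have "norm ((A * sin \<theta> ^ (DIM('a) - 2) * indicator {0..pi} \<theta>) *\<^sub>R (kernel t (cos \<theta>))\<^sup>2)
      \<le> norm (A * (\<rho> (T / t * \<theta>))\<^sup>2)" for \<theta>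
  proof (cases "\<theta> \<in> {0..pi}")
    case True
    have "\<bar>sin \<theta>\<bar> ^ (DIM('a) - 2) \<le> 1" by (intro power_le_one) auto
    then have "A * \<bar>sin \<theta>\<bar> ^ (DIM('a) - 2) * (\<rho> (T / t * \<theta>))\<^sup>2 \<le> A * 1 * (\<rho> (T / t * \<theta>))\<^sup>2"
      using A by (intro mult_right_mono mult_left_mono) auto
    then show ?thesis using True A by (simp add: kernel_cos abs_mult power_abs)
  qed simp
  then show ?thesis by (subst integral_angle_measure, measurable)
       (intro Bochner_Integration.integrable_bound[OF i] AE_I2, measurable, simp only: A_def)
qed

lemma integrable_kernel:
  assumes t: "0 < t" "t \<le> T"
  shows "integrable (angle_measure DIM('a)) (\<lambda>\<theta>. kernel t (cos \<theta>))"
proof -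
  interpret finite_measure "angle_measure DIM('a)" by (rule finite_measure_angle)
  have i: "integrable (angle_measure DIM('a)) (\<lambda>\<theta>. 1 + (kernel t (cos \<theta>))\<^sup>2)"
    by (intro Bochner_Integration.integrable_add integrable_kernel_square t) auto
  have "z \<le> 1 + z\<^sup>2" for z :: real
  proof -
    have "2 * z \<le> 1 + z\<^sup>2" using sum_squares_bound[of 1 z] by simp
    then show ?thesis using zero_le_power2[of z] by linarith
  qed
  then show ?thesis by (intro Bochner_Integration.integrable_bound[OF i]) (auto simp: kernel_nonneg)
qed

lemma kernel_square_integrable:
  assumes t: "0 < t" "t \<le> T" and xi: "norm (\<xi>::'a) = 1"
  shows "square_integrable surface (\<lambda>\<eta>. complex_of_real (kernel t (\<xi> \<bullet> \<eta>)))"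
  using integrable_zonal[OF d xi, of "\<lambda>x. (kernel t x)\<^sup>2"] integrable_kernel_square[OF t]
  by (simp add: square_integrable_def)

lemma id_measurable_surface [measurable]: "(\<lambda>x::'a. x) \<in> borel_measurable surface"
  by (intro measurable_surface_continuous continuous_intros)

lemma w_measurable2 [measurable]: "(\<lambda>(t, x). w t x) \<in> borel_measurable (borel \<Otimes>\<^sub>M borel)" unfolding w_def by measurable

lemma av_measurable:
  assumes [measurable]: "\<phi> \<in> borel_measurable borel"
  shows "(\<lambda>t. av t \<phi>) \<in> borel_measurable borel" "Z \<in> borel_measurable borel"
proof -
  show [measurable]: "Z \<in> borel_measurable borel" unfolding Z_def by measurable
  show "(\<lambda>t. av t \<phi>) \<in> borel_measurable borel" unfolding av_def by measurable
qed

lemma cap_mass_measurable [measurable]: "cap_mass \<in> borel_measurable borel"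
  unfolding cap_mass_def using av_measurable(2)[of id] by measurable

lemma adist_measurable [measurable]: "adist k \<in> borel_measurable borel"
  and mult_measurable [measurable]: "mult l \<in> borel_measurable borel"
  unfolding adist_def mult_def by (intro av_measurable; measurable)+

lemma cap_av_measurable [measurable]:
  assumes [measurable]: "f \<in> borel_measurable surface"
  shows "(\<lambda>(\<xi>, t). cap_av t f \<xi>) \<in> borel_measurable (surface \<Otimes>\<^sub>M borel)"
proof -
  interpret sigma_finite_measure "surface :: 'a measure" by simp
  show ?thesis unfolding cap_av_def kernel_def by measurable
qed

lemma cap_av_section_measurable:
  assumes [measurable]: "f \<in> borel_measurable surface"
  shows "cap_av t f \<in> borel_measurable surface"
proof -
  have "(\<lambda>\<xi>. (\<lambda>(\<xi>, t). cap_av t f \<xi>) (\<xi>, t)) \<in> borel_measurable surface" by measurable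
  then show ?thesis by simp
qed

lemma integrable_mult_kernel:
  fixes f :: "'a \<Rightarrow> complex"
  assumes t: "0 < t" "t \<le> T" and xi: "norm (\<xi>::'a) = 1" and f: "square_integrable surface f"
  shows "integrable surface (\<lambda>\<eta>. f \<eta> * of_real (kernel t (\<xi> \<bullet> \<eta>)))"
  by (rule square_integrable_mult(1)[OF f kernel_square_integrable[OF t xi]])

text \<open>The \<open>L\<^sup>2\<close> norm of the kernel does not depend on the centre of the cap.\<close>

lemma norm_integral_kernel_le:
  fixes f :: "'a \<Rightarrow> complex"
  assumes t: "0 < t" "t \<le> T" and xi: "norm (\<xi>::'a) = 1" and f: "square_integrable surface f"
  shows "(norm (LINT \<eta>|surface. f \<eta> * of_real (kernel t (\<xi> \<bullet> \<eta>))))\<^sup>2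
    \<le> (LINT \<eta>|surface. (norm (f \<eta>))\<^sup>2) * (LINT \<theta>|angle_measure DIM('a). (kernel t (cos \<theta>))\<^sup>2)"
proof -
  have "(LINT \<eta>|surface. (norm (complex_of_real (kernel t (\<xi> \<bullet> \<eta>))))\<^sup>2) = (LINT \<theta>|angle_measure DIM('a). (kernel t (cos \<theta>))\<^sup>2)"
    using integral_zonal[OF d xi, of "\<lambda>x. (kernel t x)\<^sup>2"] by simp
  then show ?thesis using integral_cauchy_schwarz[OF f kernel_square_integrable[OF t xi]] by simp
qed

lemma cap_av_square_integrable:
  assumes t: "0 < t" "t \<le> T" and f: "square_integrable surface f"
  shows "square_integrable surface (cap_av t f)"
proof -
  note [measurable] = cap_av_section_measurable[OF square_integrable_measurable[OF f]]
  define C where "C = (LINT \<eta>|surface. (norm (f \<eta>))\<^sup>2) * (LINT \<theta>|angle_measure DIM('a). (kernel t (cos \<theta>))\<^sup>2)"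
  have "(norm (cap_av t f \<xi>))\<^sup>2 \<le> C / (cap_mass t)\<^sup>2" if "norm \<xi> = 1" for \<xi>
    using norm_integral_kernel_le[OF t that f] cap_mass_pos[OF t]
    by (simp add: cap_av_def norm_divide power_divide C_def divide_right_mono)
  then show ?thesis unfolding square_integrable_def
    by (intro conjI integrable_surface_bounded[of _ "C / (cap_mass t)\<^sup>2"]) auto
qed

text \<open>The kernel is symmetric, so it may be moved to the harmonic, where the Funk--Hecke formula applies.\<close>

lemma coef_cap_av:
  assumes t: "0 < t" "t \<le> T" and f: "square_integrable surface f" and j: "j \<in> {1..\<nu> l}"
  shows "coef (cap_av t f) l j = of_real (mult l t) * coef f l j"
proof -
  interpret finite_measure "surface :: 'a measure" by simp
  interpret P: pair_sigma_finite "surface :: 'a measure" "surface :: 'a measure" by standard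
  note fm [measurable] = square_integrable_measurable[OF f]
  note Ym [measurable] = square_integrable_measurable[OF Y_square_integrable[OF j]]
  obtain B where B: "B \<ge> 0" "\<And>x. norm x = 1 \<Longrightarrow> norm (Y l j x) \<le> B"
    using continuous_sphere_bounded[OF Y_continuous[OF j]] by blast
  define G where "G \<xi> \<eta> = f \<eta> * of_real (kernel t (\<xi> \<bullet> \<eta>)) * cnj (Y l j \<xi>)" for \<xi> \<eta>
  have Gm [measurable]: "(\<lambda>(\<xi>, \<eta>). G \<xi> \<eta>) \<in> borel_measurable (surface \<Otimes>\<^sub>M surface)" unfolding G_def by measurable
  have Gi: "integrable surface (G \<xi>)" if "norm \<xi> = 1" for \<xi>
    unfolding G_def by (intro integrable_mult_left integrable_mult_kernel t that f)
  define C where "C = (LINT \<eta>|surface. (norm (f \<eta>))\<^sup>2) * (LINT \<theta>|angle_measure DIM('a). (kernel t (cos \<theta>))\<^sup>2)"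
  have f': "square_integrable surface (\<lambda>\<eta>. complex_of_real (norm (f \<eta>)))" using f by (simp add: square_integrable_def)
  have bound: "norm (LINT \<eta>|surface. norm (G \<xi> \<eta>)) \<le> sqrt C * B" if xi: "norm \<xi> = 1" for \<xi>
  proof -
    have "(LINT \<eta>|surface. norm (G \<xi> \<eta>)) = (LINT \<eta>|surface. norm (f \<eta>) * kernel t (\<xi> \<bullet> \<eta>)) * norm (Y l j \<xi>)"
      by (simp add: G_def norm_mult kernel_nonneg)
    moreover have "norm (LINT \<eta>|surface. norm (f \<eta>) * kernel t (\<xi> \<bullet> \<eta>)) \<le> sqrt C"
    proof -
      have "(LINT \<eta>|surface. complex_of_real (norm (f \<eta>)) * of_real (kernel t (\<xi> \<bullet> \<eta>)))
          = of_real (LINT \<eta>|surface. norm (f \<eta>) * kernel t (\<xi> \<bullet> \<eta>))"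
        unfolding of_real_mult[symmetric] by (rule integral_complex_of_real)
      then have "(norm (LINT \<eta>|surface. norm (f \<eta>) * kernel t (\<xi> \<bullet> \<eta>)))\<^sup>2 \<le> C"
        using norm_integral_kernel_le[OF t xi f'] by (simp add: C_def)
      then show ?thesis by (intro real_le_rsqrt)
    qed
    moreover have "C \<ge> 0" by (simp add: C_def)
    ultimately show ?thesis using B(2)[OF xi] B(1) by (auto simp: abs_mult intro!: mult_mono)
  qed
  have "integrable surface (\<lambda>\<xi>. LINT \<eta>|surface. norm (G \<xi> \<eta>))"
    by (rule integrable_surface_bounded[of _ "sqrt C * B"], measurable) (rule bound)
  then have int: "integrable (surface \<Otimes>\<^sub>M surface) (\<lambda>(\<xi>, \<eta>). G \<xi> \<eta>)"
    using Gi by (intro P.Fubini_integrable[OF Gm] AE_I2) auto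
  define M where "M = cap_mass t * mult l t"
  have inner: "(LINT \<xi>|surface. G \<xi> \<eta>) = of_real M * (f \<eta> * cnj (Y l j \<eta>))" if eta: "norm \<eta> = 1" for \<eta>
  proof -
    have "(LINT \<xi>|surface. Y l j \<xi> * of_real (kernel t (\<eta> \<bullet> \<xi>)))
        = of_real (LINT \<theta>|angle_measure DIM('a). poly (geg DIM('a) l) (cos \<theta>) * kernel t (cos \<theta>)) * Y l j \<eta>"
      by (intro funk_hecke d Y_harmonic j eta integrable_kernel t) measurable
    also have "(LINT \<theta>|angle_measure DIM('a). poly (geg DIM('a) l) (cos \<theta>) * kernel t (cos \<theta>)) = M"
      unfolding M_def mult_def by (intro integral_angle_kernel t) measurable
    finally have fh: "(LINT \<xi>|surface. Y l j \<xi> * of_real (kernel t (\<eta> \<bullet> \<xi>))) = of_real M * Y l j \<eta>" .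
    have "(LINT \<xi>|surface. G \<xi> \<eta>) = (LINT \<xi>|surface. f \<eta> * cnj (Y l j \<xi> * of_real (kernel t (\<eta> \<bullet> \<xi>))))"
      by (intro Bochner_Integration.integral_cong) (auto simp: G_def inner_commute mult_ac)
    also have "\<dots> = f \<eta> * cnj (LINT \<xi>|surface. Y l j \<xi> * of_real (kernel t (\<eta> \<bullet> \<xi>)))"
      by (subst integral_mult_right_zero, subst Bochner_Integration.integral_cnj) simp
    finally show ?thesis unfolding fh by simp
  qed
  have "coef (cap_av t f) l j = (LINT \<xi>|surface. (LINT \<eta>|surface. G \<xi> \<eta>)) / of_real (cap_mass t)"
    unfolding coef_def cap_av_def G_def by simp
  also have "(LINT \<xi>|surface. (LINT \<eta>|surface. G \<xi> \<eta>)) = (LINT \<eta>|surface. (LINT \<xi>|surface. G \<xi> \<eta>))"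
    using P.Fubini_integral[OF int] by simp
  also have "\<dots> = of_real M * coef f l j"
    unfolding coef_def by (subst integral_mult_right_zero[symmetric], intro Bochner_Integration.integral_cong) (auto simp: inner)
  finally show ?thesis using cap_mass_pos[OF t] by (simp add: M_def)
qed

lemma cap_av_dist_power:
  assumes t: "0 < t" "t \<le> T" and xi: "norm (\<xi>::'a) = 1"
  shows "cap_av t (\<lambda>\<eta>. of_real (norm (\<xi> - \<eta>) ^ (2 * k))) \<xi> = of_real (adist k t)"
proof -
  have "(LINT \<eta>|surface. complex_of_real (norm (\<xi> - \<eta>) ^ (2 * k)) * of_real (kernel t (\<xi> \<bullet> \<eta>)))
      = (LINT \<eta>|surface. complex_of_real ((2 - 2 * (\<xi> \<bullet> \<eta>)) ^ k * kernel t (\<xi> \<bullet> \<eta>)))"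
  proof (intro Bochner_Integration.integral_cong refl)
    fix \<eta> :: 'a assume "\<eta> \<in> space surface"
    then have "(norm (\<xi> - \<eta>))\<^sup>2 = 2 - 2 * (\<xi> \<bullet> \<eta>)"
      using xi by (simp add: power2_norm_eq_inner inner_diff inner_commute norm_eq_1)
    then show "complex_of_real (norm (\<xi> - \<eta>) ^ (2 * k)) * of_real (kernel t (\<xi> \<bullet> \<eta>))
        = complex_of_real ((2 - 2 * (\<xi> \<bullet> \<eta>)) ^ k * kernel t (\<xi> \<bullet> \<eta>))" by (simp add: power_mult del: of_real_power)
  qed
  also have "\<dots> = of_real (LINT \<eta>|surface. (2 - 2 * (\<xi> \<bullet> \<eta>)) ^ k * kernel t (\<xi> \<bullet> \<eta>))" by (rule integral_complex_of_real)
  also have "(LINT \<eta>|surface. (2 - 2 * (\<xi> \<bullet> \<eta>)) ^ k * kernel t (\<xi> \<bullet> \<eta>))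
      = (LINT \<theta>|angle_measure DIM('a). (2 - 2 * cos \<theta>) ^ k * kernel t (cos \<theta>))"
    by (rule integral_zonal[OF d xi, of "\<lambda>x. (2 - 2 * x) ^ k * kernel t x"]) measurable
  also have "\<dots> = cap_mass t * adist k t" unfolding adist_def by (intro integral_angle_kernel t) measurable
  finally show ?thesis using cap_mass_pos[OF t] by (simp add: cap_av_def)
qed

lemma coef_diff:
  assumes "square_integrable surface f" "square_integrable surface g" "j \<in> {1..\<nu> l}"
  shows "coef (\<lambda>x. f x - g x) l j = coef f l j - coef g l j" unfolding coef_def left_diff_distrib
  by (intro Bochner_Integration.integral_diff square_integrable_mult Y_square_integrable assms)

lemma coef_sum_cmult:
  assumes "\<And>i. i \<in> I \<Longrightarrow> square_integrable surface (f i)" "j \<in> {1..\<nu> l}"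
  shows "coef (\<lambda>x. \<Sum>i\<in>I. c i * f i x) l j = (\<Sum>i\<in>I. c i * coef (f i) l j)"
proof -
  have "coef (\<lambda>x. \<Sum>i\<in>I. c i * f i x) l j = (LINT x|surface. (\<Sum>i\<in>I. c i * (f i x * cnj (Y l j x))))"
    by (simp add: coef_def sum_distrib_right mult.assoc)
  also have "\<dots> = (\<Sum>i\<in>I. c i * coef (f i) l j)" unfolding coef_def by (subst Bochner_Integration.integral_sum)
       (auto intro!: integrable_mult_right square_integrable_mult Y_square_integrable assms)
  finally show ?thesis .
qed

lemma parseval_parameter:
  assumes F [measurable]: "(\<lambda>(\<xi>, t). F \<xi> t) \<in> borel_measurable (surface \<Otimes>\<^sub>M borel)"
    and sq: "\<And>t. 0 < t \<Longrightarrow> t < T \<Longrightarrow> square_integrable surface (\<lambda>\<xi>. F \<xi> t)"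
  shows "(\<integral>\<^sup>+\<xi>. scale_energy p (\<lambda>t. norm (F \<xi> t)) \<partial>surface)
    = (\<Sum>l. \<Sum>j=1..\<nu> l. scale_energy p (\<lambda>t. norm (coef (\<lambda>\<xi>. F \<xi> t) l j)))"
proof -
  interpret finite_measure "surface :: 'a measure" by simp
  interpret P: pair_sigma_finite "surface :: 'a measure" lborel by standard
  have cm [measurable]: "(\<lambda>t. coef (\<lambda>\<xi>. F \<xi> t) l j) \<in> borel_measurable borel" if j: "j \<in> {1..\<nu> l}" for l j
  proof -
    note [measurable] = square_integrable_measurable[OF Y_square_integrable[OF j]]
    show ?thesis unfolding coef_def by measurable
  qed
  have m: "(\<lambda>t. ennreal ((norm (coef (\<lambda>\<xi>. F \<xi> t) l j))\<^sup>2 / t powr p) * indicator {0<..<T} t) \<in> borel_measurable lborel"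
    if "j \<in> {1..\<nu> l}" for l j using cm[OF that] by measurable
  have "(\<integral>\<^sup>+\<xi>. scale_energy p (\<lambda>t. norm (F \<xi> t)) \<partial>surface)
      = (\<integral>\<^sup>+t. (\<integral>\<^sup>+\<xi>. ennreal ((norm (F \<xi> t))\<^sup>2 / t powr p) * indicator {0<..<T} t \<partial>surface) \<partial>lborel)"
    by (rule P.Fubini'[symmetric]) measurable
  also have "\<dots> = (\<integral>\<^sup>+t. (\<Sum>l. \<Sum>j=1..\<nu> l. ennreal ((norm (coef (\<lambda>\<xi>. F \<xi> t) l j))\<^sup>2 / t powr p) * indicator {0<..<T} t) \<partial>lborel)"
  proof (intro nn_integral_cong)
    fix t
    show "(\<integral>\<^sup>+\<xi>. ennreal ((norm (F \<xi> t))\<^sup>2 / t powr p) * indicator {0<..<T} t \<partial>surface)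
      = (\<Sum>l. \<Sum>j=1..\<nu> l. ennreal ((norm (coef (\<lambda>\<xi>. F \<xi> t) l j))\<^sup>2 / t powr p) * indicator {0<..<T} t)"
    proof (cases "t \<in> {0<..<T}")
      case True
      then have s: "square_integrable surface (\<lambda>\<xi>. F \<xi> t)" using sq by auto
      note [measurable] = square_integrable_measurable[OF s]
      have split: "ennreal (a / t powr p) = ennreal a * ennreal (1 / t powr p)" if "a \<ge> 0" for a
        using that by (simp add: ennreal_mult[symmetric])
      have "(\<integral>\<^sup>+\<xi>. ennreal ((norm (F \<xi> t))\<^sup>2 / t powr p) * indicator {0<..<T} t \<partial>surface)
        = (\<integral>\<^sup>+\<xi>. ennreal ((norm (F \<xi> t))\<^sup>2) * ennreal (1 / t powr p) \<partial>surface)"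
        using True by (intro nn_integral_cong) (subst split, auto)
      also have "\<dots> = (\<integral>\<^sup>+\<xi>. ennreal ((norm (F \<xi> t))\<^sup>2) \<partial>surface) * ennreal (1 / t powr p)"
        by (rule nn_integral_multc) measurable
      also have "\<dots> = (\<Sum>l. (\<Sum>j=1..\<nu> l. ennreal ((norm (coef (\<lambda>\<xi>. F \<xi> t) l j))\<^sup>2)) * ennreal (1 / t powr p))"
        unfolding parseval[OF s] by (rule ennreal_suminf_multc[symmetric])
      also have "\<dots> = (\<Sum>l. \<Sum>j=1..\<nu> l. ennreal ((norm (coef (\<lambda>\<xi>. F \<xi> t) l j))\<^sup>2 / t powr p) * indicator {0<..<T} t)"
        unfolding sum_distrib_right using True by (intro suminf_cong sum.cong refl) (subst split, auto)
      finally show ?thesis .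
    qed simp
  qed
  also have "\<dots> = (\<Sum>l. \<Sum>j=1..\<nu> l. scale_energy p (\<lambda>t. norm (coef (\<lambda>\<xi>. F \<xi> t) l j)))"
    by (subst nn_integral_suminf, intro borel_measurable_sum m, assumption, intro suminf_cong nn_integral_sum m)
  finally show ?thesis .
qed


section \<open>The square function in terms of Fourier coefficients\<close>

text \<open>
  The function whose square is integrated in the square function, with both cases for \<open>\<alpha>\<close> in
  one sum.
\<close>

definition residual :: "real \<Rightarrow> nat \<Rightarrow> ('a \<Rightarrow> complex) \<Rightarrow> (nat \<Rightarrow> 'a \<Rightarrow> complex) \<Rightarrow> 'a \<Rightarrow> real \<Rightarrow> complex" where
  "residual \<alpha> n f g \<xi> t = cap_av t f \<xi> - f \<xi>
     - (\<Sum>k=1..n. of_real (adist k t) * (if \<alpha> = 2 * real n \<and> k = n then cap_av t (g k) \<xi> else g k \<xi>))"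

definition energy :: "real \<Rightarrow> nat \<Rightarrow> ('a \<Rightarrow> complex) \<Rightarrow> (nat \<Rightarrow> 'a \<Rightarrow> complex) \<Rightarrow> ennreal" where
  "energy \<alpha> n f g = (\<integral>\<^sup>+\<xi>. scale_energy (2 * \<alpha> + 1) (\<lambda>t. norm (residual \<alpha> n f g \<xi> t)) \<partial>surface)"

lemma residual_measurable:
  assumes [measurable]: "f \<in> borel_measurable surface" and g: "\<And>k. k \<in> {1..n} \<Longrightarrow> g k \<in> borel_measurable surface"
  shows "(\<lambda>(\<xi>, t). residual \<alpha> n f g \<xi> t) \<in> borel_measurable (surface \<Otimes>\<^sub>M borel)"
proof -
  have "(\<lambda>(\<xi>, t). \<Sum>k=1..n. of_real (adist k t) * (if \<alpha> = 2 * real n \<and> k = n then cap_av t (g k) \<xi> else g k \<xi>))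
      \<in> borel_measurable (surface \<Otimes>\<^sub>M borel)" unfolding split_beta
  proof (intro borel_measurable_sum)
    fix k assume "k \<in> {1..n}"
    note [measurable] = g[OF this]
    show "(\<lambda>x. of_real (adist k (snd x)) * (if \<alpha> = 2 * real n \<and> k = n then cap_av (snd x) (g k) (fst x) else g k (fst x)))
      \<in> borel_measurable (surface \<Otimes>\<^sub>M borel)" by measurable
  qed
  note [measurable] = this
  show ?thesis unfolding residual_def by measurable
qed

lemma residual_square_integrable:
  assumes t: "0 < t" "t \<le> T" and f: "square_integrable surface f"
    and g: "\<forall>k\<in>{1..n}. square_integrable surface (g k)"
  shows "square_integrable surface (\<lambda>\<xi>. residual \<alpha> n f g \<xi> t)" unfolding residual_def
proof (intro square_integrable_diff square_integrable_sum square_integrable_cmult cap_av_square_integrable t f)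
  fix k assume "k \<in> {1..n}"
  then show "square_integrable surface (\<lambda>\<xi>. if \<alpha> = 2 * real n \<and> k = n then cap_av t (g k) \<xi> else g k \<xi>)"
    using bspec[OF g, of k] cap_av_square_integrable[OF t, of "g k"] by (cases "\<alpha> = 2 * real n \<and> k = n") auto
qed

text \<open>
  The residual is the Taylor remainder of the multiplier applied to \<open>f\<close>, up to the amounts by
  which the coefficients of the \<open>g\<^sub>k\<close> deviate from the Taylor coefficients times those of \<open>f\<close>.
\<close>

lemma coef_residual:
  assumes t: "0 < t" "t \<le> T" and f: "square_integrable surface f" and j: "j \<in> {1..\<nu> l}"
    and g: "\<forall>k\<in>{1..n}. square_integrable surface (g k)" and n: "n \<ge> 1"
  shows "coef (\<lambda>\<xi>. residual \<alpha> n f g \<xi> t) l j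
    = (\<Sum>k=1..n. (of_real (geg_taylor DIM('a) l k) * coef f l j - coef (g k) l j) * of_real (adist k t))
      + (of_real (rem (Suc n) l t) * coef f l j
         + (if \<alpha> = 2 * real n then of_real (adist n t * (1 - mult l t)) * coef (g n) l j else 0))"
proof -
  define a where "a k = complex_of_real (adist k t)" for k
  define m where "m = complex_of_real (mult l t)"
  define \<tau> where "\<tau> k = complex_of_real (geg_taylor DIM('a) l k)" for k
  define G where "G k = (\<lambda>\<xi>. if \<alpha> = 2 * real n \<and> k = n then cap_av t (g k) \<xi> else g k \<xi>)" for k
  have G_sq: "square_integrable surface (G k)" if "k \<in> {1..n}" for k
    unfolding G_def using bspec[OF g that] cap_av_square_integrable[OF t, of "g k"] by (cases "\<alpha> = 2 * real n \<and> k = n") auto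
  have G_coef: "coef (G k) l j = coef (g k) l j - (if k = n then (if \<alpha> = 2 * real n then (1 - m) * coef (g n) l j else 0) else 0)"
    if "k \<in> {1..n}" for k unfolding G_def m_def using coef_cap_av[OF t bspec[OF g that] j] by (auto simp: algebra_simps)
  have "coef (\<lambda>\<xi>. residual \<alpha> n f g \<xi> t) l j = coef (\<lambda>\<xi>. (cap_av t f \<xi> - f \<xi>) - (\<Sum>k=1..n. a k * G k \<xi>)) l j"
    by (simp add: residual_def a_def G_def)
  also have "\<dots> = m * coef f l j - coef f l j - (\<Sum>k=1..n. a k * coef (G k) l j)" using t f j G_sq
    by (subst coef_diff | subst coef_sum_cmult | subst coef_cap_av
        | intro square_integrable_diff square_integrable_sum square_integrable_cmult cap_av_square_integrable
        | simp add: m_def)+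
  also have "(\<Sum>k=1..n. a k * coef (G k) l j)
     = (\<Sum>k=1..n. a k * coef (g k) l j - (if k = n then a n * (if \<alpha> = 2 * real n then (1 - m) * coef (g n) l j else 0) else 0))"
    by (intro sum.cong refl) (simp add: G_coef algebra_simps)
  also have "\<dots> = (\<Sum>k=1..n. a k * coef (g k) l j) - a n * (if \<alpha> = 2 * real n then (1 - m) * coef (g n) l j else 0)"
    using n by (simp add: sum_subtractf)
  also have "m * coef f l j - coef f l j = of_real (rem (Suc n) l t) * coef f l j + (\<Sum>k=1..n. \<tau> k * coef f l j * a k)"
  proof -
    have "(\<Sum>k<Suc n. geg_taylor DIM('a) l k * adist k t) = 1 + (\<Sum>k=1..n. geg_taylor DIM('a) l k * adist k t)"
      unfolding sum.lessThan_Suc_shift using adist_0[OF t] geg_d1_0[OF d, of l]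
      by (simp add: sum.atLeast1_atMost_eq geg_taylor_def[of _ _ 0])
    then have "mult l t - 1 = rem (Suc n) l t + (\<Sum>k=1..n. geg_taylor DIM('a) l k * adist k t)" by (simp add: rem_def)
    from arg_cong[OF this, of complex_of_real]
    have "m - 1 = of_real (rem (Suc n) l t) + (\<Sum>k=1..n. \<tau> k * a k)" by (simp add: m_def \<tau>_def a_def)
    then have "(m - 1) * coef f l j = (of_real (rem (Suc n) l t) + (\<Sum>k=1..n. \<tau> k * a k)) * coef f l j" by simp
    then show ?thesis by (simp add: algebra_simps sum_distrib_left)
  qed
  finally show ?thesis by (simp add: a_def m_def \<tau>_def sum_subtractf algebra_simps)
qed

lemma energy_eq:
  assumes f: "square_integrable surface f" and g: "\<forall>k\<in>{1..n}. square_integrable surface (g k)"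
  shows "energy \<alpha> n f g = (\<Sum>l. \<Sum>j=1..\<nu> l.
    scale_energy (2 * \<alpha> + 1) (\<lambda>t. norm (coef (\<lambda>\<xi>. residual \<alpha> n f g \<xi> t) l j)))" unfolding energy_def
  using square_integrable_measurable[OF f] square_integrable_measurable[OF bspec[OF g]]
  by (intro parseval_parameter residual_measurable residual_square_integrable f g) auto

text \<open>
  The weight of degree \<open>l\<close> in the Sobolev norm, comparable to \<open>\<lambda>\<^sup>1\<^sup>/\<^sup>2\<close> for \<open>l \<ge> 1\<close>.
\<close>

definition sobolev_weight :: "nat \<Rightarrow> real" where
  "sobolev_weight l = 1 + sqrt (geg_eigen DIM('a) l)"

lemma sobolev_weight_lower:
  assumes "\<alpha> \<ge> 0"
  shows "geg_eigen DIM('a) l powr \<alpha> \<le> sobolev_weight l powr (2 * \<alpha>)"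
proof -
  define e where "e = geg_eigen DIM('a) l"
  have e: "e \<ge> 0" unfolding e_def by (rule geg_eigen_nonneg[OF d])
  have "e \<le> (1 + sqrt e)\<^sup>2" using e by (simp add: power2_sum)
  then have "e powr \<alpha> \<le> ((1 + sqrt e)\<^sup>2) powr \<alpha>" using e assms by (intro powr_mono2)
  also have "\<dots> = (1 + sqrt e) powr (2 * \<alpha>)" using e by (simp add: powr_powr flip: powr_numeral)
  finally show ?thesis by (simp add: sobolev_weight_def e_def)
qed

lemma sobolev_weight_upper:
  assumes "\<alpha> \<ge> 0" "l \<ge> 1"
  shows "sobolev_weight l powr (2 * \<alpha>) \<le> 4 powr \<alpha> * geg_eigen DIM('a) l powr \<alpha>"
proof -
  define e where "e = geg_eigen DIM('a) l"
  have e: "e \<ge> 1" unfolding e_def by (rule geg_eigen_ge_1[OF assms(2)])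
  then have s: "sqrt e \<ge> 1" by simp
  have "(1 + sqrt e)\<^sup>2 \<le> (2 * sqrt e)\<^sup>2" using s by (intro power_mono) auto
  also have "\<dots> = 4 * e" using e by (simp add: power_mult_distrib)
  finally have "((1 + sqrt e)\<^sup>2) powr \<alpha> \<le> (4 * e) powr \<alpha>" using assms by (intro powr_mono2) auto
  moreover have "((1 + sqrt e)\<^sup>2) powr \<alpha> = (1 + sqrt e) powr (2 * \<alpha>)"
    using s by (simp add: powr_powr flip: powr_numeral)
  ultimately show ?thesis using e by (simp add: sobolev_weight_def powr_mult flip: e_def)
qed

lemma taylor_le_sobolev_weight:
  assumes "2 * real k \<le> \<alpha>"
  shows "(geg_taylor DIM('a) l k)\<^sup>2 \<le> sobolev_weight l powr (2 * \<alpha>)"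
proof -
  have e: "geg_eigen DIM('a) l \<ge> 0" by (rule geg_eigen_nonneg[OF d])
  have w: "sobolev_weight l \<ge> 1" by (simp add: sobolev_weight_def e)
  have el: "geg_eigen DIM('a) l \<le> (sobolev_weight l)\<^sup>2" using e by (simp add: sobolev_weight_def power2_sum)
  have "(geg_taylor DIM('a) l k)\<^sup>2 = \<bar>geg_taylor DIM('a) l k\<bar>\<^sup>2" by simp
  also have "\<dots> \<le> (geg_eigen DIM('a) l ^ k)\<^sup>2" by (intro power_mono geg_taylor_upper d) auto
  also have "\<dots> \<le> (((sobolev_weight l)\<^sup>2) ^ k)\<^sup>2" using e el by (intro power_mono) auto
  also have "\<dots> = sobolev_weight l ^ (2 * k * 2)" by (simp only: power_mult)
  also have "\<dots> = sobolev_weight l powr (4 * real k)" using w powr_realpow[of "sobolev_weight l" "2 * k * 2"] by simp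
  also have "\<dots> \<le> sobolev_weight l powr (2 * \<alpha>)" using w assms by (intro powr_mono) auto
  finally show ?thesis .
qed

lemma scale_energy_cmult:
  assumes [measurable]: "R \<in> borel_measurable borel" and \<phi>: "\<And>t. 0 < t \<Longrightarrow> t < T \<Longrightarrow> \<phi> t = of_real (R t) * (c :: complex)"
  shows "scale_energy p (\<lambda>t. norm (\<phi> t)) = ennreal ((norm c)\<^sup>2) * scale_energy p R"
proof -
  have "scale_energy p (\<lambda>t. norm (\<phi> t))
    = (\<integral>\<^sup>+t. ennreal ((norm c)\<^sup>2) * (ennreal ((R t)\<^sup>2 / t powr p) * indicator {0<..<T} t) \<partial>lborel)"
    by (intro nn_integral_cong)
       (auto simp: \<phi> norm_mult power_mult_distrib mult_ac simp flip: ennreal_mult split: split_indicator)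
  also have "\<dots> = ennreal ((norm c)\<^sup>2) * scale_energy p R" by (intro nn_integral_cmult) measurable
  finally show ?thesis .
qed

text \<open>Membership in the Sobolev space makes the Taylor coefficients of the multiplier times those of \<open>f\<close> square summable.\<close>

theorem sobolev_imp_finite_energy:
  assumes n: "n \<ge> 1" and \<alpha>: "2 * real n \<le> \<alpha>" "\<alpha> < 2 * real n + 2" and f: "square_integrable surface f"
    and fin: "(\<Sum>l. ennreal (sobolev_weight l powr (2 * \<alpha>) * (\<Sum>j=1..\<nu> l. (norm (coef f l j))\<^sup>2))) < \<infinity>"
  obtains g where "\<forall>k\<in>{1..n}. square_integrable surface (g k)" "energy \<alpha> n f g < \<infinity>"
proof -
  define F where "F l = (\<Sum>j=1..\<nu> l. (norm (coef f l j))\<^sup>2)" for l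
  have F: "F l \<ge> 0" for l by (simp add: F_def sum_nonneg)
  have sum_wF: "summable (\<lambda>l. sobolev_weight l powr (2 * \<alpha>) * F l)"
    using fin F by (intro summable_suminf_not_top) (auto simp: F_def less_top)
  have "\<exists>g. square_integrable surface g \<and> (\<forall>l. \<forall>j\<in>{1..\<nu> l}. coef g l j = of_real (geg_taylor DIM('a) l k) * coef f l j)"
    if k: "k \<in> {1..n}" for k
  proof -
    have eq: "(\<Sum>j=1..\<nu> l. (norm (of_real (geg_taylor DIM('a) l k) * coef f l j))\<^sup>2) = (geg_taylor DIM('a) l k)\<^sup>2 * F l" for l
      by (simp add: norm_mult power_mult_distrib F_def sum_distrib_left)
    have "2 * real k \<le> \<alpha>" using k \<alpha> by auto
    then have "summable (\<lambda>l. (geg_taylor DIM('a) l k)\<^sup>2 * F l)"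
      using F by (intro summable_comparison_test'[OF sum_wF, of 0]) (auto intro!: mult_right_mono taylor_le_sobolev_weight)
    then show ?thesis using exists_coef[of "\<lambda>l j. of_real (geg_taylor DIM('a) l k) * coef f l j"] unfolding eq by metis
  qed
  then obtain g where g: "\<forall>k\<in>{1..n}. square_integrable surface (g k)"
    and gc: "\<And>k l j. k \<in> {1..n} \<Longrightarrow> j \<in> {1..\<nu> l} \<Longrightarrow> coef (g k) l j = of_real (geg_taylor DIM('a) l k) * coef f l j"
    by metis
  define R where "R l t = (if \<alpha> = 2 * real n then rem' n l t else rem (Suc n) l t)" for l t
  obtain C where C: "C \<ge> 0" "\<And>l. scale_energy (2 * \<alpha> + 1) (R l) \<le> ennreal (C * geg_eigen DIM('a) l powr \<alpha>)"
  proof (cases "\<alpha> = 2 * real n")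
    case True
    then show ?thesis using that rem'_integral_upper[OF n] by (auto simp: R_def)
  next
    case False
    then show ?thesis using that rem_integral_upper[of n \<alpha>] \<alpha> by (auto simp: R_def)
  qed
  have R_meas [measurable]: "R l \<in> borel_measurable borel" for l unfolding R_def rem'_def rem_def by measurable
  have coef_R: "coef (\<lambda>\<xi>. residual \<alpha> n f g \<xi> t) l j = of_real (R l t) * coef f l j"
    if t: "0 < t" "t \<le> T" and j: "j \<in> {1..\<nu> l}" for t l j
  proof -
    have "(\<Sum>k=1..n. (of_real (geg_taylor DIM('a) l k) * coef f l j - coef (g k) l j) * of_real (adist k t)) = 0"
      using gc j by (intro sum.neutral) simp
    moreover have "coef (g n) l j = of_real (geg_taylor DIM('a) l n) * coef f l j" using gc j n by simp
    ultimately show ?thesis by (simp add: coef_residual[OF t f j g n] R_def rem'_eq algebra_simps)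
  qed
  have "energy \<alpha> n f g = (\<Sum>l. \<Sum>j=1..\<nu> l.
      scale_energy (2 * \<alpha> + 1) (\<lambda>t. norm (coef (\<lambda>\<xi>. residual \<alpha> n f g \<xi> t) l j)))" by (rule energy_eq[OF f g])
  also have "\<dots> \<le> (\<Sum>l. \<Sum>j=1..\<nu> l. ennreal ((norm (coef f l j))\<^sup>2) * ennreal (C * sobolev_weight l powr (2 * \<alpha>)))"
  proof (intro suminf_le sum_mono summableI)
    fix l j assume j: "j \<in> {1..\<nu> l}"
    have "scale_energy (2 * \<alpha> + 1) (\<lambda>t. norm (coef (\<lambda>\<xi>. residual \<alpha> n f g \<xi> t) l j))
      = ennreal ((norm (coef f l j))\<^sup>2) * scale_energy (2 * \<alpha> + 1) (R l)"
      using j by (intro scale_energy_cmult R_meas) (simp add: coef_R)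
    also have "\<dots> \<le> ennreal ((norm (coef f l j))\<^sup>2) * ennreal (C * sobolev_weight l powr (2 * \<alpha>))"
      using C(1) sobolev_weight_lower[of \<alpha> l] \<alpha> by (intro mult_left_mono order.trans[OF C(2)] ennreal_leI) auto
    finally show "scale_energy (2 * \<alpha> + 1) (\<lambda>t. norm (coef (\<lambda>\<xi>. residual \<alpha> n f g \<xi> t) l j))
      \<le> ennreal ((norm (coef f l j))\<^sup>2) * ennreal (C * sobolev_weight l powr (2 * \<alpha>))" .
  qed
  also have "\<dots> = (\<Sum>l. ennreal (C * (sobolev_weight l powr (2 * \<alpha>) * F l)))"
    using C(1) by (intro suminf_cong) (simp add: F_def sum_distrib_left ennreal_mult'[symmetric] mult_ac sum_ennreal)
  also have "\<dots> < \<infinity>" using summable_mult[OF sum_wF, of C] C(1) F by (subst suminf_ennreal2) auto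
  finally show ?thesis using that g by blast
qed

text \<open>
  Conversely, finite energy leaves no choice: since \<open>t\<^sup>2\<^sup>k / t\<^sup>2\<^sup>n\<^sup>+\<^sup>1\<^sup>/\<^sup>2\<close> is not square integrable at \<open>0\<close> for
  \<open>k \<le> n\<close>, the coefficients of each \<open>g\<^sub>k\<close> are the Taylor coefficients times those of \<open>f\<close>.
\<close>

lemma finite_energy_imp_coef:
  assumes n: "n \<ge> 1" and \<alpha>: "2 * real n \<le> \<alpha>" and f: "square_integrable surface f"
    and g: "\<forall>k\<in>{1..n}. square_integrable surface (g k)"
    and fin: "energy \<alpha> n f g < \<infinity>" and k: "k \<in> {1..n}" and j: "j \<in> {1..\<nu> l}"
  shows "coef (g k) l j = of_real (geg_taylor DIM('a) l k) * coef f l j"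
proof -
  define \<Lambda> where "\<Lambda> = geg_eigen DIM('a) l"
  have lam: "\<Lambda> \<ge> 0" unfolding \<Lambda>_def by (rule geg_eigen_nonneg[OF d])
  define c where "c t = coef (\<lambda>\<xi>. residual \<alpha> n f g \<xi> t) l j" for t
  define e where "e k = of_real (geg_taylor DIM('a) l k) * coef f l j - coef (g k) l j" for k
  define r where "r t = of_real (rem (Suc n) l t) * coef f l j
         + (if \<alpha> = 2 * real n then of_real (adist n t * (1 - mult l t)) * coef (g n) l j else 0)" for t
  have c_eq: "c t = (\<Sum>k=1..n. e k * of_real (adist k t)) + r t" if "0 < t" "t \<le> T" for t
    unfolding c_def e_def r_def by (rule coef_residual[OF that f j g n])
  have "scale_energy (2 * \<alpha> + 1) (\<lambda>t. norm (c t))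
      \<le> (\<Sum>j=1..\<nu> l. scale_energy (2 * \<alpha> + 1) (\<lambda>t. norm (coef (\<lambda>\<xi>. residual \<alpha> n f g \<xi> t) l j)))"
    unfolding c_def using j by (intro member_le_sum) auto
  also have "\<dots> < \<infinity>" using fin unfolding energy_eq[OF f g] by (rule ennreal_suminf_lessD)
  finally have cfin: "scale_energy (2 * \<alpha> + 1) (\<lambda>t. norm (c t)) < \<infinity>" .
  define q where "q = 2 * \<alpha> - 4 * real n"
  have q: "q \<ge> 0" using \<alpha> by (simp add: q_def)
  have "scale_energy (4 * real n + 1) (\<lambda>t. norm ((\<Sum>k=1..n. e k * of_real (adist k t)) + r t))
     \<le> (\<integral>\<^sup>+t. ennreal (T powr q) * (ennreal ((norm (c t))\<^sup>2 / t powr (2 * \<alpha> + 1)) * indicator {0<..<T} t) \<partial>lborel)"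
  proof (intro nn_integral_mono)
    fix t
    show "ennreal ((norm ((\<Sum>k=1..n. e k * of_real (adist k t)) + r t))\<^sup>2 / t powr (4 * real n + 1)) * indicator {0<..<T} t
      \<le> ennreal (T powr q) * (ennreal ((norm (c t))\<^sup>2 / t powr (2 * \<alpha> + 1)) * indicator {0<..<T} t)"
    proof (cases "t \<in> {0<..<T}")
      case True
      have "t powr (2 * \<alpha> + 1) = t powr q * t powr (4 * real n + 1)" by (simp add: q_def flip: powr_add)
      also have "\<dots> \<le> T powr q * t powr (4 * real n + 1)" using True q by (intro mult_right_mono powr_mono2) auto
      finally have "1 / t powr (4 * real n + 1) \<le> T powr q / t powr (2 * \<alpha> + 1)" using True by (simp add: field_simps)
      then have "(norm (c t))\<^sup>2 * (1 / t powr (4 * real n + 1)) \<le> (norm (c t))\<^sup>2 * (T powr q / t powr (2 * \<alpha> + 1))"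
        by (intro mult_left_mono) auto
      then have "(norm (c t))\<^sup>2 / t powr (4 * real n + 1) \<le> T powr q * ((norm (c t))\<^sup>2 / t powr (2 * \<alpha> + 1))"
        by (simp add: mult_ac)
      moreover have c_t: "(\<Sum>k=1..n. e k * of_real (adist k t)) + r t = c t" using c_eq[of t] True by simp
      ultimately show ?thesis unfolding c_t using True by (simp add: ennreal_mult'[symmetric] ennreal_leI)
    qed simp
  qed
  also have "\<dots> = ennreal (T powr q) * scale_energy (2 * \<alpha> + 1) (\<lambda>t. norm (c t))"
  proof (rule nn_integral_cmult)
    have "(\<lambda>t. c t * indicator {0<..<T} t) = (\<lambda>t. ((\<Sum>k=1..n. e k * of_real (adist k t)) + r t) * indicator {0<..<T} t)"
      using c_eq by (auto split: split_indicator)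
    moreover have "(\<lambda>t. ((\<Sum>k=1..n. e k * of_real (adist k t)) + r t) * indicator {0<..<T} t) \<in> borel_measurable borel"
      unfolding r_def rem_def by measurable
    ultimately have [measurable]: "(\<lambda>t. c t * indicator {0<..<T} t) \<in> borel_measurable borel" by (simp only:)
    have "(\<lambda>t. ennreal ((norm (c t))\<^sup>2 / t powr (2 * \<alpha> + 1)) * indicator {0<..<T} t)
       = (\<lambda>t. ennreal ((norm (c t * indicator {0<..<T} t))\<^sup>2 / t powr (2 * \<alpha> + 1)))" by (auto split: split_indicator)
    then show "(\<lambda>t. ennreal ((norm (c t))\<^sup>2 / t powr (2 * \<alpha> + 1)) * indicator {0<..<T} t) \<in> borel_measurable lborel"
      by simp
  qed
  also have "\<dots> < \<infinity>" using cfin by (simp add: ennreal_mult_less_top)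
  finally have "e k = 0"
  proof (rule expansion_coefficients_zero[OF _ _ k])
    fix t assume t: "0 < t" "t < T"
    have "norm (of_real (rem (Suc n) l t) * coef f l j) \<le> (\<Lambda> * t\<^sup>2) ^ Suc n * norm (coef f l j)"
      using rem_bound[of t "Suc n" l] t unfolding norm_mult \<Lambda>_def by (intro mult_right_mono) auto
    moreover have "norm (of_real (adist n t * (1 - mult l t)) * coef (g n) l j) \<le> t ^ (2 * n) * (\<Lambda> * t\<^sup>2) * norm (coef (g n) l j)"
      using one_minus_mult_bound[of t l] adist_upper[of t n] t
      unfolding norm_mult norm_of_real abs_mult \<Lambda>_def by (intro mult_right_mono mult_mono) auto
    moreover have "0 \<le> t ^ (2 * n) * (\<Lambda> * t\<^sup>2) * norm (coef (g n) l j)" using lam t by simp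
    ultimately have "norm (r t) \<le> (\<Lambda> * t\<^sup>2) ^ Suc n * norm (coef f l j) + t ^ (2 * n) * (\<Lambda> * t\<^sup>2) * norm (coef (g n) l j)"
      unfolding r_def by (intro norm_triangle_le) (auto simp del: power_Suc)
    also have "\<dots> = (\<Lambda> ^ Suc n * norm (coef f l j) + \<Lambda> * norm (coef (g n) l j)) * t ^ (2 * n + 2)"
      by (simp add: power_mult_distrib power_mult power2_eq_square algebra_simps)
    finally show "norm (r t) \<le> (\<Lambda> ^ Suc n * norm (coef f l j) + \<Lambda> * norm (coef (g n) l j)) * t ^ (2 * n + 2)" .
  qed
  then show ?thesis by (simp add: e_def)
qed

text \<open>
  For \<open>\<alpha> > 2n\<close> the lower bound for the Taylor remainder gives the claim. For \<open>\<alpha> = 2n\<close> it follows already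
  from \<open>g\<^sub>n\<close> being square integrable, since its coefficients are of order \<open>\<lambda>\<^sup>n\<close> times those of \<open>f\<close>.
\<close>

theorem finite_energy_imp_sobolev:
  assumes n: "n \<ge> 1" and \<alpha>: "2 * real n \<le> \<alpha>" and f: "square_integrable surface f"
    and g: "\<forall>k\<in>{1..n}. square_integrable surface (g k)"
    and fin: "energy \<alpha> n f g < \<infinity>"
  shows "(\<Sum>l. ennreal (sobolev_weight l powr (2 * \<alpha>) * (\<Sum>j=1..\<nu> l. (norm (coef f l j))\<^sup>2))) < \<infinity>"
proof -
  define F where "F l = (\<Sum>j=1..\<nu> l. (norm (coef f l j))\<^sup>2)" for l
  have F: "F l \<ge> 0" for l by (simp add: F_def sum_nonneg)
  note coef_g = finite_energy_imp_coef[OF n \<alpha> f g fin]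
  obtain c H where c: "c > 0" and H: "summable H" "\<And>l. l \<ge> Suc n \<Longrightarrow> c * geg_eigen DIM('a) l powr \<alpha> * F l \<le> H l"
  proof (cases "\<alpha> = 2 * real n")
    case True
    obtain c where c: "c > 0" "\<And>l. l \<ge> n \<Longrightarrow> c * geg_eigen DIM('a) l ^ n \<le> \<bar>geg_taylor DIM('a) l n\<bar>"
      using geg_taylor_lower[OF d] by blast
    have gn: "square_integrable surface (g n)" using g n by simp
    show ?thesis
    proof (rule that[OF _ summable_coef[OF gn]])
      show "c\<^sup>2 > 0" using c by simp
      fix l assume l: "l \<ge> Suc n"
      have e: "geg_eigen DIM('a) l > 0" using geg_eigen_ge_1[of l] l by simp
      have "c\<^sup>2 * geg_eigen DIM('a) l powr \<alpha> = (c * geg_eigen DIM('a) l ^ n)\<^sup>2"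
      proof -
        have "geg_eigen DIM('a) l powr \<alpha> = geg_eigen DIM('a) l ^ (n * 2)"
          using powr_realpow[OF e, of "n * 2"] by (simp add: True mult.commute)
        then show ?thesis by (simp add: power_mult_distrib power_mult)
      qed
      also have "\<dots> \<le> \<bar>geg_taylor DIM('a) l n\<bar>\<^sup>2" using c l e by (intro power_mono) auto
      finally have "c\<^sup>2 * geg_eigen DIM('a) l powr \<alpha> * F l \<le> (geg_taylor DIM('a) l n)\<^sup>2 * F l"
        using F by (intro mult_right_mono) auto
      also have "\<dots> = (\<Sum>j=1..\<nu> l. (norm (coef (g n) l j))\<^sup>2)"
        using n by (simp add: F_def sum_distrib_left coef_g norm_mult power_mult_distrib)
      finally show "c\<^sup>2 * geg_eigen DIM('a) l powr \<alpha> * F l \<le> (\<Sum>j=1..\<nu> l. (norm (coef (g n) l j))\<^sup>2)" .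
    qed
  next
    case False
    have "\<alpha> > 0" using \<alpha> n by auto
    then obtain c where c: "c > 0" "\<And>l. l \<ge> Suc n \<Longrightarrow> ennreal (c * geg_eigen DIM('a) l powr \<alpha>)
        \<le> scale_energy (2 * \<alpha> + 1) (rem (Suc n) l)" using rem_integral_lower by blast
    have rem_meas [measurable]: "rem (Suc n) l \<in> borel_measurable borel" for l unfolding rem_def by measurable
    have coef_r: "coef (\<lambda>\<xi>. residual \<alpha> n f g \<xi> t) l j = of_real (rem (Suc n) l t) * coef f l j"
      if t: "0 < t" "t \<le> T" and j: "j \<in> {1..\<nu> l}" for t l j
    proof -
      have "(\<Sum>k=1..n. (of_real (geg_taylor DIM('a) l k) * coef f l j - coef (g k) l j) * of_real (adist k t)) = 0"
        using coef_g j by (intro sum.neutral) simp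
      then show ?thesis using False by (simp add: coef_residual[OF t f j g n])
    qed
    define I where "I l = (\<Sum>j=1..\<nu> l. scale_energy (2 * \<alpha> + 1) (\<lambda>t. norm (coef (\<lambda>\<xi>. residual \<alpha> n f g \<xi> t) l j)))" for l
    have I_fin: "(\<Sum>l. I l) < \<infinity>" using fin unfolding energy_eq[OF f g] I_def .
    have low: "ennreal (c * geg_eigen DIM('a) l powr \<alpha> * F l) \<le> I l" if l: "l \<ge> Suc n" for l
    proof -
      have "ennreal (c * geg_eigen DIM('a) l powr \<alpha> * F l) = (\<Sum>j=1..\<nu> l. ennreal ((norm (coef f l j))\<^sup>2) * ennreal (c * geg_eigen DIM('a) l powr \<alpha>))"
        using c(1) by (simp add: F_def sum_distrib_left ennreal_mult'[symmetric] mult_ac sum_ennreal)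
      also have "\<dots> \<le> I l" unfolding I_def
      proof (intro sum_mono)
        fix j assume j: "j \<in> {1..\<nu> l}"
        have "ennreal ((norm (coef f l j))\<^sup>2) * ennreal (c * geg_eigen DIM('a) l powr \<alpha>)
          \<le> ennreal ((norm (coef f l j))\<^sup>2) * scale_energy (2 * \<alpha> + 1) (rem (Suc n) l)"
          by (intro mult_left_mono c(2) l) auto
        also have "\<dots> = scale_energy (2 * \<alpha> + 1) (\<lambda>t. norm (coef (\<lambda>\<xi>. residual \<alpha> n f g \<xi> t) l j))"
          using j by (intro scale_energy_cmult[symmetric] rem_meas) (simp add: coef_r)
        finally show "ennreal ((norm (coef f l j))\<^sup>2) * ennreal (c * geg_eigen DIM('a) l powr \<alpha>)
          \<le> scale_energy (2 * \<alpha> + 1) (\<lambda>t. norm (coef (\<lambda>\<xi>. residual \<alpha> n f g \<xi> t) l j))" .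
      qed
      finally show ?thesis .
    qed
    have I_fin1: "I l < \<infinity>" for l using I_fin by (rule ennreal_suminf_lessD)
    show ?thesis
    proof (rule that[of c "\<lambda>l. enn2real (I l)"])
      show "summable (\<lambda>l. enn2real (I l))" using I_fin I_fin1 by (intro summable_suminf_not_top) (auto simp: less_top)
      fix l assume "l \<ge> Suc n"
      from low[OF this] show "c * geg_eigen DIM('a) l powr \<alpha> * F l \<le> enn2real (I l)"
        using I_fin1[of l] by (metis ennreal_enn2real ennreal_le_iff enn2real_nonneg infinity_ennreal_def)
    qed (rule c(1))
  qed
  have "sobolev_weight l powr (2 * \<alpha>) * F l \<le> 4 powr \<alpha> / c * H l" if l: "l \<ge> Suc n" for l
  proof -
    have "sobolev_weight l powr (2 * \<alpha>) * F l \<le> (4 powr \<alpha> * geg_eigen DIM('a) l powr \<alpha>) * F l"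
      using F \<alpha> l by (intro mult_right_mono sobolev_weight_upper) auto
    also have "\<dots> = 4 powr \<alpha> / c * (c * geg_eigen DIM('a) l powr \<alpha> * F l)" using c by simp
    also have "\<dots> \<le> 4 powr \<alpha> / c * H l" using c by (intro mult_left_mono H(2) l) auto
    finally show ?thesis .
  qed
  then have "summable (\<lambda>l. sobolev_weight l powr (2 * \<alpha>) * F l)"
    using F by (intro summable_comparison_test'[OF summable_mult[OF H(1), of "4 powr \<alpha> / c"], of "Suc n"]) auto
  then have "(\<Sum>l. ennreal (sobolev_weight l powr (2 * \<alpha>) * F l)) \<noteq> top" using F by (intro ennreal_suminf_neq_top) auto
  then show ?thesis unfolding F_def by (simp add: less_top)
qed

end

section \<open>Passage to Borel representatives\<close>

text \<open>
  A Lebesgue measurable weight may be changed on a null set, since the angle to the centre of a cap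
  has a density.
\<close>

lemma weights_borel_representative:
  assumes \<rho>: "\<rho> \<in> weights T t0 T0" and t: "0 < t0" "t0 < T0" "T0 \<le> T" "T \<le> pi" and d: "d \<ge> 2"
  obtains \<rho>' where "weight d T \<rho>'" "AE x in lborel. x \<in> {0<..<T} \<longrightarrow> \<rho> x = \<rho>' x"
proof -
  have \<rho>m: "\<rho> \<in> borel_measurable (lebesgue_on {0<..<T})" and \<rho>i: "integrable (lebesgue_on {0<..<T}) (\<lambda>x. (\<rho> x)\<^sup>2)"
    and \<rho>0: "AE x in lebesgue_on {0<..<T}. 0 \<le> \<rho> x" and \<rho>p: "(LINT \<theta>:{t0<..<T0}|lebesgue. \<rho> \<theta>) > 0"
    using \<rho> by (auto simp: weights_def square_integrable_def)
  have "(\<lambda>x. if x \<in> {0<..<T} then \<rho> x else 0) \<in> borel_measurable lebesgue" using \<rho>m by (subst borel_measurable_if) auto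
  then obtain r where r [measurable]: "r \<in> borel_measurable lborel" and r_AE: "AE x in lborel. (if x \<in> {0<..<T} then \<rho> x else 0) = r x"
    using completion_ex_borel_measurable_real by blast
  define \<rho>' where "\<rho>' x = (if x \<in> {0<..<T} then max 0 (r x) else 0)" for x
  have m [measurable]: "\<rho>' \<in> borel_measurable borel" unfolding \<rho>'_def using r by measurable
  have nn: "\<rho>' x \<ge> 0" for x by (simp add: \<rho>'_def)
  have "AE x in lborel. x \<in> {0<..<T} \<longrightarrow> 0 \<le> \<rho> x"
    using \<rho>0 by (subst (asm) AE_restrict_space_iff) (auto simp: AE_completion_iff)
  then have eq: "AE x in lborel. x \<in> {0<..<T} \<longrightarrow> \<rho> x = \<rho>' x" using r_AE by eventually_elim (auto simp: \<rho>'_def)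
  have sq: "integrable lborel (\<lambda>x. (\<rho>' x)\<^sup>2)"
  proof -
    have i: "integrable lebesgue (\<lambda>x. indicator {0<..<T} x *\<^sub>R (\<rho> x)\<^sup>2)"
      using \<rho>i by (subst (asm) integrable_restrict_space) auto
    have ae: "AE x in lborel. indicator {0<..<T} x *\<^sub>R (\<rho> x)\<^sup>2 = (\<rho>' x)\<^sup>2"
      using eq by eventually_elim (auto simp: \<rho>'_def split: split_indicator)
    have "integrable lebesgue (\<lambda>x. (\<rho>' x)\<^sup>2)"
      by (rule Bochner_Integration.integrable_cong_AE_imp[OF i _ AE_completion[OF ae]]) (intro measurable_completion; measurable)
    then show ?thesis by (subst (asm) integrable_completion) auto
  qed
  have int: "integrable lborel \<rho>'"
  proof (rule Bochner_Integration.integrable_bound)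
    show "integrable lborel (\<lambda>x. indicator {0<..<T} x + (\<rho>' x)\<^sup>2)"
      using sq t by (intro Bochner_Integration.integrable_add integrable_real_indicator) auto
    have "\<rho>' x \<le> indicator {0<..<T} x + (\<rho>' x)\<^sup>2" for x
    proof (cases "x \<in> {0<..<T}")
      case True
      have "2 * \<rho>' x \<le> 1 + (\<rho>' x)\<^sup>2" using sum_squares_bound[of 1 "\<rho>' x"] by simp
      then show ?thesis using True nn[of x] by simp
    qed (auto simp: \<rho>'_def)
    then show "AE x in lborel. norm (\<rho>' x) \<le> norm (indicator {0<..<T} x + (\<rho>' x)\<^sup>2)"
      using nn by (intro AE_I2) (simp add: order_trans[OF _ abs_ge_self])
  qed measurable
  have "(LINT \<theta>:{t0<..<T0}|lebesgue. \<rho> \<theta>) = (LINT \<theta>|lborel. indicator {t0<..<T0} \<theta> *\<^sub>R \<rho>' \<theta>)"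
    unfolding set_lebesgue_integral_def
    using eq t by (intro integral_completion_AE) (auto elim!: eventually_mono split: split_indicator)
  also have "\<dots> \<le> (LINT \<theta>|lborel. \<rho>' \<theta>)"
    using int nn by (intro integral_mono integrable_mult_indicator) (auto split: split_indicator)
  finally have "(LINT x|lborel. \<rho>' x) > 0" using \<rho>p by linarith
  then have "weight d T \<rho>'" using d t m nn sq by unfold_locales (auto simp: \<rho>'_def)
  then show ?thesis using eq by (rule that)
qed

lemma ennreal_sqrt_power2 [simp]: "(ennreal_sqrt x)\<^sup>2 = x"
  by (cases x) (auto simp: ennreal_sqrt_def ennreal_power power2_eq_square ennreal_top_mult simp flip: ennreal_mult)

lemma ennreal_sqrt_measurable [measurable]: "ennreal_sqrt \<in> borel_measurable borel"
  unfolding ennreal_sqrt_def[abs_def] by measurable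

context cap_average
begin

context
  fixes \<rho>' :: "real \<Rightarrow> real"
  assumes \<rho>': "AE x in lborel. x \<in> {0<..<T} \<longrightarrow> \<rho>' x = \<rho> x"
begin

lemma avg_const_eq:
  assumes t: "0 < t" "t \<le> T"
  shows "avg_const TYPE('a) \<rho>' T t = cap_mass t"
proof -
  have "(LINT \<theta>:{0<..<T}|lebesgue. sin (t * \<theta> / T) ^ (DIM('a) - 2) * \<rho>' \<theta>) = Z t"
    unfolding set_lebesgue_integral_def Z_def
  proof (rule integral_completion_AE)
    show "AE x in lborel. indicat_real {0<..<T} x *\<^sub>R (sin (t * x / T) ^ (DIM('a) - 2) * \<rho>' x) = w t x"
      using \<rho>' by eventually_elim (use rho_support in \<open>auto simp: w_def split: split_indicator\<close>)
  qed measurable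
  then show ?thesis by (simp add: avg_const_def cap_mass_def)
qed

text \<open>
  Outside a null set of points the angle avoids the ends of the interval and the exceptional set of
  the weight; off the cap the extended weight vanishes.
\<close>

lemma gen_avg_eq:
  assumes t: "0 < t" "t \<le> T" and xi: "norm (\<xi>::'a) = 1"
    and f: "AE \<eta> in surface. f \<eta> = h \<eta>" and h [measurable]: "h \<in> borel_measurable surface"
  shows "gen_avg \<rho>' T t f \<xi> = cap_av t h \<xi>"
proof -
  obtain N where N: "N \<in> null_sets lborel" "{x. \<not> (x \<in> {0<..<T} \<longrightarrow> \<rho>' x = \<rho> x)} \<subseteq> N"
    using \<rho>' by (auto simp: eventually_ae_filter)
  have N': "N \<union> {0, T} \<in> null_sets lborel" using N(1) by (intro null_sets.Un) (auto intro: finite_imp_null_set_lborel)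
  have tp: "t \<le> pi" using t T by simp
  have "AE \<eta> in surface. T / t * angle (\<xi> \<bullet> \<eta>) \<notin> N \<union> {0, T}" using t T by (intro AE_angle_notin_null[OF d xi _ N']) simp
  with f AE_space have "AE \<eta> in surface. indicator (spherical_cap \<xi> t) \<eta> *\<^sub>R (f \<eta> * of_real (\<rho>' (T / t * arccos (\<xi> \<bullet> \<eta>))))
      = h \<eta> * of_real (kernel t (\<xi> \<bullet> \<eta>))"
  proof eventually_elim
    case (elim \<eta>)
    then have eta: "norm \<eta> = 1" by simp
    note ang = angle_inner[OF xi eta]
    have inn: "-1 \<le> \<xi> \<bullet> \<eta>" "\<xi> \<bullet> \<eta> \<le> 1" using ang(2) by auto
    define x where "x = T / t * arccos (\<xi> \<bullet> \<eta>)"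
    have x: "x \<notin> N" "x \<noteq> 0" "x \<noteq> T" using elim by (auto simp: x_def ang(1))
    have "x \<ge> 0" unfolding x_def using t T arccos_lbound[OF inn] by simp
    then have x0: "x > 0" using x by simp
    have cos_a: "cos (arccos (\<xi> \<bullet> \<eta>)) = \<xi> \<bullet> \<eta>" using inn by (rule cos_arccos)
    have iff: "cos t \<le> \<xi> \<bullet> \<eta> \<longleftrightarrow> arccos (\<xi> \<bullet> \<eta>) \<le> t"
      using cos_mono_le_eq[of t "arccos (\<xi> \<bullet> \<eta>)"] arccos_bounded[OF inn] t tp unfolding cos_a by simp
    also have "\<dots> \<longleftrightarrow> x \<le> T" unfolding x_def using t T by (simp add: field_simps)
    finally have iff: "cos t \<le> \<xi> \<bullet> \<eta> \<longleftrightarrow> x \<le> T" .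
    have k: "kernel t (\<xi> \<bullet> \<eta>) = \<rho> x" by (simp add: kernel_def ang(1) x_def)
    show ?case
    proof (cases "x < T")
      case True
      then have "\<rho>' x = \<rho> x" using N(2) x(1) x0 by auto
      then show ?thesis using True iff eta elim unfolding k x_def[symmetric] by (simp add: spherical_cap_def)
    next
      case False
      then have "\<not> cos t \<le> \<xi> \<bullet> \<eta>" using iff x(3) by simp
      then show ?thesis using False rho_support[of x] unfolding k by (simp add: spherical_cap_def)
    qed
  qed
  then have "(LINT \<eta>:spherical_cap \<xi> t|sphere_measure. f \<eta> * of_real (\<rho>' (T / t * arccos (\<xi> \<bullet> \<eta>))))
      = (LINT \<eta>|surface. h \<eta> * of_real (kernel t (\<xi> \<bullet> \<eta>)))"
    unfolding set_lebesgue_integral_def sphere_measure_eq_completion by (rule integral_completion_AE) measurable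
  then show ?thesis by (simp add: gen_avg_def cap_av_def avg_const_eq[OF t])
qed

lemma avg_dist_power_eq:
  assumes t: "0 < t" "t \<le> T" and xi: "norm (\<xi>::'a) = 1"
  shows "avg_dist_power \<rho>' T t k \<xi> = of_real (adist k t)"
proof -
  have "avg_dist_power \<rho>' T t k \<xi> = cap_av t (\<lambda>\<eta>. of_real (norm (\<xi> - \<eta>) ^ (2 * k))) \<xi>" unfolding avg_dist_power_def
    by (intro gen_avg_eq t xi AE_I2 refl measurable_surface_continuous continuous_intros)
  then show ?thesis by (simp only: cap_av_dist_power[OF t xi])
qed

lemma square_fun_integrand_eq:
  assumes n: "n \<ge> 1" and t: "0 < t" "t \<le> T" and xi: "norm (\<xi>::'a) = 1"
    and f: "AE \<eta> in surface. f \<eta> = f0 \<eta>" "f0 \<in> borel_measurable surface" "f \<xi> = f0 \<xi>"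
    and g: "\<And>k. k \<in> {1..n} \<Longrightarrow> AE \<eta> in surface. g k \<eta> = g0 k \<eta>" "\<And>k. k \<in> {1..n} \<Longrightarrow> g0 k \<in> borel_measurable surface"
      "\<And>k. k \<in> {1..n} \<Longrightarrow> g k \<xi> = g0 k \<xi>"
  shows "square_fun_integrand \<rho>' T \<alpha> n f g \<xi> t = residual \<alpha> n f0 g0 \<xi> t"
proof (cases "\<alpha> = 2 * real n")
  case True
  have "{1..n} = insert n {1..<n}" using n by auto
  then have "residual \<alpha> n f0 g0 \<xi> t = cap_av t f0 \<xi> - f0 \<xi> - (of_real (adist n t) * cap_av t (g0 n) \<xi>
      + (\<Sum>k\<in>{1..<n}. of_real (adist k t) * (if \<alpha> = 2 * real n \<and> k = n then cap_av t (g0 k) \<xi> else g0 k \<xi>)))"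
    using True by (simp add: residual_def)
  also have "(\<Sum>k\<in>{1..<n}. of_real (adist k t) * (if \<alpha> = 2 * real n \<and> k = n then cap_av t (g0 k) \<xi> else g0 k \<xi>))
      = (\<Sum>k\<in>{1..<n}. g k \<xi> * avg_dist_power \<rho>' T t k \<xi>)"
    using g(3) by (intro sum.cong) (auto simp: avg_dist_power_eq[OF t xi])
  also have "of_real (adist n t) * cap_av t (g0 n) \<xi> = gen_avg \<rho>' T t (g n) \<xi> * avg_dist_power \<rho>' T t n \<xi>"
    using n g by (simp add: avg_dist_power_eq[OF t xi] gen_avg_eq[OF t xi, of "g n" "g0 n"])
  finally show ?thesis using True f by (simp add: square_fun_integrand_def gen_avg_eq[OF t xi f(1,2)])
next
  case False
  have "(\<Sum>k=1..n. of_real (adist k t) * g0 k \<xi>) = (\<Sum>k=1..n. g k \<xi> * avg_dist_power \<rho>' T t k \<xi>)"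
    using g(3) by (intro sum.cong) (auto simp: avg_dist_power_eq[OF t xi])
  then show ?thesis using False f by (simp add: square_fun_integrand_def residual_def gen_avg_eq[OF t xi f(1,2)])
qed

lemma square_fun_square_integrable_iff:
  assumes n: "n \<ge> 1"
    and f: "AE \<eta> in surface. f \<eta> = f0 \<eta>" "f0 \<in> borel_measurable surface"
    and g: "\<And>k. k \<in> {1..n} \<Longrightarrow> AE \<eta> in surface. g k \<eta> = g0 k \<eta>" "\<And>k. k \<in> {1..n} \<Longrightarrow> g0 k \<in> borel_measurable surface"
  shows "square_integrable_ennreal sphere_measure (square_fun \<rho>' T \<alpha> n f g) \<longleftrightarrow> energy \<alpha> n f0 g0 < \<infinity>"
proof -
  interpret sigma_finite_measure "surface :: 'a measure" by simp
  define S where "S \<xi> = (\<integral>\<^sup>+t\<in>{0<..<T}. ennreal ((norm (residual \<alpha> n f0 g0 \<xi> t))\<^sup>2 / t powr (2 * \<alpha> + 1)) \<partial>lborel)" for \<xi> :: 'a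
  note [measurable] = residual_measurable[where \<alpha> = \<alpha>, OF f(2) g(2)]
  have S_meas [measurable]: "S \<in> borel_measurable surface" unfolding S_def by measurable
  have "AE \<xi> in surface. \<forall>k\<in>{1..n}. g k \<xi> = g0 k \<xi>" using g(1) by (intro AE_ball_countable') auto
  with f(1) AE_space have ae: "AE \<xi> in surface. square_fun \<rho>' T \<alpha> n f g \<xi> = ennreal_sqrt (S \<xi>)"
  proof eventually_elim
    case (elim \<xi>)
    then have xi: "norm \<xi> = 1" by simp
    have "(\<integral>\<^sup>+t\<in>{0<..<T}. ennreal ((cmod (square_fun_integrand \<rho>' T \<alpha> n f g \<xi> t))\<^sup>2 / t powr (2 * \<alpha> + 1)) \<partial>lebesgue) = S \<xi>"
      unfolding nn_integral_completion S_def
    proof (intro nn_integral_cong)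
      fix t
      show "ennreal ((cmod (square_fun_integrand \<rho>' T \<alpha> n f g \<xi> t))\<^sup>2 / t powr (2 * \<alpha> + 1)) * indicator {0<..<T} t
          = ennreal ((norm (residual \<alpha> n f0 g0 \<xi> t))\<^sup>2 / t powr (2 * \<alpha> + 1)) * indicator {0<..<T} t"
        using square_fun_integrand_eq[OF n _ _ xi f _ g, where t = t and \<alpha> = \<alpha>] elim by (auto split: split_indicator)
    qed
    then show ?case by (simp add: square_fun_def)
  qed
  have "(\<lambda>\<xi>. ennreal_sqrt (S \<xi>)) \<in> borel_measurable surface" by measurable
  then have "square_fun \<rho>' T \<alpha> n f g \<in> borel_measurable sphere_measure"
    unfolding sphere_measure_eq_completion by (intro measurable_completion_AE[OF ae]) auto
  moreover have "(\<integral>\<^sup>+\<xi>. (square_fun \<rho>' T \<alpha> n f g \<xi>)\<^sup>2 \<partial>sphere_measure) = energy \<alpha> n f0 g0"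
    unfolding sphere_measure_eq_completion nn_integral_completion energy_def S_def[symmetric]
    using ae by (intro nn_integral_cong_AE) (auto elim!: eventually_mono)
  ultimately show ?thesis by (simp add: square_integrable_ennreal_def)
qed

lemma sobolev_norm_sq_eq:
  assumes f: "AE \<eta> in surface. f \<eta> = f0 \<eta>" "f0 \<in> borel_measurable surface"
  shows "sobolev_norm_sq \<nu> Y \<alpha> f = (\<Sum>l. ennreal (sobolev_weight l powr (2 * \<alpha>) * (\<Sum>j=1..\<nu> l. (norm (coef f0 l j))\<^sup>2)))"
proof -
  have "fourier_coeff f (Y l j) = coef f0 l j" if j: "j \<in> {1..\<nu> l}" for l j
  proof -
    note [measurable] = f(2) square_integrable_measurable[OF Y_square_integrable[OF j]]
    show ?thesis unfolding fourier_coeff_def coef_def sphere_measure_eq_completion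
      using f(1) by (intro integral_completion_AE) (auto elim!: eventually_mono)
  qed
  moreover have "1 + sqrt (real l) * sqrt (real l + real DIM('a) - 2) = sobolev_weight l" for l
    by (simp add: sobolev_weight_def geg_eigen_def real_sqrt_mult)
  ultimately show ?thesis by (simp add: sobolev_norm_sq_def)
qed

theorem sobolev_space_iff_square_fun:
  assumes n: "n \<ge> 1" and \<alpha>: "2 * real n \<le> \<alpha>" "\<alpha> < 2 * real n + 2"
  shows "f \<in> sobolev_space \<nu> Y \<alpha> \<longleftrightarrow> square_integrable sphere_measure f \<and>
    (\<exists>g. (\<forall>k\<in>{1..n}. square_integrable sphere_measure (g k)) \<and>
         square_integrable_ennreal sphere_measure (square_fun \<rho>' T \<alpha> n f g))"
proof (cases "square_integrable sphere_measure f")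
  case False
  then show ?thesis by (simp add: sobolev_space_def)
next
  case f: True
  have rep: "\<exists>h0. square_integrable surface h0 \<and> (AE \<eta> in surface. h \<eta> = h0 \<eta>)" if h: "square_integrable sphere_measure h" for h :: "'a \<Rightarrow> complex"
  proof -
    obtain h0 where "h0 \<in> borel_measurable surface" "AE \<eta> in surface. h \<eta> = h0 \<eta>"
      using square_integrable_measurable[OF h] completion_ex_borel_measurable_complex
      unfolding sphere_measure_eq_completion by blast
    then show ?thesis
      using h square_integrable_completion_AE[where M = surface and f = h and g = h0] unfolding sphere_measure_eq_completion by blast
  qed
  obtain f0 where f0: "square_integrable surface f0" "AE \<eta> in surface. f \<eta> = f0 \<eta>" using rep[OF f] by blast
  note f0m = square_integrable_measurable[OF f0(1)]
  have "(\<exists>g. (\<forall>k\<in>{1..n}. square_integrable sphere_measure (g k)) \<and>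
         square_integrable_ennreal sphere_measure (square_fun \<rho>' T \<alpha> n f g)) \<longleftrightarrow> sobolev_norm_sq \<nu> Y \<alpha> f < \<infinity>"
    unfolding sobolev_norm_sq_eq[OF f0(2) f0m]
  proof
    assume "(\<Sum>l. ennreal (sobolev_weight l powr (2 * \<alpha>) * (\<Sum>j=1..\<nu> l. (norm (coef f0 l j))\<^sup>2))) < \<infinity>"
    from sobolev_imp_finite_energy[OF n \<alpha> f0(1) this]
    obtain g where g: "\<forall>k\<in>{1..n}. square_integrable surface (g k)" "energy \<alpha> n f0 g < \<infinity>" by auto
    have gm: "g k \<in> borel_measurable surface" if "k \<in> {1..n}" for k
      using g(1) that by (auto dest: square_integrable_measurable)
    show "\<exists>g. (\<forall>k\<in>{1..n}. square_integrable sphere_measure (g k)) \<and>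
         square_integrable_ennreal sphere_measure (square_fun \<rho>' T \<alpha> n f g)"
    proof (intro exI conjI ballI)
      show "square_integrable sphere_measure (g k)" if "k \<in> {1..n}" for k unfolding sphere_measure_eq_completion
        using square_integrable_completion_AE[where M = surface and f = "g k" and g = "g k"] gm[OF that] g(1) that by auto
      show "square_integrable_ennreal sphere_measure (square_fun \<rho>' T \<alpha> n f g)"
        using g(2) gm by (subst square_fun_square_integrable_iff[OF n f0(2) f0m, where g = g and ?g0.0 = g]) auto
    qed
  next
    assume "\<exists>g. (\<forall>k\<in>{1..n}. square_integrable sphere_measure (g k)) \<and>
         square_integrable_ennreal sphere_measure (square_fun \<rho>' T \<alpha> n f g)"
    then obtain g where g: "\<And>k. k \<in> {1..n} \<Longrightarrow> square_integrable sphere_measure (g k)"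
      and fin: "square_integrable_ennreal sphere_measure (square_fun \<rho>' T \<alpha> n f g)" by blast
    obtain g0 where g0: "\<forall>k\<in>{1..n}. square_integrable surface (g0 k)" "\<And>k. k \<in> {1..n} \<Longrightarrow> AE \<eta> in surface. g k \<eta> = g0 k \<eta>"
      using rep[OF g] by metis
    have "g0 k \<in> borel_measurable surface" if "k \<in> {1..n}" for k
      using g0(1) that by (auto dest: square_integrable_measurable)
    then have "energy \<alpha> n f0 g0 < \<infinity>"
      using fin g0 square_fun_square_integrable_iff[OF n f0(2) f0m, where g = g and ?g0.0 = g0 and \<alpha> = \<alpha>] by blast
    then show "(\<Sum>l. ennreal (sobolev_weight l powr (2 * \<alpha>) * (\<Sum>j=1..\<nu> l. (norm (coef f0 l j))\<^sup>2))) < \<infinity>"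
      using finite_energy_imp_sobolev[OF n \<alpha>(1) f0(1) g0(1)] by simp
  qed
  then show ?thesis using f by (auto simp: sobolev_space_def)
qed

end

end

theorem theorem1p7:
  fixes \<rho> :: "real \<Rightarrow> real" and T t0 T0 :: real and n :: nat
    and \<nu> :: "nat \<Rightarrow> nat" and Y :: "nat \<Rightarrow> nat \<Rightarrow> 'a::euclidean_space \<Rightarrow> complex"
    and f :: "'a \<Rightarrow> complex"
  assumes "DIM('a) \<ge> 2"
    and "0 < T" "T \<le> pi"
    and "0 < t0" "t0 < T0" "T0 \<le> T" "T0 < pi"
    and "\<rho> \<in> weights T t0 T0"
    and "n \<ge> 1"
    and "\<And>l. harmonic_onb l (\<nu> l) (Y l)"
  shows "(\<forall>\<alpha>. 2 * real n < \<alpha> \<and> \<alpha> < 2 * (real n + 1) \<longrightarrow>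
            (f \<in> sobolev_space \<nu> Y \<alpha> \<longleftrightarrow>
             square_integrable sphere_measure f \<and>
             (\<exists>g. (\<forall>k\<in>{1..n}. square_integrable sphere_measure (g k)) \<and>
                  square_integrable_ennreal sphere_measure (square_fun \<rho> T \<alpha> n f g))))
       \<and> ((real DIM('a) - 1) / (real DIM('a) + 2 * real n - 1) *
            ((weight_moment \<rho> T (DIM('a) - 2))\<^sup>2 * weight_moment \<rho> T (2 * n + DIM('a)) /
             (weight_moment \<rho> T0 (DIM('a) - 2) * weight_moment \<rho> T0 DIM('a)
               * weight_moment \<rho> T0 (2 * n + DIM('a) - 2))) < 1 \<longrightarrow>
            (f \<in> sobolev_space \<nu> Y (2 * real n) \<longleftrightarrow>
             square_integrable sphere_measure f \<and>
             (\<exists>g. (\<forall>k\<in>{1..n}. square_integrable sphere_measure (g k)) \<and>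
                  square_integrable_ennreal sphere_measure (square_fun \<rho> T (2 * real n) n f g))))"
proof -
  obtain \<rho>' where w: "weight DIM('a) T \<rho>'" and eq: "AE x in lborel. x \<in> {0<..<T} \<longrightarrow> \<rho> x = \<rho>' x"
    using weights_borel_representative[OF assms(8,4,5,6,3,1)] by blast
  interpret W: weight "DIM('a)" T \<rho>' by (rule w)
  interpret cap_average \<nu> Y T \<rho>' by unfold_locales (use assms in auto)
  show ?thesis using sobolev_space_iff_square_fun[OF eq assms(9)] by auto
qed

end
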